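(* Let $k$ be an algebraically closed field of characteristic $0$, let $C$ be a genus $2$ curve over $k$ with function field $K$, and suppose $\mathrm{Aut}(C)\cong D_4$, the dihedral group of order $8$. Then there are two conjugacy classes of elliptic involutions in $\mathrm{Aut}(C)$, and thus there are two degree $2$ elliptic subfields of $K$ (up to isomorphism). If $E$ and $E'$ denote elliptic subfields fixed by elliptic involutions from the two different classes, then $E$ and $E'$ are isogenous by an isogeny of degree $2$.
   Context: An elliptic involution of $C$ is an involution in $\mathrm{Aut}(C)$ different from the hyperelliptic involution. Its fixed field in $K$ is an elliptic function field $E$ with $[K:E]=2$, called a degree $2$ elliptic subfield of $K$; equivalently, $E$ corresponds to the elliptic curve obtained as the quotient of $C$ by the involution. *)

theory Defs
  imports
    "HOL-Algebra.Algebraic_Closure_Type"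
    "HOL-Algebra.Generated_Fields"
    "HOL-Algebra.Group_Action"
begin

text \<open>
  A curve \<open>C\<close> (smooth, projective, irreducible) over the algebraically closed field \<open>'k\<close> is
  given by its function field \<open>K\<close>, which is the whole type \<open>'a\<close>; \<open>emb\<close> is the structure map
  from the constants \<open>'k\<close> to \<open>K\<close>. Subfields of \<open>K\<close>, which are function fields in their own
  right, are subsets of \<open>'a\<close>. Consequently all notions below that are not about \<open>K\<close> itself take
  the field \<open>F\<close> as an argument.
\<close>

definition field_embedding :: "('k::field \<Rightarrow> 'a::field) \<Rightarrow> bool" where
  "field_embedding emb \<longleftrightarrow> emb \<in> ring_hom ring_of_type_algebra ring_of_type_algebra"

definition intermediate_field :: "('k::field \<Rightarrow> 'a::field) \<Rightarrow> 'a set \<Rightarrow> bool" where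
  "intermediate_field emb F \<longleftrightarrow> subfield F ring_of_type_algebra \<and> range emb \<subseteq> F"

definition ext_degree :: "'a::field set \<Rightarrow> 'a set \<Rightarrow> nat \<Rightarrow> bool" where
  "ext_degree E F n \<longleftrightarrow> ring.dimension ring_of_type_algebra n E F"

definition function_field :: "('k::field \<Rightarrow> 'a::field) \<Rightarrow> 'a set \<Rightarrow> bool" where
  "function_field emb F \<longleftrightarrow> intermediate_field emb F \<and>
     (\<exists>x\<in>F. ring.transcendental ring_of_type_algebra (range emb) x \<and>
        (\<exists>n. ext_degree (generate_field ring_of_type_algebra (insert x (range emb))) F n))"

text \<open>
  The points of the curve with function field \<open>F\<close> are the normalised discrete valuations of \<open>F\<close>
  that are trivial on the constants. A valuation is a total function here, so it gets the dummy
  value \<open>0\<close> at \<open>0\<close> (where the true value is \<open>\<infinity>\<close>) and outside \<open>F\<close>; with this convention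
  each point is represented by exactly one function.
\<close>

definition places :: "('k::field \<Rightarrow> 'a::field) \<Rightarrow> 'a set \<Rightarrow> ('a \<Rightarrow> int) set" where
  "places emb F = {v.
     (\<forall>x. x \<notin> F - {0} \<longrightarrow> v x = 0) \<and>
     (\<forall>c. v (emb c) = 0) \<and>
     (\<forall>x\<in>F - {0}. \<forall>y\<in>F - {0}. v (x * y) = v x + v y) \<and>
     (\<forall>x\<in>F - {0}. \<forall>y\<in>F - {0}. x + y \<noteq> 0 \<longrightarrow> min (v x) (v y) \<le> v (x + y)) \<and>
     (\<exists>t\<in>F. v t = 1)}"

definition divisors :: "('k::field \<Rightarrow> 'a::field) \<Rightarrow> 'a set \<Rightarrow> (('a \<Rightarrow> int) \<Rightarrow> int) set" where
  "divisors emb F = {D. finite {v. D v \<noteq> 0} \<and> {v. D v \<noteq> 0} \<subseteq> places emb F}"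

text \<open>
  The constants will be algebraically closed, so every point has residue field \<open>'k\<close> and counts
  with weight \<open>1\<close> in the degree of a divisor.
\<close>

definition divisor_degree :: "(('a \<Rightarrow> int) \<Rightarrow> int) \<Rightarrow> int" where
  "divisor_degree D = (\<Sum>v | D v \<noteq> 0. D v)"

definition riemann_roch_space ::
    "('k::field \<Rightarrow> 'a::field) \<Rightarrow> 'a set \<Rightarrow> (('a \<Rightarrow> int) \<Rightarrow> int) \<Rightarrow> 'a set" where
  "riemann_roch_space emb F D = {f \<in> F. f \<noteq> 0 \<longrightarrow> (\<forall>v\<in>places emb F. - D v \<le> v f)}"

definition ell :: "('k::field \<Rightarrow> 'a::field) \<Rightarrow> 'a set \<Rightarrow> (('a \<Rightarrow> int) \<Rightarrow> int) \<Rightarrow> nat" where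
  "ell emb F D = vector_space.dim (\<lambda>c x. emb c * x) (riemann_roch_space emb F D)"

text \<open>The genus is the maximum of \<open>deg D - \<ell>(D) + 1\<close> over all divisors \<open>D\<close>.\<close>

definition has_genus :: "('k::field \<Rightarrow> 'a::field) \<Rightarrow> 'a set \<Rightarrow> nat \<Rightarrow> bool" where
  "has_genus emb F g \<longleftrightarrow>
     (\<forall>D\<in>divisors emb F. divisor_degree D - int (ell emb F D) + 1 \<le> int g) \<and>
     (\<exists>D\<in>divisors emb F. divisor_degree D - int (ell emb F D) + 1 = int g)"

definition elliptic_function_field :: "('k::field \<Rightarrow> 'a::field) \<Rightarrow> 'a set \<Rightarrow> bool" where
  "elliptic_function_field emb E \<longleftrightarrow> function_field emb E \<and> has_genus emb E 1"

definition Aut_group :: "('k::field \<Rightarrow> 'a::field) \<Rightarrow> ('a \<Rightarrow> 'a) monoid" where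
  "Aut_group emb =
     \<lparr>carrier = {\<sigma> \<in> ring_iso ring_of_type_algebra ring_of_type_algebra. \<forall>c. \<sigma> (emb c) = emb c},
      monoid.mult = (\<circ>), monoid.one = id\<rparr>"

definition involution :: "('k::field \<Rightarrow> 'a::field) \<Rightarrow> ('a \<Rightarrow> 'a) \<Rightarrow> bool" where
  "involution emb \<sigma> \<longleftrightarrow> \<sigma> \<in> carrier (Aut_group emb) \<and> \<sigma> \<noteq> id \<and> \<sigma> \<circ> \<sigma> = id"

definition fixed_field :: "('a \<Rightarrow> 'a) \<Rightarrow> 'a set" where
  "fixed_field \<sigma> = {x. \<sigma> x = x}"

text \<open>
  On a genus 2 curve the hyperelliptic involution is the unique one whose quotient is the
  projective line.
\<close>

definition hyperelliptic_involution :: "('k::field \<Rightarrow> 'a::field) \<Rightarrow> ('a \<Rightarrow> 'a) \<Rightarrow> bool" where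
  "hyperelliptic_involution emb \<sigma> \<longleftrightarrow> involution emb \<sigma> \<and> has_genus emb (fixed_field \<sigma>) 0"

definition elliptic_involution :: "('k::field \<Rightarrow> 'a::field) \<Rightarrow> ('a \<Rightarrow> 'a) \<Rightarrow> bool" where
  "elliptic_involution emb \<sigma> \<longleftrightarrow> involution emb \<sigma> \<and> \<not> hyperelliptic_involution emb \<sigma>"

definition elliptic_involution_classes ::
    "('k::field \<Rightarrow> 'a::field) \<Rightarrow> ('a \<Rightarrow> 'a) set set" where
  "elliptic_involution_classes emb =
     orbits (Aut_group emb) {\<sigma>. elliptic_involution emb \<sigma>}
       (\<lambda>\<alpha> \<sigma>. \<alpha> \<otimes>\<^bsub>Aut_group emb\<^esub> \<sigma> \<otimes>\<^bsub>Aut_group emb\<^esub> inv\<^bsub>Aut_group emb\<^esub> \<alpha>)"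

definition degree2_elliptic_subfields :: "('k::field \<Rightarrow> 'a::field) \<Rightarrow> 'a set set" where
  "degree2_elliptic_subfields emb = {E. elliptic_function_field emb E \<and> ext_degree E UNIV 2}"

text \<open>
  Two subfields of \<open>K\<close> are isomorphic as subfields if an automorphism of \<open>K\<close> carries one to the
  other. An abstract isomorphism of the subfields is not enough: at isolated members of the family
  of curves with group \<open>D\<^sub>4\<close> the two inequivalent subfields have equal \<open>j\<close>-invariant \<open>-3375\<close>.
\<close>

definition degree2_elliptic_subfield_classes ::
    "('k::field \<Rightarrow> 'a::field) \<Rightarrow> 'a set set set" where
  "degree2_elliptic_subfield_classes emb =
     orbits (Aut_group emb) (degree2_elliptic_subfields emb) (\<lambda>\<alpha> E. \<alpha> ` E)"

text \<open>
  An isogeny \<open>(E, P) \<rightarrow> (E', P')\<close> of elliptic curves is given contravariantly by its comorphism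
  \<open>\<phi>\<close> from \<open>E'\<close> to \<open>E\<close>. The point \<open>P\<close> is mapped to \<open>P'\<close> iff the valuation \<open>P \<circ> \<phi>\<close> of
  \<open>E'\<close> is equivalent to \<open>P'\<close>.
\<close>

definition isogeny_of_degree :: "('k::field \<Rightarrow> 'a::field) \<Rightarrow> nat \<Rightarrow>
    'a set \<Rightarrow> ('a \<Rightarrow> int) \<Rightarrow> 'a set \<Rightarrow> ('a \<Rightarrow> int) \<Rightarrow> ('a \<Rightarrow> 'a) \<Rightarrow> bool" where
  "isogeny_of_degree emb n E P E' P' \<phi> \<longleftrightarrow>
     \<phi> \<in> ring_hom (ring_of_type_algebra\<lparr>carrier := E'\<rparr>) (ring_of_type_algebra\<lparr>carrier := E\<rparr>) \<and>
     (\<forall>c. \<phi> (emb c) = emb c) \<and>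
     (\<exists>e>0. \<forall>x\<in>E'. P (\<phi> x) = e * P' x) \<and>
     ext_degree (\<phi> ` E') E n"

text \<open>
  An elliptic function field carries no distinguished origin; the existence of an isogeny is
  required for every choice of origins.
\<close>

definition isogenous_of_degree ::
    "('k::field \<Rightarrow> 'a::field) \<Rightarrow> nat \<Rightarrow> 'a set \<Rightarrow> 'a set \<Rightarrow> bool" where
  "isogenous_of_degree emb n E E' \<longleftrightarrow>
     elliptic_function_field emb E \<and> elliptic_function_field emb E' \<and>
     (\<forall>P\<in>places emb E. \<forall>P'\<in>places emb E'. \<exists>\<phi>. isogeny_of_degree emb n E P E' P' \<phi>)"

text \<open>The dihedral group of order \<open>2 * n\<close>: \<open>(i, s)\<close> is the \<open>i\<close>-th power of the rotation,
  followed on the right by the reflection if \<open>s\<close> holds.\<close>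

definition dihedral_group :: "nat \<Rightarrow> (int \<times> bool) monoid" where
  "dihedral_group n =
     \<lparr>carrier = {0..<int n} \<times> UNIV,
      monoid.mult = (\<lambda>(i, s) (j, t). ((if s then i - j else i + j) mod int n, s \<noteq> t)),
      monoid.one = (0, False)\<rparr>"

end

theory Submission imports Defs begin

text \<open>
  Write \<open>r\<close> for the rotation of order 4 and \<open>s\<close> for a reflection. For a large divisor
  \<open>C\<close> invariant under \<open>D\<^sub>4\<close>, Riemann-Hurwitz for \<open>h = r\<^sup>2\<close> and the parity of the dimension of the
  \<open>(-1)\<close>-eigenspace of \<open>h\<close> on \<open>L(C)\<close> (a sum of two spaces exchanged by \<open>r\<close>) show that the quotient
  by \<open>h\<close> is a line. A coordinate \<open>\<xi>\<close> of this line can be chosen with \<open>r \<xi> = - \<xi>\<close> and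
  \<open>s \<xi> = 1 / \<xi>\<close>, so that the curve becomes \<open>y\<^sup>2 = \<xi>(\<xi>\<^sup>4 + b \<xi>\<^sup>2 + 1)\<close>. In terms of
  \<open>x = \<xi> + 1/\<xi> + 2\<close> and \<open>x = - 2 i (\<xi> - 1/\<xi>) - 4\<close>, respectively, the quotients by \<open>s\<close> and by \<open>s r\<close> are the curves
  \<open>w\<^sup>2 = x(x\<^sup>2 + A x + B)\<close> and \<open>w\<^sup>2 = x(x\<^sup>2 - 2 A x + A\<^sup>2 - 4 B)\<close> with \<open>A = -4\<close> and
  \<open>B = b + 2\<close>, which are joined by the classical isogeny with kernel generated by \<open>(0, 0)\<close>. Origins
  can be moved because on an elliptic curve any two points \<open>P\<close>, \<open>Q\<close> are exchanged by the involution
  of a function of degree 2 with poles at \<open>P\<close> and \<open>Q\<close>.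
\<close>

text \<open>The genus is given only as the maximum of \<open>deg D - l(D) + 1\<close>, so the
  working substitute for Riemann-Roch is one consequence of that maximum: above a divisor that
  attains it, \<open>l(D) = deg D + 1 - g\<close> holds exactly (\<open>nonspecial\<close>).
  Finiteness of zeros, degree 0 of principal divisors and the inequality extracted from
  Riemann-Hurwitz all come from comparing two such divisors. Conversely, to find the genus of
  \<open>y^2 = f(x)\<close> every divisor must be controlled, hence every place; odd degree of
  \<open>f\<close> leaves a single place at infinity. Places of subfields are obtained by
  restricting places of \<open>K\<close> and renormalising. The parity argument works because
  \<open>h = r^2\<close> is -1 on its eigenspace, so there \<open>s r = r^-1 s = - r s\<close>. The
  constants in the quotient coordinates make them squares up to one factor:
  \<open>\<xi> + 1/\<xi> + 2 = (1 + \<xi>)^2 / \<xi>\<close> and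
  \<open>- 2 i (\<xi> - 1/\<xi>) - 4 = 2 i (1 + i \<xi>)^2 / \<xi>\<close>. Hence \<open>y\<close>
  times a rational function of \<open>\<xi>\<close> serves as second coordinate, and the scaling by
  \<open>- 2 i\<close> turns the second cubic into the 2-isogenous partner of the first.\<close>

definition field_closed :: "'a::field set \<Rightarrow> bool" where
  "field_closed F \<longleftrightarrow> 0 \<in> F \<and> 1 \<in> F \<and> (\<forall>x\<in>F. \<forall>y\<in>F. x + y \<in> F \<and> x * y \<in> F) \<and>
     (\<forall>x\<in>F. - x \<in> F \<and> inverse x \<in> F)"

section \<open>Subfields of a field type\<close>

abbreviation type_ring :: "'a::field ring" where
  "type_ring \<equiv> ring_of_type_algebra"

lemma type_ring_simps [simp]:
  "carrier (type_ring :: 'a::field ring) = UNIV" "x \<otimes>\<^bsub>type_ring\<^esub> y = x * y"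
  "x \<oplus>\<^bsub>type_ring\<^esub> y = x + y" "\<one>\<^bsub>type_ring\<^esub> = (1::'a)" "\<zero>\<^bsub>type_ring\<^esub> = (0::'a)"
  by (simp_all add: ring_of_type_algebra_def)

interpretation type_ring: cring "type_ring :: 'a::field ring"
  by (rule cring_from_type_algebra)

lemma type_ring_a_inv [simp]: "\<ominus>\<^bsub>type_ring\<^esub> x = - (x :: 'a::field)"
  by (rule type_ring.minus_equality) simp_all

lemma type_ring_inv [simp]: "x \<noteq> 0 \<Longrightarrow> inv\<^bsub>type_ring\<^esub> x = inverse (x :: 'a::field)"
  by (rule type_ring.comm_inv_char) simp_all

text \<open>Trades the carrier-based notion of the definitions for closure under the type-class
  operations. Since \<open>inverse 0 = 0\<close>, closure under inverses carries no side
  condition.\<close>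

lemma subfield_iff_field_closed: "subfield F type_ring \<longleftrightarrow> field_closed (F :: 'a::field set)"
proof
  assume F: "subfield F type_ring"
  have sr: "subring F type_ring" by (rule subfieldE(1)[OF F])
  note E = subringE[OF sr, simplified]
  have "inverse x \<in> F" if "x \<in> F" for x
  proof (cases "x = 0")
    case False
    thus ?thesis using type_ring.subfield_m_inv(1)[OF F, of x] that by simp
  qed (use that in simp)
  thus "field_closed F" using E by (auto simp: field_closed_def)
next
  assume "field_closed F"
  note F = this[unfolded field_closed_def]
  have sr: "subring F type_ring"
    by (rule type_ring.subringI) (use F in auto)
  have sc: "subcring F type_ring"
    by (rule subcring.intro[OF sr]) (unfold_locales, simp add: mult.commute)
  have "Units (type_ring\<lparr>carrier := F\<rparr>) = F - {0}"
  proof -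
    have "x \<in> F - {0} \<Longrightarrow> \<exists>y\<in>F. y * x = 1 \<and> x * y = 1" for x
      using F by (intro bexI[of _ "inverse x"]) auto
    thus ?thesis by (auto simp: Units_def)
  qed
  thus "subfield F type_ring" by (intro type_ring.subfieldI[OF sc]) simp
qed

lemma field_closedI:
  assumes "1 \<in> F" "\<And>x y. x \<in> F \<Longrightarrow> y \<in> F \<Longrightarrow> x + y \<in> F"
    "\<And>x y. x \<in> F \<Longrightarrow> y \<in> F \<Longrightarrow> x * y \<in> F" "\<And>x. x \<in> F \<Longrightarrow> - x \<in> F"
    "\<And>x. x \<in> F \<Longrightarrow> x \<noteq> 0 \<Longrightarrow> inverse x \<in> F"
  shows "field_closed F"
proof -
  have "1 + - 1 \<in> F" using assms by blast
  hence "0 \<in> F" by simp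
  moreover have "inverse x \<in> F" if "x \<in> F" for x
    using assms(5)[OF that] \<open>0 \<in> F\<close> by (cases "x = 0") auto
  ultimately show ?thesis using assms by (auto simp: field_closed_def)
qed

context
  fixes F :: "'a::field set"
  assumes F: "field_closed F"
begin

lemma fc_0: "0 \<in> F" and fc_1: "1 \<in> F"
  and fc_add: "x \<in> F \<Longrightarrow> y \<in> F \<Longrightarrow> x + y \<in> F"
  and fc_mult: "x \<in> F \<Longrightarrow> y \<in> F \<Longrightarrow> x * y \<in> F"
  and fc_minus: "x \<in> F \<Longrightarrow> - x \<in> F"
  and fc_inverse: "x \<in> F \<Longrightarrow> inverse x \<in> F"
  using F by (auto simp: field_closed_def)

lemma fc_diff: "x \<in> F \<Longrightarrow> y \<in> F \<Longrightarrow> x - y \<in> F"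
  using fc_add[of x "- y"] fc_minus by simp

lemma fc_divide: "x \<in> F \<Longrightarrow> y \<in> F \<Longrightarrow> x / y \<in> F"
  using fc_mult[of x "inverse y"] fc_inverse by (simp add: divide_inverse)

lemma fc_power: "x \<in> F \<Longrightarrow> x ^ n \<in> F"
  by (induction n) (auto intro: fc_1 fc_mult)

lemma fc_sum: "(\<And>i. i \<in> I \<Longrightarrow> f i \<in> F) \<Longrightarrow> sum f I \<in> F"
  by (induction I rule: infinite_finite_induct) (auto intro: fc_0 fc_add)

lemmas fc_intros = fc_0 fc_1 fc_add fc_mult fc_minus fc_inverse fc_diff fc_divide fc_power fc_sum

end

section \<open>Quadratic extensions of subfields\<close>

definition quad_ext :: "'a::field set \<Rightarrow> 'a \<Rightarrow> 'a set" where
  "quad_ext L t = {a + b * t | a b. a \<in> L \<and> b \<in> L}"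

lemma quad_extI: "a \<in> L \<Longrightarrow> b \<in> L \<Longrightarrow> a + b * t \<in> quad_ext L t"
  by (auto simp: quad_ext_def)

lemma quad_extE:
  assumes "z \<in> quad_ext L t"
  obtains a b where "z = a + b * t" "a \<in> L" "b \<in> L"
  using assms by (auto simp: quad_ext_def)

lemma quad_ext_subset: "field_closed L \<Longrightarrow> L \<subseteq> quad_ext L t"
  using quad_extI[of _ L 0 t] fc_0 by fastforce

lemma quad_ext_gen: "field_closed L \<Longrightarrow> t \<in> quad_ext L t"
  using quad_extI[of 0 L 1 t] by (simp add: fc_0 fc_1)

lemma quad_ext_minimal: "field_closed F \<Longrightarrow> L \<subseteq> F \<Longrightarrow> t \<in> F \<Longrightarrow> quad_ext L t \<subseteq> F"
  by (auto simp: quad_ext_def intro!: fc_add fc_mult)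

lemma quad_extI': "z = a + b * t \<Longrightarrow> a \<in> L \<Longrightarrow> b \<in> L \<Longrightarrow> z \<in> quad_ext L t"
  by (auto simp: quad_ext_def)

text \<open>The relation for \<open>t\<close> may be reducible. Inverses come from the norm; where
  the norm of a nonzero element vanishes, either \<open>b = 0\<close> or \<open>t\<close> already
  lies in \<open>L\<close>.\<close>

lemma quad_ext_field:
  assumes L: "field_closed L" and pq: "p \<in> L" "q \<in> L" and t: "t ^ 2 = p * t + q"
  shows "field_closed (quad_ext L t)"
proof (rule field_closedI)
  note ii = fc_intros[OF L]
  have tt: "t * t = p * t + q" using t by (simp add: power2_eq_square)
  show "1 \<in> quad_ext L t" by (rule quad_extI'[of _ 1 0]) (simp_all add: ii(1,2))
  show "x + y \<in> quad_ext L t" if xy: "x \<in> quad_ext L t" "y \<in> quad_ext L t" for x y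
  proof -
    obtain a b where x: "x = a + b * t" "a \<in> L" "b \<in> L" by (rule quad_extE[OF xy(1)])
    obtain c d where y: "y = c + d * t" "c \<in> L" "d \<in> L" by (rule quad_extE[OF xy(2)])
    show ?thesis
      by (rule quad_extI'[of _ "a + c" "b + d"])
        (simp_all add: x(1) y(1) ring_distribs ii(3)[OF x(2) y(2)] ii(3)[OF x(3) y(3)])
  qed
  show "x * y \<in> quad_ext L t" if xy: "x \<in> quad_ext L t" "y \<in> quad_ext L t" for x y
  proof -
    obtain a b where x: "x = a + b * t" "a \<in> L" "b \<in> L" by (rule quad_extE[OF xy(1)])
    obtain c d where y: "y = c + d * t" "c \<in> L" "d \<in> L" by (rule quad_extE[OF xy(2)])
    have "x * y = a * c + (a * d + b * c) * t + b * d * (t * t)"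
      unfolding x(1) y(1) by (simp add: algebra_simps)
    also have "\<dots> = (a * c + b * d * q) + (a * d + b * c + b * d * p) * t"
      unfolding tt by (simp add: algebra_simps)
    finally show ?thesis
      by (rule quad_extI') (intro ii(3,4) x(2,3) y(2,3) pq)+
  qed
  show "- x \<in> quad_ext L t" if xy: "x \<in> quad_ext L t" for x
  proof -
    obtain a b where x: "x = a + b * t" "a \<in> L" "b \<in> L" by (rule quad_extE[OF xy(1)])
    show ?thesis by (rule quad_extI'[of _ "- a" "- b"]) (simp_all add: x(1) ii(5)[OF x(2)] ii(5)[OF x(3)])
  qed
  show "inverse x \<in> quad_ext L t" if xy: "x \<in> quad_ext L t" "x \<noteq> 0" for x
  proof -
    obtain a b where x: "x = a + b * t" "a \<in> L" "b \<in> L" by (rule quad_extE[OF xy(1)])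
    have key: "inverse x \<in> quad_ext L t" if "t \<in> L"
    proof -
      have "x \<in> L" unfolding x(1) by (intro ii(3,4) x(2,3) that)
      thus ?thesis using quad_ext_subset[OF L, of t] ii(6) by blast
    qed
    \<comment> \<open>The two roots of \<open>T^2 - p T - q\<close> add up to \<open>p\<close>, so
      the conjugate of \<open>a + b t\<close> is \<open>a + b p - b t\<close>; \<open>N\<close> is
      the product of both.\<close>
    define N where "N = a * a + a * b * p - b * b * q"
    have NL: "N \<in> L" unfolding N_def by (intro ii(3,4,7) x(2,3) pq)
    have xN: "x * (a + b * p - b * t) = N"
    proof -
      have "x * (a + b * p - b * t) = a * a + a * b * p + b * b * p * t - b * b * (t * t)"
        unfolding x(1) by (simp add: algebra_simps)
      also have "\<dots> = N" unfolding tt N_def by (simp add: algebra_simps)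
      finally show ?thesis .
    qed
    show ?thesis
    proof (cases "N = 0")
      case True
      hence 0: "a + b * p = b * t" using xN \<open>x \<noteq> 0\<close> by simp
      show ?thesis
      proof (cases "b = 0")
        case True
        hence "x \<in> L" using x by simp
        thus ?thesis using quad_ext_subset[OF L, of t] ii(6) by blast
      next
        case False
        hence "t = (a + b * p) / b" using 0 by simp
        also have "\<dots> \<in> L" by (intro ii(3,4,8) x(2,3) pq)
        finally show ?thesis by (rule key)
      qed
    next
      case False
      have "inverse x = (a + b * p - b * t) / N"
        by (rule inverse_unique) (simp add: xN False)
      also have "\<dots> = (a + b * p) / N + (- b / N) * t" by (simp add: diff_divide_distrib)
      finally show ?thesis
        by (rule quad_extI') (intro ii(3,4,5,8) x(2,3) pq NL)+
    qed
  qed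
qed

lemma quad_ext_unique:
  assumes L: "field_closed L" and t: "t \<notin> L" and in_L: "a \<in> L" "b \<in> L" "c \<in> L" "d \<in> L"
    and eq: "a + b * t = c + d * t"
  shows "a = c \<and> b = d"
proof -
  have 1: "(b - d) * t = c - a" using eq by (simp add: algebra_simps)
  have "b = d"
  proof (rule ccontr)
    assume "b \<noteq> d"
    hence "t = (c - a) / (b - d)" using 1 by (simp add: field_simps)
    thus False using t in_L fc_diff[OF L] fc_divide[OF L] by blast
  qed
  thus ?thesis using 1 by simp
qed

text \<open>\<open>dimension\<close> is inductive, one line extension per step: from
  \<open>{0}\<close> to \<open>L\<close>, then to \<open>L t + L\<close>, which is a genuine step
  because \<open>t\<close> is outside \<open>L\<close>.\<close>

lemma dimension_quad_ext:
  assumes L: "field_closed L" and t: "t \<notin> L"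
  shows "ext_degree L (quad_ext L t) 2"
proof -
  have le: "type_ring.line_extension K v E = {k * v + e | k e. k \<in> K \<and> e \<in> E}" for K E :: "'a set" and v
    using type_ring.line_extension_mem_iff[of _ K v E] by auto
  have "type_ring.dimension (Suc 0) L (type_ring.line_extension L 1 {\<zero>\<^bsub>type_ring\<^esub>})"
    by (rule type_ring.Suc_dim[OF _ _ type_ring.zero_dim]) simp_all
  moreover have "type_ring.line_extension L 1 {\<zero>\<^bsub>type_ring\<^esub>} = L" unfolding le by simp
  ultimately have "type_ring.dimension (Suc 0) L L" by simp
  hence "type_ring.dimension (Suc (Suc 0)) L (type_ring.line_extension L t L)"
    using t by (intro type_ring.Suc_dim[of t L]) simp_all
  moreover have "type_ring.line_extension L t L = quad_ext L t"
  proof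
    show "type_ring.line_extension L t L \<subseteq> quad_ext L t"
    proof
      fix z assume "z \<in> type_ring.line_extension L t L"
      then obtain k e where "z = e + k * t" "k \<in> L" "e \<in> L"
        unfolding le by (auto simp: add.commute)
      thus "z \<in> quad_ext L t" by (simp add: quad_extI)
    qed
    show "quad_ext L t \<subseteq> type_ring.line_extension L t L"
      unfolding le quad_ext_def by (auto simp: add.commute[of _ "_ * t"])
  qed
  ultimately show ?thesis by (simp add: ext_degree_def numeral_2_eq_2)
qed

text \<open>Two line extensions give \<open>F = L v + L u\<close>. Writing 1 in this basis shows
  which of \<open>u\<close> and \<open>v\<close> can be exchanged for 1; the other one
  generates.\<close>

lemma ext_degree_2E:
  assumes L: "field_closed L" and F: "field_closed (F :: 'a::field set)" and d: "ext_degree L F 2"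
  obtains t where "t \<notin> L" "F = quad_ext L t" 
proof -
  note ii = fc_intros[OF L]
  have le: "type_ring.line_extension K v E = {k * v + e | k e. k \<in> K \<and> e \<in> E}" for K E :: "'a set" and v
    using type_ring.line_extension_mem_iff[of _ K v E] by auto
  have "type_ring.dimension (Suc (Suc 0)) L F" using d by (simp add: ext_degree_def numeral_2_eq_2)
  then obtain v E where v: "v \<notin> E" "type_ring.dimension (Suc 0) L E" and Fv: "F = type_ring.line_extension L v E"
    by (cases rule: type_ring.dimension.cases) auto
  from v(2) obtain u E' where u: "u \<notin> E'" "type_ring.dimension 0 L E'" and Eu: "E = type_ring.line_extension L u E'"
    by (cases rule: type_ring.dimension.cases) auto
  have "E' = {0}" using u(2) by (cases rule: type_ring.dimension.cases) auto
  hence u0: "u \<noteq> 0" and Eu: "E = {k * u | k. k \<in> L}" using u Eu by (auto simp: le)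
  have FF: "F = {k * v + l * u | k l. k \<in> L \<and> l \<in> L}" unfolding Fv le Eu by auto
  have "1 \<in> F" by (rule fc_1[OF F])
  then obtain k l where kl: "k * v + l * u = 1" "k \<in> L" "l \<in> L" by (auto simp: FF)
  show ?thesis
  proof (cases "k = 0")
    case True
    hence l: "l \<noteq> 0" "u = inverse l" using kl(1) inverse_unique[of l u] by auto
    hence uL: "u \<in> L" using ii(6)[OF kl(3)] by simp
    have "v \<notin> L"
    proof
      assume "v \<in> L"
      hence "v * l \<in> L" by (intro ii(4) kl(3))
      moreover have "v = (v * l) * u" using l by simp
      ultimately show False using v(1) Eu by blast
    qed
    moreover have "F = quad_ext L v"
    proof
      show "F \<subseteq> quad_ext L v"
      proof
        fix z assume "z \<in> F"
        then obtain a b where z: "z = a * v + b * u" "a \<in> L" "b \<in> L" unfolding FF by auto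
        have "z = b * u + a * v" unfolding z by simp
        thus "z \<in> quad_ext L v" using quad_extI z(2,3) uL ii(4) by metis
      qed
      show "quad_ext L v \<subseteq> F"
      proof
        fix z assume "z \<in> quad_ext L v"
        then obtain a b where z: "z = a + b * v" "a \<in> L" "b \<in> L" by (auto simp: quad_ext_def)
        have "z = b * v + (a * l) * u" unfolding z(1) using l by simp
        moreover have "a * l \<in> L" by (intro ii(4) z(2,3) kl(2,3))
        ultimately show "z \<in> F" unfolding FF using z(3) by blast
      qed
    qed
    ultimately show ?thesis by (rule that)
  next
    case False
    have "v * k = 1 - l * u" using kl(1) by (simp add: eq_diff_eq mult.commute)
    hence "v = (1 - l * u) / k" by (rule eq_divide_imp[OF False])
    hence vv: "v = inverse k - (l / k) * u" by (simp add: diff_divide_distrib inverse_eq_divide)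
    have "u \<notin> L"
    proof
      assume "u \<in> L"
      have "v \<in> L" unfolding vv by (intro ii(4,6,7,8) kl \<open>u \<in> L\<close>)
      hence "v / u \<in> L" by (rule ii(8)) fact
      moreover have "v = (v / u) * u" using u0 by simp
      ultimately show False using v(1) Eu by blast
    qed
    moreover have "F = quad_ext L u"
    proof
      show "F \<subseteq> quad_ext L u"
      proof
        fix z assume "z \<in> F"
        then obtain a b where z: "z = a * v + b * u" "a \<in> L" "b \<in> L" unfolding FF by auto
        have "z = a * inverse k + (b - a * (l / k)) * u" unfolding z vv by (simp add: algebra_simps)
        moreover have "a * inverse k \<in> L" "b - a * (l / k) \<in> L" by (intro ii(4,6,7,8) z(2,3) kl(2,3))+
        ultimately show "z \<in> quad_ext L u" by (rule quad_extI')
      qed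
      show "quad_ext L u \<subseteq> F"
      proof
        fix z assume "z \<in> quad_ext L u"
        then obtain a b where z: "z = a + b * u" "a \<in> L" "b \<in> L" by (auto simp: quad_ext_def)
        have "z = (a * k) * v + (a * l + b) * u"
        proof -
          have "z = a * (k * v + l * u) + b * u" unfolding kl(1) using z(1) by simp
          also have "\<dots> = (a * k) * v + (a * l + b) * u" by (simp add: algebra_simps)
          finally show ?thesis .
        qed
        moreover have "a * k \<in> L" "a * l + b \<in> L" by (intro ii(3,4) z(2,3) kl(2,3))+
        ultimately show "z \<in> F" unfolding FF by blast
      qed
    qed
    ultimately show ?thesis by (rule that)
  qed
qed

section \<open>The algebraically closed field of constants\<close>

locale constants =
  fixes emb :: "'k::{alg_closed_field,field_char_0} \<Rightarrow> 'a::field_char_0"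
  assumes emb_field_embedding: "field_embedding emb"
begin

lemma emb_0 [simp]: "emb 0 = 0" and emb_1 [simp]: "emb 1 = 1"
  and emb_add: "emb (a + b) = emb a + emb b" and emb_mult: "emb (a * b) = emb a * emb b"
proof -
  have h: "emb \<in> ring_hom type_ring type_ring"
    using emb_field_embedding by (simp add: field_embedding_def)
  show 1: "emb 1 = 1" using ring_hom_one[OF h] by simp
  show 2: "emb (a + b) = emb a + emb b" for a b using ring_hom_add[OF h, of a b] by simp
  show "emb (a * b) = emb a * emb b" using ring_hom_mult[OF h, of a b] by simp
  show "emb 0 = 0" using 2[of 0 0] by simp
qed

lemma emb_minus: "emb (- a) = - emb a"
  using emb_add[of a "- a"] by (simp add: eq_neg_iff_add_eq_0 add.commute)

lemma emb_diff: "emb (a - b) = emb a - emb b"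
  using emb_add[of a "- b"] by (simp add: emb_minus)

lemma emb_inverse: "emb (inverse a) = inverse (emb a)"
proof (cases "a = 0")
  case False
  hence "emb a * emb (inverse a) = 1" by (simp flip: emb_mult)
  thus ?thesis by (metis inverse_unique)
qed simp

lemma emb_divide: "emb (a / b) = emb a / emb b"
  by (simp add: divide_inverse emb_mult emb_inverse)

lemma emb_eq_0 [simp]: "emb a = 0 \<longleftrightarrow> a = 0"
  using emb_mult[of a "inverse a"] by (cases "a = 0") auto

lemma emb_eq_iff [simp]: "emb a = emb b \<longleftrightarrow> a = b"
  using emb_eq_0[of "a - b"] by (simp add: emb_diff del: emb_eq_0)

lemma emb_power: "emb (a ^ n) = emb a ^ n"
  by (induction n) (auto simp: emb_mult)

lemma emb_of_nat: "emb (of_nat n) = of_nat n"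
  by (induction n) (auto simp: emb_add)

lemma emb_numeral: "emb (numeral n) = numeral n"
  using emb_of_nat[of "numeral n"] by simp

lemmas emb_hom = emb_add emb_mult emb_minus emb_diff emb_inverse emb_divide emb_power emb_numeral

lemma sqrt_const: "\<exists>d. d ^ 2 = (c :: 'k)"
  using nth_root_exists[of 2 c] by simp

subsection \<open>Polynomials and rational functions in one element\<close>

definition ev :: "'k poly \<Rightarrow> 'a \<Rightarrow> 'a" where
  "ev p x = poly (map_poly emb p) x"

lemma ev_0 [simp]: "ev 0 x = 0" and ev_pCons [simp]: "ev (pCons c p) x = emb c + x * ev p x"
  by (simp_all add: ev_def map_poly_pCons)

lemma ev_1 [simp]: "ev 1 x = 1"
  by (simp add: one_pCons)

lemma ev_add: "ev (p + q) x = ev p x + ev q x"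
proof (induction p arbitrary: q)
  case (pCons c p)
  obtain d r where q: "q = pCons d r" by (cases q)
  show ?case using pCons.IH[of r] by (simp add: q emb_add algebra_simps)
qed simp

lemma ev_smult: "ev (Polynomial.smult c p) x = emb c * ev p x"
  by (induction p) (auto simp: emb_mult algebra_simps)

lemma ev_mult: "ev (p * q) x = ev p x * ev q x"
  by (induction p) (auto simp: ev_add ev_smult algebra_simps)

lemma ev_minus: "ev (- p) x = - ev p x"
  using ev_add[of p "- p" x] by (simp add: eq_neg_iff_add_eq_0 add.commute)

lemma ev_diff: "ev (p - q) x = ev p x - ev q x"
  using ev_add[of p "- q" x] by (simp add: ev_minus)

lemma ev_power: "ev (p ^ n) x = ev p x ^ n"
  by (induction n) (auto simp: ev_mult)

lemma ev_pcompose: "ev (pcompose p q) x = ev p (ev q x)"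
  by (induction p) (auto simp: pcompose_pCons ev_add ev_mult)

lemma ev_monom: "ev (Polynomial.monom c n) x = emb c * x ^ n"
  by (induction n) (auto simp: monom_0 monom_Suc algebra_simps)

lemmas ev_hom = ev_add ev_mult ev_minus ev_diff ev_power ev_smult

lemma ev_sum: "ev (sum f I) x = (\<Sum>i\<in>I. ev (f i) x)"
  by (induction I rule: infinite_finite_induct) (auto simp: ev_add)

lemma ev_altdef: "ev p x = (\<Sum>i\<le>degree p. emb (poly.coeff p i) * x ^ i)"
  by (simp add: ev_def poly_altdef degree_map_poly coeff_map_poly)

lemma ev_in_field:
  "field_closed F \<Longrightarrow> range emb \<subseteq> F \<Longrightarrow> x \<in> F \<Longrightarrow> ev p x \<in> F"
  by (induction p) (auto intro!: fc_intros[of F])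

text \<open>Over an algebraically closed field a polynomial splits into linear factors, and no
  \<open>x - emb c\<close> vanishes: every nonconstant element is transcendental.\<close>

lemma ev_eq_0_iff:
  assumes "x \<notin> range emb"
  shows "ev p x = 0 \<longleftrightarrow> p = 0"
proof (induction "degree p" arbitrary: p)
  case 0
  then obtain c where "p = [:c:]" by (metis degree_eq_zeroE)
  thus ?case by simp
next
  case (Suc n)
  then obtain c where "poly p c = 0" using alg_closed_imp_poly_has_root[of p] by auto
  then obtain q where q: "p = [:- c, 1:] * q" by (metis dvdE poly_eq_0_iff_dvd)
  have "q \<noteq> 0" using Suc q by auto
  hence "degree p = Suc (degree q)" unfolding q by (subst degree_mult_eq) auto
  hence "ev q x \<noteq> 0" using Suc \<open>q \<noteq> 0\<close> by auto
  moreover have "x - emb c \<noteq> 0" using assms by auto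
  moreover have "ev p x = (x - emb c) * ev q x" unfolding q ev_mult by (simp add: emb_minus)
  moreover have "p \<noteq> 0" using Suc(2) by auto
  ultimately show ?case by simp
qed

lemma ev_eq_iff:
  assumes "x \<notin> range emb"
  shows "ev p x = ev q x \<longleftrightarrow> p = q"
  using ev_eq_0_iff[OF assms, of "p - q"] by (simp add: ev_diff)

lemma ev_in_range_iff:
  assumes "x \<notin> range emb"
  shows "ev p x \<in> range emb \<longleftrightarrow> degree p = 0"
proof
  assume "ev p x \<in> range emb"
  then obtain c where "ev p x = ev [:c:] x" by auto
  hence "p = [:c:]" by (simp only: ev_eq_iff[OF assms])
  thus "degree p = 0" by simp
next
  assume "degree p = 0"
  then obtain c where "p = [:c:]" by (metis degree_eq_zeroE)
  thus "ev p x \<in> range emb" by simp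
qed

text \<open>The field \<open>k(x)\<close>; for constant \<open>x\<close> it is just the image of
  \<open>k\<close>.\<close>

definition ratf :: "'a \<Rightarrow> 'a set" where
  "ratf x = {ev p x / ev q x | p q. ev q x \<noteq> 0}"

lemma ratfI: "ev q x \<noteq> 0 \<Longrightarrow> ev p x / ev q x \<in> ratf x"
  by (auto simp: ratf_def)

lemma ev_in_ratf: "ev p x \<in> ratf x"
  using ratfI[of 1 x p] by simp

lemma gen_in_ratf: "x \<in> ratf x"
  using ev_in_ratf[of "[:0, 1:]" x] by simp

lemma range_emb_subset_ratf: "range emb \<subseteq> ratf x"
proof
  fix z assume "z \<in> range emb"
  then obtain c where "z = ev [:c:] x" by auto
  thus "z \<in> ratf x" using ev_in_ratf[of "[:c:]" x] by simp
qed

lemma ratf_field: "field_closed (ratf x)"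
proof (rule field_closedI)
  show "1 \<in> ratf x" using ev_in_ratf[of 1 x] by simp
  show "- a \<in> ratf x" if "a \<in> ratf x" for a
  proof -
    obtain p q where "a = ev p x / ev q x" "ev q x \<noteq> 0" using \<open>a \<in> ratf x\<close> by (auto simp: ratf_def)
    thus ?thesis using ratfI[of q x "- p"] by (simp add: ev_minus)
  qed
  show "inverse a \<in> ratf x" if a: "a \<in> ratf x" "a \<noteq> 0" for a
  proof -
    obtain p q where "a = ev p x / ev q x" "ev q x \<noteq> 0" using a(1) by (auto simp: ratf_def)
    thus ?thesis using a(2) ratfI[of p x q] by auto
  qed
  fix a b assume a: "a \<in> ratf x" and b: "b \<in> ratf x"
  obtain p q where p: "a = ev p x / ev q x" "ev q x \<noteq> 0" using a by (auto simp: ratf_def)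
  obtain r s where r: "b = ev r x / ev s x" "ev s x \<noteq> 0" using b by (auto simp: ratf_def)
  have "a + b = ev (p * s + r * q) x / ev (q * s) x"
    unfolding p(1) r(1) using p(2) r(2) by (simp add: ev_hom add_frac_eq)
  moreover have "ev (q * s) x \<noteq> 0" using p r by (simp add: ev_mult)
  ultimately show "a + b \<in> ratf x" using ratfI by metis
  have "a * b = ev (p * r) x / ev (q * s) x" using p r by (simp add: ev_hom)
  moreover have "ev (q * s) x \<noteq> 0" using p r by (simp add: ev_mult)
  ultimately show "a * b \<in> ratf x" using ratfI by metis
qed

lemma ratf_minimal:
  assumes "field_closed F" "range emb \<subseteq> F" "x \<in> F"
  shows "ratf x \<subseteq> F"
  unfolding ratf_def using ev_in_field[OF assms] fc_divide[OF assms(1)] by auto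

lemma ratf_subset: "x \<in> ratf y \<Longrightarrow> ratf x \<subseteq> ratf y"
  by (rule ratf_minimal[OF ratf_field range_emb_subset_ratf])

lemma intermediate_field_iff:
  "intermediate_field emb F \<longleftrightarrow> field_closed F \<and> range emb \<subseteq> F"
  by (simp add: intermediate_field_def subfield_iff_field_closed)

lemma generate_field_eq_ratf: "generate_field type_ring (insert x (range emb)) = ratf x"
proof
  show "generate_field type_ring (insert x (range emb)) \<subseteq> ratf x"
    by (rule field.generate_field_min_subfield1[OF field_from_type_algebra])
      (auto simp: subfield_iff_field_closed ratf_field gen_in_ratf intro: range_emb_subset_ratf[THEN subsetD])
  have s: "subfield (generate_field type_ring (insert x (range emb))) type_ring"
    by (rule field.generate_field_is_subfield[OF field_from_type_algebra]) simp
  have "insert x (range emb) \<subseteq> generate_field type_ring (insert x (range emb))"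
    by (auto intro: generate_field.incl)
  thus "ratf x \<subseteq> generate_field type_ring (insert x (range emb))"
    using s by (intro ratf_minimal) (auto simp: subfield_iff_field_closed)
qed

lemma transcendental_iff: "type_ring.transcendental (range emb) x \<longleftrightarrow> x \<notin> range emb"
proof -
  have dom: "domain (type_ring :: 'a ring)"
    using field_from_type_algebra by (rule field.axioms)
  have sf: "field_closed (range emb)"
  proof (rule field_closedI)
    show "1 \<in> range emb" by (metis emb_1 rangeI)
  qed (auto simp flip: emb_hom)
  have sr: "subring (range emb) type_ring"
    using sf subfieldE(1) subfield_iff_field_closed by blast
  show ?thesis
  proof
    assume t: "type_ring.transcendental (range emb) x"
    show "x \<notin> range emb"
    proof
      assume "x \<in> range emb"
      hence "type_ring.algebraic (range emb) x"
        using domain.algebraic_self[OF dom sr] by (simp add: over_def)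
      thus False using t by simp
    qed
  next
    assume x: "x \<notin> range emb"
    show "type_ring.transcendental (range emb) x"
    proof (rule ccontr)
      assume "type_ring.algebraic (range emb) x"
      then obtain p where p: "p \<in> carrier ((range emb) [X]\<^bsub>type_ring\<^esub>)" "p \<noteq> []" "type_ring.eval p x = 0"
        using domain.algebraicE[OF dom sr, of x] by (auto simp: over_def)
      have pol: "polynomial\<^bsub>type_ring\<^esub> (range emb) p"
        using p(1) by (simp add: univ_poly_carrier)
      have set: "set p \<subseteq> range emb" "hd p \<noteq> 0" using pol p(2) by (auto simp: polynomial_def)
      have pw: "x [^]\<^bsub>type_ring\<^esub> (n::nat) = x ^ n" for n
        by (induction n) (simp_all add: mult.commute)
      \<comment> \<open>HOL-Algebra polynomials are coefficient lists with the leading coefficient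
        first. The invariant tracks that coefficient, so that a nonempty list yields a nonzero
        \<open>poly\<close>.\<close>
      have "\<exists>q. type_ring.eval p x = ev q x \<and> length p \<ge> degree q \<and> (\<forall>i\<ge>length p. poly.coeff q i = 0) \<and>
              (p \<noteq> [] \<longrightarrow> emb (poly.coeff q (length p - 1)) = hd p)"
        using set(1)
      proof (induction p)
        case (Cons a p)
        then obtain q c where q: "type_ring.eval p x = ev q x" "\<forall>i\<ge>length p. poly.coeff q i = 0"
          "emb c = a" by auto
        have "type_ring.eval (a # p) x = ev (Polynomial.monom c (length p) + q) x"
          using q by (simp add: pw ev_add ev_monom)
        moreover have "\<forall>i\<ge>length (a # p). poly.coeff (Polynomial.monom c (length p) + q) i = 0"
          using q by auto
        moreover have "emb (poly.coeff (Polynomial.monom c (length p) + q) (length (a # p) - 1)) = a"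
          using q by (simp add: emb_add)
        ultimately show ?case
          by (intro exI[of _ "Polynomial.monom c (length p) + q"]) (auto intro!: degree_le)
      qed (auto intro!: exI[of _ 0])
      then obtain q where q: "ev q x = 0" "emb (poly.coeff q (length p - 1)) = hd p" using p by auto
      hence "q \<noteq> 0" using set(2) by auto
      thus False using q ev_eq_0_iff[OF x] by simp
    qed
  qed
qed

lemma emb_notin_ratf_inverse:
  assumes "x \<notin> range emb"
  shows "inverse (x - emb c) \<notin> range emb"
proof
  assume "inverse (x - emb c) \<in> range emb"
  then obtain d where "inverse (x - emb c) = emb d" by auto
  hence "x - emb c = emb (inverse d)" by (metis emb_inverse inverse_inverse_eq)
  hence "x = emb (c + inverse d)" by (simp add: emb_add algebra_simps)
  thus False using assms by blast
qed

end

context constants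
begin

subsection \<open>Dimensions over the constants\<close>

sublocale VS: vector_space "\<lambda>c x. emb c * x"
  by unfold_locales (simp_all add: emb_hom algebra_simps)

text \<open>\<open>VS.dim\<close> takes the default value 0 on infinite-dimensional sets, so
  finiteness has to be carried along separately.\<close>

definition fin_dim :: "'a set \<Rightarrow> bool" where
  "fin_dim V \<longleftrightarrow> (\<exists>B. finite B \<and> V \<subseteq> VS.span B)"

lemma fin_dimI: "finite B \<Longrightarrow> V \<subseteq> VS.span B \<Longrightarrow> fin_dim V"
  unfolding fin_dim_def by blast

lemma fin_dim_subset: "fin_dim V \<Longrightarrow> U \<subseteq> V \<Longrightarrow> fin_dim U"
  unfolding fin_dim_def by blast

lemma fin_dim_independent:
  assumes V: "fin_dim V" and B: "VS.independent B" "B \<subseteq> V"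
  shows "finite B \<and> card B \<le> VS.dim V"
proof -
  obtain S where S: "finite S" "V \<subseteq> VS.span S" using V by (auto simp: fin_dim_def)
  obtain B' where B': "B \<subseteq> B'" "B' \<subseteq> V" "VS.independent B'" "V \<subseteq> VS.span B'"
    using VS.maximal_independent_subset_extend[OF B(2,1)] by blast
  have "finite B'" using VS.independent_span_bound[OF S(1) B'(3)] B'(2) S(2) by blast
  moreover have "card B' = VS.dim V" using VS.basis_card_eq_dim B' by blast
  ultimately show ?thesis using B'(1) card_mono finite_subset by metis
qed

lemma fin_dim_basis:
  assumes "fin_dim V"
  obtains B where "finite B" "B \<subseteq> V" "VS.independent B" "V \<subseteq> VS.span B" "card B = VS.dim V"
proof -
  obtain B where B: "B \<subseteq> V" "VS.independent B" "V \<subseteq> VS.span B" "card B = VS.dim V"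
    by (rule VS.basis_exists)
  thus ?thesis using that fin_dim_independent[OF assms] by blast
qed

text \<open>Here the default value 0 helps: a positive dimension proves finiteness. This is how
  Riemann's inequality later makes Riemann-Roch spaces finite-dimensional.\<close>

lemma fin_dim_if_dim_pos: "VS.dim V > 0 \<Longrightarrow> fin_dim V"
proof -
  assume "VS.dim V > 0"
  moreover obtain B where B: "B \<subseteq> V" "VS.independent B" "V \<subseteq> VS.span B" "card B = VS.dim V"
    by (rule VS.basis_exists)
  ultimately show ?thesis unfolding fin_dim_def by (metis card.infinite less_irrefl)
qed

lemma dim_mono:
  assumes "fin_dim V" "U \<subseteq> V"
  shows "VS.dim U \<le> VS.dim V"
proof -
  obtain B where B: "B \<subseteq> U" "VS.independent B" "U \<subseteq> VS.span B" "card B = VS.dim U"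
    by (rule VS.basis_exists)
  thus ?thesis using fin_dim_independent[OF assms(1), of B] assms(2) by auto
qed

lemma dim_insert_le:
  assumes "fin_dim U" "V \<subseteq> VS.span (insert f U)"
  shows "fin_dim V" "VS.dim V \<le> VS.dim U + 1"
proof -
  obtain B where B: "finite B" "B \<subseteq> U" "U \<subseteq> VS.span B" "card B = VS.dim U"
    using fin_dim_basis[OF assms(1)] by metis
  have "insert f U \<subseteq> VS.span (insert f B)"
    using B(3) VS.span_mono[of B "insert f B"] by (auto intro: VS.span_base)
  hence V: "V \<subseteq> VS.span (insert f B)"
    using assms(2) VS.span_minimal[OF _ VS.subspace_span] by blast
  thus "fin_dim V" unfolding fin_dim_def using B(1) by blast
  have "VS.dim V \<le> card (insert f B)" using VS.dim_le_card[OF V] B(1) by simp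
  thus "VS.dim V \<le> VS.dim U + 1" using B by (simp add: card_insert_if split: if_splits)
qed

lemma dim_Suc_le:
  assumes "fin_dim V" "VS.subspace U" "U \<subseteq> V" "f \<in> V" "f \<notin> U"
  shows "VS.dim U + 1 \<le> VS.dim V"
proof -
  obtain B where B: "finite B" "B \<subseteq> U" "VS.independent B" "card B = VS.dim U"
    using fin_dim_basis[OF fin_dim_subset[OF assms(1,3)]] by metis
  have "VS.span B \<subseteq> U" using B(2) assms(2) by (rule VS.span_minimal)
  hence f: "f \<notin> VS.span B" using assms(5) by blast
  hence "VS.independent (insert f B)" using B(3) by (rule VS.independent_insertI)
  hence "card (insert f B) \<le> VS.dim V"
    using fin_dim_independent[OF assms(1), of "insert f B"] B(2) assms(3,4) by blast
  moreover have "f \<notin> B" using f VS.span_base by blast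
  ultimately show ?thesis using B(1,4) by simp
qed

lemma dim_mult_image_le:
  assumes "fin_dim V"
  shows "fin_dim ((*) a ` V)" "VS.dim ((*) a ` V) \<le> VS.dim V"
proof -
  obtain B where B: "finite B" "B \<subseteq> V" "V \<subseteq> VS.span B" "card B = VS.dim V"
    using fin_dim_basis[OF assms] by metis
  let ?T = "{x. a * x \<in> VS.span ((*) a ` B)}"
  have "VS.subspace ?T"
  proof (rule VS.subspaceI)
    show "x + y \<in> ?T" if "x \<in> ?T" "y \<in> ?T" for x y
      using that VS.span_add[of "a * x" _ "a * y"] by (simp add: distrib_left)
    show "emb c * x \<in> ?T" if "x \<in> ?T" for c x
      using that VS.span_scale[of "a * x" _ c] by (simp add: mult.left_commute)
  qed (simp add: VS.span_zero)
  hence "VS.span B \<subseteq> ?T" by (intro VS.span_minimal) (auto intro: VS.span_base)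
  hence sub: "(*) a ` V \<subseteq> VS.span ((*) a ` B)" using B(3) by auto
  thus "fin_dim ((*) a ` V)" unfolding fin_dim_def using B(1) by blast
  have "VS.dim ((*) a ` V) \<le> card ((*) a ` B)" using VS.dim_le_card[OF sub] B(1) by simp
  also have "\<dots> \<le> card B" by (rule card_image_le[OF B(1)])
  finally show "VS.dim ((*) a ` V) \<le> VS.dim V" using B(4) by simp
qed

lemma dim_mult_image:
  assumes "fin_dim V" "a \<noteq> 0"
  shows "VS.dim ((*) a ` V) = VS.dim V"
proof -
  have "(*) (inverse a) ` (*) a ` V = V"
    using assms(2) by (auto simp: image_image mult.assoc[symmetric])
  hence "VS.dim V \<le> VS.dim ((*) a ` V)"
    using dim_mult_image_le(2)[OF dim_mult_image_le(1)[OF assms(1)], of "inverse a" a] by simp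
  thus ?thesis using dim_mult_image_le(2)[OF assms(1), of a] by simp
qed

lemma dim_direct_sum:
  assumes fd: "fin_dim V" and U: "VS.subspace U" "U \<subseteq> V" and W: "VS.subspace W" "W \<subseteq> V"
    and int: "U \<inter> W \<subseteq> {0}" and sum: "\<And>v. v \<in> V \<Longrightarrow> \<exists>u\<in>U. \<exists>w\<in>W. v = u + w" 
    and V: "VS.subspace V"
  shows "VS.dim V = VS.dim U + VS.dim W"
proof -
  obtain A where A: "finite A" "A \<subseteq> U" "U \<subseteq> VS.span A" "card A = VS.dim U"
    using fin_dim_basis[OF fin_dim_subset[OF fd U(2)]] by metis
  obtain B where B: "finite B" "B \<subseteq> W" "VS.independent B" "W \<subseteq> VS.span B" "card B = VS.dim W"
    using fin_dim_basis[OF fin_dim_subset[OF fd W(2)]] by metis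
  have "V \<subseteq> VS.span (A \<union> B)"
  proof
    fix v assume "v \<in> V"
    then obtain u w where "u \<in> U" "w \<in> W" "v = u + w" using sum by blast
    thus "v \<in> VS.span (A \<union> B)" using A(3) B(4) by (auto simp: VS.span_Un)
  qed
  hence "VS.dim V \<le> card (A \<union> B)" using VS.dim_le_card A(1) B(1) by blast
  hence 1: "VS.dim V \<le> VS.dim U + VS.dim W" using card_Un_le[of A B] A(4) B(5) by linarith
  \<comment> \<open>The basis of \<open>W\<close> is added to \<open>U\<close> one vector at a time.
    Each raises the dimension, for otherwise \<open>U\<close> and \<open>W\<close> would share a
    nonzero vector or \<open>B\<close> would be dependent.\<close>
  have "VS.dim (VS.span (U \<union> C)) \<ge> VS.dim U + card C" if "finite C" "C \<subseteq> B" for C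
    using that
  proof (induction C rule: finite_induct)
    case empty
    thus ?case by simp
  next
    case (insert b C)
    have sp: "VS.span (U \<union> D) \<subseteq> V" if "D \<subseteq> B" for D
      using that V U(2) W(2) B(2) by (intro VS.span_minimal) auto
    have "b \<notin> VS.span (U \<union> C)"
    proof
      assume "b \<in> VS.span (U \<union> C)"
      then obtain u w where uw: "u \<in> U" "w \<in> VS.span C" "b = u + w"
        using U(1) by (auto simp: VS.span_Un VS.span_eq_iff[THEN iffD2])
      have "w \<in> W" using uw(2) insert(4) B(2) VS.span_minimal[OF _ W(1), of C] by blast
      moreover have "b \<in> W" using insert(4) B(2) by blast
      ultimately have "u \<in> W" using VS.subspace_diff[OF W(1), of b w] uw(3) by simp
      hence "u = 0" using uw(1) int by blast
      hence "b \<in> VS.span C" using uw by simp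
      moreover have "C \<subseteq> B - {b}" using insert by blast
      ultimately have "b \<in> VS.span (B - {b})" using VS.span_mono by blast
      thus False using B(3) insert(4) unfolding VS.dependent_def by blast
    qed
    moreover have "b \<in> VS.span (U \<union> insert b C)" by (rule VS.span_base) simp
    moreover have "VS.span (U \<union> C) \<subseteq> VS.span (U \<union> insert b C)" by (rule VS.span_mono) blast
    ultimately have "VS.dim (VS.span (U \<union> C)) + 1 \<le> VS.dim (VS.span (U \<union> insert b C))"
      by (intro dim_Suc_le[OF _ VS.subspace_span]) (use fin_dim_subset[OF fd sp[OF insert(4)]] in auto)
    thus ?case using insert by simp
  qed
  from this[OF B(1)] have "VS.dim U + card B \<le> VS.dim (VS.span (U \<union> B))" by blast
  also have "\<dots> \<le> VS.dim V"
    using V U(2) W(2) B(2) by (intro dim_mono[OF fd] VS.span_minimal) auto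
  finally show ?thesis using 1 B(5) by linarith
qed

text \<open>Indexed form of independence: a repeated member of the family would itself give a
  relation, so injectivity of \<open>w\<close> is a consequence.\<close>

lemma card_le_dim_if_independent_family:
  assumes fd: "fin_dim V" and I: "finite I" "w ` I \<subseteq> V"
    and ind: "\<And>c i. (\<Sum>i\<in>I. emb (c i) * w i) = 0 \<Longrightarrow> i \<in> I \<Longrightarrow> c i = 0"
  shows "card I \<le> VS.dim V"
proof -
  have inj: "inj_on w I"
  proof (rule inj_onI, rule ccontr)
    fix i j assume ij: "i \<in> I" "j \<in> I" "w i = w j" "i \<noteq> j"
    have "(\<Sum>l\<in>I. emb ((if l = i then 1 else 0) - (if l = j then 1 else 0)) * w l) =
          (\<Sum>l\<in>I. (if l = i then w l else 0) - (if l = j then w l else 0))"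
      by (rule sum.cong) (auto simp: emb_diff)
    also have "\<dots> = 0" using ij I(1) by (simp add: sum_subtractf sum.delta)
    finally have "(if i = i then 1 else 0) - (if i = j then 1 else 0) = (0::'k)"
      using ind[of "\<lambda>l. (if l = i then 1 else 0) - (if l = j then 1 else 0)" i] ij(1) by blast
    thus False using ij(4) by simp
  qed
  have "VS.independent (w ` I)"
  proof (rule VS.independent_if_scalars_zero)
    fix f x assume f: "(\<Sum>x\<in>w ` I. emb (f x) * x) = 0" and x: "x \<in> w ` I"
    have "(\<Sum>i\<in>I. emb (f (w i)) * w i) = 0" using f by (simp add: sum.reindex[OF inj])
    thus "f x = 0" using x ind[of "\<lambda>i. f (w i)"] by auto
  qed (use I in simp)
  thus ?thesis using fin_dim_independent[OF fd _ I(2)] card_image[OF inj] by simp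
qed

lemma dim_range_emb: "VS.dim (range emb) = 1" "fin_dim (range emb)"
proof -
  have sp: "range emb \<subseteq> VS.span {1}"
  proof
    fix z assume "z \<in> range emb"
    then obtain c where "z = emb c * 1" by auto
    thus "z \<in> VS.span {1}" using VS.span_scale[of 1 "{1}" c] VS.span_base[of 1 "{1}"] by simp
  qed
  thus "fin_dim (range emb)" unfolding fin_dim_def by blast
  have "VS.independent {1}" by simp
  thus "VS.dim (range emb) = 1"
    using VS.basis_card_eq_dim[of "{1}" "range emb"] sp rangeI[of emb 1] by simp
qed

lemma ex_nonconst_if_dim_ge_2:
  assumes "VS.dim V \<ge> 2"
  shows "\<exists>f\<in>V. f \<notin> range emb"
proof (rule ccontr)
  assume "\<not> ?thesis"
  hence "V \<subseteq> range emb" by blast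
  from dim_mono[OF dim_range_emb(2) this] show False using dim_range_emb(1) assms by linarith
qed

subsection \<open>Algebraic dependence\<close>

text \<open>A relation for \<open>g\<close> over \<open>k[f]\<close>. It is used by comparing
  valuations of its terms, with the lowest or the highest nonzero \<open>P j\<close>
  dominating.\<close>

definition alg_dep :: "'a \<Rightarrow> 'a \<Rightarrow> bool" where
  "alg_dep f g \<longleftrightarrow> (\<exists>P n. (\<exists>j\<le>n. P j \<noteq> 0) \<and> (\<Sum>j\<le>n. ev (P j) f * g ^ j) = 0)"

lemma common_denominator:
  assumes "x \<notin> range emb" "finite I" "\<And>i. i \<in> I \<Longrightarrow> a i \<in> ratf x"
  shows "\<exists>d. d \<noteq> 0 \<and> (\<forall>i\<in>I. \<exists>q. ev d x * a i = ev q x)"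
  using assms(2,3)
proof (induction I rule: finite_induct)
  case empty
  show ?case by (rule exI[of _ 1]) simp
next
  case (insert i I)
  obtain d where d: "d \<noteq> 0" "\<And>j. j \<in> I \<Longrightarrow> \<exists>q. ev d x * a j = ev q x" using insert by auto
  obtain p r where p: "a i = ev p x / ev r x" "ev r x \<noteq> 0"
    using insert(4)[of i] by (auto simp: ratf_def)
  show ?case
  proof (rule exI[of _ "d * r"], rule conjI, goal_cases)
    case 1
    show "d * r \<noteq> 0" using d(1) p(2) by auto
  next
    case 2
    show ?case
    proof
    fix j assume j: "j \<in> insert i I"
    show "\<exists>q. ev (d * r) x * a j = ev q x"
    proof (cases "j = i")
      case True
      have "ev (d * r) x * a i = ev (d * p) x" using p by (simp add: ev_mult)
      thus ?thesis using True by blast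
    next
      case False
      then obtain q where "ev d x * a j = ev q x" using d(2) j by blast
      hence "ev (d * r) x * a j = ev (q * r) x" by (simp add: ev_mult algebra_simps)
      thus ?thesis by blast
    qed
    qed
  qed
qed

lemma dimension_imp_spanning:
  assumes "type_ring.dimension n K E"
  shows "\<exists>e. \<forall>z\<in>E. \<exists>a. (\<forall>l<n. a l \<in> K) \<and> z = (\<Sum>l<n. a l * e l)"
  using assms
proof (induction rule: type_ring.dimension.induct)
  case (zero_dim K)
  show ?case by auto
next
  case (Suc_dim v E n K)
  then obtain e where e: "\<And>z. z \<in> E \<Longrightarrow> \<exists>a. (\<forall>l<n. a l \<in> K) \<and> z = (\<Sum>l<n. a l * e l)" by blast
  show ?case
  proof (rule exI[of _ "e(n := v)"], rule ballI)
    fix z assume "z \<in> type_ring.line_extension K v E"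
    then obtain k y where k: "k \<in> K" "y \<in> E" "z = k * v + y"
      using type_ring.line_extension_mem_iff[of z K v E] by auto
    obtain a where a: "\<forall>l<n. a l \<in> K" "y = (\<Sum>l<n. a l * e l)" using e[OF k(2)] by blast
    have "z = (\<Sum>l<Suc n. (a(n := k)) l * (e(n := v)) l)" using k a by simp
    moreover have "\<forall>l<Suc n. (a(n := k)) l \<in> K" using a k by (auto simp: less_Suc_eq)
    ultimately show "\<exists>a. (\<forall>l<Suc n. a l \<in> K) \<and> z = (\<Sum>l<Suc n. a l * (e(n := v)) l)" by blast
  qed
qed

text \<open>A counting argument: after one common denominator is cleared, the
  \<open>(N + 1)^2\<close> monomials \<open>f^i g^j\<close> lie in a space whose dimension grows
  only linearly in \<open>N\<close>.\<close>

lemma function_field_alg_dep: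
  assumes "function_field emb (UNIV :: 'a set)"
  shows "alg_dep f g"
proof -
  obtain x n where x: "x \<notin> range emb" and deg: "type_ring.dimension n (ratf x) (UNIV :: 'a set)"
    using assms unfolding function_field_def transcendental_iff generate_field_eq_ratf ext_degree_def
    by blast
  obtain e where e: "\<And>z. \<exists>a. (\<forall>l<n. a l \<in> ratf x) \<and> z = (\<Sum>l<n. a l * e l)"
    using dimension_imp_spanning[OF deg] by blast
  \<comment> \<open>Combinations of the generators \<open>e l\<close> with polynomial coefficients
    in \<open>x\<close> of degree at most \<open>C\<close>.\<close>
  define W where "W C = {(\<Sum>l<n. ev (p l) x * e l) | p. \<forall>l<n. degree (p l) \<le> C}" for C
  have W_I: "(\<Sum>l<n. ev (p l) x * e l) \<in> W C" if "\<And>l. l < n \<Longrightarrow> degree (p l) \<le> C" for p C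
    unfolding W_def using that by (intro CollectI exI[of _ p] conjI refl) simp
  have W_span: "W C \<subseteq> VS.span ((\<lambda>(i, l). x ^ i * e l) ` ({..C} \<times> {..<n}))" for C
  proof
    fix z assume "z \<in> W C"
    then obtain p where p: "z = (\<Sum>l<n. ev (p l) x * e l)" "\<forall>l<n. degree (p l) \<le> C"
      by (auto simp: W_def)
    have mem: "emb c * (x ^ i * e l) \<in> VS.span ((\<lambda>(i, l). x ^ i * e l) ` ({..C} \<times> {..<n}))"
      if "i \<le> C" "l < n" for c i l
      using that by (intro VS.span_scale VS.span_base image_eqI[of _ _ "(i, l)"]) auto
    show "z \<in> VS.span ((\<lambda>(i, l). x ^ i * e l) ` ({..C} \<times> {..<n}))"
      unfolding p(1) ev_altdef sum_distrib_right mult.assoc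
    proof (rule VS.span_sum, rule VS.span_sum)
      fix l i assume "l \<in> {..<n}" "i \<in> {..degree (p l)}"
      thus "emb (poly.coeff (p l) i) * (x ^ i * e l) \<in> VS.span ((\<lambda>(i, l). x ^ i * e l) ` ({..C} \<times> {..<n}))"
        using p(2) by (intro mem) (auto intro: le_trans)
    qed
  qed
  have W_fd: "fin_dim (W C)" for C
    by (rule fin_dimI[OF _ W_span]) simp
  have W_dim: "VS.dim (W C) \<le> n * (C + 1)" for C
  proof -
    have "VS.dim (W C) \<le> card ((\<lambda>(i, l). x ^ i * e l) ` ({..C} \<times> {..<n}))"
      by (rule VS.dim_le_card[OF W_span]) simp
    also have "\<dots> \<le> card ({..C} \<times> {..<n})" by (rule card_image_le) simp
    finally show ?thesis by (simp add: mult.commute)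
  qed
  obtain A where A: "\<And>h l m. m < n \<Longrightarrow> A h l m \<in> ratf x" "\<And>h l. h * e l = (\<Sum>m<n. A h l m * e m)"
  proof -
    have "\<forall>h l. \<exists>a. (\<forall>m<n. a m \<in> ratf x) \<and> h * e l = (\<Sum>m<n. a m * e m)" using e by blast
    then obtain A where "\<forall>h l. (\<forall>m<n. A h l m \<in> ratf x) \<and> h * e l = (\<Sum>m<n. A h l m * e m)" by metis
    thus ?thesis using that by blast
  qed
  \<comment> \<open>\<open>h = 1\<close> is included because bare powers of \<open>D\<close> serve
    as padding: every monomial must be multiplied by the same power \<open>2 * N\<close> of
    \<open>D\<close>.\<close>
  obtain d where d: "d \<noteq> 0" "\<And>h l m. h \<in> {f, g, 1} \<Longrightarrow> l < n \<Longrightarrow> m < n \<Longrightarrow> \<exists>q. ev d x * A h l m = ev q x"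
    using common_denominator[OF x, of "{f, g, 1} \<times> {..<n} \<times> {..<n}" "\<lambda>(h, l, m). A h l m"] A(1)
    by (auto simp: Ball_def)
  obtain Q where Q: "\<And>h l m. h \<in> {f, g, 1} \<Longrightarrow> l < n \<Longrightarrow> m < n \<Longrightarrow> ev d x * A h l m = ev (Q h l m) x"
    using d(2) by metis
  obtain C where C: "\<And>h l m. h \<in> {f, g, 1} \<Longrightarrow> l < n \<Longrightarrow> m < n \<Longrightarrow> degree (Q h l m) \<le> C"
  proof -
    let ?S = "(\<lambda>(h, l, m). degree (Q h l m)) ` ({f, g, 1} \<times> {..<n} \<times> {..<n})"
    have "degree (Q h l m) \<le> Max ?S" if "h \<in> {f, g, 1}" "l < n" "m < n" for h l m
      using that by (intro Max_ge) force+
    thus ?thesis using that by blast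
  qed
  define D where "D = ev d x"
  have D0: "D \<noteq> 0" using d(1) ev_eq_0_iff[OF x] by (simp add: D_def)
  have step: "D * h * z \<in> W (c + C)" if h: "h \<in> {f, g, 1}" and z: "z \<in> W c" for h z c
  proof -
    obtain p where p: "z = (\<Sum>l<n. ev (p l) x * e l)" "\<forall>l<n. degree (p l) \<le> c"
      using z by (auto simp: W_def)
    have "D * h * z = (\<Sum>l<n. ev (p l) x * (D * (h * e l)))"
      unfolding p(1) sum_distrib_left by (rule sum.cong) (simp_all only: ac_simps)
    also have "\<dots> = (\<Sum>l<n. \<Sum>m<n. ev (p l * Q h l m) x * e m)"
      unfolding A(2)[of h] sum_distrib_left
    proof (intro sum.cong refl)
      fix l m assume "l \<in> {..<n}" "m \<in> {..<n}"
      hence "ev (Q h l m) x = D * A h l m" using Q[OF h, of l m] by (simp add: D_def)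
      thus "ev (p l) x * (D * (A h l m * e m)) = ev (p l * Q h l m) x * e m"
        unfolding ev_mult by (simp only: ac_simps)
    qed
    also have "\<dots> = (\<Sum>m<n. ev (\<Sum>l<n. p l * Q h l m) x * e m)"
      unfolding ev_sum sum_distrib_right by (rule sum.swap)
    finally have eq: "D * h * z = (\<Sum>m<n. ev (\<Sum>l<n. p l * Q h l m) x * e m)" .
    have "degree (\<Sum>l<n. p l * Q h l m) \<le> c + C" if "m < n" for m
    proof (rule degree_sum_le)
      fix l assume "l \<in> {..<n}"
      hence "degree (p l) \<le> c" "degree (Q h l m) \<le> C" using p(2) C[OF h _ that] by auto
      thus "degree (p l * Q h l m) \<le> c + C"
        using degree_mult_le[of "p l" "Q h l m"] by linarith
    qed simp
    hence "(\<Sum>m<n. ev (\<Sum>l<n. p l * Q h l m) x * e m) \<in> W (c + C)"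
      by (intro W_I) blast
    thus ?thesis by (simp only: eq)
  qed
  have steps: "(D * h) ^ i * z \<in> W (c + i * C)" if h: "h \<in> {f, g, 1}" and z: "z \<in> W c" for h z c i
  proof (induction i)
    case (Suc i)
    show ?case using step[OF h Suc.IH] by (simp add: algebra_simps)
  qed (use z in simp)
  obtain d0 C0 where d0: "d0 \<noteq> 0" "ev d0 x \<in> W C0"
  proof -
    obtain a where a: "\<forall>l<n. a l \<in> ratf x" "1 = (\<Sum>l<n. a l * e l)" using e[of 1] by auto
    obtain d0 where d0: "d0 \<noteq> 0" "\<forall>l\<in>{..<n}. \<exists>q. ev d0 x * a l = ev q x"
      using common_denominator[OF x, of "{..<n}" a] a(1) by auto
    obtain q where q: "\<And>l. l < n \<Longrightarrow> ev d0 x * a l = ev (q l) x" using d0(2) by (metis lessThan_iff)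
    have "ev d0 x = ev d0 x * (\<Sum>l<n. a l * e l)" using a(2) by simp
    also have "\<dots> = (\<Sum>l<n. ev (q l) x * e l)"
      unfolding sum_distrib_left
    proof (intro sum.cong refl)
      fix l assume "l \<in> {..<n}"
      thus "ev d0 x * (a l * e l) = ev (q l) x * e l" using q[of l] by (simp flip: mult.assoc)
    qed
    finally have eq: "ev d0 x = (\<Sum>l<n. ev (q l) x * e l)" .
    have "(\<Sum>l<n. ev (q l) x * e l) \<in> W (Max (insert 0 ((\<lambda>l. degree (q l)) ` {..<n})))"
      by (intro W_I Max_ge) auto
    thus ?thesis unfolding eq[symmetric] using that d0(1) by blast
  qed
  \<comment> \<open>Chosen so that \<open>(N + 1)^2\<close> exceeds
    \<open>n * (C0 + 2 * N * C + 1)\<close>, the bound for the dimension.\<close>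
  define N where "N = n * (C0 + 1) + 2 * n * C"
  define M where "M = ev d0 x * D ^ (2 * N)"
  have M0: "M \<noteq> 0" using d0(1) D0 ev_eq_0_iff[OF x] by (simp add: M_def)
  let ?I = "{..N} \<times> {..N}"
  let ?w = "\<lambda>(i, j). M * (f ^ i * g ^ j)"
  have mem: "?w ` ?I \<subseteq> W (C0 + 2 * N * C)"
  proof (rule image_subsetI)
    fix t assume "t \<in> ?I"
    then obtain i j where t: "t = (i, j)" and "i \<le> N" "j \<le> N" by auto
    hence "i + j \<le> 2 * N" by simp
    then obtain r where r: "2 * N = i + j + r" using le_Suc_ex by blast
    have "(D * f) ^ i * ((D * g) ^ j * ((D * 1) ^ r * ev d0 x)) \<in> W (((C0 + r * C) + j * C) + i * C)"
      by (intro steps d0(2)) auto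
    moreover have "((C0 + r * C) + j * C) + i * C = C0 + 2 * N * C"
      unfolding r by (simp add: algebra_simps)
    moreover have "(D * f) ^ i * ((D * g) ^ j * ((D * 1) ^ r * ev d0 x)) = M * (f ^ i * g ^ j)"
      unfolding M_def r by (simp add: power_mult_distrib power_add)
    ultimately show "?w t \<in> W (C0 + 2 * N * C)"
      unfolding t by simp
  qed
  have "\<not> (\<forall>c. (\<Sum>t\<in>?I. emb (c t) * ?w t) = 0 \<longrightarrow> (\<forall>t\<in>?I. c t = 0))"
  proof
    assume ind: "\<forall>c. (\<Sum>t\<in>?I. emb (c t) * ?w t) = 0 \<longrightarrow> (\<forall>t\<in>?I. c t = 0)"
    have "card ?I \<le> VS.dim (W (C0 + 2 * N * C))"
      by (rule card_le_dim_if_independent_family[OF W_fd _ mem]) (use ind in auto)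
    hence "(N + 1) * (N + 1) \<le> n * (C0 + 2 * N * C + 1)"
      using W_dim[of "C0 + 2 * N * C"] by (simp add: card_cartesian_product)
    also have "\<dots> = n * (C0 + 1) + N * (2 * n * C)" by (simp add: algebra_simps)
    also have "\<dots> \<le> N + N * N"
      by (rule add_mono) (simp_all add: N_def)
    finally show False by (simp add: algebra_simps)
  qed
  then obtain c i j where c: "(\<Sum>t\<in>?I. emb (c t) * ?w t) = 0" "i \<le> N" "j \<le> N" "c (i, j) \<noteq> 0" by auto
  define P where "P j = (\<Sum>i\<le>N. Polynomial.monom (c (i, j)) i)" for j
  have "poly.coeff (P j) i = c (i, j)" using c(2) by (simp add: P_def coeff_sum)
  hence "P j \<noteq> 0" using c(4) by auto
  moreover have "(\<Sum>j\<le>N. ev (P j) f * g ^ j) = 0"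
  proof -
    have "0 = (\<Sum>i\<le>N. \<Sum>j\<le>N. emb (c (i, j)) * (M * (f ^ i * g ^ j)))"
      using c(1) by (simp add: sum.cartesian_product case_prod_unfold)
    also have "\<dots> = (\<Sum>j\<le>N. \<Sum>i\<le>N. emb (c (i, j)) * (M * (f ^ i * g ^ j)))" by (rule sum.swap)
    also have "\<dots> = M * (\<Sum>j\<le>N. ev (P j) f * g ^ j)"
      by (simp add: P_def ev_sum ev_monom sum_distrib_left sum_distrib_right algebra_simps)
    finally show ?thesis using M0 by simp
  qed
  ultimately show ?thesis unfolding alg_dep_def using c(3) by blast
qed

end

subsection \<open>Places\<close>

text \<open>
  The value at \<open>0\<close> of a place is the dummy \<open>0\<close>; \<open>vge v n x\<close> is the relation \<open>n \<le> v x\<close> for the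
  true value \<open>\<infinity>\<close>.
\<close>

definition vge :: "('a::zero \<Rightarrow> int) \<Rightarrow> int \<Rightarrow> 'a \<Rightarrow> bool" where
  "vge v n x \<longleftrightarrow> x = 0 \<or> n \<le> v x"

lemma vge_0 [simp]: "vge v n 0"
  by (simp add: vge_def)

lemma vge_mono: "vge v n x \<Longrightarrow> m \<le> n \<Longrightarrow> vge v m x"
  by (auto simp: vge_def)

lemma vge_refl: "vge v (v x) x"
  by (simp add: vge_def)

lemma vge_D: "vge v n x \<Longrightarrow> x \<noteq> 0 \<Longrightarrow> n \<le> v x"
  by (simp add: vge_def)

text \<open>Algebraic dependence is assumed in place of \<open>function_field\<close> because it
  passes to every intermediate field at once.\<close>

locale curve_field = constants emb
  for emb :: "'k::{alg_closed_field,field_char_0} \<Rightarrow> 'a::field_char_0" +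
  fixes F :: "'a set"
  assumes interm: "intermediate_field emb F"
    and dep: "\<And>f g. f \<in> F \<Longrightarrow> g \<in> F \<Longrightarrow> alg_dep f g"
begin

abbreviation "PL \<equiv> places emb F"

lemma fcF: "field_closed F" and emb_in_F: "emb c \<in> F"
  using interm by (auto simp: intermediate_field_iff)

lemmas F_0 = fc_0[OF fcF] and F_1 = fc_1[OF fcF] and F_add = fc_add[OF fcF] and F_mult = fc_mult[OF fcF]
  and F_minus = fc_minus[OF fcF] and F_diff = fc_diff[OF fcF] and F_inverse = fc_inverse[OF fcF]
  and F_divide = fc_divide[OF fcF] and F_power = fc_power[OF fcF] and F_sum = fc_sum[OF fcF]

lemma F_ev: "x \<in> F \<Longrightarrow> ev p x \<in> F"
  using ev_in_field[OF fcF] emb_in_F by blast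

lemmas F_intros = F_0 F_1 F_add F_mult F_minus F_diff F_inverse F_divide F_power F_sum F_ev emb_in_F

context
  fixes v assumes v: "v \<in> PL"
begin

lemma v_outside: "x \<notin> F - {0} \<Longrightarrow> v x = 0"
  using v unfolding places_def by blast

lemma v_0 [simp]: "v 0 = 0"
  by (rule v_outside) simp

lemma v_emb [simp]: "v (emb c) = 0"
  using v by (simp add: places_def)

lemma v_1 [simp]: "v 1 = 0"
  using v_emb[of 1] by simp

lemma v_mult: "x \<in> F \<Longrightarrow> y \<in> F \<Longrightarrow> x \<noteq> 0 \<Longrightarrow> y \<noteq> 0 \<Longrightarrow> v (x * y) = v x + v y"
  using v by (simp add: places_def)

lemma v_minus: "x \<in> F \<Longrightarrow> v (- x) = v x"
  using v_mult[of "emb (- 1)" x] emb_in_F[of "-1"] v_emb[of "-1"]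
  by (cases "x = 0") (simp_all add: emb_minus del: v_emb)

lemma v_inverse: "x \<in> F \<Longrightarrow> v (inverse x) = - v x"
  using v_mult[of x "inverse x"] F_inverse v by (cases "x = 0") (auto simp: places_def)

lemma v_divide: "x \<in> F \<Longrightarrow> y \<in> F \<Longrightarrow> x \<noteq> 0 \<Longrightarrow> y \<noteq> 0 \<Longrightarrow> v (x / y) = v x - v y"
  using v_mult[of x "inverse y"] v_inverse[of y] F_inverse by (simp add: divide_inverse)

lemma v_power: "x \<in> F \<Longrightarrow> x \<noteq> 0 \<Longrightarrow> v (x ^ n) = int n * v x"
  by (induction n) (simp_all add: v_mult F_power algebra_simps)

lemma vge_add: "x \<in> F \<Longrightarrow> y \<in> F \<Longrightarrow> vge v n x \<Longrightarrow> vge v n y \<Longrightarrow> vge v n (x + y)"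
proof -
  assume xy: "x \<in> F" "y \<in> F" "vge v n x" "vge v n y"
  have "x \<noteq> 0 \<Longrightarrow> y \<noteq> 0 \<Longrightarrow> x + y \<noteq> 0 \<Longrightarrow> min (v x) (v y) \<le> v (x + y)"
    using v xy(1,2) by (simp add: places_def)
  thus ?thesis using xy(3,4) unfolding vge_def by fastforce
qed

lemma vge_minus: "x \<in> F \<Longrightarrow> vge v n (- x) \<longleftrightarrow> vge v n x"
  by (simp add: vge_def v_minus)

lemma vge_diff: "x \<in> F \<Longrightarrow> y \<in> F \<Longrightarrow> vge v n x \<Longrightarrow> vge v n y \<Longrightarrow> vge v n (x - y)"
  using vge_add[of x "- y"] by (simp add: vge_minus F_minus)

lemma vge_mult: "x \<in> F \<Longrightarrow> y \<in> F \<Longrightarrow> vge v m x \<Longrightarrow> vge v n y \<Longrightarrow> vge v (m + n) (x * y)"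
  using v_mult[of x y] unfolding vge_def by fastforce

lemma vge_emb: "n \<le> 0 \<Longrightarrow> vge v n (emb c)"
  by (simp add: vge_def)

lemma vge_sum: "(\<And>i. i \<in> I \<Longrightarrow> f i \<in> F) \<Longrightarrow> (\<And>i. i \<in> I \<Longrightarrow> vge v n (f i)) \<Longrightarrow> vge v n (sum f I)"
  by (induction I rule: infinite_finite_induct) (simp_all add: vge_add F_sum)

lemma vge_scale: "x \<in> F \<Longrightarrow> vge v n x \<Longrightarrow> vge v n (emb c * x)"
  using vge_mult[of "emb c" x 0 n] by (simp add: emb_in_F vge_emb)

lemma v_add_eq:
  assumes "x \<in> F" "y \<in> F" "x \<noteq> 0" "vge v (v x + 1) y"
  shows "x + y \<noteq> 0" "v (x + y) = v x"
proof -
  show nz: "x + y \<noteq> 0"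
  proof
    assume "x + y = 0"
    hence "y = - x" by (simp add: eq_neg_iff_add_eq_0 add.commute)
    thus False using assms v_minus[of x] by (simp add: vge_def)
  qed
  have "vge v (v x) (x + y)"
    by (rule vge_add) (use assms in \<open>auto simp: vge_refl intro: vge_mono\<close>)
  hence 1: "v x \<le> v (x + y)" using nz by (rule vge_D)
  show "v (x + y) = v x"
  proof (rule ccontr)
    assume "v (x + y) \<noteq> v x"
    hence "vge v (v x + 1) (x + y)" using 1 by (simp add: vge_def)
    hence "vge v (v x + 1) (x + y - y)" by (intro vge_diff) (use assms F_add in auto)
    thus False using assms(3) by (simp add: vge_def)
  qed
qed

lemma vge_ev: "x \<in> F \<Longrightarrow> vge v 0 x \<Longrightarrow> vge v 0 (ev p x)"
proof (induction p)
  case (pCons c p)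
  have "vge v (0 + 0) (x * ev p x)" by (rule vge_mult) (use pCons F_ev in auto)
  thus ?case by (simp add: vge_add emb_in_F F_mult F_ev vge_emb pCons)
qed simp

text \<open>At a pole of \<open>x\<close> the leading term has strictly the smallest value.\<close>

lemma v_ev_neg:
  assumes x: "x \<in> F" "v x < 0" "p \<noteq> 0"
  shows "ev p x \<noteq> 0 \<and> v (ev p x) = int (degree p) * v x"
  using x(3)
proof (induction p)
  case (pCons c p)
  have x0: "x \<noteq> 0" using x(2) v by (auto simp: places_def)
  show ?case
  proof (cases "p = 0")
    case True
    thus ?thesis using pCons by simp
  next
    case False
    hence IH: "ev p x \<noteq> 0" "v (ev p x) = int (degree p) * v x" using pCons by auto
    have m: "v (x * ev p x) = int (Suc (degree p)) * v x"
      using IH x0 x(1) by (simp add: v_mult F_ev algebra_simps)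
    have "int (Suc (degree p)) * v x < 0" using x(2) by (simp add: mult_pos_neg del: of_nat_Suc)
    hence "vge v (v (x * ev p x) + 1) (emb c)" unfolding m by (intro vge_emb) simp
    from v_add_eq[OF _ emb_in_F _ this] show ?thesis
      using IH x0 x(1) m False by (simp add: F_mult F_ev add.commute)
  qed
qed simp

lemma ev_residue:
  assumes x: "x \<in> F" "vge v 1 (x - emb c)"
  shows "vge v 1 (ev p x - emb (poly p c))"
proof -
  have xx: "vge v 0 x"
    using vge_add[of "x - emb c" "emb c" 0] x vge_mono[OF x(2), of 0]
    by (simp add: F_diff emb_in_F vge_emb)
  obtain q where "p - [:poly p c:] = [:- c, 1:] * q"
    by (metis dvdE poly_eq_0_iff_dvd poly_diff poly_pCons poly_0 mult_zero_right add_0_right diff_self)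
  hence "ev (p - [:poly p c:]) x = ev ([:- c, 1:] * q) x" by simp
  hence "ev p x - emb (poly p c) = (x - emb c) * ev q x" by (simp only: ev_diff ev_mult) (simp add: emb_minus)
  moreover have "vge v (1 + 0) ((x - emb c) * ev q x)"
    by (rule vge_mult) (use x xx in \<open>auto simp: F_diff emb_in_F F_ev vge_ev\<close>)
  ultimately show ?thesis by simp
qed

lemma ev_unit:
  assumes "x \<in> F" "vge v 1 (x - emb c)" "poly p c \<noteq> 0"
  shows "ev p x \<noteq> 0 \<and> v (ev p x) = 0"
proof -
  have "vge v (v (emb (poly p c)) + 1) (ev p x - emb (poly p c))"
    using ev_residue[OF assms(1,2), of p] by simp
  from v_add_eq[OF _ _ _ this] assms(3) show ?thesis by (simp add: emb_in_F F_diff F_ev assms(1))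
qed

text \<open>The factor \<open>(T - c)^order\<close> is split off; what remains does not vanish at
  \<open>c\<close> and is a unit at \<open>v\<close>.\<close>

lemma v_ev_order:
  assumes x: "x \<in> F" "vge v 1 (x - emb c)" "x \<noteq> emb c" and p: "p \<noteq> 0"
  shows "ev p x \<noteq> 0 \<and> v (ev p x) = int (Polynomial.order c p) * v (x - emb c)"
proof -
  obtain q where q: "p = [:- c, 1:] ^ Polynomial.order c p * q" "\<not> [:- c, 1:] dvd q"
    using order_decomp[OF p] by blast
  have "poly q c \<noteq> 0" using q(2) poly_eq_0_iff_dvd by blast
  note u = ev_unit[OF x(1,2) this]
  have "ev p x = (x - emb c) ^ Polynomial.order c p * ev q x"
    by (subst q(1)) (simp add: ev_mult ev_power emb_minus)
  thus ?thesis using u x(1,3) by (simp add: v_mult v_power F_power F_diff F_ev emb_in_F)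
qed

lemma uniformizer: "\<exists>t\<in>F. t \<noteq> 0 \<and> v t = 1"
proof -
  from v[unfolded places_def mem_Collect_eq, THEN conjunct2, THEN conjunct2, THEN conjunct2, THEN conjunct2]
  obtain t where t: "t \<in> F" "v t = 1" ..
  have "t \<noteq> 0" using t(2) by (cases "t = 0") simp_all
  thus ?thesis using t by (intro bexI[of _ t] conjI)
qed

text \<open>Otherwise every nonzero polynomial in \<open>f\<close>, being a product of linear
  factors, has value 0. In a relation of a uniformizer \<open>t\<close> over \<open>k[f]\<close> the
  nonzero terms then have distinct values \<open>j\<close>, and the lowest one cannot
  cancel.\<close>

lemma ex_const_nonzero_value:
  assumes f: "f \<in> F" "f \<notin> range emb"
  shows "\<exists>c. v (f - emb c) \<noteq> 0"
proof (rule ccontr)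
  assume "\<not> ?thesis"
  hence 0: "v (f - emb c) = 0" for c by blast
  have u: "v (ev p f) = 0" if "p \<noteq> 0" for p
    using that
  proof (induction "degree p" arbitrary: p)
    case 0
    then obtain c where "p = [:c:]" by (metis degree_eq_zeroE)
    thus ?case by simp
  next
    case (Suc n)
    then obtain c where "poly p c = 0" using alg_closed_imp_poly_has_root[of p] by auto
    then obtain q where q: "p = [:- c, 1:] * q" by (metis dvdE poly_eq_0_iff_dvd)
    have q0: "q \<noteq> 0" using Suc q by auto
    hence "degree p = Suc (degree q)" unfolding q by (subst degree_mult_eq) auto
    hence IH: "v (ev q f) = 0" using Suc q0 by auto
    have "f - emb c \<noteq> 0" using f(2) by auto
    hence "v ((f - emb c) * ev q f) = v (f - emb c) + v (ev q f)"
      using q0 f by (intro v_mult) (auto simp: ev_eq_0_iff F_diff F_ev emb_in_F)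
    moreover have "ev p f = (f - emb c) * ev q f" unfolding q ev_mult by (simp add: emb_minus)
    ultimately show ?case using IH 0 by simp
  qed
  obtain t where t: "t \<in> F" "t \<noteq> 0" "v t = 1" using uniformizer by blast
  obtain P n where P: "\<exists>j\<le>n. P j \<noteq> 0" "(\<Sum>j\<le>n. ev (P j) f * t ^ j) = 0"
    using dep[OF f(1) t(1)] by (auto simp: alg_dep_def)
  define m where "m = (LEAST j. P j \<noteq> 0)"
  obtain j0 where j0: "j0 \<le> n" "P j0 \<noteq> 0" using P(1) by blast
  have m: "P m \<noteq> 0" unfolding m_def by (rule LeastI[of _ j0]) (rule j0(2))
  have mn: "m \<le> n" using Least_le[of "\<lambda>j. P j \<noteq> 0" j0] j0 unfolding m_def by linarith
  have less: "P j = 0" if "j < m" for j using not_less_Least[of j "\<lambda>j. P j \<noteq> 0"] that unfolding m_def by blast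
  let ?g = "\<lambda>j. ev (P j) f * t ^ j"
  have gF: "?g j \<in> F" for j using f t by (simp add: F_mult F_ev F_power)
  have vg: "v (?g j) = int j" if "P j \<noteq> 0" for j
    using that f t u by (simp add: v_mult F_ev F_power v_power ev_eq_0_iff)
  have "0 = ?g m + (\<Sum>j\<in>{..n} - {m}. ?g j)" using P(2) mn by (simp add: sum.remove)
  moreover have "?g m + (\<Sum>j\<in>{..n} - {m}. ?g j) \<noteq> 0"
  proof (rule v_add_eq(1))
    show "vge v (v (?g m) + 1) (\<Sum>j\<in>{..n} - {m}. ?g j)"
    proof (rule vge_sum)
      fix j assume j: "j \<in> {..n} - {m}"
      show "vge v (v (?g m) + 1) (?g j)"
      proof (cases "P j = 0")
        case False
        hence "j > m" using less[of j] j by (cases "j < m") auto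
        thus ?thesis using vg[OF False] vg[OF m] by (simp add: vge_def)
      qed simp
    qed (rule gF)
    show "?g m \<noteq> 0" using m t(2) f(2) by (simp add: ev_eq_0_iff)
  qed (intro gF F_sum)+
  ultimately show False by simp
qed

lemma residue:
  assumes f: "f \<in> F" "vge v 0 f"
  shows "\<exists>c. vge v 1 (f - emb c)"
proof (cases "f \<in> range emb")
  case True
  then obtain c where "f = emb c" by blast
  thus ?thesis by (intro exI[of _ c]) simp
next
  case False
  then obtain c where c: "v (f - emb c) \<noteq> 0" using ex_const_nonzero_value[OF f(1)] by blast
  have "vge v 0 (f - emb c)" by (rule vge_diff) (use f in \<open>auto simp: emb_in_F vge_emb\<close>)
  thus ?thesis using c by (intro exI[of _ c]) (auto simp: vge_def)
qed

end

text \<open>Inclusion of valuation rings is enough: units of \<open>v\<close> become units of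
  \<open>w\<close>, so \<open>w\<close> is \<open>w t\<close> times \<open>v\<close>, and
  normalisation forces \<open>w t = 1\<close>.\<close>

lemma place_eqI:
  assumes v: "v \<in> PL" and w: "w \<in> PL" and sub: "\<And>z. z \<in> F \<Longrightarrow> z \<noteq> 0 \<Longrightarrow> v z \<ge> 0 \<Longrightarrow> w z \<ge> 0"
  shows "v = w"
proof -
  have u: "w z = 0" if "z \<in> F" "z \<noteq> 0" "v z = 0" for z
    using sub[of z] sub[of "inverse z"] that by (auto simp: v_inverse[OF v] v_inverse[OF w] F_inverse)
  obtain t where t: "t \<in> F" "t \<noteq> 0" "v t = 1" using uniformizer[OF v] by blast
  have key: "w z = v z * w t" if z: "z \<in> F" "z \<noteq> 0" for z
  proof -
    have *: "w z = v z * w t" if z: "z \<in> F" "z \<noteq> 0" "v z \<ge> 0" for z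
    proof -
      have "w (z / t ^ nat (v z)) = 0"
        by (rule u) (use z t in \<open>auto simp: F_divide F_power v_divide[OF v] v_power[OF v]\<close>)
      thus ?thesis using z t by (simp add: v_divide[OF w] v_power[OF w] F_power)
    qed
    show ?thesis
    proof (cases "v z \<ge> 0")
      case False
      thus ?thesis using *[of "inverse z"] z by (simp add: F_inverse v_inverse[OF v] v_inverse[OF w])
    qed (use * z in simp)
  qed
  obtain s where s: "s \<in> F" "s \<noteq> 0" "w s = 1" using uniformizer[OF w] by blast
  have "v s * w t = 1" using key[of s] s by simp
  moreover have "w t \<ge> 0" using sub[of t] t by simp
  ultimately have wt: "w t = 1" by (metis zmult_eq_1_iff neg_0_le_iff_le not_one_le_zero)
  have "v z = w z" for z
  proof (cases "z \<in> F - {0}")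
    case True
    thus ?thesis using key[of z] wt by simp
  next
    case False
    thus ?thesis using v_outside[OF v] v_outside[OF w] by metis
  qed
  thus ?thesis by blast
qed

lemma place_separate:
  assumes v: "v \<in> PL" and w: "w \<in> PL" and ne: "v \<noteq> w"
  shows "\<exists>f\<in>F. f \<noteq> 0 \<and> v f > 0 \<and> w f \<le> 0"
proof -
  obtain z where z: "z \<in> F" "z \<noteq> 0" "w z \<ge> 0" "\<not> v z \<ge> 0" using place_eqI[OF w v] ne by blast
  thus ?thesis by (intro bexI[of _ "inverse z"]) (auto simp: v_inverse[OF v] v_inverse[OF w] F_inverse)
qed

text \<open>The least positive value \<open>e\<close> divides all values, since a remainder would be
  a smaller one. This turns restrictions and pullbacks of places into places, with \<open>e\<close>
  as ramification index.\<close>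

lemma normalise_valuation:
  fixes u :: "'a \<Rightarrow> int"
  assumes const: "\<And>c. u (emb c) = 0"
    and mult: "\<And>x y. x \<in> F \<Longrightarrow> y \<in> F \<Longrightarrow> x \<noteq> 0 \<Longrightarrow> y \<noteq> 0 \<Longrightarrow> u (x * y) = u x + u y"
    and add: "\<And>x y. x \<in> F \<Longrightarrow> y \<in> F \<Longrightarrow> x \<noteq> 0 \<Longrightarrow> y \<noteq> 0 \<Longrightarrow> x + y \<noteq> 0 \<Longrightarrow> min (u x) (u y) \<le> u (x + y)"
    and nontriv: "z0 \<in> F" "z0 \<noteq> 0" "u z0 \<noteq> 0"
  shows "\<exists>v\<in>PL. \<exists>e>0. \<forall>x\<in>F. x \<noteq> 0 \<longrightarrow> u x = e * v x"
proof -
  have u1: "u 1 = 0" using const[of 1] by simp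
  have inv: "u (inverse x) = - u x" if "x \<in> F" "x \<noteq> 0" for x
    using mult[of x "inverse x"] that u1 by (simp add: F_inverse)
  have pow: "u (x ^ n) = int n * u x" if "x \<in> F" "x \<noteq> 0" for x n
    by (induction n) (use that in \<open>simp_all add: u1 mult F_power algebra_simps\<close>)
  define e where "e = (LEAST n. n > 0 \<and> (\<exists>x\<in>F. x \<noteq> 0 \<and> u x = int n))"
  have "\<exists>n. n > 0 \<and> (\<exists>x\<in>F. x \<noteq> 0 \<and> u x = int n)"
  proof (cases "u z0 > 0")
    case True
    thus ?thesis using nontriv by (intro exI[of _ "nat (u z0)"]) auto
  next
    case False
    thus ?thesis using nontriv inv[of z0] by (intro exI[of _ "nat (- u z0)"]) (auto intro!: bexI[of _ "inverse z0"] F_inverse)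
  qed
  hence "e > 0 \<and> (\<exists>x\<in>F. x \<noteq> 0 \<and> u x = int e)" unfolding e_def by (rule LeastI_ex)
  then obtain t where e: "e > 0" and t: "t \<in> F" "t \<noteq> 0" "u t = int e" by blast
  have min: "e \<le> n" if "n > 0" "x \<in> F" "x \<noteq> 0" "u x = int n" for n x
    unfolding e_def using that by (intro Least_le) blast
  have dvd0: "int e dvd u x" if x: "x \<in> F" "x \<noteq> 0" "u x \<ge> 0" for x
  proof (rule ccontr)
    assume nd: "\<not> int e dvd u x"
    define q where "q = nat (u x div int e)"
    have q: "int q = u x div int e" using x e by (simp add: q_def pos_imp_zdiv_nonneg_iff)
    have "u (x * inverse t ^ q) = u x - int q * int e"
      using x t by (simp add: mult pow inv F_power F_inverse)
    also have "\<dots> = u x mod int e" unfolding q by (simp add: minus_div_mult_eq_mod)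
    finally have eq: "u (x * inverse t ^ q) = int (nat (u x mod int e))" using e by simp
    moreover have "u x mod int e > 0"
    proof -
      have "u x mod int e \<noteq> 0" using nd by (simp add: dvd_eq_mod_eq_0)
      moreover have "u x mod int e \<ge> 0" using e by simp
      ultimately show ?thesis by linarith
    qed
    ultimately have "e \<le> nat (u x mod int e)"
      using x t by (intro min[of _ "x * inverse t ^ q"]) (auto simp: F_mult F_power F_inverse)
    moreover have "u x mod int e < int e" using e by simp
    ultimately show False using e by linarith
  qed
  have dvd: "int e dvd u x" if x: "x \<in> F" "x \<noteq> 0" for x
    using dvd0[of x] dvd0[of "inverse x"] x inv[of x] by (cases "u x \<ge> 0") (auto simp: F_inverse)
  define v where "v x = (if x \<in> F - {0} then u x div int e else 0)" for x
  have uv: "u x = int e * v x" if "x \<in> F" "x \<noteq> 0" for x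
    using dvd[OF that] that by (simp add: v_def)
  have "v \<in> PL"
    unfolding places_def
  proof (intro CollectI conjI allI ballI impI)
    show "v x = 0" if "x \<notin> F - {0}" for x using that by (auto simp: v_def)
    show "v (emb c) = 0" for c by (simp add: v_def const)
    fix x y assume x: "x \<in> F - {0}" and y: "y \<in> F - {0}"
    have "int e * v (x * y) = int e * (v x + v y)"
      using x y mult[of x y] uv[of x] uv[of y] uv[of "x * y"] F_mult[of x y] by (simp add: distrib_left)
    thus "v (x * y) = v x + v y" using e by simp
    assume xy: "x + y \<noteq> 0"
    have "min (int e * v x) (int e * v y) \<le> int e * v (x + y)"
      using x y add[of x y] xy uv[of x] uv[of y] uv[of "x + y"] F_add[of x y] by simp
    thus "min (v x) (v y) \<le> v (x + y)" using e by (auto simp: min_def split: if_splits)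
  next
    show "\<exists>t\<in>F. v t = 1" using t e by (intro bexI[of _ t]) (auto simp: v_def)
  qed
  thus ?thesis using uv e by (intro bexI[of _ v] exI[of _ "int e"]) auto
qed

end

context curve_field
begin

lemma vge_power: "v \<in> PL \<Longrightarrow> x \<in> F \<Longrightarrow> vge v n x \<Longrightarrow> vge v (int k * n) (x ^ k)"
proof (induction k)
  case (Suc k)
  thus ?case using vge_mult[of v x "x ^ k" n "int k * n"] by (simp add: F_power algebra_simps)
qed (simp add: vge_def)

subsection \<open>Divisors and Riemann-Roch spaces\<close>

abbreviation "LL \<equiv> riemann_roch_space emb F"

abbreviation "Div \<equiv> divisors emb F"

lemma mem_LL: "f \<in> LL D \<longleftrightarrow> f \<in> F \<and> (\<forall>v\<in>PL. vge v (- D v) f)"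
  by (auto simp: riemann_roch_space_def vge_def)

lemma LL_vge: "f \<in> LL D \<Longrightarrow> v \<in> PL \<Longrightarrow> vge v (- D v) f" and LL_F: "f \<in> LL D \<Longrightarrow> f \<in> F"
  by (auto simp: mem_LL)

lemma LL_I: "f \<in> F \<Longrightarrow> (\<And>v. v \<in> PL \<Longrightarrow> vge v (- D v) f) \<Longrightarrow> f \<in> LL D"
  by (auto simp: mem_LL)

lemma ell_eq: "ell emb F D = VS.dim (LL D)"
  by (simp add: ell_def)

lemma subspace_LL: "VS.subspace (LL D)"
  by (rule VS.subspaceI) (auto simp: mem_LL intro: F_intros vge_add vge_scale)

lemma LL_mono: "(\<And>v. v \<in> PL \<Longrightarrow> D v \<le> E v) \<Longrightarrow> LL D \<subseteq> LL E"
  unfolding mem_LL subset_iff by (meson vge_mono neg_le_iff_le)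

lemma LL_cong: "(\<And>v. v \<in> PL \<Longrightarrow> D v = E v) \<Longrightarrow> LL D = LL E"
  by (auto simp: mem_LL)

lemma Div_iff: "D \<in> Div \<longleftrightarrow> finite {v. D v \<noteq> 0} \<and> {v. D v \<noteq> 0} \<subseteq> PL"
  by (simp add: divisors_def)

lemma Div_I: "finite S \<Longrightarrow> S \<subseteq> PL \<Longrightarrow> (\<And>v. D v \<noteq> 0 \<Longrightarrow> v \<in> S) \<Longrightarrow> D \<in> Div"
  unfolding Div_iff using finite_subset[of "{v. D v \<noteq> 0}" S] by blast

lemma Div_outside: "D \<in> Div \<Longrightarrow> v \<notin> PL \<Longrightarrow> D v = 0"
  unfolding Div_iff by blast

lemma Div_finite: "D \<in> Div \<Longrightarrow> finite {v. D v \<noteq> 0}"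
  by (simp add: Div_iff)

lemma degree_eq_sum:
  "finite S \<Longrightarrow> {v. D v \<noteq> 0} \<subseteq> S \<Longrightarrow> divisor_degree D = sum D S"
  unfolding divisor_degree_def by (rule sum.mono_neutral_left) auto

lemma degree_zero [simp]: "divisor_degree (\<lambda>v. 0) = 0"
  by (simp add: divisor_degree_def)

lemma Div_zero [simp]: "(\<lambda>v. 0) \<in> Div"
  by (simp add: Div_iff)

lemma Div_add:
  assumes D: "D \<in> Div" and E: "E \<in> Div"
  shows "(\<lambda>v. D v + E v) \<in> Div" "divisor_degree (\<lambda>v. D v + E v) = divisor_degree D + divisor_degree E"
proof -
  let ?S = "{v. D v \<noteq> 0} \<union> {v. E v \<noteq> 0}"
  have S: "finite ?S" "?S \<subseteq> PL" using D E by (auto simp: Div_iff)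
  show "(\<lambda>v. D v + E v) \<in> Div" by (rule Div_I[OF S]) auto
  have "divisor_degree (\<lambda>v. D v + E v) = (\<Sum>v\<in>?S. D v + E v)" by (rule degree_eq_sum[OF S(1)]) auto
  also have "\<dots> = sum D ?S + sum E ?S" by (rule sum.distrib)
  also have "sum D ?S = divisor_degree D" by (rule degree_eq_sum[OF S(1), symmetric]) auto
  also have "sum E ?S = divisor_degree E" by (rule degree_eq_sum[OF S(1), symmetric]) auto
  finally show "divisor_degree (\<lambda>v. D v + E v) = divisor_degree D + divisor_degree E" .
qed

lemma Div_scale:
  assumes D: "D \<in> Div"
  shows "(\<lambda>v. c * D v) \<in> Div" "divisor_degree (\<lambda>v. c * D v) = c * divisor_degree D"
proof -
  have S: "finite {v. D v \<noteq> 0}" "{v. D v \<noteq> 0} \<subseteq> PL" using D by (auto simp: Div_iff)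
  show "(\<lambda>v. c * D v) \<in> Div" by (rule Div_I[OF S]) auto
  have "divisor_degree (\<lambda>v. c * D v) = (\<Sum>v | D v \<noteq> 0. c * D v)"
    by (rule degree_eq_sum[OF S(1)]) auto
  thus "divisor_degree (\<lambda>v. c * D v) = c * divisor_degree D"
    by (simp add: divisor_degree_def sum_distrib_left)
qed

lemma Div_diff:
  assumes D: "D \<in> Div" and E: "E \<in> Div"
  shows "(\<lambda>v. D v - E v) \<in> Div" "divisor_degree (\<lambda>v. D v - E v) = divisor_degree D - divisor_degree E"
  using Div_add[OF D Div_scale(1)[OF E, of "-1"]] Div_scale(2)[OF E, of "-1"] by simp_all

definition pt :: "('a \<Rightarrow> int) \<Rightarrow> ('a \<Rightarrow> int) \<Rightarrow> int" where
  "pt v0 = (\<lambda>v. if v = v0 then 1 else 0)"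

lemma Div_pt:
  assumes "v0 \<in> PL"
  shows "pt v0 \<in> Div" "divisor_degree (pt v0) = 1"
proof -
  show "pt v0 \<in> Div" by (rule Div_I[of "{v0}"]) (use assms in \<open>auto simp: pt_def split: if_splits\<close>)
  have "divisor_degree (pt v0) = sum (pt v0) {v0}" by (rule degree_eq_sum) (auto simp: pt_def)
  thus "divisor_degree (pt v0) = 1" by (simp add: pt_def)
qed

lemma degree_nonneg: "(\<And>v. 0 \<le> D v) \<Longrightarrow> 0 \<le> divisor_degree D"
  unfolding divisor_degree_def by (rule sum_nonneg) auto

lemma degree_mono: 
  assumes "D \<in> Div" "E \<in> Div" "\<And>v. D v \<le> E v"
  shows "divisor_degree D \<le> divisor_degree E"
  using degree_nonneg[of "\<lambda>v. E v - D v"] Div_diff(2)[OF assms(2,1)] assms(3) by simp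

text \<open>If \<open>f\<close> attains the newly allowed order at \<open>v0\<close>, every other
  \<open>h\<close> has a quotient \<open>h / f\<close> with a residue \<open>c\<close> there, and
  \<open>h - c f\<close> falls back into \<open>L(D)\<close>.\<close>

lemma LL_add_pt:
  assumes v0: "v0 \<in> PL" and fd: "fin_dim (LL D)"
  shows "fin_dim (LL (\<lambda>v. D v + pt v0 v))" "VS.dim (LL (\<lambda>v. D v + pt v0 v)) \<le> VS.dim (LL D) + 1"
proof -
  let ?E = "\<lambda>v. D v + pt v0 v"
  have sub: "LL D \<subseteq> LL ?E" by (rule LL_mono) (simp add: pt_def)
  have "\<exists>f. LL ?E \<subseteq> VS.span (insert f (LL D))"
  proof (cases "LL ?E \<subseteq> LL D")
    case True
    thus ?thesis using VS.span_superset[of "insert 0 (LL D)"] by (intro exI[of _ 0]) blast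
  next
    case False
    then obtain f where f: "f \<in> LL ?E" "f \<notin> LL D" by blast
    have fv: "f \<noteq> 0" "v0 f = - D v0 - 1"
    proof -
      obtain w where w: "w \<in> PL" "\<not> vge w (- D w) f" using f mem_LL by blast
      hence "w = v0" using LL_vge[OF f(1) w(1)] by (auto simp: pt_def split: if_splits)
      thus "f \<noteq> 0" "v0 f = - D v0 - 1" using w LL_vge[OF f(1) v0] by (auto simp: pt_def vge_def)
    qed
    show ?thesis
    proof (intro exI[of _ f] subsetI)
      fix h assume h: "h \<in> LL ?E"
      have hF: "h \<in> F" "f \<in> F" using h f LL_F by blast+
      have "vge v0 (- ?E v0 + (D v0 + 1)) (h * inverse f)"
        by (rule vge_mult[OF v0]) (use hF LL_vge[OF h v0] fv in \<open>auto simp: F_inverse v_inverse[OF v0] vge_def\<close>)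
      hence "vge v0 0 (h / f)" by (simp add: pt_def divide_inverse)
      then obtain c where c: "vge v0 1 (h / f - emb c)" using residue[OF v0, of "h / f"] hF F_divide by blast
      have "vge v0 (1 + (- D v0 - 1)) ((h / f - emb c) * f)"
        by (rule vge_mult[OF v0 _ _ c]) (use hF fv in \<open>auto simp: F_intros vge_def\<close>)
      moreover have eq: "(h / f - emb c) * f = h - emb c * f" using fv by (simp add: field_simps)
      ultimately have v0': "vge v0 (- D v0) (h - emb c * f)" by simp
      have E: "h - emb c * f \<in> LL ?E"
        by (intro VS.subspace_diff VS.subspace_scale subspace_LL h f(1))
      have "h - emb c * f \<in> LL D"
      proof (rule LL_I)
        show "h - emb c * f \<in> F" using E LL_F by blast
        fix v assume "v \<in> PL"
        thus "vge v (- D v) (h - emb c * f)"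
          using v0' LL_vge[OF E, of v] by (cases "v = v0") (simp_all add: pt_def)
      qed
      hence "(h - emb c * f) + emb c * f \<in> VS.span (insert f (LL D))"
        by (intro VS.span_add VS.span_scale VS.span_base) auto
      thus "h \<in> VS.span (insert f (LL D))" by simp
    qed
  qed
  then obtain f where "LL ?E \<subseteq> VS.span (insert f (LL D))" by blast
  from dim_insert_le[OF fd this]
  show "fin_dim (LL ?E)" "VS.dim (LL ?E) \<le> VS.dim (LL D) + 1" .
qed

lemma LL_mono_dim:
  assumes D: "D \<in> Div" and E: "E \<in> Div" and le: "\<And>v. D v \<le> E v" and fd: "fin_dim (LL D)"
  shows "fin_dim (LL E) \<and> int (VS.dim (LL E)) \<le> int (VS.dim (LL D)) + divisor_degree E - divisor_degree D"
  using E le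
proof (induction "nat (divisor_degree E - divisor_degree D)" arbitrary: E rule: less_induct)
  case less
  show ?case
  proof (cases "E = D")
    case True
    thus ?thesis using fd by simp
  next
    case False
    then obtain v0 where "E v0 \<noteq> D v0" by blast
    hence v0: "D v0 < E v0" using less(3)[of v0] by simp
    hence "v0 \<in> PL" using Div_outside[OF D] Div_outside[OF less(2)] by fastforce
    note pt = Div_pt[OF this]
    let ?E = "\<lambda>v. E v - pt v0 v"
    note E' = Div_diff[OF less(2) pt(1)]
    have le': "D v \<le> ?E v" for v using less(3)[of v] v0 by (auto simp: pt_def)
    have "divisor_degree D \<le> divisor_degree ?E" by (rule degree_mono[OF D E'(1) le'])
    hence lt: "nat (divisor_degree ?E - divisor_degree D) < nat (divisor_degree E - divisor_degree D)"
      using E'(2) pt(2) by simp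
    note IH = less(1)[OF lt E'(1) le']
    have "(\<lambda>v. ?E v + pt v0 v) = E" by simp
    thus ?thesis using LL_add_pt[OF \<open>v0 \<in> PL\<close>, of ?E] IH E'(2) pt(2) by simp
  qed
qed

text \<open>At first only a function on places. Finite support is shown later, in general in
  \<open>pdiv_Div\<close> and for polynomials in \<open>x\<close> in
  \<open>pdiv_poly\<close>.\<close>

definition pdiv :: "'a \<Rightarrow> ('a \<Rightarrow> int) \<Rightarrow> int" where
  "pdiv f = (\<lambda>v. if v \<in> PL then v f else 0)"

lemma mult_LL:
  assumes f: "f \<in> F" "f \<noteq> 0"
  shows "(*) f ` LL D = LL (\<lambda>v. D v - pdiv f v)"
proof -
  have 1: "(*) f ` LL D \<subseteq> LL (\<lambda>v. D v - pdiv f v)" if f: "f \<in> F" "f \<noteq> 0" for f D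
  proof (rule image_subsetI, rule LL_I)
    fix z assume z: "z \<in> LL D"
    show "f * z \<in> F" using f z LL_F F_mult by blast
    fix v assume v: "v \<in> PL"
    have "vge v (v f + - D v) (f * z)"
      by (rule vge_mult[OF v]) (use f z v in \<open>auto simp: LL_F LL_vge vge_refl\<close>)
    thus "vge v (- (D v - pdiv f v)) (f * z)" using v by (simp add: pdiv_def)
  qed
  have "LL (\<lambda>v. D v - pdiv f v) \<subseteq> (*) f ` LL D"
  proof
    fix z assume z: "z \<in> LL (\<lambda>v. D v - pdiv f v)"
    have "inverse f * z \<in> LL (\<lambda>v. (D v - pdiv f v) - pdiv (inverse f) v)"
      using 1[of "inverse f" "\<lambda>v. D v - pdiv f v"] f z F_inverse by auto
    also have "LL (\<lambda>v. (D v - pdiv f v) - pdiv (inverse f) v) = LL D"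
      by (rule LL_cong) (simp add: pdiv_def v_inverse f)
    finally show "z \<in> (*) f ` LL D"
      using f by (intro image_eqI[of _ _ "inverse f * z"]) simp_all
  qed
  thus ?thesis using 1[OF f] by blast
qed

end

section \<open>Consequences of Riemann's inequality\<close>

locale genus_field = curve_field +
  fixes g :: nat
  assumes genus: "has_genus emb F g"
    and ex_place: "PL \<noteq> {}"
begin

lemma riemann: "D \<in> Div \<Longrightarrow> divisor_degree D + 1 - int g \<le> int (VS.dim (LL D))"
  using genus by (auto simp: has_genus_def ell_eq)

text \<open>Adding a large multiple of one point makes the dimension positive by Riemann's
  inequality, hence finite, and subspaces inherit finiteness.\<close>

lemma fin_dim_LL:
  assumes D: "D \<in> Div"
  shows "fin_dim (LL D)"
proof -
  obtain v0 where v0: "v0 \<in> PL" using ex_place by blast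
  define N where "N = int g + \<bar>divisor_degree D\<bar>"
  let ?P = "\<lambda>v. N * pt v0 v"
  note P = Div_scale[OF Div_pt(1)[OF v0], of N] 
  note A = Div_add[OF D P(1)]
  have "divisor_degree (\<lambda>v. D v + ?P v) \<ge> int g"
    unfolding A(2) P(2) using Div_pt(2)[OF v0] by (simp add: N_def)
  hence "VS.dim (LL (\<lambda>v. D v + ?P v)) > 0" using riemann[OF A(1)] by linarith
  hence "fin_dim (LL (\<lambda>v. D v + ?P v))" by (rule fin_dim_if_dim_pos)
  thus ?thesis by (rule fin_dim_subset) (auto intro!: LL_mono simp: pt_def N_def)
qed

lemma dim_LL_le:
  assumes "D \<in> Div" "E \<in> Div" "\<And>v. D v \<le> E v"
  shows "int (VS.dim (LL E)) \<le> int (VS.dim (LL D)) + divisor_degree E - divisor_degree D"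
  using LL_mono_dim[OF assms fin_dim_LL[OF assms(1)]] by blast

text \<open>Powers of an element without poles stay in \<open>L(0)\<close>; for a nonconstant
  element they are independent, contradicting finite dimension.\<close>

lemma LL_zero: "LL (\<lambda>v. 0) = range emb"
proof
  show "range emb \<subseteq> LL (\<lambda>v. 0)" by (auto intro!: LL_I vge_emb emb_in_F)
  show "LL (\<lambda>v. 0) \<subseteq> range emb"
  proof (rule subsetI, rule ccontr)
    fix f assume f: "f \<in> LL (\<lambda>v. 0)" "f \<notin> range emb"
    let ?n = "VS.dim (LL (\<lambda>v. 0))"
    have "card {..?n} \<le> VS.dim (LL (\<lambda>v. 0))"
    proof (rule card_le_dim_if_independent_family[of _ _ "\<lambda>i. f ^ i"])
      show "fin_dim (LL (\<lambda>v. 0))" by (rule fin_dim_LL) simp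
      show "(\<lambda>i. f ^ i) ` {..?n} \<subseteq> LL (\<lambda>v. 0)"
      proof (rule image_subsetI, rule LL_I)
        fix i v assume "v \<in> PL"
        thus "vge v (- 0) (f ^ i)" using vge_power[of v f 0 i] f by (simp add: LL_F LL_vge[where D = "\<lambda>v. 0", simplified])
      qed (use f LL_F F_power in blast)
      fix c i assume c: "(\<Sum>i\<in>{..?n}. emb (c i) * f ^ i) = 0" "i \<in> {..?n}"
      have "ev (\<Sum>i\<le>?n. Polynomial.monom (c i) i) f = 0"
        using c(1) by (simp add: ev_sum ev_monom)
      hence "poly.coeff (\<Sum>i\<le>?n. Polynomial.monom (c i) i) i = 0"
        using ev_eq_0_iff[OF f(2)] by simp
      thus "c i = 0" using c(2) by (simp add: coeff_sum)
    qed simp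
    thus False by simp
  qed
qed

lemma dim_LL_effective:
  assumes "D \<in> Div" "\<And>v. 0 \<le> D v"
  shows "int (VS.dim (LL D)) \<le> 1 + divisor_degree D"
  using dim_LL_le[OF Div_zero assms] by (simp add: LL_zero dim_range_emb)

lemma pole_exists:
  assumes "f \<in> F" "f \<notin> range emb"
  shows "\<exists>v\<in>PL. v f < 0"
proof (rule ccontr)
  assume "\<not> ?thesis"
  hence "f \<in> LL (\<lambda>v. 0)" using assms by (intro LL_I) (auto simp: vge_def not_less)
  thus False using assms LL_zero by blast
qed

lemma zero_exists:
  assumes "f \<in> F" "f \<notin> range emb"
  shows "\<exists>v\<in>PL. v f > 0"
proof -
  have "inverse f \<notin> range emb" using emb_notin_ratf_inverse[OF assms(2), of 0] by simp
  thus ?thesis using pole_exists[of "inverse f"] assms F_inverse by (auto simp: v_inverse)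
qed

text \<open>Above a divisor attaining the genus, the dimension grows at most as fast as the degree,
  while Riemann's inequality bounds it from below; both bounds coincide.\<close>

lemma nonspecial:
  obtains D1 where "D1 \<in> Div" "\<And>v. 0 \<le> D1 v"
    "\<And>D. D \<in> Div \<Longrightarrow> (\<And>v. D1 v \<le> D v) \<Longrightarrow> int (VS.dim (LL D)) = divisor_degree D + 1 - int g"
proof -
  obtain D0 where D0: "D0 \<in> Div" "divisor_degree D0 - int (VS.dim (LL D0)) + 1 = int g"
    using genus by (auto simp: has_genus_def ell_eq)
  let ?D1 = "\<lambda>v. max 0 (D0 v)"
  have "?D1 \<in> Div" by (rule Div_I[of "{v. D0 v \<noteq> 0}"]) (use D0(1) in \<open>auto simp: Div_iff\<close>)
  moreover have "int (VS.dim (LL D)) = divisor_degree D + 1 - int g"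
    if D: "D \<in> Div" "\<And>v. ?D1 v \<le> D v" for D
  proof -
    have "D0 v \<le> D v" for v using D(2)[of v] by simp
    from dim_LL_le[OF D0(1) D(1) this] show ?thesis using D0(2) riemann[OF D(1)] by simp
  qed
  ultimately show ?thesis using that[of ?D1] by simp
qed

text \<open>Multiplication by \<open>z\<close> embeds \<open>L(D1 + Z)\<close> into
  \<open>L(D1 + B)\<close>. Both divisors are large enough for the exact dimension formula, so
  \<open>deg Z \<le> deg B\<close>.\<close>

lemma card_zeros_le:
  assumes B: "B \<in> Div" "\<And>v. 0 \<le> B v" and z: "z \<in> LL B" "z \<noteq> 0"
    and S: "finite S" "S \<subseteq> {v\<in>PL. v z > 0}"
  shows "int (card S) \<le> divisor_degree B"
proof -
  obtain D1 where D1: "D1 \<in> Div" "\<And>v. 0 \<le> D1 v"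
    "\<And>D. D \<in> Div \<Longrightarrow> (\<And>v. D1 v \<le> D v) \<Longrightarrow> int (VS.dim (LL D)) = divisor_degree D + 1 - int g"
    using nonspecial by blast
  define Z where "Z v = (if v \<in> S then 1 else 0 :: int)" for v
  have Z: "Z \<in> Div" by (rule Div_I[OF S(1)]) (use S in \<open>auto simp: Z_def split: if_splits\<close>)
  have dZ: "divisor_degree Z = int (card S)"
    using degree_eq_sum[OF S(1), of Z] by (auto simp: Z_def)
  note A = Div_add[OF D1(1) Z] and A' = Div_add[OF D1(1) B(1)]
  have "(*) z ` LL (\<lambda>v. D1 v + Z v) \<subseteq> LL (\<lambda>v. D1 v + B v)"
  proof (rule image_subsetI, rule LL_I)
    fix f assume f: "f \<in> LL (\<lambda>v. D1 v + Z v)"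
    show "z * f \<in> F" using f z LL_F F_mult by blast
    fix v assume v: "v \<in> PL"
    define W where "W = (if v \<in> S then 1 else - B v)"
    have "vge v W z" 
      unfolding W_def using LL_vge[OF z(1) v] S v B(2)[of v] by (auto simp: vge_def)
    hence "vge v (W + - (D1 v + Z v)) (z * f)"
      by (intro vge_mult[OF v]) (use f z LL_F LL_vge[OF f v] in auto)
    thus "vge v (- (D1 v + B v)) (z * f)" by (rule vge_mono) (use B(2)[of v] in \<open>auto simp: Z_def W_def\<close>)
  qed
  from dim_mono[OF fin_dim_LL[OF A'(1)] this]
  have "VS.dim (LL (\<lambda>v. D1 v + Z v)) \<le> VS.dim (LL (\<lambda>v. D1 v + B v))"
    using dim_mult_image[OF fin_dim_LL[OF A(1)] z(2)] by simp
  moreover have "int (VS.dim (LL (\<lambda>v. D1 v + Z v))) = divisor_degree D1 + divisor_degree Z + 1 - int g"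
    using D1(3)[OF A(1)] A(2) by (simp add: Z_def)
  moreover have "int (VS.dim (LL (\<lambda>v. D1 v + B v))) = divisor_degree D1 + divisor_degree B + 1 - int g"
    using D1(3)[OF A'(1)] A'(2) B(2) by simp
  ultimately show ?thesis using dZ by linarith
qed

lemma finite_zeros:
  assumes B: "B \<in> Div" "\<And>v. 0 \<le> B v" and z: "z \<in> LL B" "z \<noteq> 0"
  shows "finite {v\<in>PL. v z > 0}"
proof (rule ccontr)
  assume "infinite {v\<in>PL. v z > 0}"
  from infinite_arbitrarily_large[OF this, of "nat (divisor_degree B) + 1"]
  obtain S where S: "S \<subseteq> {v\<in>PL. v z > 0}" "finite S" "card S = nat (divisor_degree B) + 1" by blast
  show False using card_zeros_le[OF B z S(2,1)] S(3) by linarith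
qed

text \<open>Take \<open>x\<close> with its only pole at one point and a relation of \<open>f\<close>
  over \<open>k[x]\<close>. Where \<open>x\<close> is finite, a pole of \<open>f\<close> forces a
  zero of the top coefficient, and that coefficient has finitely many zeros.\<close>

lemma finite_support:
  assumes f: "f \<in> F" "f \<noteq> 0"
  shows "finite {v\<in>PL. v f \<noteq> 0}"
proof -
  obtain v0 where v0: "v0 \<in> PL" using ex_place by blast
  \<comment> \<open>Degree \<open>g + 1\<close> is what Riemann's inequality needs for dimension 2,
    hence for a nonconstant \<open>x\<close>.\<close>
  define B where "B = (\<lambda>v. (int g + 1) * pt v0 v)"
  have B: "B \<in> Div" "divisor_degree B = int g + 1" "\<And>v. 0 \<le> B v"
    unfolding B_def using Div_scale[OF Div_pt(1)[OF v0], of "int g + 1"] Div_pt(2)[OF v0]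
    by (auto simp: pt_def)
  have "VS.dim (LL B) \<ge> 2" using riemann[OF B(1)] B(2) by simp
  then obtain x where x: "x \<in> LL B" "x \<notin> range emb" using ex_nonconst_if_dim_ge_2 by blast
  have xF: "x \<in> F" using x LL_F by blast
  have poles: "finite {v\<in>PL. v f < 0}" if f: "f \<in> F" "f \<noteq> 0" for f
  proof -
    obtain P n where P: "\<exists>j\<le>n. P j \<noteq> 0" "(\<Sum>j\<le>n. ev (P j) x * f ^ j) = 0"
      using dep[OF xF f(1)] by (auto simp: alg_dep_def)
    define m where "m = Max {j. j \<le> n \<and> P j \<noteq> 0}"
    have "m \<in> {j. j \<le> n \<and> P j \<noteq> 0}" unfolding m_def by (rule Max_in) (use P(1) in auto)
    hence m: "m \<le> n" "P m \<noteq> 0" by auto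
    have above: "P j = 0" if "m < j" "j \<le> n" for j
    proof (rule ccontr)
      assume "P j \<noteq> 0"
      hence "j \<le> m" unfolding m_def using that by (intro Max_ge) auto
      thus False using that by simp
    qed
    define N where "N = degree (P m)"
    define B' where "B' = (\<lambda>v. int N * B v)"
    have B': "B' \<in> Div" "\<And>v. 0 \<le> B' v" unfolding B'_def using Div_scale(1)[OF B(1)] B(3) by auto
    let ?a = "ev (P m) x"
    have a: "?a \<in> LL B'"
    proof (rule LL_I)
      fix v assume v: "v \<in> PL"
      show "vge v (- B' v) ?a"
        unfolding ev_altdef
      proof (rule vge_sum[OF v])
        fix i assume "i \<in> {..degree (P m)}"
        hence i: "i \<le> N" by (simp add: N_def)
        have "vge v (int i * - B v) (x ^ i)" by (rule vge_power[OF v xF LL_vge[OF x(1) v]])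
        hence "vge v (- B' v) (x ^ i)"
          by (rule vge_mono) (use i B(3)[of v] in \<open>simp add: B'_def mult_right_mono\<close>)
        thus "vge v (- B' v) (emb (poly.coeff (P m) i) * x ^ i)" by (intro vge_scale[OF v]) (auto simp: xF F_power)
      qed (auto intro: F_intros xF)
    qed (rule F_ev[OF xF])
    have a0: "?a \<noteq> 0" using m x(2) by (simp add: ev_eq_0_iff)
    have "{v\<in>PL. v f < 0} \<subseteq> {v. B v \<noteq> 0} \<union> {v\<in>PL. v ?a > 0}"
    proof (rule subsetI, rule ccontr)
      fix v assume v: "v \<in> {v\<in>PL. v f < 0}" and nv: "v \<notin> {v. B v \<noteq> 0} \<union> {v\<in>PL. v ?a > 0}"
      have vP: "v \<in> PL" and vf: "v f < 0" using v by auto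
      have x0: "vge v 0 x" using LL_vge[OF x(1) vP] nv by simp
      have va: "v ?a = 0" using vge_ev[OF vP xF x0, of "P m"] nv vP a0 by (auto simp: vge_def)
      let ?t = "\<lambda>j. ev (P j) x * f ^ j"
      have tF: "?t j \<in> F" for j by (intro F_intros xF f)
      have vt: "v (?t m) = int m * v f"
        using a0 f by (simp add: v_mult[OF vP] v_power[OF vP] F_power F_ev xF va)
      have "0 = ?t m + (\<Sum>j\<in>{..n} - {m}. ?t j)" using P(2) m(1) by (simp add: sum.remove)
      moreover have "?t m + (\<Sum>j\<in>{..n} - {m}. ?t j) \<noteq> 0"
      proof (rule v_add_eq(1)[OF vP])
        show "vge v (v (?t m) + 1) (\<Sum>j\<in>{..n} - {m}. ?t j)"
        proof (rule vge_sum[OF vP])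
          fix j assume j: "j \<in> {..n} - {m}"
          show "vge v (v (?t m) + 1) (?t j)"
          proof (cases "m < j")
            case True
            thus ?thesis using above[of j] j by simp
          next
            case False
            hence jm: "j < m" using j by auto
            have "vge v (0 + int j * v f) (?t j)"
              by (intro vge_mult[OF vP] vge_ev[OF vP] vge_power[OF vP] vge_refl F_intros xF f x0)
            moreover have "v (?t m) + 1 \<le> int j * v f"
            proof -
              have "int m * v f \<le> (int j + 1) * v f" using jm vf by (intro mult_right_mono_neg) auto
              also have "\<dots> \<le> int j * v f - 1" using vf by (simp add: algebra_simps)
              finally show ?thesis using vt by simp
            qed
            ultimately show ?thesis by (auto intro: vge_mono)
          qed
        qed (rule tF)
        show "?t m \<noteq> 0" using a0 f by simp
      qed (intro tF F_sum)+
      ultimately show False by simp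
    qed
    moreover have "finite ({v. B v \<noteq> 0} \<union> {v\<in>PL. v ?a > 0})"
      using Div_finite[OF B(1)] finite_zeros[OF B' a a0] by simp
    ultimately show ?thesis by (rule finite_subset)
  qed
  have "{v\<in>PL. v f \<noteq> 0} \<subseteq> {v\<in>PL. v f < 0} \<union> {v\<in>PL. v (inverse f) < 0}"
    using f by (auto simp: v_inverse)
  thus ?thesis using poles[OF f] poles[of "inverse f"] f F_inverse by (auto intro: finite_subset)
qed

lemma pdiv_Div: "f \<in> F \<Longrightarrow> f \<noteq> 0 \<Longrightarrow> pdiv f \<in> Div"
  by (rule Div_I[OF finite_support]) (auto simp: pdiv_def split: if_splits)

text \<open>Multiplication by \<open>f\<close> identifies \<open>L(D)\<close> with
  \<open>L(D - div f)\<close>; if the exact dimension formula holds for both, the degrees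
  agree.\<close>

lemma degree_pdiv:
  assumes f: "f \<in> F" "f \<noteq> 0"
  shows "divisor_degree (pdiv f) = 0"
proof -
  obtain D1 where D1: "D1 \<in> Div" "\<And>v. 0 \<le> D1 v"
    "\<And>D. D \<in> Div \<Longrightarrow> (\<And>v. D1 v \<le> D v) \<Longrightarrow> int (VS.dim (LL D)) = divisor_degree D + 1 - int g"
    using nonspecial by blast
  note p = pdiv_Div[OF f]
  have pa: "(\<lambda>v. \<bar>pdiv f v\<bar>) \<in> Div"
    by (rule Div_I[of "{v. pdiv f v \<noteq> 0}"]) (use p in \<open>auto simp: Div_iff\<close>)
  \<comment> \<open>The absolute value keeps both \<open>D\<close> and \<open>D - div f\<close>
    above \<open>D1\<close>.\<close>
  define D where "D = (\<lambda>v. D1 v + \<bar>pdiv f v\<bar>)"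
  have D: "D \<in> Div" unfolding D_def by (rule Div_add[OF D1(1) pa])
  note E = Div_diff[OF D p]
  have "int (VS.dim (LL D)) = divisor_degree D + 1 - int g"
    by (rule D1(3)[OF D]) (simp add: D_def)
  moreover have "int (VS.dim (LL (\<lambda>v. D v - pdiv f v))) = divisor_degree (\<lambda>v. D v - pdiv f v) + 1 - int g"
    by (rule D1(3)[OF E(1)]) (simp add: D_def)
  moreover have "VS.dim (LL (\<lambda>v. D v - pdiv f v)) = VS.dim (LL D)"
    using dim_mult_image[OF fin_dim_LL[OF D] f(2)] mult_LL[OF f] by simp
  ultimately show ?thesis using E(2) by linarith
qed

text \<open>The degree of \<open>F\<close> over \<open>k(x)\<close> is at most the degree of a divisor bounding the poles of \<open>x\<close>.\<close>

lemma dependent_over_ratf: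
  assumes D: "D \<in> Div" "\<And>v. 0 \<le> D v" and x: "x \<in> LL D" "x \<notin> range emb"
    and n: "divisor_degree D < int n" and u: "\<And>i. i < n \<Longrightarrow> u i \<in> F"
  shows "\<exists>p. (\<exists>i<n. p i \<noteq> 0) \<and> (\<Sum>i<n. ev (p i) x * u i) = 0"
proof (rule ccontr)
  assume "\<not> ?thesis"
  hence ind: "\<And>p i. (\<Sum>i<n. ev (p i) x * u i) = 0 \<Longrightarrow> i < n \<Longrightarrow> p i = 0" by blast
  have xF: "x \<in> F" using x LL_F by blast
  have x0: "vge v 0 x" if "v \<in> PL" "D v = 0" for v using LL_vge[OF x(1) that(1)] that(2) by simp
  define S where "S = (\<Union>i<n. if u i = 0 then {} else {v\<in>PL. v (u i) \<noteq> 0})"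
  have finS: "finite S" unfolding S_def using finite_support u by auto
  define M where "M = Max (insert 0 ((\<lambda>(v, i). nat \<bar>v (u i)\<bar>) ` (S \<times> {..<n})))"
  have M: "\<bar>v (u i)\<bar> \<le> int M" if "v \<in> PL" "i < n" for v i
  proof (cases "v \<in> S")
    case True
    hence "nat \<bar>v (u i)\<bar> \<le> M" unfolding M_def using finS that by (intro Max_ge) auto
    thus ?thesis by linarith
  next
    case False
    hence "v (u i) = 0" using that by (cases "u i = 0") (auto simp: S_def)
    thus ?thesis by simp
  qed
  \<comment> \<open>A polynomial in \<open>x\<close> that cancels the poles of all
    \<open>u i\<close> outside the support of \<open>D\<close>. Multiplying by it moves the
    \<open>u i\<close> into \<open>L(N D)\<close> for a fixed \<open>N\<close>.\<close>
  have "\<exists>q. q \<noteq> 0 \<and> (\<forall>v\<in>T. vge v (int M) (ev q x))" if T: "T \<subseteq> {v\<in>PL. D v = 0}" "finite T" for T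
    using T(2,1)
  proof (induction T rule: finite_induct)
    case empty
    show ?case by (rule exI[of _ 1]) simp
  next
    case (insert w T)
    then obtain q where q: "q \<noteq> 0" "\<forall>v\<in>T. vge v (int M) (ev q x)" by auto
    have w: "w \<in> PL" "D w = 0" using insert by auto
    obtain c where c: "vge w 1 (x - emb c)" using residue[OF w(1) xF x0[OF w]] by blast
    let ?r = "[:- c, 1:] ^ M"
    have r: "ev ?r x = (x - emb c) ^ M" by (simp add: ev_power emb_minus)
    have rF: "ev p x \<in> F" for p by (rule F_ev[OF xF])
    show ?case
    proof (intro exI[of _ "?r * q"] conjI ballI)
      show "?r * q \<noteq> 0" using q by simp
      fix v assume v: "v \<in> insert w T"
      hence vP: "v \<in> PL" "D v = 0" using insert by auto
      show "vge v (int M) (ev (?r * q) x)"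
      proof (cases "v = w")
        case True
        have "vge w (int M * 1 + 0) ((x - emb c) ^ M * ev q x)"
          by (intro vge_mult[OF w(1)] vge_power[OF w(1)] vge_ev[OF w(1)] c x0[OF w] F_intros xF)
        thus ?thesis using True by (simp add: ev_mult r)
      next
        case False
        hence "vge v (0 + int M) (ev ?r x * ev q x)"
          using v q by (intro vge_mult[OF vP(1)] vge_ev[OF vP(1)] xF x0[OF vP] rF) auto
        thus ?thesis by (simp add: ev_mult)
      qed
    qed
  qed
  from this[of "{v\<in>S. v \<in> PL \<and> D v = 0}"]
  obtain q where q: "q \<noteq> 0" "\<And>v. v \<in> S \<Longrightarrow> v \<in> PL \<Longrightarrow> D v = 0 \<Longrightarrow> vge v (int M) (ev q x)"
    using finS by auto
  define N where "N = M + degree q"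
  define w where "w i = ev q x * u i" for i
  have wF: "w i \<in> F" if "i < n" for i unfolding w_def by (intro F_intros xF u that)
  have w: "vge v (- (int N * D v)) (w i)" if i: "i < n" and v: "v \<in> PL" for i v
  proof (cases "u i = 0")
    case True
    thus ?thesis by (simp add: w_def)
  next
    case False
    have uM: "vge v (- int M) (u i)" using M[OF v i] unfolding vge_def by linarith
    show ?thesis
    proof (cases "D v = 0")
      case True
      have "vge v 0 (w i)"
      proof (cases "v \<in> S")
        case T: True
        have "vge v (int M + - int M) (ev q x * u i)"
          by (intro vge_mult[OF v] q(2) T v True uM F_intros xF u i)
        thus ?thesis by (simp add: w_def)
      next
        case F: False
        hence "v (u i) = 0" using i v False by (auto simp: S_def)
        hence "vge v (0 + 0) (ev q x * u i)"
          by (intro vge_mult[OF v] vge_ev[OF v] xF x0[OF v True] F_intros u i) (simp add: vge_def)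
        thus ?thesis by (simp add: w_def)
      qed
      thus ?thesis using True by simp
    next
      case False
      hence D1: "D v \<ge> 1" using D(2)[of v] by simp
      have "vge v (- (int (degree q) * D v)) (ev q x)"
        unfolding ev_altdef
      proof (rule vge_sum[OF v])
        fix j assume "j \<in> {..degree q}"
        hence j: "j \<le> degree q" by simp
        have "vge v (int j * - D v) (x ^ j)" by (rule vge_power[OF v xF LL_vge[OF x(1) v]])
        hence "vge v (- (int (degree q) * D v)) (x ^ j)"
          by (rule vge_mono) (use j D1 in \<open>simp add: mult_right_mono\<close>)
        thus "vge v (- (int (degree q) * D v)) (emb (poly.coeff q j) * x ^ j)"
          by (intro vge_scale[OF v] F_intros xF)
      qed (intro F_intros xF)
      hence "vge v (- (int (degree q) * D v) + - int M) (ev q x * u i)"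
        by (intro vge_mult[OF v] uM F_intros xF u i)
      moreover have "int M * 1 \<le> int M * D v" using D1 by (intro mult_left_mono) auto
      hence "- (int N * D v) \<le> - (int (degree q) * D v) + - int M"
        by (simp add: N_def algebra_simps)
      ultimately show ?thesis unfolding w_def by (rule vge_mono)
    qed
  qed
  define d where "d = nat (divisor_degree D)"
  have d: "divisor_degree D = int d" using degree_nonneg[of D] D(2) by (simp add: d_def)
  \<comment> \<open>Independence would give \<open>(d + 1) * (m + 1) \<le> 1 + (N + m) * d\<close>,
    that is \<open>d + m \<le> N * d\<close>, which this \<open>m\<close> violates.\<close>
  define m where "m = N * d + 1"
  let ?E = "\<lambda>v. int (N + m) * D v"
  note E = Div_scale[OF D(1), of "int (N + m)"]
  let ?I = "{..<n} \<times> {..m}"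
  have "card ?I \<le> VS.dim (LL ?E)"
  proof (rule card_le_dim_if_independent_family[of _ _ "\<lambda>(i, j). x ^ j * w i"])
    show "fin_dim (LL ?E)" by (rule fin_dim_LL[OF E(1)])
    show "(\<lambda>(i, j). x ^ j * w i) ` ?I \<subseteq> LL ?E"
    proof (rule image_subsetI)
      fix t assume "t \<in> ?I"
      then obtain i j where t: "t = (i, j)" "i < n" "j \<le> m" by auto
      have "x ^ j * w i \<in> LL ?E"
      proof (rule LL_I)
        show "x ^ j * w i \<in> F" by (intro F_intros xF wF t)
        fix v assume v: "v \<in> PL"
        have "vge v (int j * - D v + - (int N * D v)) (x ^ j * w i)"
          by (intro vge_mult[OF v] vge_power[OF v] F_intros xF wF w v t LL_vge[OF x(1) v])
        moreover have "int j * D v \<le> int m * D v" using t D(2)[of v] by (intro mult_right_mono) auto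
        hence "- ?E v \<le> int j * - D v + - (int N * D v)" by (simp add: algebra_simps)
        ultimately show "vge v (- ?E v) (x ^ j * w i)" by (rule vge_mono)
      qed
      thus "(case t of (i, j) \<Rightarrow> x ^ j * w i) \<in> LL ?E" using t by simp
    qed
    fix c t assume c: "(\<Sum>t\<in>?I. emb (c t) * (case t of (i, j) \<Rightarrow> x ^ j * w i)) = 0" and t: "t \<in> ?I"
    obtain i j where ij: "t = (i, j)" "i < n" "j \<le> m" using t by auto
    define p where "p i = (\<Sum>j\<le>m. Polynomial.monom (c (i, j)) j)" for i
    have "0 = (\<Sum>i<n. \<Sum>j\<le>m. emb (c (i, j)) * (x ^ j * w i))"
      using c by (simp add: sum.cartesian_product case_prod_unfold)
    also have "\<dots> = (\<Sum>i<n. ev (p i * q) x * u i)"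
      by (simp add: p_def w_def ev_mult ev_sum ev_monom sum_distrib_left sum_distrib_right mult.assoc)
    finally have "p i * q = 0" using ind[of "\<lambda>i. p i * q" i] ij by simp
    hence "poly.coeff (p i) j = 0" using q(1) by simp
    thus "c t = 0" using ij by (simp add: p_def coeff_sum)
  qed simp
  hence "n * (m + 1) \<le> VS.dim (LL ?E)" by (simp add: card_cartesian_product)
  moreover have "int (VS.dim (LL ?E)) \<le> 1 + divisor_degree ?E"
    by (rule dim_LL_effective[OF E(1)]) (use D(2) in simp)
  ultimately have "int (n * (m + 1)) \<le> 1 + divisor_degree ?E" by linarith
  hence "n * (m + 1) \<le> 1 + (N + m) * d" unfolding E(2) d by (simp flip: of_nat_mult of_nat_add of_nat_Suc)
  moreover have "(d + 1) * (m + 1) \<le> n * (m + 1)" using n d by (intro mult_right_mono) auto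
  ultimately have "(d + 1) * (m + 1) \<le> 1 + (N + m) * d" by linarith
  thus False by (simp add: m_def algebra_simps)
qed

end

subsection \<open>Conjugation in a quadratic extension\<close>

text \<open>Meaningful on \<open>quad_ext L t\<close> with \<open>t\<close> outside
  \<open>L\<close>, where the coordinates are unique; elsewhere the value is arbitrary.\<close>

definition quad_conj :: "'a::field set \<Rightarrow> 'a \<Rightarrow> 'a \<Rightarrow> 'a" where
  "quad_conj L t z = (case SOME (a, b). a \<in> L \<and> b \<in> L \<and> z = a + b * t of (a, b) \<Rightarrow> a - b * t)"

lemma quad_conj_eq:
  assumes L: "field_closed L" and t: "t \<notin> L" and ab: "a \<in> L" "b \<in> L"
  shows "quad_conj L t (a + b * t) = a - b * t"
proof -
  have "(SOME (c, d). c \<in> L \<and> d \<in> L \<and> a + b * t = c + d * t) = (a, b)"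
  proof (rule some_equality)
    fix cd assume "case cd of (c, d) \<Rightarrow> c \<in> L \<and> d \<in> L \<and> a + b * t = c + d * t"
    thus "cd = (a, b)" using quad_ext_unique[OF L t ab] by (cases cd) auto
  qed (use ab in auto)
  thus ?thesis by (simp add: quad_conj_def)
qed

lemma quad_conj_fixed:
  assumes "field_closed L" "t \<notin> L" "a \<in> L"
  shows "quad_conj L t a = a"
  using quad_conj_eq[OF assms fc_0[OF assms(1)]] by simp

lemma quad_conj_closed:
  assumes L: "field_closed L" and t: "t \<notin> L" and z: "z \<in> quad_ext L t"
  shows "quad_conj L t z \<in> quad_ext L t" "quad_conj L t (quad_conj L t z) = z"
proof -
  obtain a b where ab: "z = a + b * t" "a \<in> L" "b \<in> L" by (rule quad_extE[OF z])
  have nb: "- b \<in> L" by (rule fc_minus[OF L ab(3)])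
  have c: "quad_conj L t z = a + (- b) * t" unfolding ab(1) quad_conj_eq[OF L t ab(2,3)] by simp
  show "quad_conj L t z \<in> quad_ext L t" unfolding c by (rule quad_extI[OF ab(2) nb])
  have "quad_conj L t (quad_conj L t z) = a - (- b) * t"
    unfolding c by (rule quad_conj_eq[OF L t ab(2) nb])
  thus "quad_conj L t (quad_conj L t z) = z" unfolding ab(1) by simp
qed

lemma quad_conj_hom:
  assumes L: "field_closed L" and t: "t \<notin> L" "t * t \<in> L"
    and w: "w \<in> quad_ext L t" and z: "z \<in> quad_ext L t"
  shows "quad_conj L t (w + z) = quad_conj L t w + quad_conj L t z"
    and "quad_conj L t (w * z) = quad_conj L t w * quad_conj L t z"
proof -
  obtain a b where ab: "w = a + b * t" "a \<in> L" "b \<in> L" by (rule quad_extE[OF w])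
  obtain c d where cd: "z = c + d * t" "c \<in> L" "d \<in> L" by (rule quad_extE[OF z])
  note q = quad_conj_eq[OF L t(1)]
  have s: "w + z = (a + c) + (b + d) * t" unfolding ab(1) cd(1) by (simp add: algebra_simps)
  have 1: "a + c \<in> L" "b + d \<in> L" by (intro fc_add[OF L] ab cd)+
  show "quad_conj L t (w + z) = quad_conj L t w + quad_conj L t z"
    unfolding s q[OF 1] unfolding ab(1) cd(1) q[OF ab(2,3)] q[OF cd(2,3)] by (simp add: algebra_simps)
  have p: "w * z = (a * c + b * d * (t * t)) + (a * d + b * c) * t"
    unfolding ab(1) cd(1) by (simp add: algebra_simps)
  have 2: "a * c + b * d * (t * t) \<in> L" "a * d + b * c \<in> L"
    by (intro fc_add[OF L] fc_mult[OF L ab(2) cd(2)] fc_mult[OF L ab(2) cd(3)]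
      fc_mult[OF L ab(3) cd(2)] fc_mult[OF L fc_mult[OF L ab(3) cd(3)] t(2)])+
  show "quad_conj L t (w * z) = quad_conj L t w * quad_conj L t z"
    unfolding p q[OF 2] unfolding ab(1) cd(1) q[OF ab(2,3)] q[OF cd(2,3)] by (simp add: algebra_simps)
qed

text \<open>Completing the square with \<open>s = t - p / 2\<close>. Conjugation is multiplicative
  for a generator whose square lies in \<open>L\<close>, as \<open>quad_conj_hom\<close>
  demands.\<close>

lemma quad_ext_square:
  fixes L :: "'a::field_char_0 set"
  assumes L: "field_closed L" and F: "field_closed (quad_ext L t)" and t: "t \<notin> L"
  shows "\<exists>s. s \<notin> L \<and> s * s \<in> L \<and> quad_ext L s = quad_ext L t"
proof -
  have "t * t \<in> quad_ext L t" by (intro fc_mult[OF F] quad_ext_gen[OF L])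
  then obtain q p where pq: "t * t = q + p * t" "q \<in> L" "p \<in> L" by (rule quad_extE)
  have "1 + 1 \<in> L" by (intro fc_add[OF L] fc_1[OF L])
  hence p2: "p / 2 \<in> L" using fc_divide[OF L pq(3), of "1 + 1"] by simp
  let ?s = "t - p / 2"
  have "?s * ?s = t * t - p * t + p / 2 * (p / 2)" by (simp add: field_simps)
  also have "\<dots> = q + p / 2 * (p / 2)" unfolding pq(1) by simp
  finally have ss: "?s * ?s = q + p / 2 * (p / 2)" .
  have "?s * ?s \<in> L" unfolding ss by (intro fc_add[OF L] fc_mult[OF L] pq p2)
  moreover have "?s \<notin> L"
  proof
    assume "?s \<in> L"
    hence "?s + p / 2 \<in> L" by (intro fc_add[OF L] p2)
    thus False using t by simp
  qed
  moreover have "quad_ext L ?s = quad_ext L t"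
  proof
    show "quad_ext L ?s \<subseteq> quad_ext L t"
      by (rule quad_ext_minimal[OF F quad_ext_subset[OF L]])
        (use fc_diff[OF F quad_ext_gen[OF L]] quad_ext_subset[OF L] p2 in blast)
    show "quad_ext L t \<subseteq> quad_ext L ?s"
    proof
      fix z assume "z \<in> quad_ext L t"
      then obtain a b where ab: "z = a + b * t" "a \<in> L" "b \<in> L" by (rule quad_extE)
      show "z \<in> quad_ext L ?s"
      proof (rule quad_extI')
        show "z = (a + b * (p / 2)) + b * ?s" unfolding ab(1) by (simp add: algebra_simps)
        show "a + b * (p / 2) \<in> L" by (intro fc_add[OF L] fc_mult[OF L] ab p2)
      qed (rule ab(3))
    qed
  qed
  ultimately show ?thesis by blast
qed

context curve_field
begin

text \<open>Pullback along an automorphism of \<open>F\<close>. The \<open>if\<close> restores the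
  dummy value 0 outside \<open>F\<close>, so that equality of places stays equality of
  functions.\<close>

lemma place_comp:
  assumes v: "v \<in> PL" and \<sigma>: "\<And>z. z \<in> F \<Longrightarrow> \<sigma> z \<in> F" 
    and add: "\<And>x y. x \<in> F \<Longrightarrow> y \<in> F \<Longrightarrow> \<sigma> (x + y) = \<sigma> x + \<sigma> y"
    and mult: "\<And>x y. x \<in> F \<Longrightarrow> y \<in> F \<Longrightarrow> \<sigma> (x * y) = \<sigma> x * \<sigma> y"
    and const: "\<And>c. \<sigma> (emb c) = emb c" and surj: "\<And>z. z \<in> F \<Longrightarrow> \<exists>y\<in>F. \<sigma> y = z"
  shows "(\<lambda>z. if z \<in> F then v (\<sigma> z) else 0) \<in> PL"
proof -
  have s0: "\<sigma> 0 = 0" using const[of 0] by simp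
  have nz: "\<sigma> x \<noteq> 0" if "x \<in> F" "x \<noteq> 0" for x
  proof
    assume "\<sigma> x = 0"
    hence "\<sigma> (x * inverse x) = 0" using mult[of x "inverse x"] that F_inverse by simp
    thus False using that const[of 1] by simp
  qed
  show ?thesis unfolding places_def
  proof (intro CollectI conjI allI ballI impI)
    fix x y assume x: "x \<in> F - {0}" and y: "y \<in> F - {0}"
    show "(if x * y \<in> F then v (\<sigma> (x * y)) else 0) =
        (if x \<in> F then v (\<sigma> x) else 0) + (if y \<in> F then v (\<sigma> y) else 0)"
      using x y nz \<sigma> by (simp add: F_mult mult v_mult[OF v])
    assume xy: "x + y \<noteq> 0"
    have "vge v (min (v (\<sigma> x)) (v (\<sigma> y))) (\<sigma> x + \<sigma> y)"
      by (rule vge_add[OF v]) (use x y \<sigma> in \<open>auto simp: vge_def\<close>)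
    moreover have "\<sigma> x + \<sigma> y \<noteq> 0" using nz[of "x + y"] add[of x y] x y xy F_add by simp
    ultimately have "min (v (\<sigma> x)) (v (\<sigma> y)) \<le> v (\<sigma> x + \<sigma> y)" by (rule vge_D)
    thus "min (if x \<in> F then v (\<sigma> x) else 0) (if y \<in> F then v (\<sigma> y) else 0)
        \<le> (if x + y \<in> F then v (\<sigma> (x + y)) else 0)"
      using x y by (simp add: F_add add)
  next
    obtain t where t: "t \<in> F" "v t = 1" using uniformizer[OF v] by blast
    then obtain s where "s \<in> F" "\<sigma> s = t" using surj by blast
    thus "\<exists>s\<in>F. (if s \<in> F then v (\<sigma> s) else 0) = 1" using t by (intro bexI[of _ s]) auto
  next
    show "(if x \<in> F then v (\<sigma> x) else 0) = 0" if "x \<notin> F - {0}" for x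
      using that s0 v by auto
    show "(if emb c \<in> F then v (\<sigma> (emb c)) else 0) = 0" for c
      using v by (simp add: const)
  qed
qed

end

subsection \<open>The genus of \<open>y\<^sup>2 = f(x)\<close>\<close>

text \<open>\<open>zero_ex\<close> supplies places before the genus of \<open>F\<close> is known;
  interpretations take it from an ambient field of known genus. \<open>\<gamma> = 0\<close> is
  allowed and covers the line.\<close>

locale quadratic_curve = curve_field emb F
  for emb :: "'k::{alg_closed_field,field_char_0} \<Rightarrow> 'a::field_char_0" and F +
  fixes x y :: 'a and f :: "'k poly" and \<gamma> :: nat
  assumes xF: "x \<in> F" and yF: "y \<in> F" and x_nonconst: "x \<notin> range emb"
    and eqn: "y * y = ev f x" and gen: "F = quad_ext (ratf x) y"
    and sqfree: "\<And>c. \<not> [:- c, 1:] * [:- c, 1:] dvd f" and deg: "degree f = 2 * \<gamma> + 1"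
    and zero_ex: "\<And>z. z \<in> F \<Longrightarrow> z \<notin> range emb \<Longrightarrow> \<exists>v\<in>PL. v z > 0"
begin

lemma ev_x_0 [simp]: "ev p x = 0 \<longleftrightarrow> p = 0"
  by (rule ev_eq_0_iff[OF x_nonconst])

lemma f_nz: "f \<noteq> 0"
  using deg by auto

lemma y_nz: "y \<noteq> 0"
  using eqn f_nz by auto

text \<open>In \<open>p^2 = f q^2\<close> the two sides have degrees of different parity.\<close>

lemma y_notin: "y \<notin> ratf x"
proof
  assume "y \<in> ratf x"
  then obtain p q where pq: "y = ev p x / ev q x" "ev q x \<noteq> 0" by (auto simp: ratf_def)
  have "ev (p * p) x = ev (f * (q * q)) x" using eqn pq by (simp add: ev_mult field_simps)
  hence eq: "p * p = f * (q * q)" by (simp only: ev_eq_iff[OF x_nonconst])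
  have "p \<noteq> 0" using pq y_nz by auto
  hence "degree (p * p) = 2 * degree p" by (simp add: degree_mult_eq)
  moreover have "degree (f * (q * q)) = 2 * \<gamma> + 1 + 2 * degree q"
    using pq f_nz by (simp add: degree_mult_eq deg)
  ultimately have "2 * degree p = 2 * (\<gamma> + degree q) + 1" using eq by simp
  thus False by presburger
qed

lemma ratf_F: "ratf x \<subseteq> F"
  using quad_ext_subset[OF ratf_field] unfolding gen by blast

abbreviation "lin p q \<equiv> ev p x + ev q x * y"

lemma lin_F: "lin p q \<in> F"
  by (intro F_intros xF yF)

lemma lin_eq_0: "lin p q = 0 \<longleftrightarrow> p = 0 \<and> q = 0"
  using quad_ext_unique[OF ratf_field y_notin ev_in_ratf ev_in_ratf fc_0[OF ratf_field] fc_0[OF ratf_field], of p q]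
  by auto

lemma F_rep:
  assumes "z \<in> F"
  obtains p q d where "d \<noteq> 0" "z = lin p q / ev d x"
proof -
  obtain a b where ab: "z = a + b * y" "a \<in> ratf x" "b \<in> ratf x"
    using assms unfolding gen by (rule quad_extE)
  obtain p d where p: "a = ev p x / ev d x" "ev d x \<noteq> 0" using ab(2) by (auto simp: ratf_def)
  obtain q e where q: "b = ev q x / ev e x" "ev e x \<noteq> 0" using ab(3) by (auto simp: ratf_def)
  have "z = lin (p * e) (q * d) / ev (d * e) x"
    unfolding ab(1) p(1) q(1) using p(2) q(2) by (simp add: ev_mult field_simps)
  moreover have "d * e \<noteq> 0" using p q by auto
  ultimately show ?thesis using that by blast
qed

lemma norm_lin: "lin p q * lin p (- q) = ev (p * p - f * (q * q)) x"
proof -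
  have "lin p q * lin p (- q) = ev p x * ev p x - ev q x * ev q x * (y * y)"
    by (simp add: ev_minus algebra_simps)
  also have "\<dots> = ev (p * p - f * (q * q)) x" unfolding eqn by (simp add: ev_hom algebra_simps)
  finally show ?thesis .
qed

text \<open>In units of \<open>v x\<close>, twice the value of \<open>ev p x\<close> is even and
  twice the value of \<open>ev q x * y\<close> is odd, so the two terms never have equal value.
  Doubling avoids halves.\<close>

lemma infinite_value:
  assumes v: "v \<in> PL" "v x < 0" and pq: "p \<noteq> 0 \<or> q \<noteq> 0"
  shows "2 * v (lin p q) = v x * int (max (if p = 0 then 0 else 2 * degree p) (if q = 0 then 0 else 2 * (degree q + \<gamma>) + 1))"
proof -
  have "2 * v y = v (y * y)" using y_nz by (simp add: v_mult[OF v(1)] yF)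
  also have "\<dots> = int (2 * \<gamma> + 1) * v x"
    unfolding eqn using v_ev_neg[OF v(1) xF v(2) f_nz] deg by simp
  finally have vy: "2 * v y = int (2 * \<gamma> + 1) * v x" .
  have vp: "v (ev p x) = int (degree p) * v x" if "p \<noteq> 0" for p
    using v_ev_neg[OF v(1) xF v(2) that] by simp
  have vq: "2 * v (ev q x * y) = v x * int (2 * (degree q + \<gamma>) + 1)" if "q \<noteq> 0"
    using that vp[OF that] vy y_nz by (simp add: v_mult[OF v(1)] F_ev xF yF algebra_simps)
  show ?thesis
  proof (cases "p = 0 \<or> q = 0")
    case True
    thus ?thesis using pq vp[of p] vq by auto
  next
    case False
    hence nz: "p \<noteq> 0" "q \<noteq> 0" "ev p x \<noteq> 0" "ev q x * y \<noteq> 0" using y_nz by auto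
    have qF: "ev q x * y \<in> F" "ev p x \<in> F" by (intro F_intros xF yF)+
    show ?thesis
    proof (cases "2 * degree p < 2 * (degree q + \<gamma>) + 1")
      case True
      hence "v x * int (2 * (degree q + \<gamma>) + 1) < v x * int (2 * degree p)"
        using v(2) by (intro mult_strict_left_mono_neg) (simp_all only: of_nat_less_iff)
      hence "v (ev q x * y) < v (ev p x)" using vp[OF nz(1)] vq[OF nz(2)] by (simp add: mult.commute)
      hence "v (ev q x * y + ev p x) = v (ev q x * y)"
        by (intro v_add_eq(2)[OF v(1) qF nz(4)]) (simp add: vge_def)
      thus ?thesis using vq nz True by (simp add: add.commute max_def)
    next
      case F: False
      hence "2 * (degree q + \<gamma>) + 1 < 2 * degree p" by presburger
      hence "v x * int (2 * degree p) < v x * int (2 * (degree q + \<gamma>) + 1)"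
        using v(2) by (intro mult_strict_left_mono_neg) (simp_all only: of_nat_less_iff)
      hence "v (ev p x) < v (ev q x * y)" using vp[OF nz(1)] vq[OF nz(2)] by (simp add: mult.commute)
      hence "v (ev p x + ev q x * y) = v (ev p x)"
        by (intro v_add_eq(2)[OF v(1) qF(2,1) nz(3)]) (simp add: vge_def)
      thus ?thesis using vp nz F by (simp add: max_def)
    qed
  qed
qed

lemma infinite_value_ex: 
  assumes z: "z \<in> F" "z \<noteq> 0"
  shows "\<exists>k. \<forall>v\<in>PL. v x < 0 \<longrightarrow> 2 * v z = v x * k"
proof -
  obtain p q d where r: "d \<noteq> 0" "z = lin p q / ev d x" using F_rep[OF z(1)] by blast
  have pq: "p \<noteq> 0 \<or> q \<noteq> 0" using z(2) r by auto
  let ?m = "int (max (if p = 0 then 0 else 2 * degree p) (if q = 0 then 0 else 2 * (degree q + \<gamma>) + 1))"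
  have "2 * v z = v x * (?m - 2 * int (degree d))" if v: "v \<in> PL" "v x < 0" for v
  proof -
    have "v z = v (lin p q) - v (ev d x)"
      unfolding r(2) using r(1) pq lin_eq_0 by (intro v_divide[OF v(1)] lin_F F_ev xF) auto
    thus ?thesis using infinite_value[OF v pq] v_ev_neg[OF v(1) xF v(2) r(1)] by (simp add: algebra_simps)
  qed
  thus ?thesis by blast
qed

text \<open>By \<open>infinite_value_ex\<close> for a uniformizer, \<open>v x\<close> divides 2. It
  is even because \<open>2 * v y\<close> is an odd multiple of it.\<close>

lemma infinite_x:
  assumes v: "v \<in> PL" "v x < 0"
  shows "v x = - 2"
proof -
  obtain t where t: "t \<in> F" "t \<noteq> 0" "v t = 1" using uniformizer[OF v(1)] by blast
  obtain k where "2 * v t = v x * k" using infinite_value_ex[OF t(1,2)] v by blast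
  hence k: "v x * k = 2" using t by simp
  have "2 * v y = v x * int (2 * \<gamma> + 1)" using infinite_value[OF v, of 0 1] by simp
  hence "even (v x * int (2 * \<gamma> + 1))" by (metis dvd_triv_left)
  hence "even (v x)" by simp
  then obtain j where j: "v x = 2 * j" by blast
  hence "j * k = 1" using k by simp
  hence "j = 1 \<or> j = - 1" by (rule zmult_eq_1_iff[THEN iffD1, THEN disj_forward]) auto
  thus ?thesis using j v(2) by auto
qed

lemma infinite_unique:
  assumes v: "v \<in> PL" "v x < 0" and w: "w \<in> PL" "w x < 0"
  shows "v = w"
proof (rule place_eqI[OF v(1) w(1)])
  fix z assume z: "z \<in> F" "z \<noteq> 0" "0 \<le> v z"
  obtain k where "2 * v z = v x * k" "2 * w z = w x * k" using infinite_value_ex[OF z(1,2)] v w by blast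
  thus "0 \<le> w z" using z(3) infinite_x[OF v] infinite_x[OF w] by simp
qed

text \<open>The place lies over the affine point \<open>(c, e)\<close>.\<close>

definition centred :: "'k \<Rightarrow> 'k \<Rightarrow> ('a \<Rightarrow> int) \<Rightarrow> bool" where
  "centred c e v \<longleftrightarrow> v \<in> PL \<and> vge v 1 (x - emb c) \<and> vge v 1 (y - emb e)"

lemma const_vge: "v \<in> PL \<Longrightarrow> vge v 1 (emb c) \<Longrightarrow> c = 0"
  by (auto simp: vge_def)

lemma x_minus_nz: "x - emb c \<noteq> 0"
  using x_nonconst by auto

lemma finite_centre:
  assumes v: "v \<in> PL" "0 \<le> v x"
  shows "\<exists>c e. centred c e v"
proof -
  obtain c where c: "vge v 1 (x - emb c)" using residue[OF v(1) xF] v(2) by (auto simp: vge_def)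
  have "vge v 0 (y * y)" unfolding eqn using v by (intro vge_ev[OF v(1) xF]) (simp add: vge_def)
  hence "vge v 0 y" using y_nz v_mult[OF v(1) yF yF] by (simp add: vge_def)
  then obtain e where "vge v 1 (y - emb e)" using residue[OF v(1) yF] by blast
  thus ?thesis using c v(1) by (auto simp: centred_def)
qed

lemma centred_eqn:
  assumes v: "centred c e v"
  shows "poly f c = e * e"
proof -
  have vP: "v \<in> PL" and vx: "vge v 1 (x - emb c)" and vy: "vge v 1 (y - emb e)"
    using v by (auto simp: centred_def)
  have F: "y - emb e \<in> F" "y + emb e \<in> F" by (intro F_intros yF)+
  have "vge v 0 ((y - emb e) + emb (e + e))"
    by (rule vge_add[OF vP F(1) emb_in_F vge_mono[OF vy] vge_emb[OF vP]]) simp_all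
  moreover have "(y - emb e) + emb (e + e) = y + emb e" unfolding emb_add by simp
  ultimately have "vge v 0 (y + emb e)" by (simp only:)
  hence "vge v (1 + 0) ((y - emb e) * (y + emb e))"
    by (intro vge_mult[OF vP] F vy)
  moreover have "(y - emb e) * (y + emb e) = ev f x - emb (e * e)"
    using eqn by (simp add: emb_mult algebra_simps)
  ultimately have "vge v 1 (ev f x - emb (e * e))" by simp
  from vge_diff[OF vP F_diff[OF F_ev[OF xF] emb_in_F] F_diff[OF F_ev[OF xF] emb_in_F] this ev_residue[OF vP xF vx, of f]]
  have "vge v 1 (emb (poly f c - e * e))" by (simp add: emb_diff)
  thus ?thesis using const_vge[OF vP] by fastforce
qed

lemma order_f: "poly f c = 0 \<Longrightarrow> Polynomial.order c f = 1"
proof -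
  assume 0: "poly f c = 0"
  have "Polynomial.order c f \<noteq> 0" using 0 f_nz order_root by blast
  moreover have "\<not> 2 \<le> Polynomial.order c f"
    using order_divides[of c 2 f] sqfree[of c] by (simp add: power2_eq_square)
  ultimately show ?thesis by linarith
qed

lemma centred_x: "centred c e v \<Longrightarrow> v (x - emb c) > 0"
  using x_minus_nz[of c] by (auto simp: centred_def vge_def)

lemma centred_ramified:
  assumes v: "centred c 0 v"
  shows "v (x - emb c) = 2 * v y"
proof -
  have vP: "v \<in> PL" and vx: "vge v 1 (x - emb c)" using v by (auto simp: centred_def)
  have "poly f c = 0" using centred_eqn[OF v] by simp
  hence "v (ev f x) = v (x - emb c)"
    using v_ev_order[OF vP xF vx _ f_nz] x_minus_nz[of c] order_f by simp
  moreover have "v (y * y) = 2 * v y" using y_nz by (simp add: v_mult[OF vP] yF)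
  ultimately show ?thesis unfolding eqn by simp
qed

text \<open>The value of the expected local parameter at \<open>(c, e)\<close>: \<open>y\<close> at
  a branch point, \<open>x - c\<close> elsewhere. It is kept as an unknown until
  \<open>centred_scale\<close> shows that it is 1.\<close>

definition scale :: "'k \<Rightarrow> 'k \<Rightarrow> ('a \<Rightarrow> int) \<Rightarrow> int" where
  "scale c e v = (if e = 0 then v y else v (x - emb c))"

lemma scale_pos: "centred c e v \<Longrightarrow> scale c e v > 0"
  using centred_x[of c e v] centred_ramified[of c v] by (auto simp: scale_def)

lemma centred_residue:
  assumes v: "centred c e v"
  shows "vge v 1 (lin p q - emb (poly p c + poly q c * e))"
proof -
  have vP: "v \<in> PL" and vx: "vge v 1 (x - emb c)" and vy: "vge v 1 (y - emb e)"
    using v by (auto simp: centred_def)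
  have xx: "vge v 0 x"
    using vge_add[OF vP _ _ vge_mono[OF vx, of 0] vge_emb[OF vP, of 0 c]] by (simp add: F_intros xF)
  have "vge v (0 + 1) (ev q x * (y - emb e))"
    by (intro vge_mult[OF vP] vge_ev[OF vP] xF xx vy F_intros yF)
  moreover have "vge v (1 + 0) ((ev q x - emb (poly q c)) * emb e)"
    by (intro vge_mult[OF vP] ev_residue[OF vP xF vx] F_intros xF vge_emb[OF vP]) simp
  moreover note ev_residue[OF vP xF vx, of p]
  ultimately have "vge v 1 ((ev q x * (y - emb e) + (ev q x - emb (poly q c)) * emb e) + (ev p x - emb (poly p c)))"
    by (intro vge_add[OF vP] F_intros xF yF) simp_all
  moreover have "(ev q x * (y - emb e) + (ev q x - emb (poly q c)) * emb e) + (ev p x - emb (poly p c)) = 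
    lin p q - emb (poly p c + poly q c * e)" by (simp add: emb_hom algebra_simps)
  ultimately show ?thesis by simp
qed

lemma centred_unit:
  assumes v: "centred c e v" and nz: "poly p c + poly q c * e \<noteq> 0"
  shows "v (lin p q) = 0"
proof -
  have vP: "v \<in> PL" using v by (auto simp: centred_def)
  let ?r = "emb (poly p c + poly q c * e)"
  have "v (?r + (lin p q - ?r)) = v ?r"
    by (rule v_add_eq(2)[OF vP]) (use nz centred_residue[OF v, of p q] v_emb[OF vP] in \<open>auto intro!: F_intros xF yF\<close>)
  thus ?thesis using v_emb[OF vP] by simp
qed

text \<open>Common factors \<open>T - c\<close> are split off first. If then \<open>p + q y\<close>
  vanishes at \<open>(c, e)\<close>: for \<open>e \<noteq> 0\<close> its conjugate is a unit there,
  so the norm gives the value; for \<open>e = 0\<close> the term \<open>q y\<close> dominates. The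
  factor \<open>k\<close> does not depend on \<open>v\<close>, which yields uniqueness of the
  place.\<close>

lemma centred_value_ex:
  assumes pq: "p \<noteq> 0 \<or> q \<noteq> 0"
  shows "\<exists>k. \<forall>v. centred c e v \<longrightarrow> v (lin p q) = k * scale c e v"
  using pq
proof (induction "degree p + degree q" arbitrary: p q rule: less_induct)
  case less
  show ?case
  proof (cases "poly p c = 0 \<and> poly q c = 0")
    case True
    then obtain p' q' where p': "p = [:- c, 1:] * p'" and q': "q = [:- c, 1:] * q'"
      by (meson dvdE poly_eq_0_iff_dvd)
    have nz: "p' \<noteq> 0 \<or> q' \<noteq> 0" using less(2) p' q' by auto
    have d: "degree ([:- c, 1:] * r) = (if r = 0 then 0 else Suc (degree r))" for r
      by (cases "r = 0") (simp_all add: degree_mult_eq del: mult_pCons_left)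
    have "degree p' + degree q' < degree p + degree q"
      unfolding p' q' d using nz by auto
    from less(1)[OF this nz] obtain k where k: "\<forall>v. centred c e v \<longrightarrow> v (lin p' q') = k * scale c e v" by blast
    have "lin p q = (x - emb c) * lin p' q'"
      unfolding p' q' ev_mult by (simp add: emb_minus algebra_simps)
    moreover have "v ((x - emb c) * lin p' q') = (k + (if e = 0 then 2 else 1)) * scale c e v" if v: "centred c e v" for v
    proof -
      have vP: "v \<in> PL" using v by (auto simp: centred_def)
      have "v ((x - emb c) * lin p' q') = v (x - emb c) + v (lin p' q')"
        using nz lin_eq_0 x_minus_nz by (intro v_mult[OF vP] F_intros xF yF) auto
      moreover have "v (x - emb c) = (if e = 0 then 2 else 1) * scale c e v"
        using centred_ramified v by (auto simp: scale_def)
      ultimately show ?thesis using k v by (simp add: algebra_simps)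
    qed
    ultimately show ?thesis by metis
  next
    case nboth: False
    show ?thesis
    proof (cases "poly p c + poly q c * e = 0")
      case False
      thus ?thesis using centred_unit by (intro exI[of _ 0]) simp
    next
      case True
      show ?thesis
      proof (cases "e = 0")
        case e: False
        have "poly q c \<noteq> 0" using True nboth by auto
        moreover have "poly p c = - (poly q c * e)" using True by (simp add: eq_neg_iff_add_eq_0)
        ultimately have cnj: "poly p c + poly (- q) c * e \<noteq> 0" using e by simp
        define r where "r = p * p - f * (q * q)"
        show ?thesis
        proof (intro exI[of _ "int (Polynomial.order c r)"] allI impI)
          fix v assume v: "centred c e v"
          have vP: "v \<in> PL" and vx: "vge v 1 (x - emb c)" using v by (auto simp: centred_def)
          have nz: "lin p q \<noteq> 0" "lin p (- q) \<noteq> 0" using less(2) lin_eq_0 by auto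
          hence r0: "r \<noteq> 0" using norm_lin[of p q] by (auto simp: r_def)
          have "v (lin p q) = v (lin p q * lin p (- q))"
            unfolding v_mult[OF vP lin_F lin_F nz] using centred_unit[OF v cnj] by simp
          also have "\<dots> = int (Polynomial.order c r) * v (x - emb c)"
            unfolding norm_lin r_def[symmetric]
            using v_ev_order[OF vP xF vx _ r0] x_minus_nz by simp
          finally show "v (lin p q) = int (Polynomial.order c r) * scale c e v" using e by (simp add: scale_def)
        qed
      next
        case e: True
        hence pc: "poly p c = 0" and qc: "poly q c \<noteq> 0" using True nboth by auto
        show ?thesis
        proof (intro exI[of _ 1] allI impI)
          fix v assume v: "centred c e v"
          have vP: "v \<in> PL" and vx: "vge v 1 (x - emb c)" using v by (auto simp: centred_def)
          note ram = centred_ramified[OF v[unfolded e]]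
          have q: "ev q x \<noteq> 0" "v (ev q x) = 0" using ev_unit[OF vP xF vx qc] by auto
          have vqy: "v (ev q x * y) = v y" using q y_nz by (simp add: v_mult[OF vP] F_ev xF yF)
          have "vge v (v (ev q x * y) + 1) (ev p x)"
          proof (cases "p = 0")
            case False
            have "v (ev p x) = int (Polynomial.order c p) * v (x - emb c)"
              using v_ev_order[OF vP xF vx _ False] x_minus_nz by simp
            moreover have "Polynomial.order c p \<ge> 1" using pc False order_root[of p c] by (simp add: Suc_leI)
            hence "1 * v (x - emb c) \<le> int (Polynomial.order c p) * v (x - emb c)"
              using centred_x[OF v] by (intro mult_right_mono) auto
            ultimately have "v (ev p x) \<ge> v y + 1" using ram centred_x[OF v] by linarith
            thus ?thesis using vqy by (simp add: vge_def)
          qed simp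
          hence "v (ev q x * y + ev p x) = v (ev q x * y)"
            using q y_nz by (intro v_add_eq(2)[OF vP] F_intros xF yF) auto
          thus "v (lin p q) = 1 * scale c e v" using vqy e by (simp add: scale_def add.commute)
        qed
      qed
    qed
  qed
qed

lemma centred_value_F:
  assumes z: "z \<in> F" "z \<noteq> 0"
  shows "\<exists>k. \<forall>v. centred c e v \<longrightarrow> v z = k * scale c e v"
proof -
  obtain p q d where r: "d \<noteq> 0" "z = lin p q / ev d x" using F_rep[OF z(1)] by blast
  have pq: "p \<noteq> 0 \<or> q \<noteq> 0" using z(2) r by auto
  obtain k where k: "\<forall>v. centred c e v \<longrightarrow> v (lin p q) = k * scale c e v" using centred_value_ex[OF pq] by blast
  obtain l where l: "\<forall>v. centred c e v \<longrightarrow> v (lin d 0) = l * scale c e v" using centred_value_ex[of d 0] r(1) by blast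
  have "v z = (k - l) * scale c e v" if v: "centred c e v" for v
  proof -
    have vP: "v \<in> PL" using v by (auto simp: centred_def)
    have "v z = v (lin p q) - v (ev d x)"
      unfolding r(2) using r(1) pq lin_eq_0 by (intro v_divide[OF vP] lin_F F_ev xF) auto
    thus ?thesis using k l v by (simp add: algebra_simps)
  qed
  thus ?thesis by blast
qed

lemma centred_scale:
  assumes v: "centred c e v"
  shows "scale c e v = 1"
proof -
  have vP: "v \<in> PL" using v by (auto simp: centred_def)
  obtain t where t: "t \<in> F" "t \<noteq> 0" "v t = 1" using uniformizer[OF vP] by blast
  obtain k where "v t = k * scale c e v" using centred_value_F[OF t(1,2)] v by blast
  hence "scale c e v * k = 1" using t by (simp add: mult.commute)
  thus ?thesis using scale_pos[OF v] by (auto simp: zmult_eq_1_iff)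
qed

lemma centred_unique:
  assumes v: "centred c e v" and w: "centred c e w"
  shows "v = w"
proof (rule place_eqI)
  fix z assume z: "z \<in> F" "z \<noteq> 0" "0 \<le> v z"
  obtain k where k: "\<forall>v. centred c e v \<longrightarrow> v z = k * scale c e v" using centred_value_F[OF z(1,2)] by blast
  have "v z = k * scale c e v" "w z = k * scale c e w" using k v w by blast+
  thus "0 \<le> w z" using z(3) centred_scale[OF v] centred_scale[OF w] by simp
qed (use v w in \<open>auto simp: centred_def\<close>)

lemma centred_x_value: "centred c e v \<Longrightarrow> v (x - emb c) = (if e = 0 then 2 else 1)"
  using centred_scale[of c e v] centred_ramified[of c v] by (auto simp: scale_def split: if_splits)

definition fibre :: "'k \<Rightarrow> ('a \<Rightarrow> int) set" where
  "fibre c = {v\<in>PL. 0 < v (x - emb c)}"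

text \<open>The fibre lies in the points \<open>(c, e)\<close> and \<open>(c, - e)\<close>, each of
  value 1, or in the single branch point of value 2. The upper bound makes principal divisors of
  polynomials in \<open>x\<close> have degree at most 0, the direction that
  \<open>has_genus_quadratic\<close> uses.\<close>

lemma fibre_bound: "finite (fibre c)" "(\<Sum>v\<in>fibre c. v (x - emb c)) \<le> 2"
proof -
  obtain e where e: "e ^ 2 = poly f c" using sqrt_const by blast
  define A where "A e = {v. centred c e v}" for e
  have A: "finite (A e) \<and> card (A e) \<le> 1" for e
  proof (cases "A e = {}")
    case False
    then obtain v where "v \<in> A e" by blast
    hence "A e = {v}" using centred_unique by (auto simp: A_def)
    thus ?thesis by simp
  qed simp
  have fibre_sub: "fibre c \<subseteq> A e \<union> A (- e)"
  proof
    fix v assume "v \<in> fibre c"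
    hence vP: "v \<in> PL" and vx: "0 < v (x - emb c)" by (auto simp: fibre_def)
    have "vge v 0 ((x - emb c) + emb c)" 
      using vx by (intro vge_add[OF vP] F_intros xF vge_emb[OF vP]) (auto simp: vge_def)
    hence "0 \<le> v x" using x_nonconst by (auto simp: vge_def)
    then obtain c' e' where ce: "centred c' e' v" using finite_centre[OF vP] by blast
    have "vge v 1 (x - emb c)" "vge v 1 (x - emb c')" using vx ce by (simp_all add: vge_def centred_def)
    hence "vge v 1 ((x - emb c) - (x - emb c'))" by (rule vge_diff[OF vP F_diff[OF xF emb_in_F] F_diff[OF xF emb_in_F]])
    hence "vge v 1 (emb (c' - c))" by (simp add: emb_diff)
    hence "c' = c" using const_vge[OF vP] by fastforce
    hence ce: "centred c e' v" using ce by simp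
    have "e' * e' = e * e" using centred_eqn[OF ce] e by (simp add: power2_eq_square)
    hence "e' = e \<or> e' = - e" by (simp add: square_eq_iff)
    thus "v \<in> A e \<union> A (- e)" using ce by (auto simp: A_def)
  qed
  show fin: "finite (fibre c)" using finite_subset[OF fibre_sub] A by simp
  have val: "v (x - emb c) = (if e = 0 then 2 else 1)" if "v \<in> fibre c" for v
  proof -
    have "centred c e v \<or> centred c (- e) v" using fibre_sub that by (auto simp: A_def)
    thus ?thesis using centred_x_value[of c e v] centred_x_value[of c "- e" v] by auto
  qed
  have "(\<Sum>v\<in>fibre c. v (x - emb c)) = (\<Sum>v\<in>fibre c. (if e = 0 then 2 else 1))"
    by (rule sum.cong) (simp_all add: val)
  also have "\<dots> = (if e = 0 then 2 else 1) * int (card (fibre c))" by simp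
  also have "\<dots> \<le> 2"
  proof (cases "e = 0")
    case True
    hence "card (fibre c) \<le> card (A 0)" using fibre_sub A by (intro card_mono) auto
    thus ?thesis using A[of 0] True by simp
  next
    case False
    have "card (fibre c) \<le> card (A e \<union> A (- e))" using fibre_sub A by (intro card_mono) auto
    also have "\<dots> \<le> card (A e) + card (A (- e))" by (rule card_Un_le)
    finally show ?thesis using A[of e] A[of "- e"] False by simp
  qed
  finally show "(\<Sum>v\<in>fibre c. v (x - emb c)) \<le> 2" .
qed

lemma infinite_ex: "\<exists>w\<in>PL. w x < 0"
proof -
  have x0: "inverse x \<in> F" "inverse x \<notin> range emb" using emb_notin_ratf_inverse[OF x_nonconst, of 0] F_inverse[OF xF] by auto
  thus ?thesis using zero_ex[OF x0] by (auto simp: v_inverse xF)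
qed

definition winf :: "'a \<Rightarrow> int" where
  "winf = (SOME w. w \<in> PL \<and> w x < 0)"

lemma winf: "winf \<in> PL" "winf x = - 2"
proof -
  have "\<exists>w. w \<in> PL \<and> w x < 0" using infinite_ex by blast
  hence "winf \<in> PL \<and> winf x < 0" unfolding winf_def by (rule someI_ex)
  thus "winf \<in> PL" "winf x = - 2" using infinite_x by auto
qed

lemma winf_unique: "v \<in> PL \<Longrightarrow> v x < 0 \<Longrightarrow> v = winf"
  using infinite_unique winf by simp

lemma pdiv_linear:
  "pdiv (x - emb c) \<in> Div \<and> divisor_degree (pdiv (x - emb c)) \<le> 0"
proof -
  let ?S = "insert winf (fibre c)"
  have wx: "winf (x - emb c) = - 2"
  proof -
    have "winf (x + (- emb c)) = winf x"
      by (rule v_add_eq(2)[OF winf(1)]) (use winf x_nonconst in \<open>auto intro!: F_intros xF simp: vge_def v_minus emb_in_F\<close>)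
    thus ?thesis using winf by simp
  qed
  have sub: "{v. pdiv (x - emb c) v \<noteq> 0} \<subseteq> ?S"
  proof
    fix v assume "v \<in> {v. pdiv (x - emb c) v \<noteq> 0}"
    hence v: "v \<in> PL" "v (x - emb c) \<noteq> 0" by (auto simp: pdiv_def split: if_splits)
    show "v \<in> ?S"
    proof (cases "v (x - emb c) > 0")
      case True
      thus ?thesis using v by (simp add: fibre_def)
    next
      case False
      have "v x < 0"
      proof (rule ccontr)
        assume "\<not> v x < 0"
        hence "vge v 0 (x - emb c)"
          by (intro vge_diff[OF v(1)] F_intros xF vge_emb[OF v(1)]) (auto simp: vge_def)
        thus False using False v(2) x_minus_nz by (auto simp: vge_def)
      qed
      thus ?thesis using winf_unique v by simp
    qed
  qed
  have fin: "finite ?S" "?S \<subseteq> PL" using fibre_bound(1)[of c] winf(1) by (auto simp: fibre_def)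
  have D: "pdiv (x - emb c) \<in> Div" by (rule Div_I[OF fin]) (use sub in blast)
  have nin: "winf \<notin> fibre c" using wx by (simp add: fibre_def)
  have "divisor_degree (pdiv (x - emb c)) = sum (pdiv (x - emb c)) ?S" by (rule degree_eq_sum[OF fin(1) sub])
  also have "\<dots> = (\<Sum>v\<in>?S. v (x - emb c))" by (rule sum.cong) (use fin in \<open>auto simp: pdiv_def\<close>)
  also have "\<dots> = - 2 + (\<Sum>v\<in>fibre c. v (x - emb c))" using fibre_bound(1) nin wx by simp
  also have "\<dots> \<le> 0" using fibre_bound(2)[of c] by simp
  finally show ?thesis using D by simp
qed

lemma pdiv_poly:
  "P \<noteq> 0 \<Longrightarrow> pdiv (ev P x) \<in> Div \<and> divisor_degree (pdiv (ev P x)) \<le> 0"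
proof (induction "degree P" arbitrary: P)
  case 0
  then obtain c where "P = [:c:]" by (metis degree_eq_zeroE)
  hence "pdiv (ev P x) = (\<lambda>v. 0)" by (auto simp: pdiv_def)
  thus ?case by simp
next
  case (Suc n)
  then obtain c where "poly P c = 0" using alg_closed_imp_poly_has_root[of P] by auto
  then obtain Q where Q: "P = [:- c, 1:] * Q" by (metis dvdE poly_eq_0_iff_dvd)
  have Q0: "Q \<noteq> 0" using Suc(3) Q by auto
  hence "degree P = Suc (degree Q)" unfolding Q by (subst degree_mult_eq) auto
  hence IH: "pdiv (ev Q x) \<in> Div" "divisor_degree (pdiv (ev Q x)) \<le> 0" using Suc Q0 by auto
  have "ev P x = (x - emb c) * ev Q x" unfolding Q ev_mult by (simp add: emb_minus)
  hence "pdiv (ev P x) = (\<lambda>v. pdiv (x - emb c) v + pdiv (ev Q x) v)"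
    using Q0 x_minus_nz by (auto simp: pdiv_def v_mult F_intros xF)
  thus ?case using Div_add[OF _ IH(1), of "pdiv (x - emb c)"] pdiv_linear[of c] IH(2) by simp
qed

definition Einf :: "nat \<Rightarrow> ('a \<Rightarrow> int) \<Rightarrow> int" where
  "Einf M = (\<lambda>v. int (2 * M) * pt winf v)"

lemma Einf: "Einf M \<in> Div" "divisor_degree (Einf M) = int (2 * M)"
  unfolding Einf_def using Div_scale[OF Div_pt(1)[OF winf(1)], of "int (2 * M)"] Div_pt(2)[OF winf(1)] by simp_all

abbreviation "qconj \<equiv> quad_conj (ratf x) y"

lemma conj_facts:
  shows "z \<in> F \<Longrightarrow> qconj z \<in> F" "z \<in> F \<Longrightarrow> qconj (qconj z) = z"
    "w \<in> F \<Longrightarrow> z \<in> F \<Longrightarrow> qconj (w + z) = qconj w + qconj z"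
    "w \<in> F \<Longrightarrow> z \<in> F \<Longrightarrow> qconj (w * z) = qconj w * qconj z"
    "a \<in> ratf x \<Longrightarrow> qconj a = a" "qconj y = - y"
proof -
  have yy: "y * y \<in> ratf x" unfolding eqn by (rule ev_in_ratf)
  note c = quad_conj_closed[OF ratf_field y_notin, folded gen]
  note h = quad_conj_hom[OF ratf_field y_notin yy, folded gen]
  show "z \<in> F \<Longrightarrow> qconj z \<in> F" "z \<in> F \<Longrightarrow> qconj (qconj z) = z" by (fact c)+
  show "w \<in> F \<Longrightarrow> z \<in> F \<Longrightarrow> qconj (w + z) = qconj w + qconj z"
    "w \<in> F \<Longrightarrow> z \<in> F \<Longrightarrow> qconj (w * z) = qconj w * qconj z" by (fact h)+
  show "a \<in> ratf x \<Longrightarrow> qconj a = a" by (rule quad_conj_fixed[OF ratf_field y_notin])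
  show "qconj y = - y"
    using quad_conj_eq[OF ratf_field y_notin fc_0[OF ratf_field] fc_1[OF ratf_field]] by simp
qed

text \<open>Squarefreeness of \<open>f\<close> makes \<open>k[x, y]\<close> integrally closed. With
  a denominator of least degree and a root \<open>c\<close> of it, integrality of trace and
  norm-like parts at a place over \<open>c\<close> contradicts minimality.\<close>

lemma integral_imp_polynomial:
  assumes z: "z \<in> F" and int: "\<And>v. v \<in> PL \<Longrightarrow> 0 \<le> v x \<Longrightarrow> vge v 0 z"
  shows "\<exists>p q. z = lin p q"
proof -
  define R where "R n \<longleftrightarrow> (\<exists>p q d. d \<noteq> 0 \<and> degree d = n \<and> z = lin p q / ev d x)" for n
  have "\<exists>n. R n" using F_rep[OF z] unfolding R_def by metis
  hence "R (LEAST n. R n)" by (rule LeastI_ex)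
  then obtain p q d where r: "d \<noteq> 0" "degree d = (LEAST n. R n)" "z = lin p q / ev d x"
    unfolding R_def by blast
  have "degree d = 0"
  proof (rule ccontr)
    assume "degree d \<noteq> 0"
    then obtain c where dc: "poly d c = 0" using alg_closed_imp_poly_has_root[of d] by auto
    have nall: "\<not> (poly p c = 0 \<and> poly q c = 0)"
    proof
      assume "poly p c = 0 \<and> poly q c = 0"
      then obtain p' q' d' where f: "p = [:- c, 1:] * p'" "q = [:- c, 1:] * q'" "d = [:- c, 1:] * d'"
        using dc by (meson dvdE poly_eq_0_iff_dvd)
      have "d' \<noteq> 0" using r(1) f(3) by auto
      hence "degree d = Suc (degree d')" unfolding f(3) by (subst degree_mult_eq) auto
      moreover have "z = lin p' q' / ev d' x"
      proof -
        have "lin p q = (x - emb c) * lin p' q'" "ev d x = (x - emb c) * ev d' x"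
          unfolding f ev_mult by (simp_all add: emb_minus algebra_simps)
        thus ?thesis using r(3) x_minus_nz[of c] by simp
      qed
      hence "R (degree d')" unfolding R_def using \<open>d' \<noteq> 0\<close> by blast
      hence "(LEAST n. R n) \<le> degree d'" by (rule Least_le)
      ultimately show False using r(2) by simp
    qed
    have "x - emb c \<notin> range emb"
    proof
      assume "x - emb c \<in> range emb"
      then obtain e where "x = emb (c + e)" by (auto simp: emb_add algebra_simps)
      thus False using x_nonconst by blast
    qed
    then obtain v where v: "v \<in> PL" "v (x - emb c) > 0" using zero_ex[OF F_diff[OF xF emb_in_F]] by blast
    have vx: "vge v 1 (x - emb c)" using v by (simp add: vge_def)
    have "vge v 0 ((x - emb c) + emb c)" 
      using v(2) by (intro vge_add[OF v(1)] F_intros xF vge_emb[OF v(1)]) (auto simp: vge_def)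
    hence v0: "0 \<le> v x" using x_nonconst by (auto simp: vge_def)
    \<comment> \<open>The conjugate place also has \<open>x\<close> finite, so \<open>z\<close> and
      its conjugate are both integral at \<open>v\<close>; hence so are \<open>a\<close> and
      \<open>b y\<close>.\<close>
    define v' where "v' = (\<lambda>z. if z \<in> F then v (qconj z) else 0)"
    have v': "v' \<in> PL" unfolding v'_def
    proof (rule place_comp[OF v(1)])
      show "\<exists>y\<in>F. qconj y = z" if "z \<in> F" for z using conj_facts(1,2)[OF that] by blast
      show "qconj (emb c) = emb c" for c using range_emb_subset_ratf by (intro conj_facts(5)) blast
    qed (fact conj_facts)+
    have "v' x = v x" by (simp add: v'_def xF conj_facts(5) gen_in_ratf)
    hence "vge v' 0 z" using int[OF v'] v0 by simp
    hence vc: "vge v 0 (qconj z)"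
    proof -
      have "qconj z \<noteq> 0 \<Longrightarrow> z \<noteq> 0" using conj_facts(5)[OF fc_0[OF ratf_field]] by auto
      thus ?thesis using \<open>vge v' 0 z\<close> z by (auto simp: vge_def v'_def)
    qed
    have vz: "vge v 0 z" by (rule int[OF v(1) v0])
    define a where "a = ev p x / ev d x"
    define b where "b = ev q x / ev d x"
    have ab: "a \<in> ratf x" "b \<in> ratf x" unfolding a_def b_def using r(1) by (auto intro: ratfI)
    have abF: "a \<in> F" "b \<in> F" using ab ratf_F by auto
    have zab: "z = a + b * y" unfolding r(3) a_def b_def by (simp add: add_divide_distrib)
    have czab: "qconj z = a - b * y" unfolding zab by (rule quad_conj_eq[OF ratf_field y_notin ab])
    have "vge v 0 (z + qconj z)" by (rule vge_add[OF v(1) z conj_facts(1)[OF z] vz vc])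
    hence "vge v 0 (emb (1/2) * (z + qconj z))"
      by (intro vge_scale[OF v(1)] F_add z conj_facts(1))
    moreover have "emb (1/2) * (z + qconj z) = a" unfolding czab unfolding zab by (simp add: emb_hom)
    ultimately have va: "vge v 0 a" by simp
    have "vge v 0 (z - a)" by (rule vge_diff[OF v(1) z abF(1) vz va])
    hence "vge v (0 + 0) ((b * y) * (b * y))"
      by (intro vge_mult[OF v(1)] F_mult abF yF) (simp_all add: zab)
    hence vb: "vge v 0 (b * b * ev f x)" unfolding eqn[symmetric] by (simp add: ac_simps)
    have nzx: "x \<noteq> emb c" using x_nonconst by auto
    note ord = v_ev_order[OF v(1) xF vx nzx]
    have od: "Polynomial.order c d \<ge> 1" using dc r(1) order_root[of d c] by (simp add: Suc_leI)
    have pc: "poly p c = 0"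
    proof (rule ccontr)
      assume "poly p c \<noteq> 0"
      hence u: "ev p x \<noteq> 0" "v (ev p x) = 0" using ev_unit[OF v(1) xF vx] by auto
      hence "v a = - (int (Polynomial.order c d) * v (x - emb c))"
        unfolding a_def using ord[OF r(1)] r(1) by (simp add: v_divide[OF v(1)] F_ev xF)
      moreover have "int (Polynomial.order c d) * v (x - emb c) > 0" using od v(2) by simp
      moreover have "a \<noteq> 0" using u r(1) by (auto simp: a_def)
      ultimately show False using va by (simp add: vge_def)
    qed
    hence qc: "poly q c \<noteq> 0" using nall by blast
    hence u: "ev q x \<noteq> 0" "v (ev q x) = 0" using ev_unit[OF v(1) xF vx] by auto
    hence b0: "b \<noteq> 0" using r(1) by (auto simp: b_def)
    have "v b = - (int (Polynomial.order c d) * v (x - emb c))"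
      unfolding b_def using ord[OF r(1)] r(1) u by (simp add: v_divide[OF v(1)] F_ev xF)
    \<comment> \<open>The root \<open>c\<close> of the denominator contributes at least two negative
      orders to \<open>b^2 f\<close>, and squarefree \<open>f\<close> can repay at most one.\<close>
    hence "v (b * b * ev f x) = - 2 * (int (Polynomial.order c d) * v (x - emb c)) + int (Polynomial.order c f) * v (x - emb c)"
      using b0 ord[OF f_nz] by (simp add: v_mult[OF v(1)] F_intros abF xF)
    moreover have "int (Polynomial.order c f) * v (x - emb c) \<le> 1 * v (x - emb c)"
    proof (rule mult_right_mono)
      show "int (Polynomial.order c f) \<le> 1"
        using order_f[of c] order_root[of f c] f_nz by (cases "poly f c = 0") auto
    qed (use v(2) in simp)
    moreover have "1 * v (x - emb c) \<le> int (Polynomial.order c d) * v (x - emb c)"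
      using od v(2) by (intro mult_right_mono) auto
    ultimately have "v (b * b * ev f x) < 0" using v(2) by linarith
    moreover have "b * b * ev f x \<noteq> 0" using b0 f_nz by simp
    ultimately show False using vb by (simp add: vge_def)
  qed
  then obtain k where k: "d = [:k:]" by (metis degree_eq_zeroE)
  have "z = lin (Polynomial.smult (inverse k) p) (Polynomial.smult (inverse k) q)"
    unfolding r(3) k by (simp add: ev_smult emb_hom divide_inverse algebra_simps)
  thus ?thesis by blast
qed

text \<open>The basis is \<open>x^i\<close> for \<open>i \<le> M\<close> and \<open>x^j y\<close>
  for \<open>j < M - \<gamma>\<close>: a pole order \<open>2 j + 2 \<gamma> + 1 \<le> 2 M\<close>
  means exactly \<open>j < M - \<gamma>\<close>.\<close>

lemma LL_Einf:
  "fin_dim (LL (Einf M))" "\<gamma> \<le> M \<Longrightarrow> int (VS.dim (LL (Einf M))) = int (2 * M) + 1 - int \<gamma>"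
proof -
  let ?I = "{..M} <+> {..<M - \<gamma>}"
  define w where "w t = (case t of Inl i \<Rightarrow> x ^ i | Inr j \<Rightarrow> x ^ j * y)" for t :: "nat + nat"
  have sub: "LL (Einf M) \<subseteq> VS.span (w ` ?I)"
  proof
    fix z assume z: "z \<in> LL (Einf M)"
    have zF: "z \<in> F" using z LL_F by blast
    have "vge v 0 z" if v: "v \<in> PL" "0 \<le> v x" for v
    proof -
      have "v \<noteq> winf" using winf(2) v(2) by auto
      thus ?thesis using LL_vge[OF z v(1)] by (simp add: Einf_def pt_def)
    qed
    then obtain p q where pq: "z = lin p q" using integral_imp_polynomial[OF zF] by blast
    have dp: "degree p \<le> M" and dq: "q \<noteq> 0 \<Longrightarrow> degree q < M - \<gamma>"
    proof -
      have *: "degree p \<le> M \<and> (q \<noteq> 0 \<longrightarrow> degree q < M - \<gamma>)" if nz: "p \<noteq> 0 \<or> q \<noteq> 0"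
      proof -
        have "z \<noteq> 0" unfolding pq lin_eq_0 using nz by simp
        hence "- int (2 * M) \<le> winf z" using LL_vge[OF z winf(1)] by (simp add: Einf_def pt_def vge_def)
        moreover have "2 * winf z = (- 2) * int (max (if p = 0 then 0 else 2 * degree p) (if q = 0 then 0 else 2 * (degree q + \<gamma>) + 1))"
          unfolding pq using infinite_value[OF winf(1) _ nz] winf(2) by simp
        ultimately have "max (if p = 0 then 0 else 2 * degree p) (if q = 0 then 0 else 2 * (degree q + \<gamma>) + 1) \<le> 2 * M" by linarith
        thus ?thesis by (auto split: if_splits)
      qed
      show "degree p \<le> M" using * by (cases "p = 0") auto
      show "q \<noteq> 0 \<Longrightarrow> degree q < M - \<gamma>" using * by blast
    qed
    have 1: "emb a * x ^ i \<in> VS.span (w ` ?I)" if "i \<le> M" for a i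
      using that by (intro VS.span_scale VS.span_base image_eqI[of _ _ "Inl i"]) (auto simp: w_def)
    have 2: "emb a * (x ^ i * y) \<in> VS.span (w ` ?I)" if "i < M - \<gamma>" for a i
      using that by (intro VS.span_scale VS.span_base image_eqI[of _ _ "Inr i"]) (auto simp: w_def)
    have "ev p x \<in> VS.span (w ` ?I)"
      unfolding ev_altdef by (rule VS.span_sum, rule 1) (use dp in auto)
    moreover have "ev q x * y \<in> VS.span (w ` ?I)"
    proof (cases "q = 0")
      case False
      show ?thesis unfolding ev_altdef sum_distrib_right mult.assoc
        by (rule VS.span_sum, rule 2) (use dq[OF False] in auto)
    qed (simp add: VS.span_zero)
    ultimately show "z \<in> VS.span (w ` ?I)" unfolding pq by (rule VS.span_add)
  qed
  show fd: "fin_dim (LL (Einf M))" by (rule fin_dimI[OF _ sub]) simp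
  assume M: "\<gamma> \<le> M"
  have cI: "card ?I = M + 1 + (M - \<gamma>)" by (simp add: card_Plus)
  have "VS.dim (LL (Einf M)) \<le> card (w ` ?I)" by (rule VS.dim_le_card[OF sub]) simp
  also have "\<dots> \<le> card ?I" by (rule card_image_le) simp
  finally have le: "VS.dim (LL (Einf M)) \<le> M + 1 + (M - \<gamma>)" using cI by simp
  have "card ?I \<le> VS.dim (LL (Einf M))"
  proof (rule card_le_dim_if_independent_family[OF fd, of _ w])
    show "w ` ?I \<subseteq> LL (Einf M)"
    proof (rule image_subsetI)
      fix t assume t: "t \<in> ?I"
      obtain p q where pq: "w t = lin p q" "p \<noteq> 0 \<or> q \<noteq> 0"
        "max (if p = 0 then 0 else 2 * degree p) (if q = 0 then 0 else 2 * (degree q + \<gamma>) + 1) \<le> 2 * M"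
      proof (cases t)
        case (Inl i)
        show ?thesis by (rule that[of "Polynomial.monom 1 i" 0]) (use t Inl in \<open>auto simp: w_def ev_monom degree_monom_eq\<close>)
      next
        case (Inr j)
        show ?thesis by (rule that[of 0 "Polynomial.monom 1 j"]) (use t Inr in \<open>auto simp: w_def ev_monom degree_monom_eq\<close>)
      qed
      show "w t \<in> LL (Einf M)"
      proof (rule LL_I)
        show "w t \<in> F" unfolding pq(1) by (rule lin_F)
        fix v assume v: "v \<in> PL"
        show "vge v (- Einf M v) (w t)"
        proof (cases "v x < 0")
          case True
          hence vw: "v = winf" using winf_unique v by blast
          have "2 * winf (w t) = - 2 * int (max (if p = 0 then 0 else 2 * degree p) (if q = 0 then 0 else 2 * (degree q + \<gamma>) + 1))"
            unfolding pq(1) using infinite_value[OF winf(1) _ pq(2)] winf(2) by simp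
          hence "- int (2 * M) \<le> winf (w t)" using pq(3) by linarith
          thus ?thesis by (simp add: vw Einf_def pt_def vge_def)
        next
          case False
          hence ne: "v \<noteq> winf" using winf by auto
          have vx: "vge v 0 x" using False by (simp add: vge_def)
          have "vge v 0 (y * y)" unfolding eqn by (rule vge_ev[OF v xF vx])
          hence vy: "vge v 0 y" using y_nz v_mult[OF v yF yF] by (simp add: vge_def)
          have "vge v (0 + 0) (ev q x * y)" by (intro vge_mult[OF v] vge_ev[OF v] xF vx vy F_intros yF)
          hence "vge v 0 (w t)" unfolding pq(1) by (intro vge_add[OF v] vge_ev[OF v] xF vx F_intros yF) simp
          thus ?thesis using ne by (simp add: Einf_def pt_def)
        qed
      qed
    qed
    fix c t assume c: "(\<Sum>t\<in>?I. emb (c t) * w t) = 0" and t: "t \<in> ?I"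
    define p where "p = (\<Sum>i\<le>M. Polynomial.monom (c (Inl i)) i)"
    define q where "q = (\<Sum>j<M - \<gamma>. Polynomial.monom (c (Inr j)) j)"
    have "(\<Sum>t\<in>?I. emb (c t) * w t) = lin p q"
      by (simp add: sum.Plus p_def q_def ev_sum ev_monom w_def sum_distrib_right mult.assoc)
    hence "p = 0" "q = 0" using c lin_eq_0 by simp_all
    hence "poly.coeff p i = 0" "poly.coeff q i = 0" for i by simp_all
    moreover have "poly.coeff p i = c (Inl i)" if "i \<le> M" for i using that by (simp add: p_def coeff_sum)
    moreover have "poly.coeff q i = c (Inr i)" if "i < M - \<gamma>" for i using that by (simp add: q_def coeff_sum)
    ultimately show "c t = 0" using t by auto
  qed simp
  thus "int (VS.dim (LL (Einf M))) = int (2 * M) + 1 - int \<gamma>" using le cI M by linarith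
qed

text \<open>Subtracting the divisor of a polynomial in \<open>x\<close> with enough zeros moves any
  \<open>D\<close> below a multiple of the place at infinity without lowering its degree or changing
  its dimension; there the dimension is known.\<close>

theorem has_genus_quadratic: "has_genus emb F \<gamma>"
  unfolding has_genus_def ell_eq
proof (intro conjI ballI)
  fix D assume D: "D \<in> Div"
  define S where "S = {v. D v \<noteq> 0 \<and> 0 \<le> v x}"
  have S: "finite S" "S \<subseteq> PL" using D finite_subset[of S "{v. D v \<noteq> 0}"] by (auto simp: S_def Div_iff)
  have "\<exists>P. P \<noteq> 0 \<and> (\<forall>v\<in>T. D v \<le> v (ev P x))" if "finite T" "T \<subseteq> S" for T
    using that
  proof (induction T rule: finite_induct)
    case empty
    show ?case by (rule exI[of _ 1]) simp
  next
    case (insert v T)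
    then obtain P where P: "P \<noteq> 0" "\<forall>v\<in>T. D v \<le> v (ev P x)" by auto
    have v: "v \<in> PL" "0 \<le> v x" using insert S by (auto simp: S_def)
    obtain c where c: "vge v 1 (x - emb c)" using finite_centre[OF v] by (auto simp: centred_def)
    let ?r = "[:- c, 1:] ^ nat \<bar>D v\<bar>"
    have r: "ev ?r x = (x - emb c) ^ nat \<bar>D v\<bar>" by (simp add: ev_power emb_minus)
    have mult: "u (ev (P * ?r) x) = u (ev P x) + u (ev ?r x)" if "u \<in> PL" for u
      unfolding ev_mult using P(1) by (intro v_mult[OF that] F_ev xF) auto
    have pos: "0 \<le> u (ev Q x)" if "u \<in> PL" "0 \<le> u x" "Q \<noteq> 0" for u Q
      using vge_ev[OF that(1) xF, of Q] that by (simp add: vge_def)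
    show ?case
    proof (intro exI[of _ "P * ?r"] conjI ballI)
      show "P * ?r \<noteq> 0" using P(1) by simp
      fix u assume u: "u \<in> insert v T"
      have uP: "u \<in> PL" "0 \<le> u x" using u insert S by (auto simp: S_def)
      show "D u \<le> u (ev (P * ?r) x)"
      proof (cases "u = v")
        case True
        have "vge v (int (nat \<bar>D v\<bar>) * 1) (ev ?r x)"
          unfolding r by (intro vge_power[OF v(1)] c F_intros xF)
        hence "\<bar>D v\<bar> \<le> v (ev ?r x)" by (simp add: vge_def)
        thus ?thesis using mult[OF v(1)] pos[OF v P(1)] True by simp
      next
        case False
        have "0 \<le> u (ev ?r x)" by (rule pos[OF uP]) simp
        thus ?thesis using mult[OF uP(1)] P(2) u False by fastforce
      qed
    qed
  qed
  from this[OF S(1) order.refl] obtain P where P: "P \<noteq> 0" "\<forall>v\<in>S. D v \<le> v (ev P x)" by blast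
  let ?a = "ev P x"
  have a: "?a \<in> F" "?a \<noteq> 0" using P(1) by (auto intro: F_ev xF)
  note pp = pdiv_poly[OF P(1)]
  define D' where "D' = (\<lambda>v. D v - pdiv ?a v)"
  have D': "D' \<in> Div" "divisor_degree D' \<ge> divisor_degree D"
    unfolding D'_def using Div_diff[OF D conjunct1[OF pp]] pp by auto
  \<comment> \<open>At least \<open>\<gamma>\<close>, for the exact dimension of
    \<open>L(Einf M)\<close>, and large enough to dominate \<open>D'\<close> at infinity.\<close>
  define M where "M = \<gamma> + nat \<bar>D' winf\<bar>"
  have le: "D' v \<le> Einf M v" for v
  proof (cases "v = winf")
    case True
    thus ?thesis by (simp add: Einf_def pt_def M_def)
  next
    case False
    have "D' v \<le> 0"
    proof (cases "v \<in> PL")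
      case True
      hence vx: "0 \<le> v x" using winf_unique False by force
      have "0 \<le> v ?a" using vge_ev[OF True xF, of P] vx P(1) by (simp add: vge_def)
      thus ?thesis using P(2) vx True by (cases "D v = 0") (auto simp: D'_def pdiv_def S_def)
    next
      case False
      thus ?thesis using Div_outside[OF D'(1)] by simp
    qed
    thus ?thesis using False by (simp add: Einf_def pt_def)
  qed
  have fd: "fin_dim (LL D')" by (rule fin_dim_subset[OF LL_Einf(1)[of M] LL_mono]) (rule le)
  have "int (VS.dim (LL (Einf M))) \<le> int (VS.dim (LL D')) + divisor_degree (Einf M) - divisor_degree D'"
    using LL_mono_dim[OF D'(1) Einf(1) le fd] by blast
  hence ge: "divisor_degree D' + 1 - int \<gamma> \<le> int (VS.dim (LL D'))"
    using LL_Einf(2)[of M] Einf(2)[of M] by (simp add: M_def)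
  have img: "(*) (inverse ?a) ` LL D' = LL D"
  proof -
    have "LL D' = (*) ?a ` LL D" unfolding D'_def by (rule mult_LL[OF a, symmetric])
    thus ?thesis using a(2) by (auto simp: image_image mult.assoc[symmetric])
  qed
  have "VS.dim (LL D) = VS.dim (LL D')"
    using dim_mult_image[OF fd, of "inverse ?a"] a(2) unfolding img by simp
  thus "divisor_degree D - int (VS.dim (LL D)) + 1 \<le> int \<gamma>" using ge D'(2) by simp
next
  show "\<exists>D\<in>Div. divisor_degree D - int (VS.dim (LL D)) + 1 = int \<gamma>"
    using Einf[of \<gamma>] LL_Einf(2)[of \<gamma>] by (intro bexI[of _ "Einf \<gamma>"]) simp_all
qed

end

subsection \<open>Automorphisms\<close>

context constants
begin

lemma Aut_iff:
  "\<sigma> \<in> carrier (Aut_group emb) \<longleftrightarrow>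
     (\<forall>x y. \<sigma> (x + y) = \<sigma> x + \<sigma> y) \<and> (\<forall>x y. \<sigma> (x * y) = \<sigma> x * \<sigma> y) \<and> bij \<sigma> \<and> (\<forall>c. \<sigma> (emb c) = emb c)"
  (is "?l \<longleftrightarrow> ?r")
proof
  assume ?l
  thus ?r by (auto simp: Aut_group_def ring_iso_def ring_hom_def)
next
  assume r: ?r
  have "\<sigma> 1 = 1" using r emb_1 by metis
  thus ?l using r by (auto simp: Aut_group_def ring_iso_def ring_hom_def)
qed

end

locale automorphism = constants emb
  for emb :: "'k::{alg_closed_field,field_char_0} \<Rightarrow> 'a::field_char_0" +
  fixes \<sigma> :: "'a \<Rightarrow> 'a"
  assumes aut: "\<sigma> \<in> carrier (Aut_group emb)"
begin

lemma add: "\<sigma> (x + y) = \<sigma> x + \<sigma> y" and mult: "\<sigma> (x * y) = \<sigma> x * \<sigma> y"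
  and const [simp]: "\<sigma> (emb c) = emb c" and bij: "bij \<sigma>"
  using aut by (auto simp: Aut_iff)

lemma zero [simp]: "\<sigma> 0 = 0" and one [simp]: "\<sigma> 1 = 1"
  using const[of 0] const[of 1] by simp_all

lemma eq_iff [simp]: "\<sigma> x = \<sigma> y \<longleftrightarrow> x = y"
  using bij by (auto simp: bij_def inj_eq)

lemma eq_0 [simp]: "\<sigma> x = 0 \<longleftrightarrow> x = 0"
  using eq_iff[of x 0] by simp

lemma minus: "\<sigma> (- x) = - \<sigma> x"
  using add[of x "- x"] by (simp add: eq_neg_iff_add_eq_0 add.commute)

lemma diff: "\<sigma> (x - y) = \<sigma> x - \<sigma> y"
  using add[of x "- y"] by (simp add: minus)

lemma inverse: "\<sigma> (inverse x) = inverse (\<sigma> x)"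
proof (cases "x = 0")
  case False
  hence "\<sigma> x * \<sigma> (inverse x) = 1" by (simp flip: mult)
  thus ?thesis by (metis inverse_unique)
qed simp

lemma divide: "\<sigma> (x / y) = \<sigma> x / \<sigma> y"
  by (simp add: divide_inverse mult inverse)

lemma power: "\<sigma> (x ^ n) = \<sigma> x ^ n"
  by (induction n) (auto simp: mult)

lemma ev: "\<sigma> (ev p x) = ev p (\<sigma> x)"
  by (induction p) (auto simp: add mult)

lemmas hom = add mult minus diff inverse divide power ev

lemma ratf_fixed: "\<sigma> x = x \<Longrightarrow> z \<in> ratf x \<Longrightarrow> \<sigma> z = z"
  by (auto simp: ratf_def divide ev)

lemma nonconst: "x \<notin> range emb \<Longrightarrow> \<sigma> x \<notin> range emb"
  using const by (metis eq_iff rangeE rangeI)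

lemma dim_image_le:
  assumes "fin_dim V"
  shows "VS.dim (\<sigma> ` V) \<le> VS.dim V"
proof -
  obtain B where B: "finite B" "B \<subseteq> V" "V \<subseteq> VS.span B" "card B = VS.dim V"
    using fin_dim_basis[OF assms] by metis
  let ?T = "{x. \<sigma> x \<in> VS.span (\<sigma> ` B)}"
  have "VS.subspace ?T"
    by (rule VS.subspaceI) (auto simp: add mult VS.span_zero intro: VS.span_add VS.span_scale)
  hence "VS.span B \<subseteq> ?T" by (intro VS.span_minimal) (auto intro: VS.span_base)
  hence sub: "\<sigma> ` V \<subseteq> VS.span (\<sigma> ` B)" using B(3) by auto
  have "VS.dim (\<sigma> ` V) \<le> card (\<sigma> ` B)" using VS.dim_le_card[OF sub] B(1) by simp
  also have "\<dots> \<le> card B" by (rule card_image_le[OF B(1)])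
  finally show ?thesis using B(4) by simp
qed

lemma dim_image:
  assumes "fin_dim V" 
  shows "VS.dim (\<sigma> ` V) = VS.dim V" 
proof -
  obtain B where B: "finite B" "B \<subseteq> V" "VS.independent B" "V \<subseteq> VS.span B" "card B = VS.dim V"
    using fin_dim_basis[OF assms] by metis
  have fd: "fin_dim (\<sigma> ` V)"
  proof -
    let ?T = "{x. \<sigma> x \<in> VS.span (\<sigma> ` B)}"
    have "VS.subspace ?T"
      by (rule VS.subspaceI) (auto simp: add mult VS.span_zero intro: VS.span_add VS.span_scale)
    hence "VS.span B \<subseteq> ?T" by (intro VS.span_minimal) (auto intro: VS.span_base)
    thus ?thesis by (intro fin_dimI[of "\<sigma> ` B"]) (use B in auto)
  qed
  have "card B \<le> VS.dim (\<sigma> ` V)"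
  proof (rule card_le_dim_if_independent_family[OF fd B(1), of \<sigma>])
    fix c b assume 0: "(\<Sum>i\<in>B. emb (c i) * \<sigma> i) = 0" and b: "b \<in> B"
    have "\<sigma> (\<Sum>i\<in>A. emb (c i) * i) = (\<Sum>i\<in>A. emb (c i) * \<sigma> i)" for A
      by (induction A rule: infinite_finite_induct) (auto simp: add mult)
    hence "\<sigma> (\<Sum>i\<in>B. emb (c i) * i) = 0" using 0 by simp
    hence "(\<Sum>i\<in>B. emb (c i) * i) = 0" by (simp only: eq_0)
    thus "c b = 0" by (rule VS.independentD[OF B(3,1) order.refl _ b])
  qed (use B in auto)
  thus ?thesis using dim_image_le[OF assms] B(5) by simp
qed

end

locale curve_automorphism = genus_field emb UNIV g + automorphism emb \<sigma>
  for emb :: "'k::{alg_closed_field,field_char_0} \<Rightarrow> 'a::field_char_0" and g \<sigma>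
begin

lemma place: "v \<in> PL \<Longrightarrow> v \<circ> \<sigma> \<in> PL"
proof -
  assume v: "v \<in> PL"
  have "(\<lambda>z. if z \<in> UNIV then v (\<sigma> z) else 0) \<in> PL"
    by (rule place_comp[OF v]) (use bij in \<open>auto simp: hom bij_def surj_def\<close>, metis)
  thus ?thesis by (simp add: comp_def)
qed

lemma image_LL: "f \<in> LL D \<Longrightarrow> \<sigma> f \<in> LL (\<lambda>v. D (v \<circ> \<sigma>))"
proof (rule LL_I)
  fix v assume f: "f \<in> LL D" and v: "v \<in> PL"
  show "vge v (- D (v \<circ> \<sigma>)) (\<sigma> f)" using LL_vge[OF f place[OF v]] by (auto simp: vge_def)
qed simp

end

subsection \<open>An involution and its invariants in Riemann-Roch spaces\<close>

locale curve_involution = curve_automorphism emb g h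
  for emb :: "'k::{alg_closed_field,field_char_0} \<Rightarrow> 'a::field_char_0" and g h +
  assumes invol: "h \<circ> h = id" and nontrivial: "h \<noteq> id"
begin

lemma hh [simp]: "h (h x) = x"
  using invol by (metis comp_apply id_apply)

lemma vhh [simp]: "v \<circ> h \<circ> h = v"
  using invol by (simp add: comp_assoc)

lemma vh_eq: "v \<circ> h = w \<longleftrightarrow> v = w \<circ> h"
  using vhh by metis

lemma vh_place: "v \<circ> h \<in> PL \<longleftrightarrow> v \<in> PL"
  using place vhh by metis

lemma ex_anti: "\<exists>u. u \<noteq> 0 \<and> h u = - u"
proof -
  obtain z where "h z \<noteq> z" using nontrivial by (metis eq_id_iff)
  thus ?thesis by (intro exI[of _ "z - h z"]) (auto simp: diff)
qed

context
  fixes R assumes R: "R \<in> PL" "R \<circ> h = R"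
begin

lemma fixed_vge: "vge R n (h z) \<longleftrightarrow> vge R n z"
  using R(2) by (auto simp: vge_def comp_def fun_eq_iff)

text \<open>\<open>h\<close> acts trivially on the residue field at a fixed place, so the residue
  \<open>c\<close> of a unit \<open>w\<close> would satisfy \<open>c = - c\<close>.\<close>

lemma anti_not_unit:
  assumes "h w = - w" "w \<noteq> 0"
  shows "R w \<noteq> 0"
proof
  assume 0: "R w = 0"
  then obtain c where c: "vge R 1 (w - emb c)" using residue[OF R(1), of w] by (auto simp: vge_def)
  hence "vge R 1 (h (w - emb c))" by (simp only: fixed_vge)
  hence "vge R 1 (- w - emb c)" by (simp add: diff assms)
  hence "vge R 1 ((w - emb c) + (- w - emb c))" by (rule vge_add[OF R(1) UNIV_I UNIV_I c])
  moreover have "(w - emb c) + (- w - emb c) = - emb (c + c)" unfolding emb_add by simp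
  ultimately have "vge R 1 (- emb (c + c))" by (simp only:)
  hence "- emb (c + c) = 0" unfolding vge_def using R(1) by (simp add: v_minus)
  hence "emb (c + c) = 0" by simp
  hence "c + c = 0" by (simp only: emb_eq_0)
  hence "c = 0" by simp
  thus False using c 0 assms(2) by (simp add: vge_def)
qed

text \<open>A uniformizer is half the sum of an invariant and an anti-invariant part. Were only the
  invariant part a uniformizer, it would scale an anti-invariant element to an anti-invariant
  unit.\<close>

lemma anti_uniformizer: "\<exists>b. h b = - b \<and> b \<noteq> 0 \<and> R b = 1"
proof -
  obtain t where t: "t \<noteq> 0" "R t = 1" using uniformizer[OF R(1)] by blast
  let ?a = "t + h t" and ?b = "t - h t"
  have hb: "h ?b = - ?b" and ha: "h ?a = ?a" by (simp_all add: hom)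
  have "vge R 1 t" using t by (simp add: vge_def)
  hence vt: "vge R 1 t" "vge R 1 (h t)" by (simp_all only: fixed_vge)
  have ab1: "vge R 1 ?a" "vge R 1 ?b" using vt by (auto intro: vge_add[OF R(1)] vge_diff[OF R(1)])
  show ?thesis
  proof (cases "vge R 2 ?b")
    case False
    hence "R ?b = 1" "?b \<noteq> 0" using ab1(2) by (auto simp: vge_def)
    thus ?thesis using hb by blast
  next
    case True
    have "\<not> vge R 2 ?a"
    proof
      assume "vge R 2 ?a"
      hence "vge R 2 (?a + ?b)" by (rule vge_add[OF R(1) UNIV_I UNIV_I _ True])
      hence "vge R 2 (emb (1/2) * (?a + ?b))" by (intro vge_scale[OF R(1)]) auto
      moreover have "emb (1/2) * (?a + ?b) = t" by (simp add: emb_hom)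
      ultimately have "vge R 2 t" by (simp only:)
      thus False using t by (simp add: vge_def)
    qed
    hence a: "R ?a = 1" "?a \<noteq> 0" using ab1(1) by (auto simp: vge_def)
    obtain u where u: "u \<noteq> 0" "h u = - u" using ex_anti by blast
    \<comment> \<open>The power of \<open>?a\<close> with exponent \<open>- R u\<close>, split into
      two natural exponents of which at most one is nonzero.\<close>
    let ?w = "u * ?a ^ nat (- R u) * inverse (?a ^ nat (R u))"
    have "R ?w = 0" using u a by (simp add: v_mult[OF R(1)] v_inverse[OF R(1)] v_power[OF R(1)])
    moreover have "h ?w = - ?w" using u(2) ha by (simp only: mult inverse power) simp
    ultimately show ?thesis using anti_not_unit[of ?w] u a by simp
  qed
qed

text \<open>Dividing by the matching power of an anti-invariant uniformizer would turn an element of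
  the wrong parity into an anti-invariant unit.\<close>

lemma fixed_parity:
  assumes "u \<noteq> 0"
  shows "h u = u \<Longrightarrow> even (R u)" "h u = - u \<Longrightarrow> odd (R u)"
proof -
  obtain b where b: "h b = - b" "b \<noteq> 0" "R b = 1" using anti_uniformizer by blast
  let ?w = "u * b ^ nat (- R u) * inverse (b ^ nat (R u))"
  have w0: "?w \<noteq> 0" "R ?w = 0"
    using assms b by (simp_all add: v_mult[OF R(1)] v_inverse[OF R(1)] v_power[OF R(1)])
  hence key: "h ?w \<noteq> - ?w" using anti_not_unit by blast
  have hw: "h ?w = h u * (- b) ^ nat (- R u) * inverse ((- b) ^ nat (R u))"
    by (simp only: mult inverse power b)
  show "even (R u)" if "h u = u"
  proof (rule ccontr)
    assume "odd (R u)"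
    hence "h ?w = - ?w" unfolding hw that
      by (cases "R u > 0") (auto simp: even_nat_iff power_minus_odd)
    thus False using key by blast
  qed
  show "odd (R u)" if "h u = - u"
  proof
    assume "even (R u)"
    hence "h ?w = - ?w" unfolding hw that
      by (cases "R u > 0") (auto simp: even_nat_iff power_minus_even)
    thus False using key by blast
  qed
qed

end

definition Lp :: "(('a \<Rightarrow> int) \<Rightarrow> int) \<Rightarrow> 'a set" where
  "Lp D = {f \<in> LL D. h f = f}"

definition Lm :: "(('a \<Rightarrow> int) \<Rightarrow> int) \<Rightarrow> 'a set" where
  "Lm D = {f \<in> LL D. h f = - f}"

lemma Lp_subset: "Lp D \<subseteq> LL D" and Lm_subset: "Lm D \<subseteq> LL D"
  by (auto simp: Lp_def Lm_def)

lemma subspace_Lp: "VS.subspace (Lp D)"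
  unfolding Lp_def by (rule VS.subspaceI)
    (auto simp: add mult intro: VS.subspace_0[OF subspace_LL] VS.subspace_add[OF subspace_LL] VS.subspace_scale[OF subspace_LL])

lemma subspace_Lm: "VS.subspace (Lm D)"
  unfolding Lm_def by (rule VS.subspaceI)
    (auto simp: add mult intro: VS.subspace_0[OF subspace_LL] VS.subspace_add[OF subspace_LL] VS.subspace_scale[OF subspace_LL])

lemma fin_dim_Lp: "D \<in> Div \<Longrightarrow> fin_dim (Lp D)" and fin_dim_Lm: "D \<in> Div \<Longrightarrow> fin_dim (Lm D)"
  using fin_dim_LL fin_dim_subset Lp_subset Lm_subset by blast+

text \<open>The divisors that come from the quotient by the involution.\<close>

definition sym :: "(('a \<Rightarrow> int) \<Rightarrow> int) \<Rightarrow> bool" where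
  "sym D \<longleftrightarrow> D \<in> Div \<and> (\<forall>v. D (v \<circ> h) = D v) \<and> (\<forall>v\<in>PL. v \<circ> h = v \<longrightarrow> even (D v))"

lemma sym_Div: "sym D \<Longrightarrow> D \<in> Div" and sym_inv: "sym D \<Longrightarrow> D (v \<circ> h) = D v"
  and sym_even: "sym D \<Longrightarrow> v \<in> PL \<Longrightarrow> v \<circ> h = v \<Longrightarrow> even (D v)"
  by (auto simp: sym_def)

lemma sym_add: "sym D \<Longrightarrow> sym E \<Longrightarrow> sym (\<lambda>v. D v + E v)"
  by (auto simp: sym_def Div_add)

lemma sym_diff: "sym D \<Longrightarrow> sym E \<Longrightarrow> sym (\<lambda>v. D v - E v)"
  by (auto simp: sym_def Div_diff)

definition pr :: "('a \<Rightarrow> int) \<Rightarrow> ('a \<Rightarrow> int) \<Rightarrow> int" where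
  "pr R = (\<lambda>v. pt R v + pt (R \<circ> h) v)"

lemma pr_nonneg: "0 \<le> pr R v"
  by (simp add: pr_def pt_def)

lemma pr_inv: "pr R (v \<circ> h) = pr R v"
  using vh_eq[of v R] vh_eq[of v "R \<circ> h"] by (simp add: pr_def pt_def)

lemma pr_swap: "pr (R \<circ> h) = pr R"
  by (simp add: pr_def add.commute)

lemma sym_pr: "R \<in> PL \<Longrightarrow> sym (pr R)" and degree_pr: "R \<in> PL \<Longrightarrow> divisor_degree (pr R) = 2"
proof -
  assume R: "R \<in> PL"
  note d = Div_add[OF Div_pt(1)[OF R] Div_pt(1)[OF place[OF R]], folded pr_def]
  show "divisor_degree (pr R) = 2" using d(2) Div_pt(2)[OF R] Div_pt(2)[OF place[OF R]] by simp
  have "even (pr R v)" if "v \<circ> h = v" for v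
    using that vh_eq[of v R] by (auto simp: pr_def pt_def)
  thus "sym (pr R)" using d(1) by (auto simp: sym_def pr_inv)
qed

definition pd :: "('a \<Rightarrow> int) list \<Rightarrow> ('a \<Rightarrow> int) \<Rightarrow> int" where
  "pd Rs = (\<lambda>v. \<Sum>R\<leftarrow>Rs. pr R v)"

lemma pd_Nil [simp]: "pd [] = (\<lambda>v. 0)" and pd_Cons: "pd (R # Rs) = (\<lambda>v. pr R v + pd Rs v)"
  by (simp_all add: pd_def)

lemma pd_nonneg: "0 \<le> pd Rs v"
  by (induction Rs) (auto simp: pd_Cons intro: add_nonneg_nonneg pr_nonneg)

lemma sym_pd: "set Rs \<subseteq> PL \<Longrightarrow> sym (pd Rs) \<and> divisor_degree (pd Rs) = 2 * int (length Rs)"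
proof (induction Rs)
  case Nil
  show ?case by (simp add: sym_def)
next
  case (Cons R Rs)
  hence R: "R \<in> PL" and IH: "sym (pd Rs)" "divisor_degree (pd Rs) = 2 * int (length Rs)" by auto
  show ?case
    using sym_add[OF sym_pr[OF R] IH(1)] Div_add(2)[OF sym_Div[OF sym_pr[OF R]] sym_Div[OF IH(1)]] degree_pr[OF R] IH(2)
    by (simp add: pd_Cons)
qed

text \<open>The pullbacks \<open>pr R\<close> are removed one by one. At a fixed place evenness
  leaves room for \<open>2 R\<close>, so the rest stays effective.\<close>

lemma sym_imp_pd:
  assumes "sym Z" "\<And>v. 0 \<le> Z v"
  shows "\<exists>Rs. set Rs \<subseteq> PL \<and> Z = pd Rs"
  using assms
proof (induction "nat (divisor_degree Z)" arbitrary: Z rule: less_induct)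
  case less
  show ?case
  proof (cases "Z = (\<lambda>v. 0)")
    case True
    thus ?thesis by (intro exI[of _ "[]"]) simp
  next
    case False
    then obtain R where "Z R \<noteq> 0" by auto
    hence R: "0 < Z R" "R \<in> PL" using less(3)[of R] Div_outside[OF sym_Div[OF less(2)]] by fastforce+
    let ?Z = "\<lambda>v. Z v - pr R v"
    have sZ: "sym ?Z" by (rule sym_diff[OF less(2) sym_pr[OF R(2)]])
    have "0 \<le> ?Z v" for v
    proof (cases "v = R \<or> v = R \<circ> h")
      case True
      hence ZvR: "Z v = Z R" "pr R v = pr R R" using sym_inv[OF less(2)] pr_inv by auto
      show ?thesis
      proof (cases "R \<circ> h = R")
        case True
        hence "even (Z R)" using sym_even[OF less(2) R(2)] by blast
        hence "Z R \<ge> 2" using R(1) by presburger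
        thus ?thesis using ZvR True by (simp add: pr_def pt_def)
      next
        case False
        hence "pr R R = 1" by (auto simp: pr_def pt_def)
        thus ?thesis using ZvR R(1) by simp
      qed
    next
      case False
      thus ?thesis using less(3)[of v] by (simp add: pr_def pt_def)
    qed
    note pos = this
    have dZ: "divisor_degree ?Z = divisor_degree Z - 2"
      using Div_diff(2)[OF sym_Div[OF less(2)] sym_Div[OF sym_pr[OF R(2)]]] degree_pr[OF R(2)] by simp
    moreover have "0 \<le> divisor_degree ?Z" using pos by (rule degree_nonneg)
    ultimately have "nat (divisor_degree ?Z) < nat (divisor_degree Z)" by simp
    from less(1)[OF this sZ pos] obtain Rs where Rs: "set Rs \<subseteq> PL" "?Z = pd Rs" by blast
    have "Z v = pd (R # Rs) v" for v using fun_cong[OF Rs(2), of v] by (simp add: pd_Cons)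
    hence "set (R # Rs) \<subseteq> PL \<and> Z = pd (R # Rs)" using R(2) Rs(1) by auto
    thus ?thesis by blast
  qed
qed

text \<open>On the quotient only one point is added. At a fixed place two pole orders become
  available, but invariant functions have even order there, so only one of them occurs.\<close>

lemma Lp_add_pr:
  assumes D: "sym D" and R: "R \<in> PL"
  shows "VS.dim (Lp (\<lambda>v. D v + pr R v)) \<le> VS.dim (Lp D) + 1"
proof -
  let ?E = "\<lambda>v. D v + pr R v"
  have sE: "sym ?E" by (rule sym_add[OF D sym_pr[OF R]])
  have "\<exists>f. Lp ?E \<subseteq> VS.span (insert f (Lp D))"
  proof (cases "Lp ?E \<subseteq> Lp D")
    case True
    thus ?thesis using VS.span_superset[of "insert 0 (Lp D)"] by (intro exI[of _ 0]) blast
  next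
    case False
    then obtain f where f: "f \<in> LL ?E" "h f = f" "f \<notin> LL D" by (auto simp: Lp_def)
    \<comment> \<open>By invariance of \<open>z\<close> and \<open>D\<close>, the condition at
      \<open>R\<close> implies the one at its conjugate place.\<close>
    have crit: "z \<in> LL D" if z: "z \<in> LL ?E" "h z = z" "vge R (- D R) z" for z
    proof (rule LL_I)
      fix w assume w: "w \<in> PL"
      consider "w = R" | "w = R \<circ> h" | "w \<noteq> R" "w \<noteq> R \<circ> h" by blast
      thus "vge w (- D w) z"
      proof cases
        case 2
        thus ?thesis using z(2,3) sym_inv[OF D, of R] by (auto simp: vge_def)
      next
        case 3
        thus ?thesis using LL_vge[OF z(1) w] by (simp add: pr_def pt_def)
      qed (use z in simp)
    qed simp
    have nv: "\<not> vge R (- D R) f" using crit[OF f(1,2)] f(3) by blast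
    have f0: "f \<noteq> 0" using nv by auto
    have prR: "pr R R = (if R \<circ> h = R then 2 else 1)" by (auto simp: pr_def pt_def)
    have Rf: "R f = - ?E R"
    proof (cases "R \<circ> h = R")
      case True
      have "- D R - 2 \<le> R f" using LL_vge[OF f(1) R] f0 True prR by (simp add: vge_def)
      moreover have "R f < - D R" using nv by (auto simp: vge_def)
      moreover have "even (R f)" "even (D R)"
        using fixed_parity(1)[OF R True f0 f(2)] sym_even[OF D R True] by auto
      ultimately have "R f = - D R - 2" by presburger
      thus ?thesis using True prR by simp
    next
      case False
      have "- D R - 1 \<le> R f" using LL_vge[OF f(1) R] f0 False prR by (simp add: vge_def)
      moreover have "R f < - D R" using nv by (auto simp: vge_def)
      ultimately show ?thesis using False prR by simp
    qed
    show ?thesis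
    proof (intro exI[of _ f] subsetI)
      fix z assume "z \<in> Lp ?E"
      hence z: "z \<in> LL ?E" "h z = z" by (auto simp: Lp_def)
      have "vge R (- ?E R + ?E R) (z * inverse f)"
        by (rule vge_mult[OF R _ _ LL_vge[OF z(1) R]]) (use Rf in \<open>auto simp: vge_def v_inverse[OF R]\<close>)
      hence "vge R 0 (z / f)" by (simp add: divide_inverse)
      then obtain c where c: "vge R 1 (z / f - emb c)" using residue[OF R, of "z / f"] by auto
      have "vge R (1 + - ?E R) ((z / f - emb c) * f)"
        by (rule vge_mult[OF R _ _ c]) (use Rf in \<open>auto simp: vge_def\<close>)
      moreover have "(z / f - emb c) * f = z - emb c * f" using f0 by (simp add: field_simps)
      ultimately have v1: "vge R (1 + - ?E R) (z - emb c * f)" by simp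
      have E: "z - emb c * f \<in> LL ?E"
        by (intro VS.subspace_diff VS.subspace_scale subspace_LL z f)
      have inv: "h (z - emb c * f) = z - emb c * f" by (simp add: hom z f)
      \<comment> \<open>At a fixed place subtraction gains just one order; parity supplies the
        second.\<close>
      have "vge R (- D R) (z - emb c * f)"
      proof (cases "R \<circ> h = R")
        case False
        thus ?thesis using v1 prR by simp
      next
        case True
        have "- D R \<le> R (z - emb c * f)" if nz: "z - emb c * f \<noteq> 0"
        proof -
          have "even (R (z - emb c * f))" by (rule fixed_parity(1)[OF R True nz inv])
          moreover have "even (D R)" by (rule sym_even[OF D R True])
          moreover have "- 1 - D R \<le> R (z - emb c * f)" using vge_D[OF v1 nz] prR True by simp
          ultimately show ?thesis by presburger
        qed
        thus ?thesis unfolding vge_def by blast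
      qed
      hence "z - emb c * f \<in> Lp D" using crit[OF E inv] inv by (simp add: Lp_def)
      hence "(z - emb c * f) + emb c * f \<in> VS.span (insert f (Lp D))"
        by (intro VS.span_add VS.span_scale VS.span_base) auto
      thus "z \<in> VS.span (insert f (Lp D))" by simp
    qed
  qed
  then obtain f where "Lp ?E \<subseteq> VS.span (insert f (Lp D))" by blast
  thus ?thesis using dim_insert_le[OF fin_dim_Lp[OF sym_Div[OF D]]] by blast
qed

lemma Lp_add_pd:
  "sym D \<Longrightarrow> set Rs \<subseteq> PL \<Longrightarrow> VS.dim (Lp (\<lambda>v. D v + pd Rs v)) \<le> VS.dim (Lp D) + length Rs"
proof (induction Rs arbitrary: D)
  case (Cons R Rs)
  hence R: "R \<in> PL" by simp
  have "VS.dim (Lp (\<lambda>v. (D v + pr R v) + pd Rs v)) \<le> VS.dim (Lp (\<lambda>v. D v + pr R v)) + length Rs"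
    by (rule Cons.IH) (use Cons sym_add sym_pr[OF R] in auto)
  thus ?case using Lp_add_pr[OF Cons(2) R] by (simp add: pd_Cons add.assoc)
qed simp

end

locale curve_involution_nonspecial = curve_involution +
  fixes D1
  assumes D1: "D1 \<in> Div" 
    and ns: "\<And>D. D \<in> Div \<Longrightarrow> (\<And>v. D1 v \<le> D v) \<Longrightarrow> int (VS.dim (LL D)) = divisor_degree D + 1 - int g"
begin

text \<open>Both divisors lie above \<open>D1\<close>, so removing \<open>R\<close> lowers the
  dimension by exactly one, and some function has the extremal order at \<open>R\<close>.\<close>

lemma ex_exact:
  assumes D: "D \<in> Div" and R: "R \<in> PL" and le: "\<And>v. D1 v \<le> D v - pt R v"
  shows "\<exists>f\<in>LL D. f \<noteq> 0 \<and> R f = - D R"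
proof -
  let ?E = "\<lambda>v. D v - pt R v"
  note E = Div_diff[OF D Div_pt(1)[OF R]]
  have "D1 v \<le> D v" for v using le[of v] by (simp add: pt_def split: if_splits)
  hence "int (VS.dim (LL D)) = int (VS.dim (LL ?E)) + 1"
    using ns[OF D] ns[OF E(1) le] E(2) Div_pt(2)[OF R] by simp
  hence "\<not> LL D \<subseteq> LL ?E" using dim_mono[OF fin_dim_LL[OF E(1)], of "LL D"] by auto
  then obtain f where f: "f \<in> LL D" "f \<notin> LL ?E" by blast
  obtain w where w: "w \<in> PL" "\<not> vge w (- ?E w) f" using f(2) by (auto simp: mem_LL)
  have "w = R"
    using LL_vge[OF f(1) w(1)] w(2) by (auto simp: pt_def split: if_splits)
  hence "\<not> vge R (- D R + 1) f" using w(2) by (simp add: pt_def)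
  hence "f \<noteq> 0 \<and> R f = - D R" using LL_vge[OF f(1) R] by (auto simp: vge_def)
  thus ?thesis using f(1) by blast
qed

text \<open>Symmetrising \<open>f\<close> to \<open>f + h f\<close> must preserve its extremal order
  at \<open>R\<close>. At a fixed place \<open>f - h f\<close> has odd order and \<open>D R\<close>
  is even, so the extremal term sits in the invariant part.\<close>

lemma Lp_diff_pr:
  assumes D: "sym D" and R: "R \<in> PL" and le: "\<And>v. D1 v \<le> D v - pr R v"
  shows "VS.dim (Lp (\<lambda>v. D v - pr R v)) + 1 \<le> VS.dim (Lp D)"
proof -
  let ?E = "\<lambda>v. D v - pr R v"
  have "\<exists>f\<in>LL D. h f = f \<and> f \<noteq> 0 \<and> R f = - D R"
  proof (cases "R \<circ> h = R")
    case True
    have "D1 v \<le> D v - pt R v" for v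
      using le[of v] True by (auto simp: pr_def pt_def split: if_splits)
    then obtain f where f: "f \<in> LL D" "f \<noteq> 0" "R f = - D R" using ex_exact[OF sym_Div[OF D] R] by blast
    have hf: "h f \<in> LL D" using image_LL[OF f(1)] sym_inv[OF D] by simp
    let ?e = "f + h f" and ?o = "f - h f"
    have eL: "?e \<in> LL D" "?o \<in> LL D" by (intro VS.subspace_add VS.subspace_diff subspace_LL f hf)+
    have he: "h ?e = ?e" "h ?o = - ?o" by (simp_all add: hom)
    have o: "vge R (- D R + 1) ?o"
    proof (cases "?o = 0")
      case False
      have "odd (R ?o)" by (rule fixed_parity(2)[OF R True False he(2)])
      moreover have "even (D R)" by (rule sym_even[OF D R True])
      ultimately have "R ?o \<noteq> - D R" by auto
      thus ?thesis using LL_vge[OF eL(2) R] by (auto simp: vge_def)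
    qed simp
    have "\<not> vge R (- D R + 1) ?e"
    proof
      assume "vge R (- D R + 1) ?e"
      hence "vge R (- D R + 1) (?e + ?o)" by (rule vge_add[OF R UNIV_I UNIV_I _ o])
      hence "vge R (- D R + 1) (emb (1/2) * (?e + ?o))" by (intro vge_scale[OF R]) auto
      moreover have "emb (1/2) * (?e + ?o) = f" by (simp add: emb_hom)
      ultimately have "vge R (- D R + 1) f" by (simp only:)
      thus False using f by (simp add: vge_def)
    qed
    hence "?e \<noteq> 0 \<and> R ?e = - D R" using LL_vge[OF eL(1) R] by (auto simp: vge_def)
    thus ?thesis using eL(1) he(1) by blast
  next
    case False
    \<comment> \<open>One order less is allowed at the conjugate place, so that \<open>h f\<close>
      cannot cancel the extremal term of \<open>f\<close> at \<open>R\<close>.\<close>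
    let ?D = "\<lambda>v. D v - pt (R \<circ> h) v"
    have "D1 v \<le> ?D v - pt R v" for v using le[of v] by (simp add: pr_def)
    then obtain f where f: "f \<in> LL ?D" "f \<noteq> 0" "R f = - ?D R"
      using ex_exact[OF Div_diff(1)[OF sym_Div[OF D] Div_pt(1)[OF place[OF R]]] R] by blast
    have Rf: "R f = - D R" using f(3) False by (auto simp: pt_def)
    have fD: "f \<in> LL D" by (rule subsetD[OF LL_mono f(1)]) (simp add: pt_def)
    have hf: "h f \<in> LL D" using image_LL[OF fD] sym_inv[OF D] by simp
    have "vge (R \<circ> h) (- D R + 1) f"
      using LL_vge[OF f(1) place[OF R]] sym_inv[OF D, of R] by (simp add: pt_def)
    hence "vge R (R f + 1) (h f)" using Rf by (simp add: vge_def)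
    from v_add_eq[OF R _ _ f(2) this] have "f + h f \<noteq> 0" "R (f + h f) = - D R" using Rf by auto
    moreover have "f + h f \<in> LL D" by (intro VS.subspace_add subspace_LL fD hf)
    moreover have "h (f + h f) = f + h f" by (simp add: hom)
    ultimately show ?thesis by blast
  qed
  then obtain f where f: "f \<in> LL D" "h f = f" "f \<noteq> 0" "R f = - D R" by blast
  have "f \<notin> LL ?E" using LL_vge[of f ?E R] R f(3,4) by (auto simp: vge_def pr_def pt_def split: if_splits)
  hence "f \<in> Lp D" "f \<notin> Lp ?E" using f by (auto simp: Lp_def)
  moreover have "LL ?E \<subseteq> LL D" by (rule LL_mono) (simp add: pr_nonneg)
  hence "Lp ?E \<subseteq> Lp D" by (auto simp: Lp_def)
  ultimately show ?thesis by (intro dim_Suc_le[OF fin_dim_Lp[OF sym_Div[OF D]] subspace_Lp])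
qed

lemma Lp_diff_pd:
  "sym D \<Longrightarrow> set Rs \<subseteq> PL \<Longrightarrow> (\<And>v. D1 v \<le> D v - pd Rs v) \<Longrightarrow>
    VS.dim (Lp (\<lambda>v. D v - pd Rs v)) + length Rs \<le> VS.dim (Lp D)"
proof (induction Rs arbitrary: D)
  case (Cons R Rs)
  hence R: "R \<in> PL" by simp
  have "VS.dim (Lp (\<lambda>v. (D v - pr R v) - pd Rs v)) + length Rs \<le> VS.dim (Lp (\<lambda>v. D v - pr R v))"
    by (rule Cons.IH) (use Cons sym_diff sym_pr[OF R] in \<open>auto simp: pd_Cons algebra_simps\<close>)
  moreover have "VS.dim (Lp (\<lambda>v. D v - pr R v)) + 1 \<le> VS.dim (Lp D)"
  proof (rule Lp_diff_pr[OF Cons(2) R])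
    show "D1 v \<le> D v - pr R v" for v using Cons(4)[of v] pd_nonneg[of Rs v] by (simp add: pd_Cons)
  qed
  ultimately show ?case by (simp add: pd_Cons diff_diff_eq)
qed simp

text \<open>The part of the Riemann-Hurwitz formula that is needed: the ramification divisor is effective.\<close>

lemma dim_Lm_le_dim_Lp:
  "\<exists>A\<in>Div. (\<forall>v. 0 \<le> A v) \<and> (\<forall>C. sym C \<longrightarrow> (\<forall>v. A v \<le> C v) \<longrightarrow> VS.dim (Lm C) \<le> VS.dim (Lp C))"
proof -
  obtain u where u: "u \<noteq> 0" "h u = - u" using ex_anti by blast
  \<comment> \<open>The reduced divisor of fixed places. \<open>T = div u + \<delta>\<close> is a
    pullback from the quotient, and \<open>deg T = deg \<delta> \<ge> 0\<close> is the sign needed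
    below.\<close>
  define \<delta> where "\<delta> v = (if v \<in> PL \<and> v \<circ> h = v then 1 else 0 :: int)" for v
  define T where "T v = pdiv u v + \<delta> v" for v
  note pu = pdiv_Div[OF UNIV_I u(1)]
  have odd: "odd (v u)" if "v \<in> PL" "v \<circ> h = v" for v by (rule fixed_parity(2)[OF that u])
  have \<delta>D: "\<delta> \<in> Div"
  proof (rule Div_I[OF finite_support[OF UNIV_I u(1)]])
    show "v \<in> {v \<in> PL. v u \<noteq> 0}" if "\<delta> v \<noteq> 0" for v
      using that odd[of v] by (auto simp: \<delta>_def split: if_splits)
  qed auto
  note TD = Div_add[OF pu \<delta>D, folded T_def]
  have "0 \<le> divisor_degree \<delta>" by (rule degree_nonneg) (simp add: \<delta>_def)
  hence dT: "0 \<le> divisor_degree T" using TD(2) degree_pdiv[OF UNIV_I u(1)] by simp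
  have T_inv: "T (v \<circ> h) = T v" for v
  proof -
    have "v \<in> PL \<Longrightarrow> v (- u) = v u" by (simp add: v_minus)
    thus ?thesis using vh_place[of v] vh_eq[of v v] u by (auto simp: T_def pdiv_def \<delta>_def vh_eq)
  qed
  have T_even: "even (T v)" if "v \<in> PL" "v \<circ> h = v" for v
    using odd[OF that] that by (simp add: T_def pdiv_def \<delta>_def)
  have sym_part: "sym (\<lambda>v. max 0 (c * T v))" for c
  proof -
    have "(\<lambda>v. max 0 (c * T v)) \<in> Div"
      by (rule Div_I[of "{v. T v \<noteq> 0}"]) (use TD(1) in \<open>auto simp: Div_iff\<close>)
    moreover have "even (max 0 (c * T v))" if "v \<in> PL" "v \<circ> h = v" for v
      using T_even[OF that] by (simp add: max_def)
    ultimately show ?thesis by (auto simp: sym_def T_inv)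
  qed
  define Tp where "Tp v = max 0 (1 * T v)" for v
  define Tm where "Tm v = max 0 (- 1 * T v)" for v
  have sTp: "sym Tp" and sTm: "sym Tm" unfolding Tp_def Tm_def by (rule sym_part)+
  have T_eq: "T v = Tp v - Tm v" for v by (simp add: Tp_def Tm_def)
  obtain Rs where Rs: "set Rs \<subseteq> PL" "Tp = pd Rs" using sym_imp_pd[OF sTp] by (auto simp: Tp_def)
  obtain Ss where Ss: "set Ss \<subseteq> PL" "Tm = pd Ss" using sym_imp_pd[OF sTm] by (auto simp: Tm_def)
  have "divisor_degree T = divisor_degree Tp - divisor_degree Tm"
    using Div_diff(2)[OF sym_Div[OF sTp] sym_Div[OF sTm]] by (simp flip: T_eq)
  hence len: "length Ss \<le> length Rs" using dT sym_pd[OF Rs(1)] sym_pd[OF Ss(1)] Rs(2) Ss(2) by simp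
  \<comment> \<open>Above \<open>A\<close>, subtracting the positive part of \<open>T\<close> still
    leaves a divisor above \<open>D1\<close>.\<close>
  define A where "A v = max 0 (D1 v) + Tp v" for v
  have AD: "A \<in> Div" unfolding A_def
    by (rule Div_add(1)[OF Div_I[of "{v. D1 v \<noteq> 0}"] sym_Div[OF sTp]]) (use D1 in \<open>auto simp: Div_iff\<close>)
  have A0: "0 \<le> A v" for v by (simp add: A_def Tp_def)
  have "VS.dim (Lm C) \<le> VS.dim (Lp C)" if C: "sym C" and AC: "\<And>v. A v \<le> C v" for C
  proof -
    \<comment> \<open>This is \<open>C - T\<close>, arranged so that first the pullbacks in the
      negative part of \<open>T\<close> are added and then those in its positive part
      removed.\<close>
    let ?E = "\<lambda>v. (C v + pd Ss v) - pd Rs v"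
    have E: "?E v = C v - T v" for v using T_eq[of v] Rs(2) Ss(2) by simp
    have sE: "sym ?E" by (intro sym_diff sym_add C conjunct1[OF sym_pd] Rs Ss)
    have "(*) u ` Lm C \<subseteq> Lp ?E"
    proof (rule image_subsetI)
      fix f assume "f \<in> Lm C"
      hence f: "f \<in> LL C" "h f = - f" by (auto simp: Lm_def)
      have inv: "h (u * f) = u * f" using f u by (simp add: mult)
      have "u * f \<in> LL ?E"
      proof (rule LL_I)
        fix v assume v: "v \<in> PL"
        have 1: "vge v (v u + - C v) (u * f)"
          by (rule vge_mult[OF v _ _ vge_refl LL_vge[OF f(1) v]]) auto
        show "vge v (- ?E v) (u * f)"
        proof (cases "v \<circ> h = v \<and> u * f \<noteq> 0")
          case True
          have "even (v (u * f))" using fixed_parity(1)[OF v _ _ inv] True by blast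
          moreover have "even (C v)" using sym_even[OF C v] True by blast
          moreover have "odd (v u)" using odd[OF v] True by blast
          moreover have "v u + - C v \<le> v (u * f)" using 1 True by (simp add: vge_def)
          \<comment> \<open>The invariant product has even order while \<open>v u - C v\<close> is
            odd; the order gained pays for \<open>\<delta>\<close>.\<close>
          ultimately have "v u + 1 - C v \<le> v (u * f)" by presburger
          thus ?thesis unfolding E using True v by (simp add: T_def pdiv_def \<delta>_def vge_def)
        next
          case False
          thus ?thesis unfolding E using 1 v by (auto simp: T_def pdiv_def \<delta>_def vge_def)
        qed
      qed simp
      thus "u * f \<in> Lp ?E" using inv by (simp add: Lp_def)
    qed
    from dim_mono[OF fin_dim_Lp[OF sym_Div[OF sE]] this]
    have "VS.dim (Lm C) \<le> VS.dim (Lp ?E)"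
      using dim_mult_image[OF fin_dim_Lm[OF sym_Div[OF C]] u(1)] by simp
    moreover have "VS.dim (Lp ?E) + length Rs \<le> VS.dim (Lp (\<lambda>v. C v + pd Ss v))"
    proof (rule Lp_diff_pd[OF _ Rs(1)])
      show "sym (\<lambda>v. C v + pd Ss v)" by (intro sym_add C conjunct1[OF sym_pd] Ss)
      show "D1 v \<le> ?E v" for v
        using AC[of v] pd_nonneg[of Ss v] Rs(2) unfolding A_def by simp
    qed
    moreover have "VS.dim (Lp (\<lambda>v. C v + pd Ss v)) \<le> VS.dim (Lp C) + length Ss"
      by (rule Lp_add_pd[OF C Ss(1)])
    ultimately show ?thesis using len by linarith
  qed
  thus ?thesis using AD A0 by blast
qed

end

context curve_automorphism
begin

lemma place_iff: "v \<circ> \<sigma> \<in> PL \<longleftrightarrow> v \<in> PL"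
proof
  have i: "inv_into UNIV \<sigma> (\<sigma> z) = z" "\<sigma> (inv_into UNIV \<sigma> z) = z" for z
    using bij by (simp_all add: bij_def surj_f_inv_f)
  have "\<sigma> (inv_into UNIV \<sigma> x + inv_into UNIV \<sigma> y) = x + y" "\<sigma> (inv_into UNIV \<sigma> x * inv_into UNIV \<sigma> y) = x * y" for x y
    by (simp_all add: add mult i)
  hence "inv_into UNIV \<sigma> (x + y) = inv_into UNIV \<sigma> x + inv_into UNIV \<sigma> y"
    "inv_into UNIV \<sigma> (x * y) = inv_into UNIV \<sigma> x * inv_into UNIV \<sigma> y" for x y
    using i(1) by metis+
  moreover have "inv_into UNIV \<sigma> (emb c) = emb c" for c using i(1)[of "emb c"] by simp
  ultimately interpret inv: curve_automorphism emb g "inv_into UNIV \<sigma>"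
    by unfold_locales (simp add: Aut_iff bij_imp_bij_inv bij)
  assume "v \<circ> \<sigma> \<in> PL"
  hence "v \<circ> \<sigma> \<circ> inv_into UNIV \<sigma> \<in> PL" by (rule inv.place)
  moreover have "v \<circ> \<sigma> \<circ> inv_into UNIV \<sigma> = v" by (rule ext) (simp add: i)
  ultimately show "v \<in> PL" by simp
qed (rule place)

lemma Div_comp: "A \<in> Div \<Longrightarrow> (\<lambda>v. A (v \<circ> \<sigma>)) \<in> Div"
proof -
  assume A: "A \<in> Div"
  have "inj (\<lambda>v::'a \<Rightarrow> int. v \<circ> \<sigma>)"
  proof (rule injI)
    fix v w :: "'a \<Rightarrow> int" assume eq: "v \<circ> \<sigma> = w \<circ> \<sigma>"
    show "v = w"
    proof
      fix z
      obtain y where "z = \<sigma> y" using bij by (auto simp: bij_def surj_def)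
      thus "v z = w z" using fun_cong[OF eq, of y] by simp
    qed
  qed
  hence "finite ((\<lambda>v. v \<circ> \<sigma>) -` {v. A v \<noteq> 0})" by (intro finite_vimageI Div_finite[OF A])
  thus ?thesis
    by (rule Div_I) (use Div_outside[OF A] place_iff in auto)
qed

end

lemma clear_denominator:
  fixes x d b q :: "'a::field"
  assumes "q \<noteq> 0" "x = d + b / q"
  shows "(x - d) * q = b"
  unfolding assms(2) using assms(1) by simp

lemma clear_denominators:
  fixes u w a b :: "'a::field_char_0"
  assumes "u \<noteq> 0" "w \<noteq> 0" "- (a + b / u) = a + b / w"
  shows "2 * a * u * w + b * w + b * u = 0"
proof -
  have "a + b / w + (a + b / u) = 0" using assms(3) by (metis add.left_inverse)
  hence "2 * a + b / u + b / w = 0" by (simp add: algebra_simps)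
  moreover have "2 * a * u * w + b * w + b * u = (2 * a + b / u + b / w) * (u * w)"
    using assms(1,2) by (simp add: distrib_right)
  ultimately show ?thesis by simp
qed

context genus_field
begin

lemma degree_zero_imp:
  assumes "D \<in> Div" "\<And>v. 0 \<le> D v" "divisor_degree D \<le> 0"
  shows "D v = 0"
proof (rule ccontr)
  assume v: "D v \<noteq> 0"
  have "sum D {v. D v \<noteq> 0} > 0"
  proof (rule sum_pos2[OF Div_finite[OF assms(1)]])
    show "v \<in> {v. D v \<noteq> 0}" using v by simp
    show "0 < D v" using v assms(2)[of v] by simp
  qed (rule assms(2))
  thus False using assms(3) by (simp add: divisor_degree_def)
qed

lemma quadratic_relation:
  assumes "\<xi> \<notin> range emb" "emb a * (\<xi> * \<xi>) + emb b * \<xi> + emb c = 0"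
  shows "a = 0" "b = 0" "c = 0"
proof -
  have "ev [:c, b, a:] \<xi> = 0" using assms(2) by (simp add: algebra_simps)
  hence "[:c, b, a:] = 0" using ev_eq_0_iff[OF assms(1)] by blast
  thus "a = 0" "b = 0" "c = 0" by simp_all
qed

lemma linear_relation:
  assumes "\<xi> \<notin> range emb" "emb b * \<xi> + emb c = 0"
  shows "b = 0" "c = 0"
  using quadratic_relation[of \<xi> 0 b c] assms by simp_all

end

section \<open>Dihedral action in genus 2: the hyperelliptic quotient and its coordinate\<close>

locale dihedral_curve = genus_field emb UNIV 2
  for emb :: "'k::{alg_closed_field,field_char_0} \<Rightarrow> 'a::field_char_0" +
  fixes r s :: "'a \<Rightarrow> 'a"
  assumes r_aut: "r \<in> carrier (Aut_group emb)" and s_aut: "s \<in> carrier (Aut_group emb)"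
    and r4: "r (r (r (r z))) = z" and r2: "r \<circ> r \<noteq> id" and s2: "s (s z) = z"
    and srs: "s (r (s z)) = r (r (r z))"
    and s_ne: "s \<noteq> id" "s \<noteq> r \<circ> r" "s \<circ> r \<noteq> id" "s \<circ> r \<noteq> r \<circ> r"
begin

sublocale r: curve_automorphism emb 2 r
  by unfold_locales (rule r_aut)

sublocale s: curve_automorphism emb 2 s
  by unfold_locales (rule s_aut)

abbreviation h :: "'a \<Rightarrow> 'a" where "h \<equiv> r \<circ> r"

sublocale h: curve_involution emb 2 "r \<circ> r"
proof unfold_locales
  show "r \<circ> r \<in> carrier (Aut_group emb)" using r_aut by (auto simp: Aut_iff bij_comp)
  show "r \<circ> r \<circ> (r \<circ> r) = id" by (rule ext) (simp add: r4)
qed (rule r2)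

lemma sr: "s (r z) = r (r (r (s z)))"
  using srs[of "s z"] by (simp add: s2)

lemma hs: "h (s z) = s (h z)"
  by (simp add: sr r4)

text \<open>On \<open>L\<^sup>-\<close> the inverse of \<open>r\<close> is \<open>- r\<close>, so
  \<open>s r = - r s\<close> there: \<open>r\<close> interchanges the eigenspaces of
  \<open>s\<close> for 1 and -1.\<close>

lemma dim_Lm_even:
  assumes C: "C \<in> Div" "\<And>v. C (v \<circ> r) = C v" "\<And>v. C (v \<circ> s) = C v"
  shows "even (VS.dim (h.Lm C))"
proof -
  define A where "A = {f \<in> h.Lm C. s f = f}"
  define B where "B = {f \<in> h.Lm C. s f = - f}"
  have sLm: "s f \<in> h.Lm C" if "f \<in> h.Lm C" for f
    using that s.image_LL[of f C] hs[of f] C(3) by (auto simp: h.Lm_def s.minus)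
  have rLm: "r f \<in> h.Lm C" if "f \<in> h.Lm C" for f
    using that r.image_LL[of f C] C(2) by (auto simp: h.Lm_def r.minus)
  have subA: "VS.subspace A" unfolding A_def
    by (rule VS.subspaceI) (auto simp: s.add s.mult intro: VS.subspace_0[OF h.subspace_Lm] VS.subspace_add[OF h.subspace_Lm] VS.subspace_scale[OF h.subspace_Lm])
  have subB: "VS.subspace B" unfolding B_def
    by (rule VS.subspaceI) (auto simp: s.add s.mult intro: VS.subspace_0[OF h.subspace_Lm] VS.subspace_add[OF h.subspace_Lm] VS.subspace_scale[OF h.subspace_Lm])
  have AB: "A \<subseteq> h.Lm C" "B \<subseteq> h.Lm C" by (auto simp: A_def B_def)
  note fd = h.fin_dim_Lm[OF C(1)]
  have "VS.dim (h.Lm C) = VS.dim A + VS.dim B"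
  proof (rule dim_direct_sum[OF fd subA AB(1) subB AB(2)])
    show "A \<inter> B \<subseteq> {0}" by (auto simp: A_def B_def)
    show "VS.subspace (h.Lm C)" by (rule h.subspace_Lm)
    fix f assume f: "f \<in> h.Lm C"
    have a: "emb (1/2) * (f + s f) \<in> A"
      using f sLm[OF f] by (auto simp: A_def s.hom s2 add.commute intro!: VS.subspace_scale[OF h.subspace_Lm] VS.subspace_add[OF h.subspace_Lm])
    have "emb (1/2) * (f - s f) \<in> h.Lm C"
      by (intro VS.subspace_scale[OF h.subspace_Lm] VS.subspace_diff[OF h.subspace_Lm] f sLm)
    moreover have "s (emb (1/2) * (f - s f)) = - (emb (1/2) * (f - s f))"
      by (simp add: s.hom s2 algebra_simps)
    ultimately have "emb (1/2) * (f - s f) \<in> B" by (simp add: B_def)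
    moreover have "f = emb (1/2) * (f + s f) + emb (1/2) * (f - s f)" by (simp add: emb_hom field_simps)
    ultimately show "\<exists>u\<in>A. \<exists>w\<in>B. f = u + w" using a by blast
  qed
  moreover have "VS.dim A = VS.dim B"
  proof -
    have rrr: "r (r (r f)) = - r f" if "f \<in> h.Lm C" for f
    proof -
      have "r (r f) = - f" using that by (simp add: h.Lm_def)
      thus ?thesis by (simp add: r.minus)
    qed
    have "r ` A \<subseteq> B" using rLm rrr by (auto simp: A_def B_def sr)
    hence "VS.dim A \<le> VS.dim B"
      using dim_mono[OF fin_dim_subset[OF fd AB(2)], of "r ` A"] r.dim_image[OF fin_dim_subset[OF fd AB(1)]] by simp
    moreover have "r ` B \<subseteq> A" using rLm rrr by (auto simp: A_def B_def sr r.minus)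
    hence "VS.dim B \<le> VS.dim A"
      using dim_mono[OF fin_dim_subset[OF fd AB(1)], of "r ` B"] r.dim_image[OF fin_dim_subset[OF fd AB(2)]] by simp
    ultimately show ?thesis by simp
  qed
  ultimately show ?thesis by simp
qed

lemma dim_LL_split:
  assumes C: "C \<in> Div" "\<And>v. C (v \<circ> h) = C v"
  shows "VS.dim (LL C) = VS.dim (h.Lp C) + VS.dim (h.Lm C)"
proof (rule dim_direct_sum[OF fin_dim_LL[OF C(1)] h.subspace_Lp h.Lp_subset h.subspace_Lm h.Lm_subset])
  show "h.Lp C \<inter> h.Lm C \<subseteq> {0}" by (auto simp: h.Lp_def h.Lm_def)
  show "VS.subspace (LL C)" by (rule subspace_LL)
  fix f assume f: "f \<in> LL C"
  have hf: "h f \<in> LL C" using h.image_LL[OF f] C(2) by simp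
  have "emb (1/2) * (f + h f) \<in> h.Lp C"
    using f hf by (auto simp: h.Lp_def r.hom r4 add.commute intro!: VS.subspace_scale[OF subspace_LL] VS.subspace_add[OF subspace_LL])
  moreover have "emb (1/2) * (f - h f) \<in> h.Lm C"
  proof -
    have "emb (1/2) * (f - h f) \<in> LL C"
      by (intro VS.subspace_scale[OF subspace_LL] VS.subspace_diff[OF subspace_LL] f hf)
    moreover have "h (emb (1/2) * (f - h f)) = - (emb (1/2) * (f - h f))"
      by (simp add: r.hom r4 algebra_simps)
    ultimately show ?thesis by (simp add: h.Lm_def)
  qed
  moreover have "f = emb (1/2) * (f + h f) + emb (1/2) * (f - h f)" by (simp add: emb_hom field_simps)
  ultimately show "\<exists>u\<in>h.Lp C. \<exists>w\<in>h.Lm C. f = u + w" by blast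
qed

text \<open>A coordinate of the quotient line whose pole is the point under
  \<open>P\<close>.\<close>

definition hyp_coord :: "'a \<Rightarrow> ('a \<Rightarrow> int) \<Rightarrow> bool" where
  "hyp_coord \<xi> P \<longleftrightarrow> P \<in> PL \<and> \<xi> \<in> h.Lp (h.pr P) \<and> \<xi> \<notin> range emb"

text \<open>
  The idea: \<open>dim L\<^sup>- \<le> dim L\<^sup>+\<close> by Riemann-Hurwitz, their sum is \<open>deg C - 1\<close>, and \<open>dim L\<^sup>-\<close> is even
  because \<open>r\<close> exchanges the two eigenspaces of \<open>s\<close> in \<open>L\<^sup>-\<close>. As \<open>4\<close> divides \<open>deg C\<close>, this forces
  \<open>dim L\<^sup>+ > deg C / 2\<close>, that is, the quotient by \<open>r\<^sup>2\<close> has genus \<open>0\<close>.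
\<close>

lemma ex_hyp_coord: "\<exists>\<xi> P. hyp_coord \<xi> P"
proof -
  obtain D1 where D1: "D1 \<in> Div" "\<And>v. 0 \<le> D1 v"
    "\<And>D. D \<in> Div \<Longrightarrow> (\<And>v. D1 v \<le> D v) \<Longrightarrow> int (VS.dim (LL D)) = divisor_degree D + 1 - int 2"
    using nonspecial by blast
  interpret N: curve_involution_nonspecial emb 2 "r \<circ> r" D1
    by unfold_locales (use D1 in auto)
  obtain A where A: "A \<in> Div" "\<And>v. 0 \<le> A v"
    "\<And>C. h.sym C \<Longrightarrow> (\<And>v. A v \<le> C v) \<Longrightarrow> VS.dim (h.Lm C) \<le> VS.dim (h.Lp C)"
    using N.dim_Lm_le_dim_Lp by blast
  define B where "B v = D1 v + A v" for v
  have B: "B \<in> Div" "\<And>v. 0 \<le> B v" unfolding B_def using Div_add[OF D1(1) A(1)] D1(2) A(2) by auto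
  \<comment> \<open>\<open>O1\<close>, \<open>O2\<close> and \<open>E\<close> sum \<open>B\<close>
    over the powers of \<open>r\<close> and then over \<open>s\<close>, which makes the result
    invariant and still at least \<open>B\<close>.\<close>
  define O1 where "O1 v = B v + B (v \<circ> r)" for v
  have O1: "O1 \<in> Div" "\<And>v. 0 \<le> O1 v" unfolding O1_def using Div_add(1)[OF B(1) r.Div_comp[OF B(1)]] B(2) by auto
  define O2 where "O2 v = O1 v + O1 (v \<circ> h)" for v
  have O2: "O2 \<in> Div" "\<And>v. 0 \<le> O2 v" unfolding O2_def using Div_add(1)[OF O1(1) h.Div_comp[OF O1(1)]] O1(2) by auto
  have v4: "v \<circ> r \<circ> r \<circ> r \<circ> r = v" for v by (rule ext) (simp add: r4)
  have O2r: "O2 (v \<circ> r) = O2 v" for v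
    unfolding O2_def O1_def comp_assoc[symmetric] v4 by simp
  define E where "E v = O2 v + O2 (v \<circ> s)" for v
  have E: "E \<in> Div" "\<And>v. 0 \<le> E v" unfolding E_def using Div_add(1)[OF O2(1) s.Div_comp[OF O2(1)]] O2(2) by auto
  have Es: "E (v \<circ> s) = E v" for v
  proof -
    have "v \<circ> s \<circ> s = v" by (rule ext) (simp add: s2)
    thus ?thesis by (simp add: E_def)
  qed
  have Er: "E (v \<circ> r) = E v" for v
  proof -
    have "v \<circ> r \<circ> s = v \<circ> s \<circ> r \<circ> r \<circ> r" by (rule ext) (simp add: sr r4)
    hence "O2 (v \<circ> r \<circ> s) = O2 (v \<circ> s)" by (simp only: O2r)
    thus ?thesis by (simp add: E_def O2r)
  qed
  have BE: "B v \<le> E v" for v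
    using B(2)[of "v \<circ> r"] O1(2)[of "v \<circ> h"] O2(2)[of "v \<circ> s"] by (simp add: E_def O2_def O1_def)
  \<comment> \<open>The factor 4 makes the degree divisible by 4 and the values at fixed places
    even, as \<open>h.sym\<close> requires.\<close>
  define C where "C v = 4 * E v" for v
  have C: "C \<in> Div" "divisor_degree C = 4 * divisor_degree E"
    unfolding C_def using Div_scale[OF E(1), of 4] by auto
  have Ch: "C (v \<circ> h) = C v" for v by (simp add: C_def comp_assoc[symmetric] Er)
  have symC: "h.sym C" using C(1) Ch by (simp add: h.sym_def C_def)
  have BC: "B v \<le> C v" for v using BE[of v] E(2)[of v] by (simp add: C_def)
  have "VS.dim (h.Lm C) \<le> VS.dim (h.Lp C)"
  proof (rule A(3)[OF symC])
    show "A v \<le> C v" for v using BC[of v] D1(2)[of v] by (simp add: B_def)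
  qed
  moreover have "int (VS.dim (LL C)) = divisor_degree C + 1 - int 2"
  proof (rule D1(3)[OF C(1)])
    show "D1 v \<le> C v" for v using BC[of v] A(2)[of v] by (simp add: B_def)
  qed
  moreover have "VS.dim (LL C) = VS.dim (h.Lp C) + VS.dim (h.Lm C)" by (rule dim_LL_split[OF C(1) Ch])
  moreover have "even (VS.dim (h.Lm C))" by (rule dim_Lm_even[OF C(1)]) (simp_all add: C_def Er Es)
  then obtain m where "VS.dim (h.Lm C) = 2 * m" by blast
  ultimately have 1: "int (2 * m) \<le> int (VS.dim (h.Lp C))"
      "int (VS.dim (h.Lp C)) + int (2 * m) = 4 * divisor_degree E - 1"
    using C(2) by simp_all
  hence "4 * int m \<le> 4 * divisor_degree E - 1" by simp
  hence 2: "int m \<le> divisor_degree E - 1" by presburger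
  hence ge: "int (VS.dim (h.Lp C)) \<ge> 2 * divisor_degree E + 1" and E1: "divisor_degree E > 0"
    using 1 by linarith+
  obtain Rs where Rs: "set Rs \<subseteq> PL" "C = h.pd Rs"
    using h.sym_imp_pd[OF symC] E(2) by (auto simp: C_def)
  have len: "int (length Rs) = 2 * divisor_degree E" using h.sym_pd[OF Rs(1)] Rs(2) C(2) by simp
  then obtain P Rs' where PR: "Rs = P # Rs'" using E1 by (cases Rs) auto
  have P: "P \<in> PL" using Rs(1) PR by simp
  \<comment> \<open>All but one of the \<open>2 deg E\<close> pullbacks are removed, each costing at
    most one dimension; from \<open>2 deg E + 1\<close> at least two remain, enough for a
    nonconstant function.\<close>
  have "VS.dim (h.Lp (\<lambda>v. h.pr P v + h.pd Rs' v)) \<le> VS.dim (h.Lp (h.pr P)) + length Rs'"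
    by (rule h.Lp_add_pd[OF h.sym_pr[OF P]]) (use Rs PR in auto)
  hence "VS.dim (h.Lp (h.pr P)) \<ge> 2" using ge len Rs(2) PR by (simp add: h.pd_Cons)
  then obtain \<xi> where "\<xi> \<in> h.Lp (h.pr P)" "\<xi> \<notin> range emb" using ex_nonconst_if_dim_ge_2 by blast
  thus ?thesis using P unfolding hyp_coord_def by blast
qed

context
  fixes \<xi> P assumes \<xi>: "hyp_coord \<xi> P"
begin

lemma hc_P: "P \<in> PL" and hc_nonconst: "\<xi> \<notin> range emb" and hc_LL: "\<xi> \<in> LL (h.pr P)" and hc_h: "h \<xi> = \<xi>"
  using \<xi> by (auto simp: hyp_coord_def h.Lp_def)

lemma h_ratf: "z \<in> ratf \<xi> \<Longrightarrow> h z = z"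
  by (rule h.ratf_fixed[OF hc_h])

text \<open>\<open>K\<close> has degree at most 2 over \<open>k(\<xi>)\<close>, so 1, an
  anti-invariant \<open>y\<close> and \<open>f\<close> are dependent. Applying \<open>h\<close>
  eliminates \<open>y\<close> and expresses \<open>f\<close> by \<open>\<xi>\<close>.\<close>

lemma h_fixed_ratf:
  assumes "h f = f"
  shows "f \<in> ratf \<xi>"
proof -
  obtain y where y: "y \<noteq> 0" "h y = - y" using h.ex_anti by blast
  define u where "u i = (if i = 0 then 1 else if i = 1 then y else f)" for i :: nat
  obtain p where p: "\<exists>i<3. p i \<noteq> 0" "(\<Sum>i<3. ev (p i) \<xi> * u i) = 0"
    using dependent_over_ratf[OF h.sym_Div[OF h.sym_pr[OF hc_P]] h.pr_nonneg hc_LL hc_nonconst, of 3 u] h.degree_pr[OF hc_P]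
    by auto
  have eq: "ev (p 0) \<xi> + ev (p 1) \<xi> * y + ev (p 2) \<xi> * f = 0"
    using p(2) by (simp add: u_def numeral_3_eq_3 numeral_2_eq_2)
  have "h (ev (p 0) \<xi> + ev (p 1) \<xi> * y + ev (p 2) \<xi> * f) = ev (p 0) \<xi> - ev (p 1) \<xi> * y + ev (p 2) \<xi> * f"
    using y(2) assms hc_h by (simp only: h.add h.mult h.ev) simp
  hence eq': "ev (p 0) \<xi> - ev (p 1) \<xi> * y + ev (p 2) \<xi> * f = 0" using eq by simp
  have "2 * (ev (p 1) \<xi> * y) = (ev (p 0) \<xi> + ev (p 1) \<xi> * y + ev (p 2) \<xi> * f) -
      (ev (p 0) \<xi> - ev (p 1) \<xi> * y + ev (p 2) \<xi> * f)" by simp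
  also have "\<dots> = 0" unfolding eq eq' by simp
  finally have "2 * (ev (p 1) \<xi> * y) = 0" .
  hence p1: "p 1 = 0" using y(1) ev_eq_0_iff[OF hc_nonconst] by simp
  hence eq2: "ev (p 0) \<xi> + ev (p 2) \<xi> * f = 0" using eq by simp
  have p2: "p 2 \<noteq> 0"
  proof
    assume "p 2 = 0"
    hence "p 0 = 0" using eq2 ev_eq_0_iff[OF hc_nonconst] by simp
    moreover have "i < 3 \<Longrightarrow> i = 0 \<or> i = 1 \<or> i = 2" for i :: nat by auto
    ultimately show False using p(1) p1 \<open>p 2 = 0\<close> by metis
  qed
  hence p2': "ev (p 2) \<xi> \<noteq> 0" using ev_eq_0_iff[OF hc_nonconst] by simp
  have "f * ev (p 2) \<xi> = ev (- p 0) \<xi>" using eq2 by (simp add: ev_minus eq_neg_iff_add_eq_0 algebra_simps)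
  hence "f = ev (- p 0) \<xi> / ev (p 2) \<xi>" by (rule eq_divide_imp[OF p2'])
  thus ?thesis using ratfI[of "p 2" \<xi> "- p 0"] p2 ev_eq_0_iff[OF hc_nonconst] by simp
qed

text \<open>\<open>L\<^sup>+(0)\<close> consists of constants and one pullback adds at most one
  dimension, so 1 and \<open>\<xi>\<close> already span.\<close>

lemma Lp_pr_span:
  assumes f: "f \<in> h.Lp (h.pr P)"
  shows "\<exists>a b. f = emb a + emb b * \<xi>"
proof -
  have Xm: "\<xi> \<in> h.Lp (h.pr P)" using \<xi> by (simp add: hyp_coord_def)
  have one: "1 \<in> h.Lp (h.pr P)"
    using h.pr_nonneg by (auto simp: h.Lp_def mem_LL vge_def v_1)
  have s1: "VS.span {1} = range emb" by (auto simp: VS.span_singleton)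
  have "VS.independent {1}" by simp
  hence "VS.independent (insert \<xi> {1})"
    using hc_nonconst s1 by (intro VS.independent_insertI[of _ "{1}"]) auto
  hence d2: "VS.dim (VS.span {\<xi>, 1}) = 2"
  proof -
    have "\<xi> \<noteq> 1" using hc_nonconst rangeI[of emb 1] by auto
    thus ?thesis using VS.dim_span_eq_card_independent[OF \<open>VS.independent (insert \<xi> {1})\<close>] by simp
  qed
  have sub: "VS.span {\<xi>, 1} \<subseteq> h.Lp (h.pr P)"
    by (rule VS.span_minimal) (use Xm one h.subspace_Lp in auto)
  have "h.sym (\<lambda>v. 0)" by (simp add: h.sym_def)
  from h.Lp_add_pr[OF this hc_P]
  have "VS.dim (h.Lp (h.pr P)) \<le> VS.dim (h.Lp (\<lambda>v. 0)) + 1" by simp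
  also have "VS.dim (h.Lp (\<lambda>v. 0)) \<le> 1"
    using dim_mono[OF fin_dim_LL[OF Div_zero] h.Lp_subset] dim_range_emb(1) by (simp add: LL_zero)
  finally have le: "VS.dim (h.Lp (h.pr P)) \<le> 2" by simp
  have "f \<in> VS.span {\<xi>, 1}"
  proof (rule ccontr)
    assume "f \<notin> VS.span {\<xi>, 1}"
    from dim_Suc_le[OF h.fin_dim_Lp[OF h.sym_Div[OF h.sym_pr[OF hc_P]]] VS.subspace_span sub f this]
    show False using d2 le by simp
  qed
  then obtain k where "f - emb k * \<xi> \<in> VS.span {1}" by (auto simp: VS.span_insert)
  then obtain a where "f - emb k * \<xi> = emb a" unfolding s1 by auto
  hence "f = emb a + emb k * \<xi>" by (simp add: algebra_simps)
  thus ?thesis by blast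
qed

lemma hyp_coord_affine:
  assumes "b \<noteq> 0"
  shows "hyp_coord (emb a + emb b * \<xi>) P"
proof -
  have "emb a + emb b * \<xi> \<notin> range emb"
  proof
    assume "emb a + emb b * \<xi> \<in> range emb"
    then obtain c where "emb a + emb b * \<xi> = emb c" by auto
    hence "emb b * \<xi> + emb (a - c) = 0" by (simp add: emb_diff algebra_simps)
    thus False using linear_relation(1)[OF hc_nonconst] assms by blast
  qed
  moreover have "emb a + emb b * \<xi> \<in> h.Lp (h.pr P)"
  proof -
    have "emb a * 1 \<in> h.Lp (h.pr P)" using h.pr_nonneg
      by (intro VS.subspace_scale[OF h.subspace_Lp]) (auto simp: h.Lp_def mem_LL vge_def v_1)
    moreover have "emb b * \<xi> \<in> h.Lp (h.pr P)"
      using \<xi> by (intro VS.subspace_scale[OF h.subspace_Lp]) (auto simp: hyp_coord_def)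
    ultimately show ?thesis using VS.subspace_add[OF h.subspace_Lp] by simp
  qed
  ultimately show ?thesis using hc_P by (simp add: hyp_coord_def)
qed

lemma coordinate_minus_nz: "\<xi> - emb c \<noteq> 0"
  using hc_nonconst by auto

text \<open>\<open>div (\<xi> - c) + pr P\<close> is effective of degree 2 and dominates
  \<open>pr v'\<close>, also of degree 2; hence they coincide, and \<open>pr v'\<close> bounds the
  poles of the inverse.\<close>

lemma hyp_coord_inverse:
  assumes v': "v' \<in> PL" "vge v' 1 (\<xi> - emb c)"
  shows "hyp_coord (inverse (\<xi> - emb c)) v'"
proof -
  let ?x = "\<xi> - emb c"
  have hx: "h ?x = ?x" using hc_h by (simp only: h.diff h.const)
  have xL: "?x \<in> LL (h.pr P)"
  proof -
    have "emb (- c) + emb 1 * \<xi> \<in> h.Lp (h.pr P)" using hyp_coord_affine[of 1 "- c"] by (simp add: hyp_coord_def)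
    thus ?thesis by (simp add: h.Lp_def emb_minus)
  qed
  define D where "D = (\<lambda>v. pdiv ?x v + h.pr P v)"
  note sp = h.sym_Div[OF h.sym_pr[OF hc_P]] and sv = h.sym_Div[OF h.sym_pr[OF v'(1)]]
  note DD = Div_add[OF pdiv_Div[OF UNIV_I coordinate_minus_nz[of c]] sp, folded D_def]
  have D2: "divisor_degree D = 2"
    using DD(2) degree_pdiv[OF UNIV_I coordinate_minus_nz[of c]] h.degree_pr[OF hc_P] by simp
  have D0: "0 \<le> D v" for v
    using LL_vge[OF xL, of v] coordinate_minus_nz h.pr_nonneg by (auto simp: D_def pdiv_def vge_def)
  have inv: "v (h ?x) = v ?x" for v by (simp only: hx)
  have "h.pr v' v \<le> D v" for v
  proof (cases "v = v' \<or> v = v' \<circ> h")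
    case True
    have v: "v \<in> PL" using True v'(1) h.place by auto
    have "v ?x = v' ?x" using True inv by auto
    hence vx: "v ?x \<ge> 1" using v'(2) coordinate_minus_nz by (simp add: vge_def)
    have e: "even (v ?x)" if "v \<circ> h = v" by (rule h.fixed_parity(1)[OF v that coordinate_minus_nz hx])
    have "h.pr v' v \<le> v ?x"
    proof (cases "v \<circ> h = v")
      case F: True
      hence "v ?x \<ge> 2" using e vx by presburger
      moreover have "h.pr v' v \<le> 2" by (simp add: h.pr_def pt_def)
      ultimately show ?thesis by simp
    next
      case False
      have "h.pr v' v = 1"
      proof (cases "v = v'")
        case True
        thus ?thesis using False by (auto simp: h.pr_def pt_def)
      next
        case F: False
        hence "v = v' \<circ> h" using True by blast
        thus ?thesis using F by (auto simp: h.pr_def pt_def)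
      qed
      thus ?thesis using vx by simp
    qed
    thus ?thesis using v h.pr_nonneg[of P v] by (simp add: D_def pdiv_def)
  next
    case False
    thus ?thesis using D0[of v] by (simp add: h.pr_def pt_def)
  qed
  hence Deq: "D v = h.pr v' v" for v
    using degree_zero_imp[OF Div_diff(1)[OF DD(1) sv], of v] Div_diff(2)[OF DD(1) sv] D2 h.degree_pr[OF v'(1)] by simp
  have "inverse ?x \<in> LL (h.pr v')"
  proof (rule LL_I)
    fix v assume v: "v \<in> PL"
    have "- h.pr v' v \<le> - v ?x" using Deq[of v] v h.pr_nonneg[of P v] by (simp add: D_def pdiv_def)
    thus "vge v (- h.pr v' v) (inverse ?x)" using v by (simp add: vge_def v_inverse)
  qed simp
  moreover have "h (inverse ?x) = inverse ?x" by (simp only: h.inverse hx)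
  ultimately show ?thesis
    using v'(1) emb_notin_ratf_inverse[OF hc_nonconst] by (simp add: hyp_coord_def h.Lp_def)
qed

lemma ex_zero_coordinate: "\<exists>v\<in>PL. vge v 1 (\<xi> - emb c)"
proof -
  have "\<xi> - emb c \<notin> range emb"
  proof
    assume "\<xi> - emb c \<in> range emb"
    then obtain e where "\<xi> = emb (c + e)" by (auto simp: emb_add algebra_simps)
    thus False using hc_nonconst by blast
  qed
  thus ?thesis using zero_exists[of "\<xi> - emb c"] by (force simp: vge_def)
qed

text \<open>The poles of \<open>\<sigma> \<xi>\<close> lie over \<open>w = P \<circ> \<tau>\<close>.
  Either \<open>\<xi>\<close> has its pole there too, or \<open>1 / (\<xi> - c)\<close> does for a
  suitable \<open>c\<close>; functions with the same simple pole on the line differ by an affine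
  map.\<close>

lemma moebius:
  assumes "curve_automorphism emb 2 \<sigma>" "curve_automorphism emb 2 \<tau>" 
    and \<sigma>\<tau>: "\<And>z. \<sigma> (\<tau> z) = z" "\<And>z. \<tau> (\<sigma> z) = z" and comm: "\<And>z. h (\<sigma> z) = \<sigma> (h z)"
  shows "\<exists>a b. b \<noteq> 0 \<and> (\<sigma> \<xi> = emb a + emb b * \<xi> \<or> (\<exists>c. \<sigma> \<xi> = emb a + emb b * inverse (\<xi> - emb c)))"
proof -
  interpret \<sigma>: curve_automorphism emb 2 \<sigma> by fact
  interpret \<tau>: curve_automorphism emb 2 \<tau> by fact
  define w where "w = P \<circ> \<tau>"
  have w: "w \<in> PL" unfolding w_def by (rule \<tau>.place[OF hc_P])
  have comm': "h (\<tau> z) = \<tau> (h z)" for z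
    using comm[of "\<tau> z"] \<sigma>\<tau> by metis
  have pr: "h.pr P (v \<circ> \<sigma>) = h.pr w v" for v
  proof -
    have "v \<circ> \<sigma> = P \<longleftrightarrow> v = w" unfolding w_def using \<sigma>\<tau> by (auto simp: fun_eq_iff) (metis)
    moreover have "v \<circ> \<sigma> = P \<circ> h \<longleftrightarrow> v = w \<circ> h"
      unfolding w_def using \<sigma>\<tau> comm comm' by (auto simp: fun_eq_iff) (metis comp_apply)+
    ultimately show ?thesis by (simp add: h.pr_def pt_def)
  qed
  have "\<sigma> \<xi> \<in> LL (\<lambda>v. h.pr P (v \<circ> \<sigma>))" by (rule \<sigma>.image_LL[OF hc_LL])
  hence "\<sigma> \<xi> \<in> LL (h.pr w)" by (simp only: pr)
  hence m: "\<sigma> \<xi> \<in> h.Lp (h.pr w)" using comm[of \<xi>] hc_h by (simp add: h.Lp_def)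
  have nc: "\<sigma> \<xi> \<notin> range emb" by (rule \<sigma>.nonconst[OF hc_nonconst])
  show ?thesis
  proof (cases "vge w 0 \<xi>")
    case True
    then obtain c where c: "vge w 1 (\<xi> - emb c)" using residue[OF w, of \<xi>] by auto
    have "\<exists>a b. \<sigma> \<xi> = emb a + emb b * inverse (\<xi> - emb c)"
      using dihedral_curve.Lp_pr_span[OF dihedral_curve_axioms hyp_coord_inverse[OF w c] m] .
    then obtain a b where ab: "\<sigma> \<xi> = emb a + emb b * inverse (\<xi> - emb c)" by blast
    hence "b \<noteq> 0" using nc by auto
    thus ?thesis using ab by blast
  next
    case False
    hence "w = P \<or> w = P \<circ> h" using LL_vge[OF hc_LL w] by (auto simp: h.pr_def pt_def split: if_splits)
    hence "h.pr w = h.pr P" using h.pr_swap by auto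
    hence "\<sigma> \<xi> \<in> h.Lp (h.pr P)" using m by simp
    then obtain a b where ab: "\<sigma> \<xi> = emb a + emb b * \<xi>" using Lp_pr_span by blast
    hence "b \<noteq> 0" using nc by auto
    thus ?thesis using ab by blast
  qed
qed

text \<open>\<open>K\<close> is generated over the fixed field of \<open>h\<close> by an
  anti-invariant \<open>y\<close> with \<open>y^2\<close> in \<open>k(\<xi>)\<close>, so
  \<open>\<sigma> y\<close> can only be \<open>y\<close> or \<open>- y\<close>.\<close>

lemma fixes_coordinate:
  assumes "curve_automorphism emb 2 \<sigma>" "\<sigma> \<xi> = \<xi>"
  shows "\<sigma> = id \<or> \<sigma> = h"
proof -
  interpret \<sigma>: curve_automorphism emb 2 \<sigma> by fact
  obtain y where y: "y \<noteq> 0" "h y = - y" using h.ex_anti by blast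
  have fx: "\<sigma> z = z" if "h z = z" for z
    using \<sigma>.ratf_fixed[OF assms(2) h_fixed_ratf[OF that]] .
  have "h (y * y) = y * y" using y by (simp only: h.mult) simp
  hence "\<sigma> y * \<sigma> y = y * y" using fx[of "y * y"] by (simp add: \<sigma>.mult)
  hence pm: "\<sigma> y = y \<or> \<sigma> y = - y" by (simp add: square_eq_iff)
  have dec: "\<exists>a b. h a = a \<and> h b = b \<and> z = a + b * y" for z
  proof (rule exI[of _ "(z + h z) / 2"], rule exI[of _ "(z - h z) / (2 * y)"], intro conjI)
    have 1: "h (z - h z) = - (z - h z)" by (simp only: h.diff h.hh) simp
    have 2: "h (2 * y) = - (2 * y)" using y h.const[of 2] by (simp only: h.mult emb_numeral) simp
    show "h ((z - h z) / (2 * y)) = (z - h z) / (2 * y)"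
      by (simp only: h.divide 1 2 minus_divide_divide)
    show "h ((z + h z) / 2) = (z + h z) / 2"
      using h.const[of 2] by (simp only: h.divide h.add h.hh emb_numeral) (simp add: add.commute)
    show "z = (z + h z) / 2 + (z - h z) / (2 * y) * y" using y(1) by (simp add: field_simps)
  qed
  show ?thesis
  proof (cases "\<sigma> y = y")
    case True
    have "\<sigma> z = z" for z
    proof -
      obtain a b where "h a = a" "h b = b" "z = a + b * y" using dec by blast
      thus ?thesis using fx True by (simp add: \<sigma>.add \<sigma>.mult)
    qed
    thus ?thesis by (simp add: fun_eq_iff)
  next
    case False
    hence m: "\<sigma> y = - y" using pm by blast
    have "\<sigma> z = h z" for z
    proof -
      obtain a b where ab: "h a = a" "h b = b" "z = a + b * y" using dec by blast
      have "h z = a - b * y" unfolding ab(3) using ab y by (simp only: h.add h.mult) simp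
      thus ?thesis using fx[OF ab(1)] fx[OF ab(2)] m ab(3) by (simp add: \<sigma>.add \<sigma>.mult)
    qed
    thus ?thesis by (simp add: fun_eq_iff)
  qed
qed

lemma r_moves_coordinate: "r \<xi> \<noteq> \<xi>"
proof
  assume "r \<xi> = \<xi>"
  hence "r = id \<or> r = h" by (rule fixes_coordinate[OF r.curve_automorphism_axioms])
  thus False
  proof
    assume "r = id" thus False using r2 by simp
  next
    assume eq: "r = h"
    have "r z = z" for z
      using fun_cong[OF eq, of z] by simp
    thus False using r2 by (auto simp: fun_eq_iff)
  qed
qed

end

text \<open>An involution of the line becomes \<open>- \<xi>\<close> once its two fixed points are
  placed at 0 and infinity. In the non-affine case, being an involution forces the form
  \<open>x \<mapsto> b / x\<close>.\<close>

lemma ex_coord_r: "\<exists>\<xi> P. hyp_coord \<xi> P \<and> r \<xi> = - \<xi>"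
proof -
  obtain \<xi> P where \<xi>: "hyp_coord \<xi> P" using ex_hyp_coord by blast
  note nc = hc_nonconst[OF \<xi>]
  have rr: "r (r \<xi>) = \<xi>" using hc_h[OF \<xi>] by simp
  have aut_rrr: "curve_automorphism emb 2 (r \<circ> r \<circ> r)"
  proof unfold_locales
    show "r \<circ> r \<circ> r \<in> carrier (Aut_group emb)" using r_aut by (auto simp: Aut_iff bij_comp)
  qed
  have "\<exists>a b. b \<noteq> 0 \<and> (r \<xi> = emb a + emb b * \<xi> \<or> (\<exists>c. r \<xi> = emb a + emb b * inverse (\<xi> - emb c)))"
    by (rule moebius[OF \<xi> r.curve_automorphism_axioms aut_rrr]) (simp_all add: r4)
  then obtain a b where b0: "b \<noteq> 0" and
    cases: "r \<xi> = emb a + emb b * \<xi> \<or> (\<exists>c. r \<xi> = emb a + emb b * inverse (\<xi> - emb c))" by blast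
  from cases show ?thesis
  proof
    assume rX: "r \<xi> = emb a + emb b * \<xi>"
    have "r (r \<xi>) = emb a + emb b * (emb a + emb b * \<xi>)"
      by (subst rX) (simp only: r.add r.mult r.const rX)
    hence "emb (b * b - 1) * \<xi> + emb (a + b * a) = 0" using rr by (simp add: emb_hom algebra_simps)
    from linear_relation[OF nc this] have b1: "b * b = 1" "a * (1 + b) = 0" by (simp_all add: algebra_simps)
    have "b \<noteq> 1"
    proof
      assume "b = 1"
      hence "a = 0" using b1 by simp
      thus False using rX \<open>b = 1\<close> r_moves_coordinate[OF \<xi>] by simp
    qed
    hence bm: "b = - 1" using b1(1) square_eq_1_iff[of b] by auto
    have "r (emb (- a / 2) + emb 1 * \<xi>) = - (emb (- a / 2) + emb 1 * \<xi>)"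
    proof -
      have "r (emb (- a / 2) + emb 1 * \<xi>) = emb (- a / 2) + r \<xi>" by (simp add: r.add)
      also have "\<dots> = - (emb (- a / 2) + emb 1 * \<xi>)" unfolding rX bm by (simp add: emb_hom field_simps)
      finally show ?thesis .
    qed
    thus ?thesis using hyp_coord_affine[OF \<xi>, of 1 "- a / 2"] by auto
  next
    assume "\<exists>c. r \<xi> = emb a + emb b * inverse (\<xi> - emb c)"
    then obtain c where rX: "r \<xi> = emb a + emb b * inverse (\<xi> - emb c)" by blast
    define x where "x = \<xi> - emb c"
    define d where "d = a - c"
    have x0: "x \<noteq> 0" unfolding x_def by (rule coordinate_minus_nz[OF \<xi>])
    have rx: "r x = emb d + emb b / x" unfolding x_def d_def using rX by (simp add: r.diff emb_diff divide_inverse)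
    have "hyp_coord x P" using hyp_coord_affine[OF \<xi>, of 1 "- c"] by (simp add: x_def emb_minus)
    hence ncx: "x \<notin> range emb" by (rule hc_nonconst)
    have "r (r x) = emb d + emb b / (emb d + emb b / x)"
      by (subst rx) (simp only: r.add r.divide r.const rx)
    moreover have "r (r x) = x" using rr by (simp add: x_def r.diff)
    moreover have "emb d + emb b / x \<noteq> 0" using rx x0 r.eq_0[of x] by simp
    ultimately have "(x - emb d) * (emb d + emb b / x) = emb b" by (intro clear_denominator) simp_all
    hence "(x - emb d) * (emb d * x + emb b) = emb b * x" using x0 by (simp add: field_simps)
    hence "emb d * (x * x) + emb (- (d * d)) * x + emb (- (d * b)) = 0" by (simp add: emb_hom algebra_simps)
    hence d0: "d = 0" by (rule quadratic_relation(1)[OF ncx])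
    obtain k where k: "k * k = b" using sqrt_const[of b] by (auto simp: power2_eq_square)
    have k0: "k \<noteq> 0" using k b0 by auto
    have rx': "r x = emb k * emb k / x" using rx d0 by (simp add: k[symmetric] emb_mult)
    obtain v where v: "v \<in> PL" "vge v 1 (\<xi> - emb (c - k))" using ex_zero_coordinate[OF \<xi>] by blast
    have Xk: "\<xi> - emb (c - k) = x + emb k" by (simp add: x_def emb_diff)
    have xk0: "x + emb k \<noteq> 0" using coordinate_minus_nz[OF \<xi>, of "c - k"] Xk by simp
    \<comment> \<open>This is \<open>(x - k) / (x + k)\<close>: it sends the fixed points
      \<open>k\<close> and \<open>- k\<close> of \<open>x \<mapsto> k^2 / x\<close> to 0 and
      infinity.\<close>
    let ?Y = "emb 1 + emb (- 2 * k) * inverse (x + emb k)"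
    have "hyp_coord ?Y v"
      using hyp_coord_affine[OF hyp_coord_inverse[OF \<xi> v], of "- 2 * k" 1] k0 Xk by simp
    moreover have "r ?Y = - ?Y"
    proof -
      have Y: "?Y = (x - emb k) / (x + emb k)" using xk0 by (simp add: emb_hom field_simps)
      have "r (x + emb k) = emb k * (emb k + x) / x" using rx' x0 by (simp add: r.add field_simps)
      moreover have "r (x - emb k) = emb k * (emb k - x) / x" using rx' x0 by (simp add: r.diff field_simps)
      ultimately have "r ?Y = (emb k - x) / (emb k + x)" unfolding Y r.divide using x0 k0 by simp
      also have "\<dots> = - ?Y" unfolding Y by (simp add: minus_divide_left add.commute)
      finally show ?thesis .
    qed
    ultimately show ?thesis by blast
  qed
qed

text \<open>On the line \<open>s\<close> commutes with \<open>\<xi> \<mapsto> - \<xi>\<close>, so it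
  is \<open>b \<xi>\<close> or \<open>b / \<xi>\<close>. The first has \<open>b = 1\<close> or
  \<open>b = - 1\<close>, and \<open>s\<close> or \<open>s r\<close> would fix \<open>\<xi>\<close>,
  which \<open>s_ne\<close> excludes.\<close>

lemma ex_coord: "\<exists>\<xi> P. hyp_coord \<xi> P \<and> r \<xi> = - \<xi> \<and> s \<xi> = inverse \<xi>"
proof -
  obtain \<xi> P where \<xi>: "hyp_coord \<xi> P" and rX: "r \<xi> = - \<xi>" using ex_coord_r by blast
  note nc = hc_nonconst[OF \<xi>]
  have X0: "\<xi> \<noteq> 0" using coordinate_minus_nz[OF \<xi>, of 0] by simp
  have comm: "s (r \<xi>) = r (s \<xi>)"
  proof -
    have "h (s \<xi>) = s \<xi>" using hs[of \<xi>] hc_h[OF \<xi>] by simp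
    thus ?thesis using sr[of \<xi>] by simp
  qed
  have "\<exists>a b. b \<noteq> 0 \<and> (s \<xi> = emb a + emb b * \<xi> \<or> (\<exists>c. s \<xi> = emb a + emb b * inverse (\<xi> - emb c)))"
    by (rule moebius[OF \<xi> s.curve_automorphism_axioms s.curve_automorphism_axioms]) (simp_all add: s2 hs[simplified])
  then obtain a b where b0: "b \<noteq> 0" and
    cases: "s \<xi> = emb a + emb b * \<xi> \<or> (\<exists>c. s \<xi> = emb a + emb b * inverse (\<xi> - emb c))" by blast
  from cases show ?thesis
  proof
    assume sX: "s \<xi> = emb a + emb b * \<xi>"
    have "- (emb a + emb b * \<xi>) = emb a + emb b * (- \<xi>)"
      using comm unfolding rX s.minus sX by (simp add: r.add r.mult rX)
    hence "emb (2 * a) = 0" by (simp add: emb_hom algebra_simps)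
    hence a0: "a = 0" by simp
    hence sX': "s \<xi> = emb b * \<xi>" using sX by simp
    have "\<xi> = s (s \<xi>)" by (simp add: s2)
    also have "\<dots> = emb b * (emb b * \<xi>)" by (simp only: sX' s.mult s.const)
    finally have "emb (b * b) = 1" using X0 by (simp add: emb_mult)
    hence "b * b = 1" using emb_eq_iff[of "b * b" 1] by simp
    hence "b = 1 \<or> b = - 1" by (simp add: square_eq_1_iff)
    thus ?thesis
    proof
      assume "b = 1"
      hence "s \<xi> = \<xi>" using sX' by simp
      hence "s = id \<or> s = h" by (rule fixes_coordinate[OF \<xi> s.curve_automorphism_axioms])
      thus ?thesis using s_ne by blast
    next
      assume "b = - 1"
      hence "(s \<circ> r) \<xi> = \<xi>" using sX' rX by (simp add: s.minus emb_minus)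
      moreover have "curve_automorphism emb 2 (s \<circ> r)"
      proof unfold_locales
        show "s \<circ> r \<in> carrier (Aut_group emb)" using r_aut s_aut by (auto simp: Aut_iff bij_comp)
      qed
      ultimately have "s \<circ> r = id \<or> s \<circ> r = h" using fixes_coordinate[OF \<xi>] by blast
      thus ?thesis using s_ne by blast
    qed
  next
    assume "\<exists>c. s \<xi> = emb a + emb b * inverse (\<xi> - emb c)"
    then obtain c where sX: "s \<xi> = emb a + emb b * inverse (\<xi> - emb c)" by blast
    have n1: "\<xi> - emb c \<noteq> 0" by (rule coordinate_minus_nz[OF \<xi>])
    have n2: "- \<xi> - emb c \<noteq> 0"
    proof
      assume "- \<xi> - emb c = 0"
      moreover have "\<xi> - emb (- c) = - (- \<xi> - emb c)" by (simp add: emb_minus)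
      ultimately have "\<xi> - emb (- c) = 0" by simp
      thus False using coordinate_minus_nz[OF \<xi>] by blast
    qed
    have "- (emb a + emb b * inverse (\<xi> - emb c)) = emb a + emb b * inverse (- \<xi> - emb c)"
      using comm unfolding rX s.minus sX by (simp add: r.add r.mult r.inverse r.diff rX)
    hence "- (emb a + emb b / (\<xi> - emb c)) = emb a + emb b / (- \<xi> - emb c)" by (simp add: divide_inverse)
    hence "2 * emb a * (\<xi> - emb c) * (- \<xi> - emb c) + emb b * (- \<xi> - emb c) + emb b * (\<xi> - emb c) = 0"
      by (rule clear_denominators[OF n1 n2])
    moreover have "emb (- 2 * a) * (\<xi> * \<xi>) + emb 0 * \<xi> + emb (2 * a * c * c - 2 * b * c) =
      2 * emb a * (\<xi> - emb c) * (- \<xi> - emb c) + emb b * (- \<xi> - emb c) + emb b * (\<xi> - emb c)"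
      unfolding emb_mult emb_diff emb_minus emb_numeral emb_0 by (simp only: algebra_simps) (simp add: emb_mult)
    ultimately have "emb (- 2 * a) * (\<xi> * \<xi>) + emb 0 * \<xi> + emb (2 * a * c * c - 2 * b * c) = 0"
      by (simp only:)
    from quadratic_relation(1,3)[OF nc this] have 0: "- 2 * a = 0" "2 * a * c * c - 2 * b * c = 0" .
    have a0: "a = 0" using 0(1) by simp
    have "c = 0" using 0(2) a0 b0 by simp
    hence sX': "s \<xi> = emb b / \<xi>" using sX a0 by (simp add: divide_inverse)
    obtain k where k: "k * k = b" using sqrt_const[of b] by (auto simp: power2_eq_square)
    have k0: "k \<noteq> 0" using k b0 by auto
    \<comment> \<open>Dividing by a square root \<open>k\<close> of \<open>b\<close> turns
      \<open>b / \<xi>\<close> into the inverse.\<close>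
    let ?Y = "emb 0 + emb (inverse k) * \<xi>"
    have "hyp_coord ?Y P" using hyp_coord_affine[OF \<xi>, of "inverse k" 0] k0 by simp
    moreover have "r ?Y = - ?Y" by (simp add: r.mult rX)
    moreover have "s ?Y = inverse ?Y"
    proof -
      have "s ?Y = emb (inverse k) * (emb b / \<xi>)" by (simp add: s.mult sX')
      also have "\<dots> = emb (inverse k * b) / \<xi>" by (simp add: emb_mult)
      also have "inverse k * b = k" using k0 by (simp add: k[symmetric])
      also have "emb k / \<xi> = inverse ?Y" by (simp add: emb_inverse divide_inverse)
      finally show ?thesis .
    qed
    ultimately show ?thesis by blast
  qed
qed

end

subsection \<open>The normal form\<close>

lemma sqfree_order_le:
  fixes f :: "'k::field poly"
  assumes "f \<noteq> 0" "\<not> [:- c, 1:] * [:- c, 1:] dvd f"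
  shows "Polynomial.order c f \<le> 1"
  using order_divides[of c 2 f] assms by (simp add: power2_eq_square not_le flip: not_less_eq_eq)

lemma has_genus_unique:
  assumes "has_genus emb F g" "has_genus emb F g'"
  shows "g = g'"
proof -
  have le: "g \<le> g'" if g: "has_genus emb F g" and g': "has_genus emb F g'" for g g'
  proof -
    obtain D where "D \<in> divisors emb F" "divisor_degree D - int (ell emb F D) + 1 = int g"
      using g by (auto simp: has_genus_def)
    moreover have "\<forall>D\<in>divisors emb F. divisor_degree D - int (ell emb F D) + 1 \<le> int g'"
      using g' by (simp add: has_genus_def)
    ultimately have "int g \<le> int g'" by metis
    thus ?thesis by simp
  qed
  show ?thesis using le assms by (meson antisym)
qed

context constants
begin

text \<open>In lowest terms \<open>p^2 f = q^2 g\<close>: a root of \<open>q\<close> would be a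
  multiple root of the squarefree \<open>f\<close>, and the degree bound then leaves no room for a
  nonconstant \<open>p\<close>.\<close>

lemma square_ratio_const:
  assumes x: "x \<notin> range emb" and \<rho>: "\<rho> \<in> ratf x" and eq: "\<rho> * \<rho> * ev f x = ev g x"
    and f: "f \<noteq> 0" "\<And>c. \<not> [:- c, 1:] * [:- c, 1:] dvd f" and g: "g \<noteq> 0" "degree g \<le> degree f"
  shows "\<exists>c. \<rho> = emb c \<and> g = Polynomial.smult (c * c) f"
proof -
  note e0 = ev_eq_0_iff[OF x]
  define R where "R n \<longleftrightarrow> (\<exists>p q. q \<noteq> 0 \<and> degree q = n \<and> \<rho> = ev p x / ev q x)" for n
  have "\<exists>n. R n" using \<rho> e0 unfolding R_def ratf_def by blast
  hence "R (LEAST n. R n)" by (rule LeastI_ex)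
  then obtain p q where r: "q \<noteq> 0" "degree q = (LEAST n. R n)" "\<rho> = ev p x / ev q x"
    unfolding R_def by blast
  have "ev (p * p * f) x = ev (q * q * g) x"
    using eq r(1) e0 unfolding r(3) by (simp add: ev_mult field_simps)
  hence pq: "p * p * f = q * q * g" by (simp only: ev_eq_iff[OF x])
  have p0: "p \<noteq> 0" using pq r(1) g(1) by auto
  have "degree q = 0"
  proof (rule ccontr)
    assume "degree q \<noteq> 0"
    then obtain c where qc: "poly q c = 0" using alg_closed_imp_poly_has_root[of q] by auto
    have pc: "poly p c \<noteq> 0"
    proof
      assume "poly p c = 0"
      then obtain p' q' where f': "p = [:- c, 1:] * p'" "q = [:- c, 1:] * q'"
        using qc by (meson dvdE poly_eq_0_iff_dvd)
      have q0: "q' \<noteq> 0" using r(1) f'(2) by auto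
      have "degree q = Suc (degree q')" unfolding f'(2) using q0 by (subst degree_mult_eq) auto
      moreover have "\<rho> = ev p' x / ev q' x"
      proof -
        have "x - emb c \<noteq> 0" using x by auto
        moreover have "ev p x = (x - emb c) * ev p' x" "ev q x = (x - emb c) * ev q' x"
          unfolding f' ev_mult by (simp_all add: emb_minus)
        ultimately show ?thesis using r(3) by simp
      qed
      hence "R (degree q')" unfolding R_def using q0 by blast
      hence "(LEAST n. R n) \<le> degree q'" by (rule Least_le)
      ultimately show False using r(2) by simp
    qed
    have "Polynomial.order c (p * p * f) = Polynomial.order c f"
      using p0 f(1) pc order_root[of p c] by (simp add: order_mult)
    moreover have "Polynomial.order c (q * q * g) \<ge> 2"
      using r(1) g(1) qc order_root[of q c] by (simp add: order_mult)
    ultimately show False using pq sqfree_order_le[OF f(1) f(2)[of c]] by simp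
  qed
  then obtain k where k: "q = [:k:]" by (metis degree_eq_zeroE)
  have k0: "k \<noteq> 0" using r(1) k by simp
  have "2 * degree p + degree f = degree g"
    using arg_cong[OF pq, of degree] p0 f(1) g(1) k k0 by (simp add: degree_mult_eq)
  hence "degree p = 0" using g(2) by simp
  then obtain l where l: "p = [:l:]" by (metis degree_eq_zeroE)
  have "\<rho> = emb (l / k)" using r(3) k l by (simp add: emb_divide)
  moreover have "emb (l / k) * emb (l / k) * ev f x = ev g x"
    using eq by (simp only: \<open>\<rho> = emb (l / k)\<close>)
  hence "ev (Polynomial.smult ((l / k) * (l / k)) f) x = ev g x"
    by (simp only: ev_smult emb_mult)
  hence "Polynomial.smult ((l / k) * (l / k)) f = g" by (simp only: ev_eq_iff[OF x])
  ultimately show ?thesis by (intro exI[of _ "l / k"]) simp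
qed

end

context dihedral_curve
begin

text \<open>\<open>b * b \<noteq> 4\<close> says that the quintic has no multiple root.
  \<open>\<mu>\<close> is a square root of -1 because \<open>r^2\<close> negates
  \<open>y\<close>.\<close>

definition normal_form :: "'a \<Rightarrow> 'a \<Rightarrow> 'k \<Rightarrow> 'k \<Rightarrow> bool" where
  "normal_form \<xi> y b \<mu> \<longleftrightarrow> \<xi> \<notin> range emb \<and> y \<noteq> 0 \<and> UNIV = quad_ext (ratf \<xi>) y \<and> fixed_field h = ratf \<xi> \<and>
     y * y = \<xi> * (\<xi> ^ 4 + emb b * \<xi> ^ 2 + 1) \<and> b * b \<noteq> 4 \<and> \<mu> * \<mu> = - 1 \<and>
     r \<xi> = - \<xi> \<and> s \<xi> = inverse \<xi> \<and> r y = emb \<mu> * y \<and> s y = y / \<xi> ^ 3"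

lemma ex_normal_form: "\<exists>\<xi> y b \<mu>. normal_form \<xi> y b \<mu>"
proof -
  obtain \<xi> P where \<xi>: "hyp_coord \<xi> P" and r\<xi>: "r \<xi> = - \<xi>" and s\<xi>: "s \<xi> = inverse \<xi>"
    using ex_coord by blast
  note nc = hc_nonconst[OF \<xi>] and fixed = h_fixed_ratf[OF \<xi>] and hfix = h_ratf[OF \<xi>]
  note e0 = ev_eq_0_iff[OF nc]
  have \<xi>0: "\<xi> \<noteq> 0" using coordinate_minus_nz[OF \<xi>, of 0] by simp
  \<comment> \<open>Among anti-invariant \<open>y\<close> with \<open>y^2\<close> a polynomial in
    \<open>\<xi>\<close>, least degree makes the polynomial squarefree: a square factor could be
    divided out.\<close>
  define G where "G n \<longleftrightarrow> (\<exists>y f. y \<noteq> 0 \<and> h y = - y \<and> y * y = ev f \<xi> \<and> degree f = n)" for n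
  have "\<exists>n. G n"
  proof -
    obtain y where y: "y \<noteq> 0" "h y = - y" using h.ex_anti by blast
    have "h (y * y) = y * y" using y by (simp only: h.mult) simp
    hence "y * y \<in> ratf \<xi>" by (rule fixed)
    then obtain p q where pq: "y * y = ev p \<xi> / ev q \<xi>" "ev q \<xi> \<noteq> 0" by (auto simp: ratf_def)
    have "h (y * ev q \<xi>) = - (y * ev q \<xi>)" using y hfix[OF ev_in_ratf] by (simp only: h.mult) simp
    moreover have "(y * ev q \<xi>) * (y * ev q \<xi>) = (y * y) * (ev q \<xi> * ev q \<xi>)" by (simp only: ac_simps)
    hence "(y * ev q \<xi>) * (y * ev q \<xi>) = ev (p * q) \<xi>" using pq by (simp add: ev_mult)
    ultimately have "G (degree (p * q))" unfolding G_def using y(1) pq(2) by (metis mult_eq_0_iff)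
    thus ?thesis by blast
  qed
  hence "G (LEAST n. G n)" by (rule LeastI_ex)
  then obtain y f where y: "y \<noteq> 0" "h y = - y" and yf: "y * y = ev f \<xi>" and deg: "degree f = (LEAST n. G n)"
    unfolding G_def by blast
  have f0: "f \<noteq> 0" using yf y(1) by auto
  have sqf: "\<not> [:- c, 1:] * [:- c, 1:] dvd f" for c
  proof
    assume "[:- c, 1:] * [:- c, 1:] dvd f"
    then obtain q where q: "f = [:- c, 1:] * [:- c, 1:] * q" by (elim dvdE)
    have q0: "q \<noteq> 0" using f0 q by auto
    have l: "ev [:- c, 1:] \<xi> = \<xi> - emb c" by (simp add: emb_minus)
    have n: "\<xi> - emb c \<noteq> 0" by (rule coordinate_minus_nz[OF \<xi>])
    have hn: "h (\<xi> - emb c) = \<xi> - emb c" using hc_h[OF \<xi>] by (simp only: h.diff h.const)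
    have "h (y / (\<xi> - emb c)) = - (y / (\<xi> - emb c))" using y(2) hn by (simp only: h.divide) simp
    moreover have "y / (\<xi> - emb c) * (y / (\<xi> - emb c)) = ev q \<xi>"
      unfolding times_divide_times_eq yf q ev_mult l using n by simp
    ultimately have "G (degree q)" unfolding G_def using y(1) n by (metis divide_eq_0_iff)
    hence "degree f \<le> degree q" unfolding deg by (rule Least_le)
    moreover have "degree f = 2 + degree q"
      unfolding q using q0 by (subst degree_mult_eq, simp, simp, subst degree_mult_eq) auto
    ultimately show False by simp
  qed
  have K: "UNIV = quad_ext (ratf \<xi>) y"
  proof -
    have "z \<in> quad_ext (ratf \<xi>) y" for z
    proof (rule quad_extI')
      show "z = (z + h z) / 2 + (z - h z) / (2 * y) * y" using y(1) by (simp add: field_simps)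
      have 1: "h (z - h z) = - (z - h z)" by (simp only: h.diff h.hh) simp
      have 2: "h (2 * y) = - (2 * y)" using y h.const[of 2] by (simp only: h.mult emb_numeral) simp
      have "h ((z - h z) / (2 * y)) = (z - h z) / (2 * y)"
        by (simp only: h.divide 1 2 minus_divide_divide)
      thus "(z - h z) / (2 * y) \<in> ratf \<xi>" by (rule fixed)
      have "h ((z + h z) / 2) = (z + h z) / 2"
        using h.const[of 2] by (simp only: h.divide h.add h.hh emb_numeral) (simp add: add.commute)
      thus "(z + h z) / 2 \<in> ratf \<xi>" by (rule fixed)
    qed
    thus ?thesis by blast
  qed
  \<comment> \<open>An automorphism commuting with \<open>h\<close> sends \<open>y\<close> to
    another anti-invariant element, hence to a multiple of \<open>y\<close> over
    \<open>k(\<xi>)\<close>.\<close>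
  have ratio: "\<exists>\<rho>\<in>ratf \<xi>. g y = \<rho> * y" if "\<And>z w. g (z * w) = g z * g w" "\<And>z. h (g z) = g (h z)" "\<And>z. g (- z) = - g z" for g
  proof (intro bexI[of _ "g y / y"] fixed)
    have "h (g y) = - g y" using that y by simp
    thus "h (g y / y) = g y / y" using y(2) by (simp only: h.divide minus_divide_divide)
    show "g y = g y / y * y" using y(1) by simp
  qed
  \<comment> \<open>\<open>f\<close> is odd\<close>
  obtain \<mu> where \<mu>: "r y = emb \<mu> * y" and fr: "pcompose f [:0, - 1:] = Polynomial.smult (\<mu> * \<mu>) f"
  proof -
    obtain \<rho> where \<rho>: "\<rho> \<in> ratf \<xi>" "r y = \<rho> * y" using ratio[of r] r.mult r.minus by auto
    have "\<rho> * \<rho> * ev f \<xi> = r y * r y" unfolding \<rho>(2) yf[symmetric] by (simp only: ac_simps)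
    also have "\<dots> = r (ev f \<xi>)" by (simp add: yf r.mult[symmetric])
    also have "\<dots> = ev (pcompose f [:0, - 1:]) \<xi>" by (simp add: r.ev r\<xi> ev_pcompose emb_minus)
    finally have "\<exists>c. \<rho> = emb c \<and> pcompose f [:0, - 1:] = Polynomial.smult (c * c) f"
      by (rule square_ratio_const[OF nc \<rho>(1) _ f0 sqf]) (use f0 in \<open>simp_all add: pcompose_eq_0_iff degree_pcompose\<close>)
    thus ?thesis using \<rho>(2) that by blast
  qed
  have "- y = emb (\<mu> * \<mu>) * y"
  proof -
    have "- y = r (r y)" using y(2) by simp
    also have "\<dots> = emb (\<mu> * \<mu>) * y" by (simp add: \<mu> r.mult emb_mult)
    finally show ?thesis .
  qed
  hence "emb (\<mu> * \<mu>) * y + y = 0" by (metis add.left_inverse)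
  hence "emb (\<mu> * \<mu> + 1) * y = 0" by (simp add: emb_add distrib_right)
  hence "\<mu> * \<mu> + 1 = 0" using y(1) by simp
  hence \<mu>2: "\<mu> * \<mu> = - 1" by (simp add: eq_neg_iff_add_eq_0)
  have coeff: "poly.coeff f n = 0" if "even n" for n
  proof -
    have "poly.coeff (pcompose f [:0, - 1:]) n = (- 1) ^ n * poly.coeff f n"
      by (rule coeff_pcompose_linear)
    hence "poly.coeff f n = - poly.coeff f n" using fr \<mu>2 that by simp
    thus ?thesis by simp
  qed
  have "odd (degree f)"
    using coeff[of "degree f"] f0 by auto
  \<comment> \<open>Odd degree puts the curve into the form of \<open>quadratic_curve\<close>;
    comparing genera then gives degree 5.\<close>
  then obtain \<gamma> where \<gamma>: "degree f = 2 * \<gamma> + 1" by (elim oddE)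
  interpret Q: quadratic_curve emb UNIV \<xi> y f \<gamma>
    by unfold_locales (use nc yf K sqf \<gamma> zero_exists in auto)
  have "\<gamma> = 2" by (rule has_genus_unique[OF Q.has_genus_quadratic genus])
  hence deg5: "degree f = 5" using \<gamma> by simp
  define a where "a = poly.coeff f 1"
  define b where "b = poly.coeff f 3"
  define c where "c = poly.coeff f 5"
  have f_eq: "f = [:0, a, 0, b, 0, c:]"
  proof (rule poly_eqI)
    fix n
    show "poly.coeff f n = poly.coeff [:0, a, 0, b, 0, c:] n"
    proof (cases "n \<le> 5")
      case True
      hence "n = 0 \<or> n = 1 \<or> n = 2 \<or> n = 3 \<or> n = 4 \<or> n = 5" by auto
      moreover have "poly.coeff f 0 = 0" "poly.coeff f 2 = 0" "poly.coeff f 4 = 0" by (rule coeff, simp)+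
      ultimately show ?thesis
        by (auto simp: a_def b_def c_def numeral_eq_Suc)
    next
      case False
      have "degree [:0, a, 0, b, 0, c:] \<le> 5" by (simp add: degree_pCons_eq_if)
      thus ?thesis using False deg5 by (simp add: coeff_eq_0)
    qed
  qed
  have c0: "c \<noteq> 0" using deg5 f0 by (simp add: c_def flip: leading_coeff_0_iff)
  \<comment> \<open>\<open>f\<close> is palindromic\<close>
  obtain \<nu> where \<nu>: "s y = emb \<nu> * y / \<xi> ^ 3" and fs: "[:0, c, 0, b, 0, a:] = Polynomial.smult (\<nu> * \<nu>) f"
  proof -
    obtain \<rho> where \<rho>: "\<rho> \<in> ratf \<xi>" "s y = \<rho> * y" using ratio[of s] s.mult s.minus hs by auto
    \<comment> \<open>\<open>\<xi>^6 f(1 / \<xi>)\<close> is the polynomial with reversed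
      coefficients, so \<open>\<rho> \<xi>^3\<close> is the ratio to which
      \<open>square_ratio_const\<close> applies.\<close>
    have M: "\<rho> * \<xi> ^ 3 \<in> ratf \<xi>"
      by (intro fc_mult[OF ratf_field \<rho>(1)] fc_power[OF ratf_field] gen_in_ratf)
    have "(\<rho> * \<xi> ^ 3) * (\<rho> * \<xi> ^ 3) * ev f \<xi> = s y * s y * \<xi> ^ 6"
      unfolding \<rho>(2) yf[symmetric] by (simp add: algebra_simps power_numeral_reduce)
    also have "s y * s y = s (ev f \<xi>)" by (simp add: yf s.mult[symmetric])
    also have "s (ev f \<xi>) = ev f (inverse \<xi>)" by (simp add: s.ev s\<xi>)
    also have "ev f (inverse \<xi>) * \<xi> ^ 6 = ev [:0, c, 0, b, 0, a:] \<xi>"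
      unfolding f_eq using \<xi>0 by (simp add: field_simps power_numeral_reduce)
    finally have "\<exists>k. \<rho> * \<xi> ^ 3 = emb k \<and> [:0, c, 0, b, 0, a:] = Polynomial.smult (k * k) f"
      by (rule square_ratio_const[OF nc M _ f0 sqf])
        (use c0 deg5 in \<open>auto simp: degree_pCons_eq_if\<close>)
    then obtain k where k: "\<rho> * \<xi> ^ 3 = emb k" "[:0, c, 0, b, 0, a:] = Polynomial.smult (k * k) f" by blast
    have "\<rho> = emb k / \<xi> ^ 3" using k(1) \<xi>0 by (simp add: field_simps)
    hence "s y = emb k * y / \<xi> ^ 3" using \<rho>(2) by simp
    thus ?thesis using k(2) that by blast
  qed
  have "y = s (s y)" by (simp only: s2)
  also have "\<dots> = emb \<nu> * (emb \<nu> * y / \<xi> ^ 3) / (inverse \<xi>) ^ 3"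
    unfolding \<nu> s.divide s.mult s.power s.const s\<xi> ..
  also have "\<dots> = emb (\<nu> * \<nu>) * y" using \<xi>0 by (simp add: emb_mult power_inverse divide_inverse)
  finally have "emb (\<nu> * \<nu>) * y = y" by (rule sym)
  hence "emb (\<nu> * \<nu> - 1) * y = 0" by (simp add: emb_diff left_diff_distrib)
  hence "\<nu> * \<nu> - 1 = 0" using y(1) by simp
  hence \<nu>2: "\<nu> * \<nu> = 1" by simp
  have "[:0, c, 0, b, 0, a:] = [:0, a, 0, b, 0, c:]"
    using fs by (simp only: \<nu>2 smult_1_left f_eq[symmetric])
  from arg_cong[OF this, of "\<lambda>p. poly.coeff p 1"] have ac: "a = c" by simp
  obtain k where k: "k * k = c" using sqrt_const[of c] by (auto simp: power2_eq_square)
  have k0: "k \<noteq> 0" using k c0 by auto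
  define B where "B = b / c"
  define \<eta> where "\<eta> = y / emb k"
  have \<eta>0: "\<eta> \<noteq> 0" using y(1) k0 by (simp add: \<eta>_def)
  have "\<eta> * \<eta> = ev f \<xi> / emb c" unfolding \<eta>_def k[symmetric] emb_mult using yf by simp
  also have "ev f \<xi> = emb c * (\<xi> * (\<xi> ^ 4 + emb B * \<xi> ^ 2 + 1))"
    unfolding f_eq ac B_def using c0 by (simp add: emb_divide algebra_simps power_numeral_reduce)
  finally have \<eta>2: "\<eta> * \<eta> = \<xi> * (\<xi> ^ 4 + emb B * \<xi> ^ 2 + 1)" using c0 by simp
  have B4: "B * B \<noteq> 4"
  proof
    assume B: "B * B = 4"
    \<comment> \<open>If \<open>B^2 = 4\<close>, the quartic factor is
      \<open>(\<xi>^2 - d^2)^2\<close>, with a multiple root \<open>d\<close>.\<close>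
    obtain d where d: "d * d = - B / 2" using sqrt_const[of "- B / 2"] by (auto simp: power2_eq_square)
    have "b = - 2 * (d * d) * c" unfolding d using c0 by (simp add: B_def)
    moreover have "d * d * (d * d) = 1" unfolding d using B by simp
    hence "a = d * d * (d * d) * c" using ac by simp
    ultimately have "f = [:- d, 1:] * [:- d, 1:] * [:0, d * d * c, 2 * d * c, c:]"
      unfolding f_eq by (simp add: algebra_simps)
    thus False using sqf[of d] by (metis dvd_triv_left)
  qed
  have r\<eta>: "r \<eta> = emb \<mu> * \<eta>" by (simp add: \<eta>_def r.divide \<mu>)
  have s\<eta>: "s \<eta> = emb \<nu> * \<eta> / \<xi> ^ 3" by (simp add: \<eta>_def s.divide \<nu>)
  have qe: "UNIV = quad_ext (ratf \<xi>) (emb l * y)" if "l \<noteq> 0" for l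
  proof -
    have "z \<in> quad_ext (ratf \<xi>) (emb l * y)" for z
    proof -
      have "z \<in> quad_ext (ratf \<xi>) y" using K by blast
      then obtain a b where ab: "z = a + b * y" "a \<in> ratf \<xi>" "b \<in> ratf \<xi>" by (rule quad_extE)
      show ?thesis
      proof (rule quad_extI')
        show "z = a + (b / emb l) * (emb l * y)" using ab(1) that by simp
        show "b / emb l \<in> ratf \<xi>" using ab(3) range_emb_subset_ratf by (intro fc_divide[OF ratf_field]) auto
      qed (rule ab(2))
    qed
    thus ?thesis by blast
  qed
  have ff: "fixed_field h = ratf \<xi>" using fixed hfix by (auto simp: fixed_field_def)
  have "\<nu> = 1 \<or> \<nu> = - 1" using \<nu>2 square_eq_1_iff[of \<nu>] by simp
  thus ?thesis
  proof
    assume "\<nu> = 1"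
    moreover have "\<eta> = emb (inverse k) * y" by (simp add: \<eta>_def emb_inverse divide_inverse)
    ultimately have "normal_form \<xi> \<eta> B \<mu>"
      unfolding normal_form_def using nc \<eta>0 qe[of "inverse k"] k0 ff \<eta>2 B4 \<mu>2 r\<xi> s\<xi> r\<eta> s\<eta> by simp
    thus ?thesis by blast
  next
    assume \<nu>: "\<nu> = - 1"
    have \<mu>0: "\<mu> \<noteq> 0" using \<mu>2 by auto
    \<comment> \<open>Changing the sign of \<open>\<xi>\<close> flips the sign of
      \<open>\<xi>^3\<close> and so absorbs \<open>\<nu> = - 1\<close>; the factor
      \<open>\<mu>\<close> on \<open>\<eta>\<close> keeps the equation.\<close>
    let ?x = "- \<xi>" and ?y = "emb \<mu> * \<eta>"
    have nx: "?x \<notin> range emb"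
    proof
      assume "?x \<in> range emb"
      then obtain c where "- \<xi> = emb c" by auto
      hence "\<xi> = emb (- c)" by (metis emb_minus minus_minus)
      thus False using nc by blast
    qed
    have rx: "ratf ?x = ratf \<xi>"
    proof
      show "ratf ?x \<subseteq> ratf \<xi>" by (rule ratf_subset) (intro fc_minus[OF ratf_field] gen_in_ratf)
      have "- ?x \<in> ratf ?x" by (intro fc_minus[OF ratf_field] gen_in_ratf)
      thus "ratf \<xi> \<subseteq> ratf ?x" by (intro ratf_subset) simp
    qed
    have "?y = emb (\<mu> / k) * y" by (simp add: \<eta>_def emb_divide)
    hence K': "UNIV = quad_ext (ratf ?x) ?y" unfolding rx using qe[of "\<mu> / k"] \<mu>0 k0 by simp
    have "?y * ?y = emb (\<mu> * \<mu>) * (\<eta> * \<eta>)" by (simp add: emb_mult algebra_simps)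
    hence "?y * ?y = ?x * (?x ^ 4 + emb B * ?x ^ 2 + 1)" unfolding \<mu>2 \<eta>2 by (simp add: emb_minus)
    moreover have "s ?y = ?y / ?x ^ 3"
      by (simp add: s.mult s\<eta> \<nu> emb_minus power_minus_odd)
    moreover have "r ?y = emb \<mu> * ?y" by (simp add: r.mult r\<eta>)
    moreover have "r ?x = - ?x" "s ?x = inverse ?x" by (simp_all add: r.minus r\<xi> s.minus s\<xi>)
    moreover have "?y \<noteq> 0" using \<mu>0 \<eta>0 by simp
    ultimately have "normal_form ?x ?y B \<mu>"
      unfolding normal_form_def using nx K' ff rx B4 \<mu>2 by blast
    thus ?thesis by blast
  qed
qed

end

subsection \<open>Field homomorphisms\<close>

context constants
begin

text \<open>A homomorphism over \<open>k\<close> on \<open>E\<close> alone; values outside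
  \<open>E\<close> are arbitrary.\<close>

definition fhom :: "'a set \<Rightarrow> ('a \<Rightarrow> 'a) \<Rightarrow> bool" where
  "fhom E \<phi> \<longleftrightarrow> (\<forall>x\<in>E. \<forall>y\<in>E. \<phi> (x + y) = \<phi> x + \<phi> y \<and> \<phi> (x * y) = \<phi> x * \<phi> y) \<and> (\<forall>c. \<phi> (emb c) = emb c)"

context
  fixes E \<phi> assumes \<phi>: "fhom E \<phi>" and E: "field_closed E" "range emb \<subseteq> E"
begin

lemma fhom_add: "x \<in> E \<Longrightarrow> y \<in> E \<Longrightarrow> \<phi> (x + y) = \<phi> x + \<phi> y"
  and fhom_mult: "x \<in> E \<Longrightarrow> y \<in> E \<Longrightarrow> \<phi> (x * y) = \<phi> x * \<phi> y"
  and fhom_const: "\<phi> (emb c) = emb c"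
  using \<phi> by (auto simp: fhom_def)

lemma fhom_0: "\<phi> 0 = 0" and fhom_1: "\<phi> 1 = 1"
  using fhom_const[of 0] fhom_const[of 1] by simp_all

lemma fhom_inverse_mult: "x \<in> E \<Longrightarrow> x \<noteq> 0 \<Longrightarrow> \<phi> x * \<phi> (inverse x) = 1"
  using fhom_mult[of x "inverse x"] fc_inverse[OF E(1), of x] by (simp add: fhom_1)

lemma fhom_nz: "x \<in> E \<Longrightarrow> x \<noteq> 0 \<Longrightarrow> \<phi> x \<noteq> 0"
  using fhom_inverse_mult[of x] by auto

lemma fhom_inverse: "x \<in> E \<Longrightarrow> \<phi> (inverse x) = inverse (\<phi> x)"
proof (cases "x = 0")
  case False
  assume "x \<in> E"
  thus ?thesis using inverse_unique[OF fhom_inverse_mult[of x]] False by simp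
qed (simp add: fhom_0)

lemma fhom_divide: "x \<in> E \<Longrightarrow> y \<in> E \<Longrightarrow> \<phi> (x / y) = \<phi> x / \<phi> y"
  by (simp add: divide_inverse fhom_mult fhom_inverse fc_inverse[OF E(1)])

lemma fhom_ev: "x \<in> E \<Longrightarrow> \<phi> (ev p x) = ev p (\<phi> x)"
proof (induction p)
  case (pCons c p)
  have m: "emb c \<in> E" "ev p x \<in> E" using E ev_in_field[OF E pCons(3)] by auto
  show ?case using pCons m fc_mult[OF E(1), of x "ev p x"] by (simp add: fhom_add fhom_mult fhom_const)
qed (simp add: fhom_0)

lemma fhom_minus: "x \<in> E \<Longrightarrow> \<phi> (- x) = - \<phi> x"
  using fhom_add[of x "- x"] fc_minus[OF E(1), of x] by (simp add: fhom_0 eq_neg_iff_add_eq_0 add.commute)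

lemma fhom_diff: "x \<in> E \<Longrightarrow> y \<in> E \<Longrightarrow> \<phi> (x - y) = \<phi> x - \<phi> y"
  using fhom_add[of x "- y"] fc_minus[OF E(1), of y] by (simp add: fhom_minus)

lemma fhom_image_quad_ext:
  assumes x: "x \<in> E" "\<phi> x \<notin> range emb" and y: "y \<in> E"
  shows "\<phi> ` quad_ext (ratf x) y = quad_ext (ratf (\<phi> x)) (\<phi> y)"
proof -
  have nc: "x \<notin> range emb" using x(2) fhom_const by auto
  note e0 = ev_eq_0_iff[OF nc] ev_eq_0_iff[OF x(2)]
  have evE: "ev p x \<in> E" for p by (rule ev_in_field[OF E x(1)])
  have rat: "\<phi> ` ratf x = ratf (\<phi> x)"
  proof
    show "\<phi> ` ratf x \<subseteq> ratf (\<phi> x)"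
    proof (rule image_subsetI)
      fix z assume "z \<in> ratf x"
      then obtain p q where pq: "z = ev p x / ev q x" "ev q x \<noteq> 0" by (auto simp: ratf_def)
      hence "\<phi> z = ev p (\<phi> x) / ev q (\<phi> x)" by (simp add: fhom_divide evE fhom_ev[OF x(1)])
      thus "\<phi> z \<in> ratf (\<phi> x)" using pq(2) e0 ratfI[of q "\<phi> x" p] by simp
    qed
    show "ratf (\<phi> x) \<subseteq> \<phi> ` ratf x"
    proof
      fix z assume "z \<in> ratf (\<phi> x)"
      then obtain p q where pq: "z = ev p (\<phi> x) / ev q (\<phi> x)" "ev q (\<phi> x) \<noteq> 0" by (auto simp: ratf_def)
      hence "z = \<phi> (ev p x / ev q x)" by (simp add: fhom_divide evE fhom_ev[OF x(1)])
      moreover have "ev p x / ev q x \<in> ratf x" using pq(2) e0 by (intro ratfI) simp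
      ultimately show "z \<in> \<phi> ` ratf x" by blast
    qed
  qed
  have rE: "ratf x \<subseteq> E" by (rule ratf_minimal[OF E x(1)])
  have im: "\<phi> (a + b * y) = \<phi> a + \<phi> b * \<phi> y" if "a \<in> ratf x" "b \<in> ratf x" for a b
  proof -
    have "a \<in> E" "b \<in> E" using that rE by auto
    thus ?thesis using fc_mult[OF E(1), of b y] y by (simp add: fhom_add fhom_mult)
  qed
  show ?thesis
  proof
    show "\<phi> ` quad_ext (ratf x) y \<subseteq> quad_ext (ratf (\<phi> x)) (\<phi> y)"
    proof (rule image_subsetI)
      fix z assume "z \<in> quad_ext (ratf x) y"
      then obtain a b where ab: "z = a + b * y" "a \<in> ratf x" "b \<in> ratf x" by (rule quad_extE)
      show "\<phi> z \<in> quad_ext (ratf (\<phi> x)) (\<phi> y)"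
        unfolding ab(1) im[OF ab(2,3)] by (rule quad_extI) (use ab rat in auto)
    qed
    show "quad_ext (ratf (\<phi> x)) (\<phi> y) \<subseteq> \<phi> ` quad_ext (ratf x) y"
    proof
      fix z assume "z \<in> quad_ext (ratf (\<phi> x)) (\<phi> y)"
      then obtain a b where ab: "z = a + b * \<phi> y" "a \<in> ratf (\<phi> x)" "b \<in> ratf (\<phi> x)" by (rule quad_extE)
      obtain a' b' where a': "a = \<phi> a'" "a' \<in> ratf x" and b': "b = \<phi> b'" "b' \<in> ratf x"
        using ab(2,3) unfolding rat[symmetric] by blast
      have "z = \<phi> (a' + b' * y)" using ab(1) a' b' im by simp
      thus "z \<in> \<phi> ` quad_ext (ratf x) y" using a'(2) b'(2) quad_extI by blast
    qed
  qed
qed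

lemma fhom_fixes_quad_ext:
  assumes "x \<in> E" "\<phi> x = x" "y \<in> E" "\<phi> y = y" "z \<in> quad_ext (ratf x) y"
  shows "\<phi> z = z"
proof -
  obtain a b where ab: "z = a + b * y" "a \<in> ratf x" "b \<in> ratf x" using assms(5) by (rule quad_extE)
  have evE: "ev p x \<in> E" for p by (rule ev_in_field[OF E assms(1)])
  have r: "\<phi> a = a" "a \<in> E" if "a \<in> ratf x" for a
  proof -
    obtain p q where "a = ev p x / ev q x" using \<open>a \<in> ratf x\<close> by (auto simp: ratf_def)
    thus "\<phi> a = a" "a \<in> E"
      using assms(2) by (simp_all add: fhom_divide evE fhom_ev[OF assms(1)] fc_divide[OF E(1)])
  qed
  show ?thesis unfolding ab(1)
    using r[OF ab(2)] r[OF ab(3)] assms(3,4) fc_mult[OF E(1), of b y] by (simp add: fhom_add fhom_mult)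
qed

end

text \<open>The equation for \<open>y1\<close> is the only relation, and \<open>x2\<close> satisfies
  none over \<open>k\<close>, so sending \<open>x1\<close> to \<open>x2\<close> and
  \<open>y1\<close> to \<open>y2\<close> is consistent on fractions. It serves for the isogeny and
  for a translation.\<close>

lemma ex_quad_hom:
  assumes x1: "x1 \<notin> range emb" and y1: "y1 \<notin> ratf x1" "y1 * y1 = ev f x1"
    and x2: "x2 \<notin> range emb" and y2: "y2 * y2 = ev f x2"
  shows "\<exists>\<phi>. fhom (quad_ext (ratf x1) y1) \<phi> \<and> \<phi> x1 = x2 \<and> \<phi> y1 = y2"
proof -
  note e1 = ev_eq_0_iff[OF x1] and e2 = ev_eq_0_iff[OF x2]
  let ?v1 = "\<lambda>p q d. (ev p x1 + ev q x1 * y1) / ev d x1" and ?v2 = "\<lambda>p q d. (ev p x2 + ev q x2 * y2) / ev d x2"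
  define \<phi> where "\<phi> z = (case SOME (p, q, d). d \<noteq> 0 \<and> z = ?v1 p q d of (p, q, d) \<Rightarrow> ?v2 p q d)" for z
  have wd: "?v2 p q d = ?v2 p' q' d'" if d: "d \<noteq> 0" "d' \<noteq> 0" and eq: "?v1 p q d = ?v1 p' q' d'" for p q d p' q' d'
  proof -
    have "ev (p * d') x1 + ev (q * d') x1 * y1 = ev (p' * d) x1 + ev (q' * d) x1 * y1"
      using eq d e1 by (simp add: ev_mult frac_eq_eq algebra_simps)
    hence "ev (p * d') x1 = ev (p' * d) x1 \<and> ev (q * d') x1 = ev (q' * d) x1"
      using quad_ext_unique[OF ratf_field y1(1)] ev_in_ratf by metis
    hence "p * d' = p' * d" "q * d' = q' * d" by (simp_all only: ev_eq_iff[OF x1])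
    hence "ev p x2 * ev d' x2 = ev p' x2 * ev d x2" "ev q x2 * ev d' x2 = ev q' x2 * ev d x2"
      by (simp_all only: ev_mult[symmetric])
    hence "(ev p x2 + ev q x2 * y2) * ev d' x2 = (ev p' x2 + ev q' x2 * y2) * ev d x2"
    proof -
      assume 1: "ev p x2 * ev d' x2 = ev p' x2 * ev d x2" and 2: "ev q x2 * ev d' x2 = ev q' x2 * ev d x2"
      have "(ev p x2 + ev q x2 * y2) * ev d' x2 = ev p x2 * ev d' x2 + (ev q x2 * ev d' x2) * y2"
        by (simp add: algebra_simps)
      also have "\<dots> = (ev p' x2 + ev q' x2 * y2) * ev d x2" unfolding 1 2 by (simp add: algebra_simps)
      finally show ?thesis .
    qed
    thus ?thesis using d e2 by (simp add: frac_eq_eq)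
  qed
  have val: "\<phi> (?v1 p q d) = ?v2 p q d" if d: "d \<noteq> 0" for p q d
  proof -
    let ?P = "\<lambda>(p', q', d'). d' \<noteq> 0 \<and> ?v1 p q d = ?v1 p' q' d'"
    have "?P (p, q, d)" using d by simp
    hence "?P (SOME t. ?P t)" by (rule someI)
    moreover obtain p' q' d' where t1: "(SOME t. ?P t) = (p', q', d')" by (rule prod_cases3)
    ultimately have "?P (p', q', d')" by (simp only:)
    hence t: "(SOME t. ?P t) = (p', q', d')" "d' \<noteq> 0" "?v1 p q d = ?v1 p' q' d'" using t1 by simp_all
    have "\<phi> (?v1 p q d) = ?v2 p' q' d'" unfolding \<phi>_def t(1) by simp
    also have "\<dots> = ?v2 p q d" by (rule wd[OF t(2) d t(3)[symmetric]])
    finally show ?thesis .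
  qed
  have rep: "\<exists>p q d. d \<noteq> 0 \<and> z = ?v1 p q d" if "z \<in> quad_ext (ratf x1) y1" for z
  proof -
    obtain a b where ab: "z = a + b * y1" "a \<in> ratf x1" "b \<in> ratf x1" using \<open>z \<in> _\<close> by (rule quad_extE)
    obtain p d where p: "a = ev p x1 / ev d x1" "ev d x1 \<noteq> 0" using ab(2) by (auto simp: ratf_def)
    obtain q e where q: "b = ev q x1 / ev e x1" "ev e x1 \<noteq> 0" using ab(3) by (auto simp: ratf_def)
    have "z = ?v1 (p * e) (q * d) (d * e)"
      unfolding ab(1) p(1) q(1) using p(2) q(2) by (simp add: ev_mult field_simps)
    moreover have "d * e \<noteq> 0" using p q by auto
    ultimately show ?thesis by blast
  qed
  have add: "(ev p x + ev q x * y) / ev d x + (ev p' x + ev q' x * y) / ev d' x =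
      (ev (p * d' + p' * d) x + ev (q * d' + q' * d) x * y) / ev (d * d') x"
    if "ev d x \<noteq> 0" "ev d' x \<noteq> 0" for p q d p' q' d' x y
    using that by (simp add: add_frac_eq ev_add ev_mult) (simp add: algebra_simps)
  have mult: "(ev p x + ev q x * y) / ev d x * ((ev p' x + ev q' x * y) / ev d' x) =
      (ev (p * p' + f * (q * q')) x + ev (p * q' + q * p') x * y) / ev (d * d') x"
    if "y * y = ev f x" for p q d p' q' d' x y
  proof -
    have "(ev p x + ev q x * y) * (ev p' x + ev q' x * y) =
      ev p x * ev p' x + (y * y) * (ev q x * ev q' x) + (ev p x * ev q' x + ev q x * ev p' x) * y"
      by (simp add: algebra_simps)
    thus ?thesis unfolding that by (simp add: ev_add ev_mult)
  qed
  have "fhom (quad_ext (ratf x1) y1) \<phi>"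
    unfolding fhom_def
  proof (intro conjI ballI allI)
    fix z w assume zw: "z \<in> quad_ext (ratf x1) y1" "w \<in> quad_ext (ratf x1) y1"
    obtain p q d where z: "d \<noteq> 0" "z = ?v1 p q d" using rep[OF zw(1)] by blast
    obtain p' q' d' where w: "d' \<noteq> 0" "w = ?v1 p' q' d'" using rep[OF zw(2)] by blast
    have dd: "d * d' \<noteq> 0" using z w by simp
    have n: "ev d x1 \<noteq> 0" "ev d' x1 \<noteq> 0" "ev d x2 \<noteq> 0" "ev d' x2 \<noteq> 0"
      using z(1) w(1) e1 e2 by simp_all
    show "\<phi> (z + w) = \<phi> z + \<phi> w"
      unfolding z(2) w(2) val[OF z(1)] val[OF w(1)] add[OF n(1,2)] add[OF n(3,4)] val[OF dd] ..
    show "\<phi> (z * w) = \<phi> z * \<phi> w"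
      unfolding z(2) w(2) val[OF z(1)] val[OF w(1)] mult[OF y1(2)] mult[OF y2] val[OF dd] ..
  next
    show "\<phi> (emb c) = emb c" for c using val[of 1 "[:c:]" 0] by simp
  qed
  moreover have "\<phi> x1 = x2" using val[of 1 "[:0, 1:]" 0] by simp
  moreover have "\<phi> y1 = y2" using val[of 1 0 1] by simp
  ultimately show ?thesis by blast
qed

end

subsection \<open>Subfields\<close>

context genus_field
begin

lemma curve_subfield:
  assumes "field_closed E" "range emb \<subseteq> E" "E \<subseteq> F"
  shows "curve_field emb E"
proof unfold_locales
  show "intermediate_field emb E" using assms by (simp add: intermediate_field_iff)
  show "alg_dep f g" if "f \<in> E" "g \<in> E" for f g by (rule dep) (use that assms(3) in auto)
qed

text \<open>A zero of \<open>z\<close> on the larger field is restricted to \<open>E\<close> and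
  divided by its ramification index.\<close>

lemma subfield_zero_exists:
  assumes E: "field_closed E" "range emb \<subseteq> E" "E \<subseteq> F" and z: "z \<in> E" "z \<notin> range emb"
  shows "\<exists>v\<in>places emb E. 0 < v z"
proof -
  interpret E: curve_field emb E by (rule curve_subfield[OF E])
  have zF: "z \<in> F" using z E by blast
  obtain w where w: "w \<in> PL" "0 < w z" using zero_exists[OF zF z(2)] by blast
  have z0: "z \<noteq> 0" using z(2) rangeI[of emb 0] by auto
  have "\<exists>v\<in>E.PL. \<exists>e>0. \<forall>x\<in>E. x \<noteq> 0 \<longrightarrow> w x = e * v x"
  proof (rule E.normalise_valuation[of w z])
    show "w (emb c) = 0" for c by (rule v_emb[OF w(1)])
    show "w (x * y) = w x + w y" if "x \<in> E" "y \<in> E" "x \<noteq> 0" "y \<noteq> 0" for x y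
      by (rule v_mult[OF w(1)]) (use that E(3) in auto)
    show "min (w x) (w y) \<le> w (x + y)" if "x \<in> E" "y \<in> E" "x \<noteq> 0" "y \<noteq> 0" "x + y \<noteq> 0" for x y
    proof -
      have "vge w (min (w x) (w y)) (x + y)"
        by (rule vge_add[OF w(1)]) (use that E(3) in \<open>auto simp: vge_def\<close>)
      thus ?thesis using that(5) by (rule vge_D)
    qed
  qed (use z z0 w in auto)
  then obtain v e where v: "v \<in> E.PL" "0 < e" "w z = e * v z" using z(1) z0 by blast
  hence "0 < v z" using w(2) by (simp add: zero_less_mult_iff)
  thus ?thesis using v(1) by blast
qed

end

lemma linear_sqfree: "\<not> [:- c, 1:] * [:- c, 1:] dvd [:0, 1 :: 'k::field:]"
proof
  assume "[:- c, 1:] * [:- c, 1:] dvd [:0, 1 :: 'k:]"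
  hence "degree ([:- c, 1:] * [:- c, 1:]) \<le> degree [:0, 1 :: 'k:]" by (rule dvd_imp_degree_le) simp
  thus False by simp
qed

text \<open>The line \<open>k(t)\<close> is the curve \<open>y^2 = x\<close> with
  \<open>y = t\<close> and \<open>x = t * t\<close>, the case \<open>\<gamma> = 0\<close>.\<close>

lemma (in curve_field) rational_genus_0:
  assumes t: "t \<notin> range emb" and F: "F = ratf t"
    and zero_ex: "\<And>z. z \<in> F \<Longrightarrow> z \<notin> range emb \<Longrightarrow> \<exists>v\<in>PL. v z > 0"
  shows "has_genus emb F 0"
proof -
  have tF: "t \<in> F" unfolding F by (rule gen_in_ratf)
  have t2: "t * t = ev [:0, 0, 1:] t" by simp
  have nc: "t * t \<notin> range emb" unfolding t2 ev_in_range_iff[OF t] by simp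
  have "quad_ext (ratf (t * t)) t = ratf t"
  proof
    have sub: "ratf (t * t) \<subseteq> ratf t" by (intro ratf_subset fc_mult[OF ratf_field] gen_in_ratf)
    show "quad_ext (ratf (t * t)) t \<subseteq> ratf t" by (rule quad_ext_minimal[OF ratf_field sub gen_in_ratf])
    have fld: "field_closed (quad_ext (ratf (t * t)) t)"
      by (rule quad_ext_field[OF ratf_field fc_0[OF ratf_field] gen_in_ratf]) (simp add: power2_eq_square)
    show "ratf t \<subseteq> quad_ext (ratf (t * t)) t"
      by (rule ratf_minimal[OF fld]) (use range_emb_subset_ratf quad_ext_subset[OF ratf_field] quad_ext_gen[OF ratf_field] in blast)+
  qed
  hence K: "F = quad_ext (ratf (t * t)) t" using F by simp
  interpret Q: quadratic_curve emb F "t * t" t "[:0, 1:]" 0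
  proof unfold_locales
    show "\<not> [:- c, 1:] * [:- c, 1:] dvd [:0, 1:]" for c :: 'k by (rule linear_sqfree)
  qed (rule F_mult tF nc zero_ex K | assumption | simp)+
  show ?thesis by (rule Q.has_genus_quadratic)
qed

subsection \<open>Automorphisms of elliptic function fields act transitively on places\<close>

locale elliptic_field = genus_field emb F 1
  for emb :: "'k::{alg_closed_field,field_char_0} \<Rightarrow> 'a::field_char_0" and F
begin

lemma not_rational: "t \<notin> range emb \<Longrightarrow> F \<noteq> ratf t"
  using rational_genus_0[of t] zero_exists has_genus_unique[OF genus] by force

text \<open>
  By Riemann's inequality there is a function with poles only at \<open>P\<close> and \<open>Q\<close>; it has degree \<open>2\<close>,
  and the corresponding involution exchanges \<open>P\<close> and \<open>Q\<close>.
\<close>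

lemma transitive:
  assumes P: "P \<in> PL" and Q: "Q \<in> PL"
  shows "\<exists>\<iota>. fhom F \<iota> \<and> \<iota> ` F = F \<and> (\<forall>z\<in>F. P (\<iota> z) = Q z)"
proof (cases "P = Q")
  case True
  thus ?thesis by (intro exI[of _ id]) (simp add: fhom_def)
next
  case False
  let ?D = "\<lambda>v. pt P v + pt Q v"
  note D = Div_add[OF Div_pt(1)[OF P] Div_pt(1)[OF Q]]
  have D2: "divisor_degree ?D = 2" using D(2) Div_pt(2)[OF P] Div_pt(2)[OF Q] by simp
  have "VS.dim (LL ?D) \<ge> 2" using riemann[OF D(1)] D2 by simp
  then obtain t where t: "t \<in> LL ?D" "t \<notin> range emb" using ex_nonconst_if_dim_ge_2 by blast
  have tF: "t \<in> F" using t LL_F by blast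
  note e0 = ev_eq_0_iff[OF t(2)]
  have rF: "ratf t \<subseteq> F" using ratf_minimal[OF fcF _ tF] emb_in_F by blast
  \<comment> \<open>A function with just one simple pole would generate \<open>F\<close>, making it
    rational.\<close>
  have no1: "t \<notin> LL (pt R)" if R: "R \<in> PL" for R
  proof
    assume tR: "t \<in> LL (pt R)"
    have "F \<subseteq> ratf t"
    proof
      fix f assume f: "f \<in> F"
      have "\<exists>p. (\<exists>i<2::nat. p i \<noteq> 0) \<and> (\<Sum>i<2. ev (p i) t * (if i = 0 then 1 else f)) = 0"
        by (rule dependent_over_ratf[OF Div_pt(1)[OF R] _ tR t(2)])
          (use Div_pt(2)[OF R] f F_1 in \<open>auto simp: pt_def\<close>)
      then obtain p i where p: "i < (2::nat)" "p i \<noteq> 0" "(\<Sum>i<2. ev (p i) t * (if i = 0 then 1 else f)) = 0" by blast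
      have eq: "ev (p 0) t + ev (p 1) t * f = 0" using p(3) by (simp add: numeral_2_eq_2)
      have p1: "ev (p 1) t \<noteq> 0"
      proof
        assume 0: "ev (p 1) t = 0"
        hence "ev (p 0) t = 0" using eq by simp
        hence "p 0 = 0" "p 1 = 0" using 0 e0 by auto
        thus False using p(1,2) by (cases i) (auto simp: less_Suc_eq numeral_2_eq_2)
      qed
      have "f * ev (p 1) t = ev (- p 0) t" using eq by (simp add: ev_minus eq_neg_iff_add_eq_0 algebra_simps)
      hence "f = ev (- p 0) t / ev (p 1) t" by (rule eq_divide_imp[OF p1])
      thus "f \<in> ratf t" using ratfI[OF p1] by simp
    qed
    thus False using rF not_rational[OF t(2)] by blast
  qed
  have neg: "R t = - 1" if R: "R \<in> {P, Q}" for R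
  proof -
    let ?S = "if R = P then Q else P"
    have S: "?S \<in> PL" "?S \<noteq> R" using P Q R False by auto
    have Deq: "?D v = pt R v + pt ?S v" for v using R False by (auto simp: pt_def)
    obtain w where w: "w \<in> PL" "\<not> vge w (- pt ?S w) t" using no1[OF S(1)] tF by (auto simp: mem_LL)
    have wR: "w = R"
    proof (rule ccontr)
      assume "w \<noteq> R"
      hence "?D w = pt ?S w" unfolding Deq by (simp add: pt_def)
      thus False using LL_vge[OF t(1) w(1)] w(2) by simp
    qed
    have "?D R = 1" "pt ?S R = 0" unfolding Deq using S(2) by (simp_all add: pt_def)
    thus ?thesis using LL_vge[OF t(1) w(1)] w(2) unfolding wR by (auto simp: vge_def)
  qed
  have poles: "v \<in> {P, Q}" if v: "v \<in> PL" "v t < 0" for v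
  proof (rule ccontr)
    assume "v \<notin> {P, Q}"
    hence "vge v 0 t" using LL_vge[OF t(1) v(1)] by (simp add: pt_def)
    thus False using v(2) t(2) rangeI[of emb 0] by (auto simp: vge_def)
  qed
  obtain y where y: "y \<in> F" "y \<notin> ratf t" using rF not_rational[OF t(2)] by blast
  have Fy: "F = quad_ext (ratf t) y"
  proof
    show "quad_ext (ratf t) y \<subseteq> F" by (rule quad_ext_minimal[OF fcF rF y(1)])
    show "F \<subseteq> quad_ext (ratf t) y"
    proof
      fix f assume f: "f \<in> F"
      define u where "u i = (if i = 0 then 1 else if i = 1 then y else f)" for i :: nat
      have "\<exists>p. (\<exists>i<3::nat. p i \<noteq> 0) \<and> (\<Sum>i<3. ev (p i) t * u i) = 0"
        by (rule dependent_over_ratf[OF D(1) _ t]) (use D2 f y F_1 in \<open>auto simp: pt_def u_def\<close>)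
      then obtain p i where p: "i < (3::nat)" "p i \<noteq> 0" "(\<Sum>i<3. ev (p i) t * u i) = 0" by blast
      have eq: "ev (p 0) t + ev (p 1) t * y + ev (p 2) t * f = 0"
        using p(3) by (simp add: u_def numeral_3_eq_3 numeral_2_eq_2)
      have p2: "ev (p 2) t \<noteq> 0"
      proof
        assume 0: "ev (p 2) t = 0"
        hence "ev (p 0) t + ev (p 1) t * y = 0 + 0 * y" using eq by simp
        hence "ev (p 0) t = 0 \<and> ev (p 1) t = 0"
          by (rule quad_ext_unique[OF ratf_field y(2) ev_in_ratf ev_in_ratf fc_0[OF ratf_field] fc_0[OF ratf_field]])
        hence "p 0 = 0" "p 1 = 0" "p 2 = 0" using 0 e0 by auto
        moreover have "i = 0 \<or> i = 1 \<or> i = 2" using p(1) by auto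
        ultimately show False using p(2) by auto
      qed
      show "f \<in> quad_ext (ratf t) y"
      proof (rule quad_extI')
        have "f * ev (p 2) t = - ev (p 0) t - ev (p 1) t * y"
          using eq by (simp add: eq_diff_eq eq_neg_iff_add_eq_0 algebra_simps)
        hence "f = (- ev (p 0) t - ev (p 1) t * y) / ev (p 2) t" by (rule eq_divide_imp[OF p2])
        thus "f = ev (- p 0) t / ev (p 2) t + (ev (- p 1) t / ev (p 2) t) * y"
          by (simp add: ev_minus diff_divide_distrib)
      qed (rule ratfI[OF p2])+
    qed
  qed
  have "\<exists>s. s \<notin> ratf t \<and> s * s \<in> ratf t \<and> quad_ext (ratf t) s = quad_ext (ratf t) y"
    by (rule quad_ext_square[OF ratf_field _ y(2)]) (use fcF Fy in simp)
  then obtain s where s: "s \<notin> ratf t" "s * s \<in> ratf t" and Fs: "F = quad_ext (ratf t) s" using Fy by auto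
  define \<iota> where "\<iota> = quad_conj (ratf t) s"
  note cl = quad_conj_closed[OF ratf_field s(1), folded \<iota>_def Fs]
    and hom = quad_conj_hom[OF ratf_field s, folded \<iota>_def Fs]
    and fixed = quad_conj_fixed[OF ratf_field s(1), folded \<iota>_def]
  have const: "\<iota> (emb c) = emb c" for c using range_emb_subset_ratf by (intro fixed) blast
  have fh: "fhom F \<iota>" unfolding fhom_def using hom const by blast
  have surj: "\<exists>y\<in>F. \<iota> y = z" if "z \<in> F" for z using cl[OF that] by blast
  have onto: "\<iota> ` F = F" using cl(1) surj by blast
  \<comment> \<open>The involution fixes \<open>t\<close>, so pullback along it permutes the two
    poles \<open>P\<close> and \<open>Q\<close> of \<open>t\<close>.\<close>
  define c where "c v = (\<lambda>z. if z \<in> F then v (\<iota> z) else 0)" for v :: "'a \<Rightarrow> int"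
  have c: "c v \<in> PL" if "v \<in> PL" for v
    unfolding c_def by (rule place_comp[OF that]) (use cl hom const surj in auto)
  have ct: "c v t = v t" for v using fixed[OF gen_in_ratf] tF by (simp add: c_def)
  have cin: "c v \<in> {P, Q}" if "v \<in> {P, Q}" for v
  proof (rule poles)
    show "c v \<in> PL" using c that P Q by blast
    show "c v t < 0" using neg[OF that] ct by simp
  qed
  consider "c P = Q" | "c Q = P" | "c P = P" "c Q = Q" using cin[of P] cin[of Q] by blast
  thus ?thesis
  proof cases
    case 1
    have "P (\<iota> z) = Q z" if "z \<in> F" for z using fun_cong[OF 1, of z] that by (simp add: c_def)
    thus ?thesis using fh onto by blast
  next
    case 2
    have "P (\<iota> z) = Q z" if "z \<in> F" for z using fun_cong[OF 2, of "\<iota> z"] cl[OF that] by (simp add: c_def)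
    thus ?thesis using fh onto by blast
  next
    case 3
    \<comment> \<open>If both poles were fixed, \<open>P\<close> and \<open>Q\<close> would take
      twice their value of \<open>f\<close> on the norm of \<open>f\<close>. That norm lies in
      \<open>k(t)\<close>, where \<open>P\<close> and \<open>Q\<close> agree because both are simple
      poles of \<open>t\<close>; but \<open>f\<close> separates them.\<close>
    obtain f where f: "f \<in> F" "f \<noteq> 0" "P f > 0" "Q f \<le> 0" using place_separate[OF P Q False] by blast
    have nz: "\<iota> f \<noteq> 0" using fhom_nz[OF fh fcF _ f(1,2)] emb_in_F by blast
    have if': "\<iota> f \<in> F" by (rule cl(1)[OF f(1)])
    have NF: "f * \<iota> f \<in> F" by (rule F_mult[OF f(1) if'])
    have N: "\<iota> (f * \<iota> f) = f * \<iota> f" using hom(2)[OF f(1) if'] cl(2)[OF f(1)] by (simp add: mult.commute)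
    obtain a b where ab: "f * \<iota> f = a + b * s" "a \<in> ratf t" "b \<in> ratf t"
      using NF unfolding Fs by (rule quad_extE)
    have "\<iota> (f * \<iota> f) = \<iota> (a + b * s)" by (simp only: ab(1))
    also have "\<dots> = a - b * s" unfolding \<iota>_def by (rule quad_conj_eq[OF ratf_field s(1) ab(2,3)])
    finally have "\<iota> (f * \<iota> f) = a - b * s" .
    hence bs: "b * s = 0" using N ab(1) by simp
    have "f * \<iota> f = a" unfolding ab(1) bs by simp
    hence "f * \<iota> f \<in> ratf t" using ab(2) by simp
    then obtain p q where pq: "f * \<iota> f = ev p t / ev q t" "ev q t \<noteq> 0" by (auto simp: ratf_def)
    have q0: "q \<noteq> 0" using pq(2) by auto
    have p0: "p \<noteq> 0" using pq f(2) nz by auto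
    have vN: "v (f * \<iota> f) = int (degree q) - int (degree p)" if v: "v \<in> {P, Q}" for v
    proof -
      have vP: "v \<in> PL" using v P Q by blast
      have "v t < 0" using neg[OF v] by simp
      from v_ev_neg[OF vP tF this p0] v_ev_neg[OF vP tF this q0] show ?thesis
        unfolding pq(1) using neg[OF v] by (simp add: v_divide[OF vP] F_ev tF)
    qed
    have v2: "v (f * \<iota> f) = 2 * v f" if v: "v \<in> {P, Q}" "c v = v" for v
    proof -
      have vP: "v \<in> PL" using v P Q by blast
      have "v (\<iota> f) = v f" using fun_cong[OF v(2), of f] f(1) by (simp add: c_def)
      thus ?thesis using v_mult[OF vP f(1) if' f(2) nz] by simp
    qed
    have "2 * P f = 2 * Q f" using vN[of P] vN[of Q] v2[of P] v2[of Q] 3 by simp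
    thus ?thesis using f by simp
  qed
qed

end

subsection \<open>The isogeny of degree two\<close>

text \<open>A double root at 0 gives \<open>B = 0\<close>; a double root \<open>c \<noteq> 0\<close>
  gives \<open>B = c^2\<close> and \<open>A = - 2 c\<close>.\<close>

lemma cubic_sqfree:
  fixes A B c :: "'k::field_char_0"
  assumes "B \<noteq> 0" "A * A \<noteq> 4 * B"
  shows "\<not> [:- c, 1:] * [:- c, 1:] dvd [:0, B, A, 1:]"
proof
  assume "[:- c, 1:] * [:- c, 1:] dvd [:0, B, A, 1:]"
  then obtain q where q: "[:0, B, A, 1:] = [:- c, 1:] * [:- c, 1:] * q" by (elim dvdE)
  have q0: "q \<noteq> 0" using q by auto
  have "3 = degree [:0, B, A, 1:]" by simp
  also have "\<dots> = 2 + degree q"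
    unfolding q using q0 by (subst degree_mult_eq, simp, simp, subst degree_mult_eq) auto
  finally have "degree q = 1" by simp
  then obtain d e where de: "q = [:d, e:]" by (rule degree1_coeffs)
  have co: "poly.coeff [:0, B, A, 1:] n = poly.coeff ([:- c, 1:] * [:- c, 1:] * [:d, e:]) n" for n
    by (simp only: q[unfolded de])
  have 0: "c * c * d = 0" "B = c * c * e - 2 * c * d" "A = d - 2 * c * e" "1 = e"
    using co[of 0] co[of 1] co[of 2] co[of 3] by (simp_all add: algebra_simps numeral_eq_Suc)
  show False
  proof (cases "c = 0")
    case True
    thus ?thesis using 0(2) assms(1) by simp
  next
    case False
    hence "d = 0" using 0(1) by simp
    hence "B = c * c" "A = - 2 * c" using 0 by simp_all
    thus ?thesis using assms(2) by simp
  qed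
qed

context constants
begin

text \<open>An elliptic curve with the marked point \<open>(0, 0)\<close> of order 2; the two
  inequalities express nonsingularity.\<close>

definition weierstrass :: "'a set \<Rightarrow> 'a \<Rightarrow> 'a \<Rightarrow> 'k \<Rightarrow> 'k \<Rightarrow> bool" where
  "weierstrass E x w A B \<longleftrightarrow> x \<notin> range emb \<and> w * w = ev [:0, B, A, 1:] x \<and> E = quad_ext (ratf x) w \<and>
     B \<noteq> 0 \<and> A * A \<noteq> 4 * B"

lemma ev_cubic: "ev [:0, B, A, 1:] x = x * (x ^ 2 + emb A * x + emb B)"
  by (simp add: algebra_simps power2_eq_square)

end

context genus_field
begin

lemma weierstrass_curve:
  assumes W: "weierstrass E x w A B" and EF: "E \<subseteq> F"
  shows "field_closed E" "range emb \<subseteq> E" "x \<in> E" "w \<in> E" "quadratic_curve emb E x w [:0, B, A, 1:] 1"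
proof -
  have x: "x \<notin> range emb" and w: "w * w = ev [:0, B, A, 1:] x" and E: "E = quad_ext (ratf x) w"
    and AB: "B \<noteq> 0" "A * A \<noteq> 4 * B"
    using W by (auto simp: weierstrass_def)
  show fE: "field_closed E"
    unfolding E by (rule quad_ext_field[OF ratf_field fc_0[OF ratf_field] ev_in_ratf[of "[:0, B, A, 1:]"]])
      (simp only: power2_eq_square w mult_zero_left add_0)
  have rE: "ratf x \<subseteq> E" unfolding E by (rule quad_ext_subset[OF ratf_field])
  show cE: "range emb \<subseteq> E" and xE: "x \<in> E" using rE range_emb_subset_ratf gen_in_ratf by blast+
  show wE: "w \<in> E" unfolding E by (rule quad_ext_gen[OF ratf_field])
  interpret E: curve_field emb E by (rule curve_subfield[OF fE cE EF])
  show "quadratic_curve emb E x w [:0, B, A, 1:] 1"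
    by (unfold_locales; (rule cubic_sqfree[OF AB] | rule xE wE x w E | rule subfield_zero_exists[OF fE cE EF] | simp))
qed

lemma weierstrass_elliptic:
  assumes W: "weierstrass E x w A B" and EF: "E \<subseteq> F"
  shows "elliptic_function_field emb E" "elliptic_field emb E" "w \<notin> ratf x"
proof -
  note c = weierstrass_curve[OF W EF]
  interpret Q: quadratic_curve emb E x w "[:0, B, A, 1:]" 1 by (rule c(5))
  show w: "w \<notin> ratf x" by (rule Q.y_notin)
  have E: "E = quad_ext (ratf x) w" and x: "x \<notin> range emb" using W by (auto simp: weierstrass_def)
  have d: "ext_degree (ratf x) E 2" unfolding E by (rule dimension_quad_ext[OF ratf_field w])
  have "function_field emb E"
    unfolding function_field_def
    using Q.interm c(3) x d by (auto simp: transcendental_iff generate_field_eq_ratf)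
  thus "elliptic_function_field emb E" using Q.has_genus_quadratic by (simp add: elliptic_function_field_def)
  show "elliptic_field emb E"
    by unfold_locales (use Q.has_genus_quadratic Q.infinite_ex in auto)
qed

text \<open>The image of the comorphism is fixed by translation by \<open>(0, 0)\<close>, which
  moves \<open>x\<close>; and \<open>x\<close> is quadratic over that image. This gives degree
  exactly 2.\<close>

lemma weierstrass_isogeny_hom:
  assumes W: "weierstrass E x w A B" and EF: "E \<subseteq> F"
    and W': "weierstrass E' x' w' (- 2 * A) (A * A - 4 * B)" and EF': "E' \<subseteq> F"
  shows "\<exists>\<phi>. fhom E' \<phi> \<and> \<phi> ` E' \<subseteq> E \<and> \<phi> x' \<notin> range emb \<and> ext_degree (\<phi> ` E') E 2"
proof -
  note c = weierstrass_curve[OF W EF] and c' = weierstrass_curve[OF W' EF']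
  have w: "w * w = ev [:0, B, A, 1:] x" and x: "x \<notin> range emb" and E: "E = quad_ext (ratf x) w" and AB: "B \<noteq> 0" "A * A \<noteq> 4 * B"
    using W by (auto simp: weierstrass_def)
  have w': "w' * w' = ev [:0, A * A - 4 * B, - 2 * A, 1:] x'" and x': "x' \<notin> range emb" and E': "E' = quad_ext (ratf x') w'"
    using W' by (auto simp: weierstrass_def)
  note wn = weierstrass_elliptic(3)[OF W EF] and wn' = weierstrass_elliptic(3)[OF W' EF']
  define a where "a = emb A"
  define b where "b = emb B"
  have x0: "x \<noteq> 0" using x rangeI[of emb 0] by auto
  have w2: "w * w = x * (x ^ 2 + a * x + b)" using w unfolding ev_cubic a_def b_def .
  define i where "i = inverse x"
  have xi: "x * i = 1" using x0 by (simp add: i_def)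
  \<comment> \<open>\<open>u = (w / x)^2\<close> and \<open>v = w (B - x^2) / x^2\<close>, the
    coordinates of the quotient by the point \<open>(0, 0)\<close>.\<close>
  define u where "u = x + a + b * i"
  define v where "v = w * (b * i * i - 1)"
  have iE: "i \<in> E" unfolding i_def by (rule fc_inverse[OF c(1,3)])
  have abE: "a \<in> E" "b \<in> E" unfolding a_def b_def using c(2) by auto
  have uE: "u \<in> E" unfolding u_def by (intro fc_add[OF c(1)] fc_mult[OF c(1)] c(3) iE abE)
  have vE: "v \<in> E" unfolding v_def by (intro fc_diff[OF c(1)] fc_mult[OF c(1)] c(4) iE abE fc_1[OF c(1)])
  have v2: "v * v = u * (u ^ 2 - 2 * a * u + (a ^ 2 - 4 * b))"
  proof -
    have "w * w * i * i = u"
      using xi unfolding w2 u_def by Groebner_Basis.algebra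
    moreover have "u ^ 2 - 2 * a * u + (a ^ 2 - 4 * b) = (x - b * i) ^ 2"
      using xi unfolding u_def by Groebner_Basis.algebra
    moreover have "v * v = (w * w * i * i) * (x - b * i) ^ 2"
    proof -
      have "b * i * i - 1 = - i * (x - b * i)" using xi by Groebner_Basis.algebra
      thus ?thesis unfolding v_def by (simp add: power2_eq_square)
    qed
    ultimately show ?thesis by simp
  qed
  have u_ev: "v * v = ev [:0, A * A - 4 * B, - 2 * A, 1:] u"
    unfolding v2 ev_cubic a_def b_def by (simp add: emb_hom power2_eq_square)
  \<comment> \<open>\<open>x\<close> is a root of \<open>T^2 - (u - a) T + b\<close>: this makes
    \<open>u\<close> nonconstant and bounds the degree by 2.\<close>
  have ux: "x * x = (u - a) * x - b" using xi unfolding u_def by Groebner_Basis.algebra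
  have un: "u \<notin> range emb"
  proof
    assume "u \<in> range emb"
    then obtain d where d: "u = emb d" by auto
    have "ev [:B, A - d, 1:] x = x * x - ((emb d - emb A) * x - emb B)"
      by (simp add: emb_hom algebra_simps)
    also have "\<dots> = 0" unfolding ux[unfolded d a_def b_def] by (rule diff_self)
    finally have "ev [:B, A - d, 1:] x = 0" .
    thus False unfolding ev_eq_0_iff[OF x] by simp
  qed
  obtain \<phi> where \<phi>: "fhom E' \<phi>" "\<phi> x' = u" "\<phi> w' = v"
    using ex_quad_hom[OF x' wn' w' un u_ev] unfolding E' by blast
  define L where "L = quad_ext (ratf u) v"
  have im: "\<phi> ` E' = L"
    using fhom_image_quad_ext[OF \<phi>(1) c'(1,2,3) _ c'(4)] un unfolding \<phi>(2,3) L_def E' by simp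
  have fL: "field_closed L"
    unfolding L_def by (rule quad_ext_field[OF ratf_field fc_0[OF ratf_field] ev_in_ratf])
      (simp only: power2_eq_square u_ev mult_zero_left add_0)
  have rL: "ratf u \<subseteq> L" unfolding L_def by (rule quad_ext_subset[OF ratf_field])
  have uL: "u \<in> L" using rL gen_in_ratf by blast
  have vL: "v \<in> L" unfolding L_def by (rule quad_ext_gen[OF ratf_field])
  have cL: "range emb \<subseteq> L" using rL range_emb_subset_ratf by blast
  have LE: "L \<subseteq> E" unfolding L_def
    by (rule quad_ext_minimal[OF c(1) ratf_minimal[OF c(1,2) uE] vE])
  \<comment> \<open>translation by the point \<open>(0, 0)\<close> of order 2\<close>
  have bi: "b * i \<notin> range emb"
  proof
    assume "b * i \<in> range emb"
    then obtain d where "b * i = emb d" by auto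
    moreover have "b = (b * i) * x" using xi by Groebner_Basis.algebra
    ultimately have "ev [:- B, d:] x = 0" unfolding b_def by (simp add: emb_hom mult.commute)
    thus False using AB unfolding ev_eq_0_iff[OF x] by simp
  qed
  have tr: "(- b * w * i * i) * (- b * w * i * i) = ev [:0, B, A, 1:] (b * i)"
  proof -
    have "(- b * w * i * i) * (- b * w * i * i) = (w * w) * (b * i * i) ^ 2" by (simp add: algebra_simps power2_eq_square)
    also have "\<dots> = (b * i) * ((b * i) ^ 2 + a * (b * i) + b)" unfolding w2 using xi by Groebner_Basis.algebra
    finally show ?thesis unfolding ev_cubic a_def b_def .
  qed
  obtain T where T: "fhom E T" "T x = b * i" "T w = - b * w * i * i"
    using ex_quad_hom[OF x wn w bi tr] unfolding E by blast
  note hT = T(1) c(1,2)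
  have b0: "b \<noteq> 0" using AB by (simp add: b_def)
  have Ti: "T i = x * inverse b"
    unfolding i_def fhom_inverse[OF hT c(3)] T(2) by (simp add: i_def mult.commute)
  have Tab: "T a = a" "T b = b" unfolding a_def b_def by (rule fhom_const[OF hT])+
  have Tu: "T u = u"
  proof -
    have "T u = b * i + a + b * (x * inverse b)"
      unfolding u_def using c(3) abE iE fc_mult[OF c(1) abE(2) iE] fc_add[OF c(1) c(3) abE(1)]
      by (simp add: fhom_add[OF hT] fhom_mult[OF hT] T(2) Ti Tab)
    also have "\<dots> = u" unfolding u_def using b0 by simp
    finally show ?thesis .
  qed
  have Tv: "T v = v"
  proof -
    have E1: "b * i \<in> E" "b * i * i \<in> E" "b * i * i - 1 \<in> E"
      by (intro fc_diff[OF c(1)] fc_mult[OF c(1)] iE abE fc_1[OF c(1)])+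
    have "T v = (- b * w * i * i) * (b * (x * inverse b) * (x * inverse b) - 1)"
      unfolding v_def using E1 c(4) abE iE fc_1[OF c(1)]
      by (simp add: fhom_mult[OF hT] fhom_diff[OF hT] T(3) Ti Tab fhom_1[OF hT])
    also have "\<dots> = v"
    proof -
      define j where "j = inverse b"
      have j: "b * j = 1" using b0 by (simp add: j_def)
      have "b * (x * j) * (x * j) = x * x * j" using j by Groebner_Basis.algebra
      moreover have "b * i * i * x * x * j = 1" using j xi by Groebner_Basis.algebra
      moreover have "(- b * w * i * i) * (x * x * j - 1) = w * (b * i * i - b * i * i * x * x * j)" by (simp add: algebra_simps)
      ultimately show ?thesis unfolding v_def j_def by (simp only:)
    qed
    finally show ?thesis .
  qed
  have xL: "x \<notin> L"
  proof
    assume "x \<in> L"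
    hence "T x = x" unfolding L_def by (rule fhom_fixes_quad_ext[OF hT uE Tu vE Tv])
    hence "b * i = x" using T(2) by simp
    moreover have "(b * i) * x = b" using xi by Groebner_Basis.algebra
    ultimately have "x * x - b = 0" by simp
    hence "ev [:- B, 0, 1:] x = 0" unfolding b_def by (simp add: emb_hom)
    thus False unfolding ev_eq_0_iff[OF x] by simp
  qed
  have "E = quad_ext L x"
  proof
    have aL: "a \<in> L" "b \<in> L" unfolding a_def b_def using cL by auto
    have f: "field_closed (quad_ext L x)"
    proof (rule quad_ext_field[OF fL])
      show "x ^ 2 = (u - a) * x + (- b)" using ux by (simp add: power2_eq_square)
    qed (intro fc_diff[OF fL] fc_minus[OF fL] uL aL)+
    have LQ: "L \<subseteq> quad_ext L x" by (rule quad_ext_subset[OF fL])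
    have xQ: "x \<in> quad_ext L x" by (rule quad_ext_gen[OF fL])
    have bn: "b * i * i - 1 \<noteq> 0"
    proof
      assume "b * i * i - 1 = 0"
      hence "x * x - b = 0" using xi by Groebner_Basis.algebra
      hence "ev [:- B, 0, 1:] x = 0" unfolding b_def by (simp add: emb_hom)
      thus False unfolding ev_eq_0_iff[OF x] by simp
    qed
    \<comment> \<open>\<open>w\<close> is recovered from \<open>v\<close> and \<open>x\<close>, so
      \<open>x\<close> generates all of \<open>E\<close> over the image.\<close>
    have "v / (b * inverse x * inverse x - 1) \<in> quad_ext L x"
      by (intro fc_divide[OF f] fc_diff[OF f] fc_mult[OF f] fc_inverse[OF f] fc_1[OF f] xQ subsetD[OF LQ] vL aL)
    moreover have "v / (b * inverse x * inverse x - 1) = w" using bn by (simp add: v_def i_def)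
    ultimately have wQ: "w \<in> quad_ext L x" by simp
    show "E \<subseteq> quad_ext L x"
      unfolding E by (rule quad_ext_minimal[OF f ratf_minimal[OF f _ xQ] wQ]) (use cL LQ in blast)
    show "quad_ext L x \<subseteq> E" by (rule quad_ext_minimal[OF c(1) LE c(3)])
  qed
  hence "ext_degree L E 2" using dimension_quad_ext[OF fL xL] by simp
  thus ?thesis using \<phi> im LE un by (intro exI[of _ \<phi>]) simp
qed

text \<open>Pulling \<open>P\<close> back along \<open>\<phi>\<close> gives a multiple of some place
  \<open>v\<close> of \<open>E'\<close>; an automorphism of \<open>E'\<close> carrying
  \<open>v\<close> to the prescribed \<open>P'\<close> corrects the origin without changing the
  image.\<close>

theorem weierstrass_isogenous:
  assumes W: "weierstrass E x w A B" and EF: "E \<subseteq> F"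
    and W': "weierstrass E' x' w' (- 2 * A) (A * A - 4 * B)" and EF': "E' \<subseteq> F"
  shows "isogenous_of_degree emb 2 E E'"
  unfolding isogenous_of_degree_def
proof (intro conjI ballI)
  show "elliptic_function_field emb E" "elliptic_function_field emb E'"
    using weierstrass_elliptic(1)[OF W EF] weierstrass_elliptic(1)[OF W' EF'] by auto
  fix P P' assume P: "P \<in> places emb E" and P': "P' \<in> places emb E'"
  interpret E: elliptic_field emb E by (rule weierstrass_elliptic(2)[OF W EF])
  interpret E': elliptic_field emb E' by (rule weierstrass_elliptic(2)[OF W' EF'])
  note c' = weierstrass_curve[OF W' EF']
  obtain \<phi> where \<phi>: "fhom E' \<phi>" "\<phi> ` E' \<subseteq> E" "\<phi> x' \<notin> range emb" "ext_degree (\<phi> ` E') E 2"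
    using weierstrass_isogeny_hom[OF W EF W' EF'] by blast
  note h = \<phi>(1) c'(1,2)
  have \<phi>E: "\<phi> z \<in> E" if "z \<in> E'" for z using \<phi>(2) that by blast
  \<comment> \<open>Guarantees that the pullback is not the trivial valuation, as
    \<open>normalise_valuation\<close> requires.\<close>
  obtain k where k: "P (\<phi> x' - emb k) \<noteq> 0"
    using E.ex_const_nonzero_value[OF P \<phi>E[OF c'(3)] \<phi>(3)] by blast
  have xk: "x' - emb k \<in> E'" by (rule E'.F_diff[OF c'(3) E'.emb_in_F])
  have \<phi>k: "\<phi> (x' - emb k) = \<phi> x' - emb k"
    using fhom_diff[OF h c'(3) E'.emb_in_F] fhom_const[OF h] by simp
  have "\<exists>v\<in>E'.PL. \<exists>e>0. \<forall>z\<in>E'. z \<noteq> 0 \<longrightarrow> P (\<phi> z) = e * v z"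
  proof (rule E'.normalise_valuation[of "\<lambda>z. P (\<phi> z)" "x' - emb k"])
    show "P (\<phi> (emb c)) = 0" for c by (simp add: fhom_const[OF h] E.v_emb[OF P])
    show "P (\<phi> (z * y)) = P (\<phi> z) + P (\<phi> y)" if "z \<in> E'" "y \<in> E'" "z \<noteq> 0" "y \<noteq> 0" for z y
      using that by (simp add: fhom_mult[OF h] E.v_mult[OF P] \<phi>E fhom_nz[OF h])
    show "min (P (\<phi> z)) (P (\<phi> y)) \<le> P (\<phi> (z + y))" if "z \<in> E'" "y \<in> E'" "z \<noteq> 0" "y \<noteq> 0" "z + y \<noteq> 0" for z y
    proof -
      have "vge P (min (P (\<phi> z)) (P (\<phi> y))) (\<phi> z + \<phi> y)"
        by (rule E.vge_add[OF P]) (use that \<phi>E in \<open>auto simp: vge_def\<close>)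
      hence "vge P (min (P (\<phi> z)) (P (\<phi> y))) (\<phi> (z + y))" using that by (simp add: fhom_add[OF h])
      moreover have "\<phi> (z + y) \<noteq> 0" by (rule fhom_nz[OF h E'.F_add[OF that(1,2)] that(5)])
      ultimately show ?thesis by (rule vge_D)
    qed
    show "x' - emb k \<in> E'" by (rule xk)
    show "P (\<phi> (x' - emb k)) \<noteq> 0" using k \<phi>k by simp
    thus "x' - emb k \<noteq> 0" using fhom_0[OF h] E.v_0[OF P] by auto
  qed
  then obtain v e where v: "v \<in> E'.PL" "0 < e" "\<And>z. z \<in> E' \<Longrightarrow> z \<noteq> 0 \<Longrightarrow> P (\<phi> z) = e * v z" by blast
  obtain \<iota> where \<iota>: "fhom E' \<iota>" "\<iota> ` E' = E'" "\<And>z. z \<in> E' \<Longrightarrow> v (\<iota> z) = P' z"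
    using E'.transitive[OF v(1) P'] by blast
  note h\<iota> = \<iota>(1) c'(1,2)
  have \<iota>E: "\<iota> z \<in> E'" if "z \<in> E'" for z using \<iota>(2) that by blast
  have val: "P (\<phi> (\<iota> z)) = e * P' z" if z: "z \<in> E'" for z
  proof (cases "z = 0")
    case True
    thus ?thesis by (simp add: fhom_0[OF h] fhom_0[OF h\<iota>] E.v_0[OF P] E'.v_0[OF P'])
  next
    case False
    thus ?thesis using v(3)[OF \<iota>E[OF z] fhom_nz[OF h\<iota> z False]] \<iota>(3)[OF z] by simp
  qed
  have "isogeny_of_degree emb 2 E P E' P' (\<phi> \<circ> \<iota>)"
    unfolding isogeny_of_degree_def
  proof (intro conjI allI)
    show "\<phi> \<circ> \<iota> \<in> ring_hom (type_ring\<lparr>carrier := E'\<rparr>) (type_ring\<lparr>carrier := E\<rparr>)"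
      by (rule ring_hom_memI)
        (auto simp: \<phi>E \<iota>E fhom_add[OF h] fhom_add[OF h\<iota>] fhom_mult[OF h] fhom_mult[OF h\<iota>] fhom_1[OF h] fhom_1[OF h\<iota>])
    show "(\<phi> \<circ> \<iota>) (emb c) = emb c" for c by (simp add: fhom_const[OF h] fhom_const[OF h\<iota>])
    show "\<exists>e>0. \<forall>x\<in>E'. P ((\<phi> \<circ> \<iota>) x) = e * P' x" using v(2) val by auto
    have "(\<phi> \<circ> \<iota>) ` E' = \<phi> ` E'" by (metis image_comp \<iota>(2))
    thus "ext_degree ((\<phi> \<circ> \<iota>) ` E') E 2" using \<phi>(4) by simp
  qed
  thus "\<exists>\<phi>. isogeny_of_degree emb 2 E P E' P' \<phi>" by blast
qed

end

subsection \<open>The elliptic quotients\<close>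

text \<open>With \<open>i = 1 / t\<close>, the first factor on the right is
  \<open>(1 + t)^2 / t\<close> and the second is
  \<open>t^2 + 1 / t^2 + c = y^2 / t^3\<close>.\<close>

lemma quotient_identity_1:
  fixes t i y c :: "'a::field_char_0"
  assumes "t * i = 1" "y * y = t * (t ^ 4 + c * t ^ 2 + 1)"
  shows "(y * (1 + t) * i * i) * (y * (1 + t) * i * i) =
    (t + i + 2) * ((t + i + 2) ^ 2 - 4 * (t + i + 2) + (c + 2))"
  using assms by Groebner_Basis.algebra

text \<open>The first factor on the right is \<open>2 m (1 + m t)^2 / t\<close>, the second is
  \<open>- 4 (t^2 + 1 / t^2 + c)\<close>; their constants multiply to \<open>- 8 m\<close>, whence
  \<open>k\<close>.\<close>

lemma quotient_identity_2:
  fixes t i y c m k :: "'a::field_char_0"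
  assumes "t * i = 1" "y * y = t * (t ^ 4 + c * t ^ 2 + 1)" "m * m = - 1" "k * k = - 8 * m"
  shows "(k * (y * (1 + m * t) * i * i)) * (k * (y * (1 + m * t) * i * i)) =
    (- 2 * m * (t - i) - 4) * ((- 2 * m * (t - i) - 4) ^ 2 + 8 * (- 2 * m * (t - i) - 4) + (8 - 4 * c))"
  using assms by Groebner_Basis.algebra

context dihedral_curve
begin

text \<open>The fixed elements \<open>x\<close> and \<open>w\<close> generate a field
  \<open>M\<close> over which \<open>K = M + M \<xi>\<close>. As \<open>\<sigma>\<close> fixes
  \<open>M\<close> and moves \<open>\<xi>\<close>, only \<open>M\<close> is fixed.\<close>

lemma fixed_field_quotient:
  assumes nf: "normal_form \<xi> y b \<mu>" and \<sigma>: "curve_automorphism emb 2 \<sigma>"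
    and x: "x \<notin> range emb" "\<sigma> x = x" and w: "w * w = ev f x" "\<sigma> w = w" and \<xi>: "\<sigma> \<xi> \<noteq> \<xi>"
    and p: "p \<in> ratf x" "q \<in> ratf x" "\<xi> * \<xi> = p * \<xi> + q" and y: "\<exists>g\<in>ratf \<xi>. y = w * g"
  shows "fixed_field \<sigma> = quad_ext (ratf x) w"
proof -
  interpret \<sigma>: curve_automorphism emb 2 \<sigma> by fact
  let ?M = "quad_ext (ratf x) w"
  have fM: "field_closed ?M"
    by (rule quad_ext_field[OF ratf_field fc_0[OF ratf_field] ev_in_ratf])
      (simp only: power2_eq_square w mult_zero_left add_0)
  have rM: "ratf x \<subseteq> ?M" by (rule quad_ext_subset[OF ratf_field])
  have wM: "w \<in> ?M" by (rule quad_ext_gen[OF ratf_field])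
  have fix1: "\<sigma> z = z" if z: "z \<in> ?M" for z
  proof -
    obtain c d where "z = c + d * w" "c \<in> ratf x" "d \<in> ratf x" using z by (rule quad_extE)
    thus ?thesis using \<sigma>.ratf_fixed[OF x(2)] w(2) by (simp add: \<sigma>.add \<sigma>.mult)
  qed
  let ?N = "quad_ext ?M \<xi>"
  have fN: "field_closed ?N"
    by (rule quad_ext_field[OF fM, of p q]) (use p rM in \<open>auto simp: power2_eq_square\<close>)
  have MN: "?M \<subseteq> ?N" by (rule quad_ext_subset[OF fM])
  have \<xi>N: "\<xi> \<in> ?N" by (rule quad_ext_gen[OF fM])
  have rN: "ratf \<xi> \<subseteq> ?N"
    by (rule ratf_minimal[OF fN _ \<xi>N]) (use range_emb_subset_ratf rM MN in blast)
  have "y \<in> ?N" using y rN wM MN fc_mult[OF fN] by blast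
  hence "UNIV \<subseteq> ?N" using nf quad_ext_minimal[OF fN rN] unfolding normal_form_def by metis
  hence N: "z \<in> ?N" for z by blast
  have "z \<in> ?M" if z: "\<sigma> z = z" for z
  proof -
    obtain c d where cd: "z = c + d * \<xi>" "c \<in> ?M" "d \<in> ?M" using N[of z] by (rule quad_extE)
    have "c + d * \<sigma> \<xi> = c + d * \<xi>" using z cd fix1 by (simp add: \<sigma>.add \<sigma>.mult)
    hence "d = 0" using \<xi> by simp
    thus ?thesis using cd by simp
  qed
  thus ?thesis using fix1 by (auto simp: fixed_field_def)
qed

lemma ex_weierstrass:
  shows "\<exists>x w x' w' A B. weierstrass (fixed_field s) x w A B \<and>
      weierstrass (fixed_field (s \<circ> r)) x' w' (- 2 * A) (A * A - 4 * B)"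
    and "has_genus emb (fixed_field h) 0"
proof -
  obtain \<xi> y b \<mu> where nf: "normal_form \<xi> y b \<mu>" using ex_normal_form by blast
  have nc: "\<xi> \<notin> range emb" and y0: "y \<noteq> 0" and y2: "y * y = \<xi> * (\<xi> ^ 4 + emb b * \<xi> ^ 2 + 1)"
    and b4: "b * b \<noteq> 4" and \<mu>: "\<mu> * \<mu> = - 1" and r\<xi>: "r \<xi> = - \<xi>" and s\<xi>: "s \<xi> = inverse \<xi>"
    and ry: "r y = emb \<mu> * y" and sy: "s y = y / \<xi> ^ 3" and ff: "fixed_field h = ratf \<xi>"
    using nf by (auto simp: normal_form_def)
  note e0 = ev_eq_0_iff[OF nc]
  show "has_genus emb (fixed_field h) 0"
  proof -
    interpret R: curve_field emb "ratf \<xi>" by (rule curve_subfield[OF ratf_field range_emb_subset_ratf]) simp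
    show ?thesis unfolding ff
      by (rule R.rational_genus_0[OF nc refl]) (rule subfield_zero_exists[OF ratf_field range_emb_subset_ratf], auto)
  qed
  define i where "i = inverse \<xi>"
  have \<xi>0: "\<xi> \<noteq> 0" using nc rangeI[of emb 0] by auto
  have ti: "\<xi> * i = 1" using \<xi>0 by (simp add: i_def)
  have si: "s \<xi> = i" "s i = \<xi>" "r i = - i" by (simp_all add: i_def s\<xi> s.inverse r.inverse r\<xi>)
  have sy': "s y = y * i * i * i" by (simp add: sy i_def field_simps power3_eq_cube)
  have \<mu>0: "\<mu> \<noteq> 0" using \<mu> by auto
  define m where "m = emb \<mu>"
  have m: "m * m = - 1" using \<mu> by (simp add: m_def emb_minus flip: emb_mult)
  have m0: "m \<noteq> 0" using \<mu>0 by (simp add: m_def)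
  have rat: "i \<in> ratf \<xi>" "\<xi> \<in> ratf \<xi>" "m \<in> ratf \<xi>"
    unfolding i_def m_def using range_emb_subset_ratf by (auto intro: fc_inverse[OF ratf_field] gen_in_ratf)
  have irr: "\<xi> * \<xi> \<noteq> emb d * \<xi> + emb e" for d e
  proof
    assume "\<xi> * \<xi> = emb d * \<xi> + emb e"
    hence "emb 1 * (\<xi> * \<xi>) + emb (- d) * \<xi> + emb (- e) = 0" by (simp add: emb_minus)
    from quadratic_relation(1)[OF nc this] show False by simp
  qed
  have lin: "\<xi> \<noteq> emb d" for d using nc by auto
  define x where "x = \<xi> + i + 2"
  \<comment> \<open>Since \<open>s y = y / \<xi>^3\<close>, the factor
    \<open>(1 + \<xi>) / \<xi>^2\<close> makes the product with \<open>y\<close> invariant under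
    \<open>s\<close>.\<close>
  define w where "w = y * (1 + \<xi>) * i * i"
  have xn: "x \<notin> range emb"
  proof
    assume "x \<in> range emb"
    then obtain d where d: "x = emb d" by auto
    have "\<xi> * \<xi> = (x - 2) * \<xi> + (- 1)" using ti unfolding x_def by Groebner_Basis.algebra
    hence "\<xi> * \<xi> = emb (d - 2) * \<xi> + emb (- 1)" by (simp add: d emb_hom)
    thus False using irr by blast
  qed
  have w2: "w * w = ev [:0, b + 2, - 4, 1:] x"
    unfolding ev_cubic w_def x_def using quotient_identity_1[OF ti y2]
    by (simp add: emb_hom)
  have s1: "s 2 = 2" using s.const[of 2] by (simp only: emb_numeral)
  have sx: "s x = x" by (simp add: x_def s.add si s1 add.commute)
  have sw: "s w = w"
  proof -
    have "s w = (y * i * i * i) * (1 + i) * \<xi> * \<xi>" by (simp add: w_def s.mult s.add si sy')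
    also have "\<dots> = w" using ti unfolding w_def by Groebner_Basis.algebra
    finally show ?thesis .
  qed
  have s\<xi>n: "s \<xi> \<noteq> \<xi>"
  proof
    assume "s \<xi> = \<xi>"
    hence "\<xi> * \<xi> = emb 0 * \<xi> + emb 1" using ti si by simp
    thus False using irr by blast
  qed
  have p1: "\<xi> * \<xi> = (x - 2) * \<xi> + (- 1)" using ti unfolding x_def by Groebner_Basis.algebra
  have two: "2 \<in> ratf z" for z using range_emb_subset_ratf[of z] rangeI[of emb 2] by (auto simp: emb_numeral)
  have fE: "fixed_field s = quad_ext (ratf x) w"
  proof (rule fixed_field_quotient[OF nf s.curve_automorphism_axioms xn sx w2 sw s\<xi>n _ _ p1])
    show "x - 2 \<in> ratf x" by (intro fc_diff[OF ratf_field] gen_in_ratf two)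
    show "- 1 \<in> ratf x" by (intro fc_minus[OF ratf_field] fc_1[OF ratf_field])
    have n: "1 + \<xi> \<noteq> 0"
    proof
      assume "1 + \<xi> = 0"
      hence "\<xi> = emb (- 1)" by (simp add: emb_minus eq_neg_iff_add_eq_0 add.commute)
      thus False using lin by blast
    qed
    show "\<exists>g\<in>ratf \<xi>. y = w * g"
    proof (intro bexI)
      show "y = w * (\<xi> * \<xi> * inverse (1 + \<xi>))"
        using ti right_inverse[OF n] unfolding w_def by Groebner_Basis.algebra
    qed (intro fc_mult[OF ratf_field] fc_inverse[OF ratf_field] fc_add[OF ratf_field] fc_1[OF ratf_field] rat)
  qed
  have b2: "b \<noteq> 2" "b \<noteq> - 2" using b4 by auto
  have "b + 2 \<noteq> 0" using b2(2) by (simp add: eq_neg_iff_add_eq_0)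
  moreover have "(- 4) * (- 4) \<noteq> 4 * (b + 2)" using b2(1) by (auto simp: algebra_simps)
  ultimately have W: "weierstrass (fixed_field s) x w (- 4) (b + 2)"
    using xn w2 fE by (simp add: weierstrass_def)
  \<comment> \<open>\<open>s r\<close> sends \<open>\<xi>\<close> to \<open>- 1 / \<xi>\<close>, so
    \<open>\<xi> - 1 / \<xi>\<close> is invariant. The scaling and shift give the cubic the
    coefficients 8 and \<open>8 - 4 b\<close>, which are \<open>- 2 A\<close> and
    \<open>A^2 - 4 B\<close> for \<open>A = - 4\<close>, \<open>B = b + 2\<close>.\<close>
  define x' where "x' = - 2 * m * (\<xi> - i) - 4"
  obtain k where k: "k * k = - 8 * \<mu>" using sqrt_const[of "- 8 * \<mu>"] by (auto simp: power2_eq_square)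
  have k0: "k \<noteq> 0" using k \<mu>0 by auto
  define l where "l = emb k"
  have l: "l * l = - 8 * m"
    unfolding l_def m_def emb_mult[symmetric] k by (simp add: emb_hom)
  have l0: "l \<noteq> 0" using k0 by (simp add: l_def)
  define w' where "w' = l * (y * (1 + m * \<xi>) * i * i)"
  let ?\<tau> = "s \<circ> r"
  interpret \<tau>: curve_automorphism emb 2 "s \<circ> r"
  proof unfold_locales
    show "s \<circ> r \<in> carrier (Aut_group emb)" using r_aut s_aut by (auto simp: Aut_iff bij_comp)
  qed
  have \<tau>: "?\<tau> \<xi> = - i" "?\<tau> i = - \<xi>" "?\<tau> y = m * (y * i * i * i)" "?\<tau> m = m" "?\<tau> l = l"
    by (simp_all add: r\<xi> si s.minus ry s.mult sy' m_def l_def)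
  have four: "?\<tau> 4 = 4" "?\<tau> 2 = 2" using \<tau>.const[of 4] \<tau>.const[of 2] by (simp_all only: emb_numeral)
  have p2: "\<xi> * \<xi> = ((x' + 4) * m * inverse 2) * \<xi> + 1"
    using ti m right_inverse[of "2::'a"] unfolding x'_def by Groebner_Basis.algebra
  have x'n: "x' \<notin> range emb"
  proof
    assume "x' \<in> range emb"
    then obtain d where d: "x' = emb d" by auto
    have "\<xi> * \<xi> = emb ((d + 4) * \<mu> * inverse 2) * \<xi> + emb 1"
      using p2 by (simp add: d emb_hom m_def)
    thus False using irr by blast
  qed
  have w'2: "w' * w' = ev [:0, 8 - 4 * b, 8, 1:] x'"
    unfolding ev_cubic w'_def x'_def using quotient_identity_2[OF ti y2 m l]
    by (simp add: emb_hom)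
  have \<tau>x: "?\<tau> x' = x'"
  proof -
    have "?\<tau> x' = - 2 * m * (- i - (- \<xi>)) - 4"
      unfolding x'_def by (simp only: \<tau>.diff \<tau>.mult \<tau>.minus four \<tau>)
    thus ?thesis by (simp add: x'_def algebra_simps)
  qed
  have \<tau>w: "?\<tau> w' = w'"
  proof -
    have "?\<tau> w' = l * ((m * (y * i * i * i)) * (1 + m * (- i)) * (- \<xi>) * (- \<xi>))"
      unfolding w'_def by (simp only: \<tau>.mult \<tau>.add \<tau>.one \<tau>)
    also have "\<dots> = w'" using ti m unfolding w'_def by Groebner_Basis.algebra
    finally show ?thesis .
  qed
  have \<tau>n: "?\<tau> \<xi> \<noteq> \<xi>"
  proof
    assume "?\<tau> \<xi> = \<xi>"
    hence "- i = \<xi>" using \<tau>(1) by simp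
    hence "\<xi> * \<xi> = emb 0 * \<xi> + emb (- 1)" using ti \<open>- i = \<xi>\<close> by (simp add: emb_minus) (metis minus_minus mult_minus_right)
    thus False using irr by blast
  qed
  have fE': "fixed_field ?\<tau> = quad_ext (ratf x') w'"
  proof (rule fixed_field_quotient[OF nf \<tau>.curve_automorphism_axioms x'n \<tau>x w'2 \<tau>w \<tau>n _ _ p2])
    have mx: "m \<in> ratf x'" "4 \<in> ratf x'" unfolding m_def
      using range_emb_subset_ratf[of x'] rangeI[of emb 4] by (auto simp: emb_numeral)
    show "(x' + 4) * m * inverse 2 \<in> ratf x'"
      by (intro fc_mult[OF ratf_field] fc_add[OF ratf_field] fc_inverse[OF ratf_field] gen_in_ratf mx two)
    show "1 \<in> ratf x'" by (rule fc_1[OF ratf_field])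
    have n: "1 + m * \<xi> \<noteq> 0"
    proof
      assume "1 + m * \<xi> = 0"
      hence "\<xi> = m" using m by Groebner_Basis.algebra
      thus False using lin by (simp add: m_def)
    qed
    show "\<exists>g\<in>ratf \<xi>. y = w' * g"
    proof (intro bexI)
      show "y = w' * (inverse l * \<xi> * \<xi> * inverse (1 + m * \<xi>))"
        using ti right_inverse[OF n] right_inverse[OF l0] unfolding w'_def by Groebner_Basis.algebra
      show "inverse l * \<xi> * \<xi> * inverse (1 + m * \<xi>) \<in> ratf \<xi>"
        using range_emb_subset_ratf[of \<xi>] unfolding l_def
        by (intro fc_mult[OF ratf_field] fc_inverse[OF ratf_field] fc_add[OF ratf_field] fc_1[OF ratf_field] rat) auto
    qed
  qed
  have "8 - 4 * b \<noteq> 0"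
  proof
    assume "8 - 4 * b = 0"
    hence "4 * b = 4 * 2" by simp
    hence "b = 2" by (simp only: mult_cancel_left) simp
    thus False using b2 by simp
  qed
  moreover have "8 * 8 \<noteq> 4 * (8 - 4 * b)"
  proof
    assume "8 * 8 = 4 * (8 - 4 * b)"
    hence "b = - 2" by (simp add: algebra_simps) Groebner_Basis.algebra
    thus False using b2 by simp
  qed
  ultimately have "weierstrass (fixed_field ?\<tau>) x' w' 8 (8 - 4 * b)"
    using x'n w'2 fE' by (simp add: weierstrass_def)
  moreover have "- 2 * (- 4) = (8::'k)" "(- 4) * (- 4) - 4 * (b + 2) = 8 - 4 * b" by simp_all
  ultimately have "weierstrass (fixed_field ?\<tau>) x' w' (- 2 * (- 4)) ((- 4) * (- 4) - 4 * (b + 2))" by simp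
  thus "\<exists>x w x' w' A B. weierstrass (fixed_field s) x w A B \<and>
      weierstrass (fixed_field (s \<circ> r)) x' w' (- 2 * A) (A * A - 4 * B)"
    using W by blast
qed

theorem dihedral_quotients:
  "isogenous_of_degree emb 2 (fixed_field s) (fixed_field (s \<circ> r))"
  "has_genus emb (fixed_field (r \<circ> r)) 0"
  using ex_weierstrass weierstrass_isogenous by blast+

end

subsection \<open>Involutions and subfields of degree two\<close>

lemma fixed_field_conj:
  assumes "bij \<alpha>"
  shows "\<alpha> ` fixed_field \<sigma> = fixed_field (\<alpha> \<circ> \<sigma> \<circ> inv_into UNIV \<alpha>)"
proof -
  have "\<alpha> z \<in> fixed_field (\<alpha> \<circ> \<sigma> \<circ> inv_into UNIV \<alpha>) \<longleftrightarrow> z \<in> fixed_field \<sigma>" for z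
    using assms by (auto simp: fixed_field_def bij_def inj_eq)
  moreover have "\<exists>w. z = \<alpha> w" for z using assms by (simp add: bij_def surj_def)
  ultimately show ?thesis by (metis image_eqI image_subsetI subsetI subset_antisym)
qed

context constants
begin

lemma Aut_comp: "\<sigma> \<in> carrier (Aut_group emb) \<Longrightarrow> \<tau> \<in> carrier (Aut_group emb) \<Longrightarrow> \<sigma> \<circ> \<tau> \<in> carrier (Aut_group emb)"
  by (auto simp: Aut_iff bij_comp)

lemma Aut_inv:
  assumes "\<sigma> \<in> carrier (Aut_group emb)"
  shows "inv_into UNIV \<sigma> \<in> carrier (Aut_group emb)" "inv\<^bsub>Aut_group emb\<^esub> \<sigma> = inv_into UNIV \<sigma>"
proof -
  have b: "bij \<sigma>" using assms by (simp add: Aut_iff)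
  note i = inv_f_f[OF bij_is_inj[OF b]] and s = surj_f_inv_f[OF bij_is_surj[OF b]]
  have "inv_into UNIV \<sigma> (x + y) = inv_into UNIV \<sigma> x + inv_into UNIV \<sigma> y" "inv_into UNIV \<sigma> (x * y) = inv_into UNIV \<sigma> x * inv_into UNIV \<sigma> y" "inv_into UNIV \<sigma> (emb c) = emb c" for x y c
    using assms i s by (metis Aut_iff)+
  thus m: "inv_into UNIV \<sigma> \<in> carrier (Aut_group emb)" using b by (simp add: Aut_iff bij_imp_bij_inv)
  have c: "\<sigma> \<circ> inv_into UNIV \<sigma> = id" "inv_into UNIV \<sigma> \<circ> \<sigma> = id" using i s by auto
  show "inv\<^bsub>Aut_group emb\<^esub> \<sigma> = inv_into UNIV \<sigma>"
    unfolding m_inv_def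
  proof (rule the_equality)
    show "inv_into UNIV \<sigma> \<in> carrier (Aut_group emb) \<and> \<sigma> \<otimes>\<^bsub>Aut_group emb\<^esub> inv_into UNIV \<sigma> = \<one>\<^bsub>Aut_group emb\<^esub> \<and>
        inv_into UNIV \<sigma> \<otimes>\<^bsub>Aut_group emb\<^esub> \<sigma> = \<one>\<^bsub>Aut_group emb\<^esub>"
      using m c by (simp add: Aut_group_def)
    fix y assume y: "y \<in> carrier (Aut_group emb) \<and> \<sigma> \<otimes>\<^bsub>Aut_group emb\<^esub> y = \<one>\<^bsub>Aut_group emb\<^esub> \<and>
        y \<otimes>\<^bsub>Aut_group emb\<^esub> \<sigma> = \<one>\<^bsub>Aut_group emb\<^esub>"
    hence "\<sigma> (y z) = z" for z by (auto simp: Aut_group_def fun_eq_iff)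
    thus "y = inv_into UNIV \<sigma>" using i by (metis ext)
  qed
qed

lemma involution_decomposition:
  assumes \<sigma>: "involution emb \<sigma>"
  shows "\<exists>u. field_closed (fixed_field \<sigma>) \<and> u \<notin> fixed_field \<sigma> \<and> u * u \<in> fixed_field \<sigma> \<and> \<sigma> u = - u \<and>
    quad_ext (fixed_field \<sigma>) u = UNIV"
proof -
  have aut: "\<sigma> \<in> carrier (Aut_group emb)" and ne: "\<sigma> \<noteq> id" and inv: "\<And>z. \<sigma> (\<sigma> z) = z"
    using \<sigma> by (auto simp: involution_def fun_eq_iff)
  interpret automorphism emb \<sigma> by unfold_locales (rule aut)
  obtain z where z: "\<sigma> z \<noteq> z" using ne by (auto simp: fun_eq_iff)
  define u where "u = z - \<sigma> z"
  have u: "u \<noteq> 0" "\<sigma> u = - u" using z by (auto simp: u_def diff inv)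
  have two: "\<sigma> 2 = 2" using const[of 2] by (simp only: emb_numeral)
  have fc: "field_closed (fixed_field \<sigma>)"
    by (rule field_closedI) (auto simp: fixed_field_def hom)
  have "w \<in> quad_ext (fixed_field \<sigma>) u" for w
  proof (rule quad_extI')
    show "w = (w + \<sigma> w) / 2 + ((w - \<sigma> w) / (2 * u)) * u" using u by (simp add: field_simps)
    show "(w + \<sigma> w) / 2 \<in> fixed_field \<sigma>" by (simp add: fixed_field_def hom inv two add.commute)
    have "\<sigma> ((w - \<sigma> w) / (2 * u)) = (\<sigma> w - w) / (2 * - u)" by (simp only: hom inv two u)
    also have "\<dots> = (w - \<sigma> w) / (2 * u)" by (metis minus_diff_eq minus_divide_divide mult_minus_right)
    finally show "(w - \<sigma> w) / (2 * u) \<in> fixed_field \<sigma>" by (simp add: fixed_field_def)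
  qed
  moreover have "u \<notin> fixed_field \<sigma>" using u by (auto simp: fixed_field_def)
  moreover have "u * u \<in> fixed_field \<sigma>" using u by (simp add: fixed_field_def hom)
  ultimately show ?thesis using fc u by blast
qed

lemma fixed_field_degree_2:
  assumes "involution emb \<sigma>"
  shows "ext_degree (fixed_field \<sigma>) UNIV 2"
  using involution_decomposition[OF assms] dimension_quad_ext by metis

text \<open>An element negated by \<open>\<sigma>\<close> has its square in the common fixed field
  and is itself moved by \<open>\<tau>\<close>, so \<open>\<tau>\<close> negates it too; together
  with the fixed field it generates everything.\<close>

lemma fixed_field_inj:
  assumes \<sigma>: "involution emb \<sigma>" and \<tau>: "involution emb \<tau>" and eq: "fixed_field \<sigma> = fixed_field \<tau>"
  shows "\<sigma> = \<tau>"
proof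
  fix z
  obtain u where u: "u \<notin> fixed_field \<sigma>" "u * u \<in> fixed_field \<sigma>" "\<sigma> u = - u" "quad_ext (fixed_field \<sigma>) u = UNIV"
    using involution_decomposition[OF \<sigma>] by blast
  interpret \<sigma>: automorphism emb \<sigma> by unfold_locales (use \<sigma> in \<open>simp add: involution_def\<close>)
  interpret \<tau>: automorphism emb \<tau> by unfold_locales (use \<tau> in \<open>simp add: involution_def\<close>)
  have "\<tau> (u * u) = u * u" "\<tau> u \<noteq> u" using u(1,2) unfolding eq by (auto simp: fixed_field_def)
  hence \<tau>u: "\<tau> u = - u" by (simp add: \<tau>.mult square_eq_iff)
  obtain a b where ab: "z = a + b * u" "a \<in> fixed_field \<sigma>" "b \<in> fixed_field \<sigma>"
    using quad_extE[of z "fixed_field \<sigma>" u] u(4) by blast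
  hence "\<sigma> a = a" "\<sigma> b = b" "\<tau> a = a" "\<tau> b = b" using eq by (auto simp: fixed_field_def)
  thus "\<sigma> z = \<tau> z" unfolding ab(1) by (simp add: \<sigma>.add \<sigma>.mult \<tau>.add \<tau>.mult \<tau>u u(3))
qed

text \<open>After completing the square, conjugation of the quadratic extension is the involution
  sought.\<close>

lemma degree_2_subfield_is_fixed_field:
  assumes E: "intermediate_field emb E" and d: "ext_degree E UNIV 2"
  shows "\<exists>\<sigma>. involution emb \<sigma> \<and> fixed_field \<sigma> = E"
proof -
  have fE: "field_closed E" and cE: "range emb \<subseteq> E" using E by (auto simp: intermediate_field_iff)
  have fU: "field_closed (UNIV :: 'a set)" by (simp add: field_closed_def)
  obtain t0 where t0: "t0 \<notin> E" "UNIV = quad_ext E t0" using ext_degree_2E[OF fE fU d] by blast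
  obtain t where t: "t \<notin> E" "t * t \<in> E" "quad_ext E t = UNIV"
    using quad_ext_square[OF fE _ t0(1)] fU unfolding t0(2)[symmetric] by blast
  define \<sigma> where "\<sigma> = quad_conj E t"
  have U: "z \<in> quad_ext E t" for z using t(3) by simp
  have inv: "\<sigma> (\<sigma> z) = z" for z unfolding \<sigma>_def by (rule quad_conj_closed(2)[OF fE t(1) U])
  have fix_E: "\<sigma> z = z" if "z \<in> E" for z unfolding \<sigma>_def by (rule quad_conj_fixed[OF fE t(1) that])
  have "bij \<sigma>" using inv by (rule involuntory_imp_bij)
  moreover have "\<sigma> (x + y) = \<sigma> x + \<sigma> y" "\<sigma> (x * y) = \<sigma> x * \<sigma> y" for x y
    unfolding \<sigma>_def by (rule quad_conj_hom[OF fE t(1,2) U U])+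
  moreover have "\<sigma> (emb c) = emb c" for c using cE by (intro fix_E) auto
  ultimately have aut: "\<sigma> \<in> carrier (Aut_group emb)" by (simp add: Aut_iff)
  have moved: "\<sigma> (a + b * t) = a - b * t" if "a \<in> E" "b \<in> E" for a b
    unfolding \<sigma>_def by (rule quad_conj_eq[OF fE t(1) that])
  have t0: "t \<noteq> 0" using t(1) fc_0[OF fE] by auto
  have "\<sigma> t = - t" using moved[OF fc_0[OF fE] fc_1[OF fE]] by simp
  hence "\<sigma> \<noteq> id" using t0 by auto
  hence "involution emb \<sigma>" using aut inv by (auto simp: involution_def)
  moreover have "fixed_field \<sigma> = E"
  proof
    show "fixed_field \<sigma> \<subseteq> E"
    proof
      fix z assume "z \<in> fixed_field \<sigma>"
      hence z: "\<sigma> z = z" by (simp add: fixed_field_def)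
      obtain a b where ab: "z = a + b * t" "a \<in> E" "b \<in> E" using U[of z] by (rule quad_extE)
      have "a - b * t = a + b * t" using z unfolding ab(1) moved[OF ab(2,3)] .
      hence "b = 0" using t0 by (simp add: eq_neg_iff_add_eq_0 flip: mult_2)
      thus "z \<in> E" using ab by simp
    qed
  qed (use fix_E in \<open>auto simp: fixed_field_def\<close>)
  ultimately show ?thesis by blast
qed

text \<open>Without places the only divisor is 0, and then \<open>deg D - l(D) + 1\<close> is at
  most 1; so \<open>g \<ge> 2\<close> produces a place.\<close>

lemma genus_field_UNIV:
  assumes ff: "function_field emb UNIV" and g: "has_genus emb UNIV g" and "g \<ge> 2"
  shows "genus_field emb UNIV g"
proof -
  interpret curve_field emb UNIV
    by unfold_locales (use ff function_field_alg_dep in \<open>auto simp: function_field_def\<close>)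
  have "PL \<noteq> {}"
  proof
    assume *: "PL = {}"
    obtain D where D: "D \<in> Div" "divisor_degree D - int (ell emb UNIV D) + 1 = int g"
      using g by (auto simp: has_genus_def)
    have "{v. D v \<noteq> 0} = {}" using D(1) * by (auto simp: divisors_def)
    hence "divisor_degree D = 0" by (simp add: divisor_degree_def)
    thus False using D(2) assms(3) by simp
  qed
  thus ?thesis by unfold_locales (rule g)
qed

end

subsection \<open>The dihedral group of order eight\<close>

text \<open>
  \<open>\<rho> i\<close> is the \<open>i\<close>-th power of the rotation and \<open>\<rho>' i\<close> the reflection \<open>(i, True)\<close>, indexed by
  all integers so that no reduction modulo 4 is needed.
\<close>

locale dihedral_action = genus_field emb UNIV 2
  for emb :: "'k::{alg_closed_field,field_char_0} \<Rightarrow> 'a::field_char_0" +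
  fixes \<rho> \<rho>' :: "int \<Rightarrow> 'a \<Rightarrow> 'a"
  assumes Aut: "carrier (Aut_group emb) = range \<rho> \<union> range \<rho>'"
    and eq: "\<rho> i = \<rho> j \<longleftrightarrow> i mod 4 = j mod 4" "\<rho>' i = \<rho>' j \<longleftrightarrow> i mod 4 = j mod 4" "\<rho> i \<noteq> \<rho>' j"
    and comp: "\<rho> i \<circ> \<rho> j = \<rho> (i + j)" "\<rho> i \<circ> \<rho>' j = \<rho>' (i + j)" "\<rho>' i \<circ> \<rho> j = \<rho>' (i - j)" "\<rho>' i \<circ> \<rho>' j = \<rho> (i - j)"
    and one: "\<rho> 0 = id"
begin

lemma comp': "\<rho> i (\<rho> j z) = \<rho> (i + j) z" "\<rho> i (\<rho>' j z) = \<rho>' (i + j) z"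
    "\<rho>' i (\<rho> j z) = \<rho>' (i - j) z" "\<rho>' i (\<rho>' j z) = \<rho> (i - j) z"
  using comp[of i j] by (auto simp: fun_eq_iff)

lemma Aut_\<rho>: "\<rho> i \<in> carrier (Aut_group emb)" "\<rho>' i \<in> carrier (Aut_group emb)"
  using Aut by auto

text \<open>For odd \<open>d = i - j\<close> the rotation \<open>\<rho> d\<close> has order 4 and
  \<open>\<rho>' i \<circ> \<rho> d = \<rho>' j\<close>, so \<open>dihedral_curve\<close> applies to
  this pair.\<close>

lemma quotients:
  assumes "odd (i - j)"
  shows "isogenous_of_degree emb 2 (fixed_field (\<rho>' i)) (fixed_field (\<rho>' j))"
    and "has_genus emb (fixed_field (\<rho> 2)) 0"
proof -
  define d where "d = i - j"
  have d: "(4 * d) mod 4 = 0" "(2 * d) mod 4 = 2" "(- d) mod 4 = (3 * d) mod 4" using assms by (presburger add: d_def)+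
  have 2: "\<rho> d \<circ> \<rho> d = \<rho> 2" using d by (simp add: comp eq)
  have 4: "\<rho> d (\<rho> d (\<rho> d (\<rho> d z))) = z" for z
  proof -
    have "\<rho> (4 * d) = \<rho> 0" using d by (simp add: eq)
    thus ?thesis by (simp add: comp' one)
  qed
  interpret dihedral_curve emb "\<rho> d" "\<rho>' i"
  proof unfold_locales
    show "\<rho>' i (\<rho> d (\<rho>' i z)) = \<rho> d (\<rho> d (\<rho> d z))" for z
    proof -
      have "\<rho> (- d) = \<rho> (3 * d)" using d by (simp only: eq)
      thus ?thesis by (simp add: comp')
    qed
    show "\<rho>' i (\<rho>' i z) = z" for z by (simp add: comp' one)
    have "\<rho> 2 \<noteq> \<rho> 0" by (simp add: eq)
    thus "\<rho> d \<circ> \<rho> d \<noteq> id" by (simp only: 2 one) simp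
    show "\<rho>' i \<noteq> id" "\<rho>' i \<circ> \<rho> d \<noteq> id" using eq(3)[of 0] by (metis comp(3) one)+
    show "\<rho>' i \<noteq> \<rho> d \<circ> \<rho> d" "\<rho>' i \<circ> \<rho> d \<noteq> \<rho> d \<circ> \<rho> d" using eq(3) by (metis comp(1,3))+
  qed (rule Aut_\<rho> 4)+
  have "\<rho>' i \<circ> \<rho> d = \<rho>' j" by (simp add: comp d_def)
  thus "isogenous_of_degree emb 2 (fixed_field (\<rho>' i)) (fixed_field (\<rho>' j))"
    using dihedral_quotients(1) by simp
  show "has_genus emb (fixed_field (\<rho> 2)) 0" using dihedral_quotients(2) 2 by simp
qed

lemma elliptic_quotient: "elliptic_function_field emb (fixed_field (\<rho>' i))"
  using quotients(1)[of i "i + 1"] by (simp add: isogenous_of_degree_def)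

text \<open>\<open>\<rho> 2\<close> is the only involution among the rotations and its quotient is a
  line, whereas quotients by reflections have genus 1.\<close>

lemma elliptic_involution_iff: "elliptic_involution emb \<sigma> \<longleftrightarrow> \<sigma> \<in> range \<rho>'"
proof
  assume \<sigma>: "elliptic_involution emb \<sigma>"
  show "\<sigma> \<in> range \<rho>'"
  proof (rule ccontr)
    assume "\<sigma> \<notin> range \<rho>'"
    then obtain i where i: "\<sigma> = \<rho> i" using \<sigma> Aut by (auto simp: elliptic_involution_def involution_def)
    have "\<rho> (i + i) = \<rho> 0" "\<rho> i \<noteq> \<rho> 0"
      using \<sigma> unfolding i one by (simp_all add: elliptic_involution_def involution_def comp)
    hence "(i + i) mod 4 = 0" "i mod 4 \<noteq> 0" by (simp_all add: eq)
    hence "i mod 4 = 2" by presburger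
    hence "\<sigma> = \<rho> 2" by (simp add: i eq)
    thus False using \<sigma> quotients(2)[of 1 0] by (simp add: elliptic_involution_def hyperelliptic_involution_def)
  qed
next
  assume "\<sigma> \<in> range \<rho>'"
  then obtain i where i: "\<sigma> = \<rho>' i" by auto
  have "\<rho>' i \<noteq> id" using eq(3)[of 0 i] by (simp add: one)
  hence "involution emb (\<rho>' i)" using Aut_\<rho> by (simp add: involution_def comp one)
  moreover have "\<not> has_genus emb (fixed_field (\<rho>' i)) 0"
    using has_genus_unique[of emb _ 0 1] elliptic_quotient[of i] by (auto simp: elliptic_function_field_def)
  ultimately show "elliptic_involution emb \<sigma>"
    by (simp add: i elliptic_involution_def hyperelliptic_involution_def)
qed

lemma involution_\<rho>': "involution emb (\<rho>' i)"
  using elliptic_involution_iff[of "\<rho>' i"] by (simp add: elliptic_involution_def)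

definition cl :: "int \<Rightarrow> ('a \<Rightarrow> 'a) set" where
  "cl i = \<rho>' ` {j. even (i - j)}"

lemma inv_\<rho>: "inv_into UNIV (\<rho> k) = \<rho> (- k)" "inv_into UNIV (\<rho>' k) = \<rho>' k"
  by (rule inv_unique_comp; simp add: comp one)+

text \<open>Conjugation shifts the index of a reflection by an even number, so parity of the index
  is the class invariant.\<close>

lemma conj_\<rho>': "\<rho> k \<circ> \<rho>' i \<circ> inv_into UNIV (\<rho> k) = \<rho>' (i + 2 * k)" "\<rho>' k \<circ> \<rho>' i \<circ> inv_into UNIV (\<rho>' k) = \<rho>' (i + 2 * (k - i))"
  by (simp_all add: inv_\<rho> comp algebra_simps)

lemma conj_orbit: "{\<alpha> \<circ> \<rho>' i \<circ> inv_into UNIV \<alpha> | \<alpha>. \<alpha> \<in> carrier (Aut_group emb)} = cl i" (is "?O = _")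
proof
  show "?O \<subseteq> cl i"
  proof
    fix \<sigma> assume "\<sigma> \<in> ?O"
    then obtain \<alpha> where "\<sigma> = \<alpha> \<circ> \<rho>' i \<circ> inv_into UNIV \<alpha>" "\<alpha> \<in> range \<rho> \<union> range \<rho>'" using Aut by blast
    then obtain k where "\<sigma> = \<rho>' (i + 2 * k)" using conj_\<rho>'[of _ i] by blast
    thus "\<sigma> \<in> cl i" unfolding cl_def by (auto intro!: imageI)
  qed
  show "cl i \<subseteq> ?O"
  proof
    fix \<sigma> assume "\<sigma> \<in> cl i"
    then obtain j where j: "\<sigma> = \<rho>' j" "even (i - j)" by (auto simp: cl_def)
    then obtain k where "i - j = 2 * k" by (elim evenE)
    hence "\<sigma> = \<rho> (- k) \<circ> \<rho>' i \<circ> inv_into UNIV (\<rho> (- k))" unfolding conj_\<rho>' j(1) by (simp add: algebra_simps)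
    thus "\<sigma> \<in> ?O" using Aut_\<rho>(1) by blast
  qed
qed

lemma cl_eq_iff: "cl i = cl j \<longleftrightarrow> even (i - j)"
proof
  assume "cl i = cl j"
  moreover have "\<rho>' i \<in> cl i" by (simp add: cl_def)
  ultimately obtain k where "\<rho>' i = \<rho>' k" "even (j - k)" by (auto simp: cl_def)
  hence "i mod 4 = k mod 4" "even (j - k)" by (simp_all only: eq)
  thus "even (i - j)" by presburger
next
  assume "even (i - j)"
  hence "{k. even (i - k)} = {k. even (j - k)}" by auto
  thus "cl i = cl j" by (simp add: cl_def)
qed

lemma range_cl: "range cl = {cl 0, cl 1}"
proof -
  have "cl i = cl 0 \<or> cl i = cl 1" for i unfolding cl_eq_iff by presburger
  thus ?thesis by auto
qed

lemma card_range_cl: "card (range cl) = 2"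
  unfolding range_cl using cl_eq_iff[of 0 1] by simp

lemma elliptic_involution_classes_eq: "elliptic_involution_classes emb = range cl"
proof -
  have "orbit (Aut_group emb) (\<lambda>\<alpha> \<sigma>. \<alpha> \<otimes>\<^bsub>Aut_group emb\<^esub> \<sigma> \<otimes>\<^bsub>Aut_group emb\<^esub> inv\<^bsub>Aut_group emb\<^esub> \<alpha>) (\<rho>' i) = cl i" for i
  proof -
    have "\<alpha> \<otimes>\<^bsub>Aut_group emb\<^esub> \<rho>' i \<otimes>\<^bsub>Aut_group emb\<^esub> inv\<^bsub>Aut_group emb\<^esub> \<alpha> = \<alpha> \<circ> \<rho>' i \<circ> inv_into UNIV \<alpha>"
      if "\<alpha> \<in> carrier (Aut_group emb)" for \<alpha>
      using Aut_inv(2)[OF that] by (simp add: Aut_group_def)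
    thus ?thesis unfolding orbit_def conj_orbit[symmetric] by (intro Collect_cong) metis
  qed
  thus ?thesis unfolding elliptic_involution_classes_def orbits_def elliptic_involution_iff by auto
qed

lemma degree2_elliptic_subfields_eq: "degree2_elliptic_subfields emb = fixed_field ` range \<rho>'"
proof
  show "degree2_elliptic_subfields emb \<subseteq> fixed_field ` range \<rho>'"
  proof
    fix E assume "E \<in> degree2_elliptic_subfields emb"
    hence E: "function_field emb E" "has_genus emb E 1" "ext_degree E UNIV 2"
      by (auto simp: degree2_elliptic_subfields_def elliptic_function_field_def)
    then obtain \<sigma> where \<sigma>: "involution emb \<sigma>" "fixed_field \<sigma> = E"
      using degree_2_subfield_is_fixed_field[of E] by (auto simp: function_field_def)
    have "\<not> has_genus emb E 0" using has_genus_unique[of emb E 0 1] E(2) by auto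
    hence "elliptic_involution emb \<sigma>"
      using \<sigma> by (simp add: elliptic_involution_def hyperelliptic_involution_def)
    thus "E \<in> fixed_field ` range \<rho>'" using \<sigma>(2) elliptic_involution_iff by blast
  qed
  show "fixed_field ` range \<rho>' \<subseteq> degree2_elliptic_subfields emb"
    using elliptic_quotient fixed_field_degree_2[OF involution_\<rho>']
    by (auto simp: degree2_elliptic_subfields_def)
qed

lemma degree2_elliptic_subfield_classes_eq:
  "degree2_elliptic_subfield_classes emb = (`) fixed_field ` range cl"
proof -
  have "orbit (Aut_group emb) (\<lambda>\<alpha> E. \<alpha> ` E) (fixed_field (\<rho>' i)) = fixed_field ` cl i" for i
  proof -
    have "\<alpha> ` fixed_field (\<rho>' i) = fixed_field (\<alpha> \<circ> \<rho>' i \<circ> inv_into UNIV \<alpha>)" if "\<alpha> \<in> carrier (Aut_group emb)" for \<alpha>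
      by (rule fixed_field_conj) (use that in \<open>simp add: Aut_iff\<close>)
    hence "orbit (Aut_group emb) (\<lambda>\<alpha> E. \<alpha> ` E) (fixed_field (\<rho>' i)) =
        {fixed_field (\<alpha> \<circ> \<rho>' i \<circ> inv_into UNIV \<alpha>) | \<alpha>. \<alpha> \<in> carrier (Aut_group emb)}"
      unfolding orbit_def by (intro Collect_cong) metis
    thus ?thesis unfolding conj_orbit[symmetric] by auto
  qed
  thus ?thesis
    unfolding degree2_elliptic_subfield_classes_def orbits_def degree2_elliptic_subfields_eq by auto
qed

lemma card_subfield_classes: "card ((`) fixed_field ` range cl) = 2"
proof -
  have "inj_on fixed_field (range \<rho>')" by (intro inj_onI) (auto intro: fixed_field_inj involution_\<rho>')
  hence "inj_on ((`) fixed_field) (Pow (range \<rho>'))" by (rule inj_on_image_Pow)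
  moreover have "range cl \<subseteq> Pow (range \<rho>')" by (auto simp: cl_def)
  ultimately show ?thesis using card_range_cl by (metis card_image inj_on_subset)
qed

theorem classes_and_isogeny:
  "card (elliptic_involution_classes emb) = 2
    \<and> card (degree2_elliptic_subfield_classes emb) = 2
    \<and> (\<forall>A\<in>elliptic_involution_classes emb. \<forall>B\<in>elliptic_involution_classes emb.
         A \<noteq> B \<longrightarrow> (\<forall>\<sigma>\<in>A. \<forall>\<tau>\<in>B.
           isogenous_of_degree emb 2 (fixed_field \<sigma>) (fixed_field \<tau>)))"
proof (intro conjI ballI impI)
  show "card (elliptic_involution_classes emb) = 2"
    unfolding elliptic_involution_classes_eq by (rule card_range_cl)
  show "card (degree2_elliptic_subfield_classes emb) = 2"
    unfolding degree2_elliptic_subfield_classes_eq by (rule card_subfield_classes)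
  fix A B \<sigma> \<tau> assume "A \<in> elliptic_involution_classes emb" "B \<in> elliptic_involution_classes emb" "A \<noteq> B"
    and \<sigma>: "\<sigma> \<in> A" and \<tau>: "\<tau> \<in> B"
  then obtain i j where ij: "A = cl i" "B = cl j" "odd (i - j)"
    unfolding elliptic_involution_classes_eq using cl_eq_iff by blast
  then obtain i' j' where "\<sigma> = \<rho>' i'" "\<tau> = \<rho>' j'" "even (i - i')" "even (j - j')"
    using \<sigma> \<tau> by (auto simp: cl_def)
  moreover from this ij(3) have "odd (i' - j')" by presburger
  ultimately show "isogenous_of_degree emb 2 (fixed_field \<sigma>) (fixed_field \<tau>)"
    using quotients(1) by blast
qed

end

lemma dihedral_actionI:
  fixes emb :: "'k::{alg_closed_field,field_char_0} \<Rightarrow> 'a::field_char_0"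
  assumes gf: "genus_field emb UNIV 2" and iso: "Aut_group emb \<cong> dihedral_group 4"
  shows "\<exists>\<rho> \<rho>'. dihedral_action emb \<rho> \<rho>'"
proof -
  interpret genus_field emb UNIV 2 by (rule gf)
  let ?G = "Aut_group emb" and ?D = "dihedral_group 4"
  obtain \<phi> where \<phi>: "\<phi> \<in> iso ?G ?D" using iso by (auto simp: is_iso_def)
  hence b: "bij_betw \<phi> (carrier ?G) (carrier ?D)" and hom: "\<phi> \<in> hom ?G ?D" by (auto simp: iso_def)
  define \<psi> where "\<psi> = inv_into (carrier ?G) \<phi>"
  define \<rho> where "\<rho> i = \<psi> (i mod 4, False)" for i
  define \<rho>' where "\<rho>' i = \<psi> (i mod 4, True)" for i
  have D: "carrier ?D = {0..<4} \<times> UNIV" by (simp add: dihedral_group_def)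
  have mem: "(i mod 4, x) \<in> carrier ?D" for i :: int and x by (simp add: D)
  have \<psi>b: "bij_betw \<psi> (carrier ?D) (carrier ?G)" unfolding \<psi>_def by (rule bij_betw_inv_into[OF b])
  have \<phi>\<psi>: "\<phi> (\<psi> p) = p" if "p \<in> carrier ?D" for p
    unfolding \<psi>_def by (rule bij_betw_inv_into_right[OF b that])
  have \<psi>\<phi>: "\<psi> (\<phi> a) = a" if "a \<in> carrier ?G" for a
    unfolding \<psi>_def by (rule bij_betw_inv_into_left[OF b that])
  have \<psi>G: "\<psi> p \<in> carrier ?G" if "p \<in> carrier ?D" for p using \<psi>b that by (rule bij_betwE[THEN bspec])
  have \<psi>_mult: "\<psi> p \<circ> \<psi> q = \<psi> (p \<otimes>\<^bsub>?D\<^esub> q)" if p: "p \<in> carrier ?D" and q: "q \<in> carrier ?D" for p q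
  proof -
    have c: "\<psi> p \<circ> \<psi> q \<in> carrier ?G" by (rule Aut_comp[OF \<psi>G[OF p] \<psi>G[OF q]])
    have "\<phi> (\<psi> p \<circ> \<psi> q) = \<phi> (\<psi> p) \<otimes>\<^bsub>?D\<^esub> \<phi> (\<psi> q)"
      using hom_mult[OF hom \<psi>G[OF p] \<psi>G[OF q]] by (simp add: Aut_group_def)
    thus ?thesis using \<psi>\<phi>[OF c] \<phi>\<psi>[OF p] \<phi>\<psi>[OF q] by simp
  qed
  have mult: "(i mod 4, x) \<otimes>\<^bsub>?D\<^esub> (j mod 4, y) = ((if x then i - j else i + j) mod 4, x \<noteq> y)" for i j :: int and x y
    by (simp add: dihedral_group_def mod_simps)
  have comp: "\<rho> i \<circ> \<rho> j = \<rho> (i + j)" "\<rho> i \<circ> \<rho>' j = \<rho>' (i + j)" "\<rho>' i \<circ> \<rho> j = \<rho>' (i - j)" "\<rho>' i \<circ> \<rho>' j = \<rho> (i - j)" for i j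
    unfolding \<rho>_def \<rho>'_def \<psi>_mult[OF mem mem] mult by simp_all
  have inj: "\<psi> p = \<psi> q \<longleftrightarrow> p = q" if "p \<in> carrier ?D" "q \<in> carrier ?D" for p q
    using \<phi>\<psi> that by metis
  have "\<rho> 0 \<circ> \<rho> 0 = \<rho> 0" by (simp add: comp)
  moreover have "bij (\<rho> 0)" using \<psi>G[OF mem[of 0 False]] by (simp add: \<rho>_def Aut_iff)
  ultimately have one: "\<rho> 0 = id" by (metis bij_is_inj inj_iff comp_assoc comp_id id_comp)
  \<comment> \<open>The locale axioms are transported along the inverse of the isomorphism;
    composition of indices modulo 4 was settled in \<open>comp\<close>, and \<open>\<rho> 0\<close>
    is the identity as an idempotent bijection.\<close>
  have "dihedral_action emb \<rho> \<rho>'"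
  proof unfold_locales
    show "carrier ?G = range \<rho> \<union> range \<rho>'"
    proof
      show "range \<rho> \<union> range \<rho>' \<subseteq> carrier ?G" using \<psi>G[OF mem] by (auto simp: \<rho>_def \<rho>'_def)
      show "carrier ?G \<subseteq> range \<rho> \<union> range \<rho>'"
      proof
        fix a assume a: "a \<in> carrier ?G"
        obtain i x where ix: "\<phi> a = (i, x)" by (cases "\<phi> a")
        have "\<phi> a \<in> carrier ?D" using b a by (auto simp: bij_betw_def)
        hence "i = i mod 4" using ix by (simp add: D)
        hence "a = (if x then \<rho>' i else \<rho> i)" using \<psi>\<phi>[OF a] ix by (cases x) (simp_all add: \<rho>_def \<rho>'_def)
        thus "a \<in> range \<rho> \<union> range \<rho>'" by (auto split: if_splits)
      qed
    qed
    show "\<rho> i = \<rho> j \<longleftrightarrow> i mod 4 = j mod 4" "\<rho>' i = \<rho>' j \<longleftrightarrow> i mod 4 = j mod 4" "\<rho> i \<noteq> \<rho>' j" for i j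
      unfolding \<rho>_def \<rho>'_def inj[OF mem mem] by simp_all
  qed (rule comp one)+
  thus ?thesis by blast
qed

theorem mainTheorem6:
  fixes emb :: "'k::{alg_closed_field, field_char_0} \<Rightarrow> 'a::field_char_0"
  assumes "field_embedding emb"
    and "function_field emb (UNIV :: 'a set)"
    and "has_genus emb (UNIV :: 'a set) 2"
    and "Aut_group emb \<cong> dihedral_group 4"
  shows "card (elliptic_involution_classes emb) = 2
    \<and> card (degree2_elliptic_subfield_classes emb) = 2
    \<and> (\<forall>A\<in>elliptic_involution_classes emb. \<forall>B\<in>elliptic_involution_classes emb.
         A \<noteq> B \<longrightarrow> (\<forall>\<sigma>\<in>A. \<forall>\<tau>\<in>B.
           isogenous_of_degree emb 2 (fixed_field \<sigma>) (fixed_field \<tau>)))"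
proof -
  interpret constants emb by unfold_locales (rule assms(1))
  obtain \<rho> \<rho>' where "dihedral_action emb \<rho> \<rho>'"
    using dihedral_actionI[OF genus_field_UNIV[OF assms(2,3)] assms(4)] by auto
  thus ?thesis by (rule dihedral_action.classes_and_isogeny)
qed

end
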